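(* Let $1\le k\le 3$, let $\boldsymbol{j}=(j_1,\dots,j_r)$ be a vector of distinct integers and $\boldsymbol{a}=(a_1,\dots,a_r)$ a vector of integers with $a_i\ge 1$ and $\sum_{i=1}^r a_i=k$. Let $\epsilon>0$ be fixed and assume $\max_i|j_i|\le N^{1-\epsilon}$ and $R\gg N^{\epsilon}$. Then, as $N\to\infty$, $$\sum_{n=1}^N \lambda_R(n+j_1)^{a_1}\lambda_R(n+j_2)^{a_2}\cdots\lambda_R(n+j_r)^{a_r}=\bigl(\mathcal{C}_k(\boldsymbol{a})\,\mathfrak{S}(\boldsymbol{j})+o(1)\bigr)N(\log R)^{k-r}+O(R^k),$$ where $\mathcal{C}_1(1)=1$, $\mathcal{C}_2(2)=1$, $\mathcal{C}_2(1,1)=1$, $\mathcal{C}_3(3)=\tfrac34$, $\mathcal{C}_3(2,1)=\mathcal{C}_3(1,2)=1$, $\mathcal{C}_3(1,1,1)=1$.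
   Context: For $n\ge1$ and $R\ge 1$, $\lambda_R(n)=\sum_{q\le R}\frac{\mu^2(q)}{\phi(q)}\sum_{d\mid (q,n)}d\,\mu(d)$, and $\lambda_R(n)=0$ for $n\le 0$; here $\mu$ is the Möbius function, $\phi$ is Euler's function, and $(q,n)$ is the gcd. For a vector $\boldsymbol{j}=(j_1,\dots,j_r)$ of distinct integers, $\mathfrak{S}(\boldsymbol{j})=\prod_p\left(1-\frac1p\right)^{-r}\left(1-\frac{\nu_p(\boldsymbol{j})}{p}\right)$, the product being over all primes $p$, where $\nu_p(\boldsymbol{j})$ is the number of distinct residue classes modulo $p$ occupied by the $j_i$. $N$ is a large natural number; $R$ and $\boldsymbol{j}$ may vary with $N$ subject to the stated conditions, and the $o(1)$ (as $N\to\infty$) and the implied constant in $O(R^k)$ are uniform in them for fixed $\epsilon$ and fixed implied constant in $R\gg N^\epsilon$. *)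

theory Defs
  imports "HOL-Analysis.Infinite_Products" "HOL-Computational_Algebra.Squarefree"
    "HOL-Number_Theory.Number_Theory"
begin

definition moebius_mu :: "nat \<Rightarrow> real" where
  "moebius_mu n = (if squarefree n then (-1) ^ card (prime_factors n) else 0)"

definition lambda_R :: "real \<Rightarrow> int \<Rightarrow> real" where
  "lambda_R R n =
     (if n \<le> 0 then 0
      else (\<Sum>q | 1 \<le> q \<and> real q \<le> R.
              (moebius_mu q)\<^sup>2 / real (totient q) *
              (\<Sum>d | d dvd gcd q (nat n). real d * moebius_mu d)))"

definition nu_p :: "nat \<Rightarrow> int list \<Rightarrow> nat" where
  "nu_p p js = card ((\<lambda>j. j mod int p) ` set js)"

text \<open>
  The factor at \<open>p\<close> is \<open>1 + O(1 / p\<^sup>2)\<close> once \<open>p\<close> divides no difference of two entries, so the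
  product converges. The library product takes the value \<open>0\<close> if \<open>nu_p p js = p\<close> for some
  prime \<open>p\<close>, because only finitely many factors vanish.
\<close>

definition singular_series :: "int list \<Rightarrow> real" where
  "singular_series js =
     (\<Prod>p. if prime p
           then (1 - 1 / real p) powi (- int (length js)) * (1 - real (nu_p p js) / real p)
           else 1)"

text \<open>The value \<open>0\<close> in the last branch is never used: the exponent vectors of positive integers
  with sum \<open>k \<in> {1, 2, 3}\<close> are exactly the ones listed.\<close>

definition corr_const :: "nat \<Rightarrow> nat list \<Rightarrow> real" where
  "corr_const k as =
     (if k = 1 \<and> as = [1] then 1
      else if k = 2 \<and> as = [2] then 1
      else if k = 2 \<and> as = [1, 1] then 1
      else if k = 3 \<and> as = [3] then 3 / 4
      else if k = 3 \<and> as = [2, 1] then 1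
      else if k = 3 \<and> as = [1, 2] then 1
      else if k = 3 \<and> as = [1, 1, 1] then 1
      else 0)"

definition corr_sum :: "nat \<Rightarrow> real \<Rightarrow> int list \<Rightarrow> nat list \<Rightarrow> real" where
  "corr_sum N R js as =
     (\<Sum>n = 1..N. \<Prod>i<length as. lambda_R R (int n + js ! i) ^ (as ! i))"

end

theory Submission
  imports Defs "HOL-Analysis.Analysis" "HOL-Real_Asymp.Real_Asymp"
begin

text \<open>
  The weight \<open>\<lambda>\<^sub>R(n)\<close> is the sum over squarefree \<open>q \<le> R\<close> of \<open>\<Prod>p | q. (1 - p [p | n]) / (p - 1)\<close>,
  so a product of at most three such weights is periodic in \<open>n\<close>; its sum over an interval is the
  length times its mean, up to an error \<open>O(R\<^sup>k)\<close>. The mean is a sum over triples \<open>q\<^sub>1, q\<^sub>2, q\<^sub>3 \<le> R\<close>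
  of multiplicative local correlations, and these vanish unless every prime divides at least two of
  the moduli. Hence \<open>q\<^sub>1 = d a b\<close>, \<open>q\<^sub>2 = d a c\<close>, \<open>q\<^sub>3 = d b c\<close> with pairwise coprime
  \<open>a, b, c, d\<close>, and the sum is a product over primes of operators
  \<open>\<phi> \<mapsto> \<Sum>k. c\<^sub>k \<phi>(\<cdot> + s\<^sub>k)\<close>, applied to the indicator of a box in logarithmic coordinates.

  If the shifts are distinct, the local weights are \<open>O(1 / p\<^sup>2)\<close> away from the primes dividing a
  difference, the box may be dropped by Rankin's trick, and the Euler product of the singular series
  remains. If exactly two shifts agree, one weight is about \<open>1 / p\<close>: factoring out the
  operator of \<open>\<Sum>n. \<phi>(\<cdot> + ln n) / n\<close> produces the factor \<open>ln R\<close>.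

  If three shifts agree, the sum runs over \<open>a, b, c, d\<close> with weights \<open>1 / \<phi>(a b c)\<close> and a weight close
  to \<open>\<mu>(d) / d\<close>. Splitting according to which of \<open>a, b, c\<close> is largest reduces it to three times a
  sum in which the variables \<open>c, d\<close> can be merged; this collapses to the square of
  \<open>G = \<Sum>q \<le> \<surd>R. \<mu>\<^sup>2(q) / \<phi>(q) = (1 / 2) ln R + O(1)\<close>, and \<open>3 G\<^sup>2\<close> accounts for the constant
  \<open>3 / 4\<close>. The remaining terms cancel through \<open>d\<close>, by elementary bounds for sums of the Moebius
  function with logarithmic weights.
\<close>

section \<open>Products of shift operators\<close>

text \<open>A sharp cutoff such as \<open>q \<le> R\<close> is not multiplicative, so a truncated
  sum has no Euler product. Letting the local factors act on the cutoff in logarithmic coordinates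
  restores one: multiplication by \<open>p\<close> is a translation, translations commute, and a
  local factor is a finite signed measure of translations. Dividing out a zeta factor then happens
  prime by prime, and the cutoff matters only through the function finally bounded. Uniformity in
  the shifts is the obstacle: they may be as large as a power of \<open>N\<close>, and many primes
  may divide their differences. For distinct shifts these primes cost a small power of
  \<open>N\<close>, which Rankin's saving absorbs. With two equal shifts the margin is a single
  factor \<open>ln R\<close>, so the cost must be a power of an iterated logarithm. With three equal
  shifts absolute values lose logarithms, and the signs carried by \<open>d\<close> are essential.
  The sum over \<open>b\<close>, \<open>c\<close>, \<open>d\<close> lives on a box
  \<open>b, c \<le> t\<close> under the hyperbola \<open>b c d \<le> R\<close>, and a logarithm can
  appear only where the box sticks out of the hyperbola.\<close>

definition shift_op :: "(real \<times> 'v::comm_monoid_add) list \<Rightarrow> ('v \<Rightarrow> real) \<Rightarrow> 'v \<Rightarrow> real" where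
  "shift_op xs \<phi> v = (\<Sum>(k, s)\<leftarrow>xs. k * \<phi> (v + s))"

primrec prod_op :: "('p \<Rightarrow> (real \<times> 'v::comm_monoid_add) list) \<Rightarrow> 'p list \<Rightarrow> ('v \<Rightarrow> real) \<Rightarrow> 'v \<Rightarrow> real" where
  "prod_op X [] \<phi> = \<phi>"
| "prod_op X (p # ps) \<phi> = shift_op (X p) (prod_op X ps \<phi>)"

lemma shift_op_Nil [simp]: "shift_op [] \<phi> v = 0"
  and shift_op_Cons [simp]: "shift_op (x # xs) \<phi> v = fst x * \<phi> (v + snd x) + shift_op xs \<phi> v"
  by (simp_all add: shift_op_def case_prod_unfold)

lemma shift_op_append: "shift_op (xs @ ys) \<phi> v = shift_op xs \<phi> v + shift_op ys \<phi> v"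
  by (induction xs) simp_all

lemma shift_op_linear: "shift_op xs (\<lambda>v. a * \<phi> v + b * \<psi> v) v = a * shift_op xs \<phi> v + b * shift_op xs \<psi> v"
  by (induction xs) (simp_all add: algebra_simps)

lemma shift_op_translate: "shift_op xs (\<lambda>v. \<phi> (v + s)) v = shift_op xs \<phi> (v + s)"
  by (induction xs) (simp_all add: algebra_simps)

lemma shift_op_commute: "shift_op xs (shift_op ys \<phi>) v = shift_op ys (shift_op xs \<phi>) v"
proof (induction xs arbitrary: v)
  case Nil
  show ?case using shift_op_linear[of ys 0 \<phi> 0 \<phi> v]
    by (simp add: shift_op_Nil[abs_def])
next
  case (Cons x xs)
  have "shift_op ys (shift_op (x # xs) \<phi>) v
      = shift_op ys (\<lambda>v. fst x * \<phi> (v + snd x) + 1 * shift_op xs \<phi> v) v"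
    by (simp add: shift_op_Cons[abs_def])
  also have "\<dots> = fst x * shift_op ys \<phi> (v + snd x) + shift_op ys (shift_op xs \<phi>) v"
    by (simp add: shift_op_linear[where b = 1, simplified] shift_op_translate)
  finally have "shift_op ys (shift_op (x # xs) \<phi>) v
      = fst x * shift_op ys \<phi> (v + snd x) + shift_op ys (shift_op xs \<phi>) v" .
  then show ?case
    unfolding shift_op_Cons[of x xs "shift_op ys \<phi>" v] Cons.IH ..
qed

lemma shift_op_commute': "shift_op xs (shift_op ys \<phi>) = shift_op ys (shift_op xs \<phi>)"
  using shift_op_commute by blast

lemma prod_op_commute_shift: "prod_op X ps (shift_op ys \<phi>) = shift_op ys (prod_op X ps \<phi>)"
  by (induction ps) (simp_all add: shift_op_commute'[of ys])

text \<open>Convolution of finite measures, that is, the product of two local factors. Equal shifts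
  are not collected.\<close>

definition op_comp :: "(real \<times> 'v::comm_monoid_add) list \<Rightarrow> (real \<times> 'v) list \<Rightarrow> (real \<times> 'v) list" where
  "op_comp xs ys = concat (map (\<lambda>x. map (\<lambda>y. (fst x * fst y, snd x + snd y)) ys) xs)"

lemma shift_op_comp: "shift_op (op_comp xs ys) \<phi> = shift_op xs (shift_op ys \<phi>)"
proof
  fix v
  have *: "shift_op (map (\<lambda>y. (k * fst y, s + snd y)) ys) \<phi> v = k * shift_op ys \<phi> (v + s)" for k s
    by (induction ys) (simp_all add: algebra_simps)
  show "shift_op (op_comp xs ys) \<phi> v = shift_op xs (shift_op ys \<phi>) v"
    by (induction xs) (simp_all add: op_comp_def shift_op_append *)
qed

text \<open>Since all translations commute, the second factors of all primes can be gathered on the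
  right. Read from right to left, this reduces the composition of an Euler product with an inverse
  zeta product to one local computation per prime.\<close>

lemma prod_op_comp: "prod_op (\<lambda>p. op_comp (X p) (Y p)) ps \<phi> = prod_op X ps (prod_op Y ps \<phi>)"
  by (induction ps) (simp_all add: shift_op_comp prod_op_commute_shift[symmetric])

lemma prod_op_cong:
  assumes "\<And>p \<phi> v. p \<in> set ps \<Longrightarrow> shift_op (X p) \<phi> v = shift_op (Y p) \<phi> v"
  shows "prod_op X ps \<phi> = prod_op Y ps \<phi>"
  using assms
proof (induction ps)
  case (Cons p ps)
  then have "prod_op X ps \<phi> = prod_op Y ps \<phi>" by simp
  then show ?case using Cons.prems by (simp add: fun_eq_iff)
qed simp

text \<open>A constant does not see translations, so each local factor contributes its total mass.
  Main terms arise in this way: the cutoff is replaced by a constant and an Euler product comes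
  out.\<close>

lemma prod_op_const:
  fixes X :: "'p \<Rightarrow> (real \<times> 'v::comm_monoid_add) list"
  shows "prod_op X ps (\<lambda>_. c) v = c * (\<Prod>p\<leftarrow>ps. \<Sum>x\<leftarrow>X p. fst x)"
proof (induction ps arbitrary: v)
  case (Cons p ps)
  have *: "shift_op xs (\<lambda>_. d) v = d * (\<Sum>x\<leftarrow>xs. fst x)" for xs :: "(real \<times> 'v) list" and d v
    by (induction xs) (simp_all add: algebra_simps)
  from Cons have "prod_op X ps (\<lambda>_. c) = (\<lambda>v. c * (\<Prod>p\<leftarrow>ps. \<Sum>x\<leftarrow>X p. fst x))" by blast
  then show ?case by (simp add: * algebra_simps)
qed simp

lemma prod_op_diff:
  "prod_op X ps (\<lambda>v. \<phi> v - \<psi> v) v = prod_op X ps \<phi> v - prod_op X ps \<psi> v"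
proof (induction ps arbitrary: v)
  case (Cons p ps)
  from Cons have "prod_op X ps (\<lambda>v. \<phi> v - \<psi> v) = (\<lambda>v. 1 * prod_op X ps \<phi> v + (-1) * prod_op X ps \<psi> v)"
    by auto
  then show ?case using shift_op_linear[of "X p" 1 _ "-1"] by simp
qed simp

text \<open>An additive change of coordinates moves from the shifts to the test function. It serves
  to pass from the three moduli to the four coprime variables of which they are products.\<close>

lemma prod_op_map:
  assumes "\<And>u v. A (u + v) = A u + A v"
  shows "prod_op (\<lambda>p. map (\<lambda>x. (fst x, A (snd x))) (X p)) ps \<phi> (A v) = prod_op X ps (\<lambda>v. \<phi> (A v)) v"
proof (induction ps arbitrary: v)
  case (Cons p ps)
  have *: "shift_op (map (\<lambda>x. (fst x, A (snd x))) xs) \<psi> (A v) = shift_op xs (\<lambda>v. \<psi> (A v)) v" for xs \<psi> v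
    by (induction xs) (simp_all add: assms)
  show ?case by (simp add: * Cons.IH)
qed simp

lemma shift_op_abs_le:
  assumes "\<And>k s. (k, s) \<in> set xs \<Longrightarrow> \<bar>\<phi> (v + s)\<bar> \<le> W s"
  shows "\<bar>shift_op xs \<phi> v\<bar> \<le> (\<Sum>x\<leftarrow>xs. \<bar>fst x\<bar> * W (snd x))"
  using assms
proof (induction xs)
  case (Cons x xs)
  have "\<bar>shift_op xs \<phi> v\<bar> \<le> (\<Sum>x\<leftarrow>xs. \<bar>fst x\<bar> * W (snd x))"
    using Cons by auto
  moreover have "\<bar>fst x * \<phi> (v + snd x)\<bar> \<le> \<bar>fst x\<bar> * W (snd x)"
    using Cons.prems[of "fst x" "snd x"] by (simp add: abs_mult mult_left_mono)
  ultimately show ?case by simp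
qed simp

text \<open>A weight \<open>W\<close> that each local factor reproduces up to \<open>N p\<close> is
  an approximate eigenfunction, so the bounds multiply. The invariant set \<open>C\<close> is
  carried along because majorants of \<open>\<psi>\<close> are known only at points with nonnegative
  coordinates.\<close>

lemma prod_op_bound:
  assumes closed: "\<And>p k s v. p \<in> set ps \<Longrightarrow> (k, s) \<in> set (X p) \<Longrightarrow> C v \<Longrightarrow> C (v + s)"
    and bd: "\<And>v. C v \<Longrightarrow> \<bar>\<psi> v\<bar> \<le> W v"
    and step: "\<And>p v. p \<in> set ps \<Longrightarrow> C v \<Longrightarrow> (\<Sum>x\<leftarrow>X p. \<bar>fst x\<bar> * W (v + snd x)) \<le> N p * W v"
    and N: "\<And>p. p \<in> set ps \<Longrightarrow> 0 \<le> N p"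
    and v: "C v"
  shows "\<bar>prod_op X ps \<psi> v\<bar> \<le> (\<Prod>p\<leftarrow>ps. N p) * W v"
  using closed step N v
proof (induction ps arbitrary: v)
  case Nil
  then show ?case using bd by simp
next
  case (Cons p ps)
  let ?T = "\<Prod>p\<leftarrow>ps. N p"
  have T: "0 \<le> ?T" using Cons.prems(3) by (intro prod_list_nonneg) auto
  have IH: "\<bar>prod_op X ps \<psi> v\<bar> \<le> ?T * W v" if "C v" for v
    using Cons.prems that by (intro Cons.IH) auto
  have "\<bar>prod_op X (p # ps) \<psi> v\<bar> \<le> (\<Sum>x\<leftarrow>X p. \<bar>fst x\<bar> * (?T * W (v + snd x)))"
    unfolding prod_op.simps
    by (rule shift_op_abs_le) (use IH Cons.prems in force)
  also have "\<dots> = ?T * (\<Sum>x\<leftarrow>X p. \<bar>fst x\<bar> * W (v + snd x))"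
    by (simp add: sum_list_const_mult[symmetric] algebra_simps)
  also have "\<dots> \<le> ?T * (N p * W v)"
    using Cons.prems T by (intro mult_left_mono) auto
  finally show ?case by (simp add: algebra_simps)
qed

text \<open>Exponentials of additive functionals are exact eigenfunctions of translations, so the
  step condition becomes a bound for a weighted mass of each local factor.\<close>

lemma prod_op_bound_exp:
  fixes l :: "'v::comm_monoid_add \<Rightarrow> real"
  assumes closed: "\<And>p k s v. p \<in> set ps \<Longrightarrow> (k, s) \<in> set (X p) \<Longrightarrow> C v \<Longrightarrow> C (v + s)"
    and bd: "\<And>v. C v \<Longrightarrow> \<bar>\<psi> v\<bar> \<le> B * exp (l v)"
    and add: "\<And>u v. l (u + v) = l u + l v"
    and N: "\<And>p. p \<in> set ps \<Longrightarrow> (\<Sum>x\<leftarrow>X p. \<bar>fst x\<bar> * exp (l (snd x))) \<le> N p"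
    and v: "C v" and B: "0 \<le> B"
  shows "\<bar>prod_op X ps \<psi> v\<bar> \<le> (\<Prod>p\<leftarrow>ps. N p) * (B * exp (l v))"
proof (rule prod_op_bound[where C = C])
  fix p v assume p: "p \<in> set ps"
  have "(\<Sum>x\<leftarrow>X p. \<bar>fst x\<bar> * (B * exp (l (v + snd x))))
      = B * exp (l v) * (\<Sum>x\<leftarrow>X p. \<bar>fst x\<bar> * exp (l (snd x)))"
    by (simp add: sum_list_const_mult[symmetric] add exp_add algebra_simps)
  also have "\<dots> \<le> B * exp (l v) * N p"
    using N[OF p] B by (intro mult_left_mono) auto
  finally show "(\<Sum>x\<leftarrow>X p. \<bar>fst x\<bar> * (B * exp (l (v + snd x)))) \<le> N p * (B * exp (l v))"
    by (simp add: algebra_simps)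
next
  fix p assume p: "p \<in> set ps"
  have "0 \<le> (\<Sum>x\<leftarrow>X p. \<bar>fst x\<bar> * exp (l (snd x)))"
    by (rule sum_list_nonneg) auto
  then show "0 \<le> N p" using N[OF p] by linarith
qed (use assms in auto)

text \<open>For a majorant of linear growth each prime only adds its first moment
  \<open>m p\<close>. At primes whose weights are as large as \<open>1 / p\<close>, an exponential
  majorant would put a sum of \<open>p powr (\<eta> - 1)\<close> into an exponent; here
  \<open>ln p / p\<close> is merely added.\<close>

lemma prod_op_bound_linear:
  fixes l :: "'v::comm_monoid_add \<Rightarrow> real"
  assumes closed: "\<And>p k s v. p \<in> set ps \<Longrightarrow> (k, s) \<in> set (X p) \<Longrightarrow> C v \<Longrightarrow> C (v + s)"
    and bd: "\<And>v. C v \<Longrightarrow> \<bar>\<psi> v\<bar> \<le> B + l v"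
    and add: "\<And>u v. l (u + v) = l u + l v"
    and pos: "\<And>v. C v \<Longrightarrow> 0 \<le> l v"
    and N: "\<And>p. p \<in> set ps \<Longrightarrow> (\<Sum>x\<leftarrow>X p. \<bar>fst x\<bar>) \<le> 1 + \<kappa> p"
    and N2: "\<And>p. p \<in> set ps \<Longrightarrow> (\<Sum>x\<leftarrow>X p. \<bar>fst x\<bar> * l (snd x)) \<le> m p"
    and \<kappa>: "\<And>p. p \<in> set ps \<Longrightarrow> 0 \<le> \<kappa> p" and m: "\<And>p. p \<in> set ps \<Longrightarrow> 0 \<le> m p"
    and v: "C v" and B: "0 \<le> B"
  shows "\<bar>prod_op X ps \<psi> v\<bar> \<le> (\<Prod>p\<leftarrow>ps. 1 + \<kappa> p) * (B + (\<Sum>p\<leftarrow>ps. m p) + l v)"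
  using closed N N2 \<kappa> m v
proof (induction ps arbitrary: v)
  case Nil
  then show ?case using bd by simp
next
  case (Cons p ps)
  let ?T = "\<Prod>p\<leftarrow>ps. 1 + \<kappa> p" and ?S = "B + (\<Sum>p\<leftarrow>ps. m p)"
  have T: "0 \<le> ?T" using Cons.prems(4) by (intro prod_list_nonneg) (auto simp: add_nonneg_nonneg)
  have S: "0 \<le> ?S" using Cons.prems(5) B by (intro add_nonneg_nonneg sum_list_nonneg) auto
  have IH: "\<bar>prod_op X ps \<psi> v\<bar> \<le> ?T * (?S + l v)" if "C v" for v
    using Cons.prems that by (intro Cons.IH) auto
  have "\<bar>prod_op X (p # ps) \<psi> v\<bar> \<le> (\<Sum>x\<leftarrow>X p. \<bar>fst x\<bar> * (?T * (?S + l (v + snd x))))"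
    unfolding prod_op.simps
    by (rule shift_op_abs_le) (use IH Cons.prems in force)
  also have "\<dots> = (\<Sum>x\<leftarrow>X p. ?T * ((?S + l v) * \<bar>fst x\<bar> + \<bar>fst x\<bar> * l (snd x)))"
    by (simp add: add algebra_simps)
  also have "\<dots> = ?T * ((?S + l v) * (\<Sum>x\<leftarrow>X p. \<bar>fst x\<bar>) + (\<Sum>x\<leftarrow>X p. \<bar>fst x\<bar> * l (snd x)))"
    by (simp only: sum_list_const_mult sum_list_addf)
  \<comment> \<open>The moment is inflated by \<open>1 + \<kappa> p\<close> so that the factor of
    this prime can be taken out of both terms.\<close>
  also have "\<dots> \<le> ?T * ((?S + l v) * (1 + \<kappa> p) + m p * (1 + \<kappa> p))"
  proof (intro mult_left_mono[OF _ T] add_mono)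
    show "(?S + l v) * (\<Sum>x\<leftarrow>X p. \<bar>fst x\<bar>) \<le> (?S + l v) * (1 + \<kappa> p)"
      using Cons.prems S pos by (intro mult_left_mono) auto
    have "(\<Sum>x\<leftarrow>X p. \<bar>fst x\<bar> * l (snd x)) \<le> m p * 1" using Cons.prems by auto
    also have "\<dots> \<le> m p * (1 + \<kappa> p)" using Cons.prems by (intro mult_left_mono) auto
    finally show "(\<Sum>x\<leftarrow>X p. \<bar>fst x\<bar> * l (snd x)) \<le> m p * (1 + \<kappa> p)" .
  qed
  finally show ?case by (simp add: algebra_simps)
qed

section \<open>Squarefree numbers and multiplicative weights\<close>

definition sqf :: "nat set \<Rightarrow> nat set" where
  "sqf P = {q. squarefree q \<and> (\<forall>p. prime p \<longrightarrow> p dvd q \<longrightarrow> p \<in> P)}"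

lemma sqf_pos: "q \<in> sqf P \<Longrightarrow> q > 0"
  by (auto simp: sqf_def intro!: Nat.gr0I)

lemma sqf_empty [simp]: "sqf {} = {1}"
proof -
  have "q = 1" if q: "q \<in> sqf {}" for q
  proof (rule ccontr)
    assume "q \<noteq> 1"
    then obtain p where "prime p" "p dvd q" using prime_factor_nat by blast
    with q show False by (simp add: sqf_def)
  qed
  moreover have "(1::nat) \<in> sqf {}" by (auto simp: sqf_def)
  ultimately show ?thesis by blast
qed

lemma sqf_insert:
  assumes p: "prime p" "p \<notin> P"
  shows "sqf (insert p P) = sqf P \<union> (*) p ` sqf P" "sqf P \<inter> (*) p ` sqf P = {}"
proof -
  have "q \<in> sqf P \<union> (*) p ` sqf P" if q: "q \<in> sqf (insert p P)" for q
  proof (cases "p dvd q")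
    case False
    then show ?thesis using q by (auto simp: sqf_def)
  next
    case True
    then obtain r where r: "q = p * r" by blast
    have sq: "squarefree (p * r)" using q r by (simp add: sqf_def)
    have "\<not> p dvd r"
    proof
      assume "p dvd r"
      then have "p ^ 2 dvd p * r" by (auto simp: power2_eq_square)
      with sq have "p dvd 1" unfolding squarefree_def by blast
      then show False using p(1) not_prime_unit by blast
    qed
    moreover have "squarefree r" using sq by (rule squarefree_multD)
    ultimately have "r \<in> sqf P" using q r by (auto simp: sqf_def)
    then show ?thesis using r by blast
  qed
  moreover have "p * r \<in> sqf (insert p P)" if r: "r \<in> sqf P" for r
  proof -
    have "\<not> p dvd r" using r p by (auto simp: sqf_def)
    then have "coprime p r" using p(1) prime_imp_coprime by blast
    then have "squarefree (p * r)" using r p(1)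
      by (simp add: squarefree_mult_coprime squarefree_prime sqf_def)
    moreover have "q = p \<or> q \<in> P" if "prime q" "q dvd p * r" for q
      using that p r by (auto simp: sqf_def prime_dvd_mult_iff primes_dvd_imp_eq)
    ultimately show ?thesis by (auto simp: sqf_def)
  qed
  moreover have "sqf P \<subseteq> sqf (insert p P)" by (auto simp: sqf_def)
  ultimately show "sqf (insert p P) = sqf P \<union> (*) p ` sqf P" by blast
  show "sqf P \<inter> (*) p ` sqf P = {}" using p by (auto simp: sqf_def)
qed

lemma finite_sqf:
  assumes "finite P" "\<And>p. p \<in> P \<Longrightarrow> prime p"
  shows "finite (sqf P)"
  using assms by (induction P) (simp_all add: sqf_insert)

lemma sum_sqf_insert:
  fixes f :: "nat \<Rightarrow> 'a::comm_monoid_add"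
  assumes "finite P" "\<And>p. p \<in> P \<Longrightarrow> prime p" and p: "prime p" "p \<notin> P"
  shows "(\<Sum>q\<in>sqf (insert p P). f q) = (\<Sum>q\<in>sqf P. f q + f (p * q))"
proof -
  have "inj_on ((*) p) (sqf P)" using p(1) by (auto simp: inj_on_def)
  then show ?thesis
    using assms finite_sqf[of P] sqf_insert[OF p]
    by (simp add: sum.union_disjoint sum.reindex sum.distrib)
qed

lemma sqf_not_dvd: "q \<in> sqf P \<Longrightarrow> prime p \<Longrightarrow> p \<notin> P \<Longrightarrow> \<not> p dvd q"
  by (auto simp: sqf_def)

type_synonym vec4 = "real \<times> real \<times> real \<times> real"

definition ln4 :: "nat \<Rightarrow> nat \<Rightarrow> nat \<Rightarrow> nat \<Rightarrow> vec4" where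
  "ln4 x y z u = (ln (real x), ln (real y), ln (real z), ln (real u))"

definition pick :: "bool \<Rightarrow> nat \<Rightarrow> nat" where
  "pick i p = (if i then p else 1)"

lemma pick_simps [simp]: "pick True p = p" "pick False p = 1"
  by (simp_all add: pick_def)

text \<open>At each prime the weight depends only on which of the four variables it divides. Four
  slots cover both kinds of sums that occur: those over three variables, with the last one forced to
  be 1, and those over the quadruples \<open>a, b, c, d\<close> of the diagonal case.\<close>

definition flag_sum :: "nat set \<Rightarrow> (nat \<Rightarrow> bool \<Rightarrow> bool \<Rightarrow> bool \<Rightarrow> bool \<Rightarrow> real) \<Rightarrow>
    (nat \<Rightarrow> nat \<Rightarrow> nat \<Rightarrow> nat \<Rightarrow> real) \<Rightarrow> real" where
  "flag_sum P E \<phi> = (\<Sum>x\<in>sqf P. \<Sum>y\<in>sqf P. \<Sum>z\<in>sqf P. \<Sum>u\<in>sqf P.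
     (\<Prod>p\<in>P. E p (p dvd x) (p dvd y) (p dvd z) (p dvd u)) * \<phi> x y z u)"

lemma sum_sqf_insert_pick:
  fixes f :: "nat \<Rightarrow> real"
  assumes "finite P" "\<And>p. p \<in> P \<Longrightarrow> prime p" "prime p" "p \<notin> P"
  shows "(\<Sum>q\<in>sqf (insert p P). f q) = (\<Sum>i\<in>UNIV. \<Sum>q\<in>sqf P. f (pick i p * q))"
  using sum_sqf_insert[OF assms] by (simp add: UNIV_bool sum.distrib)

lemma flag_sum_insert:
  assumes P: "finite P" "\<And>p. p \<in> P \<Longrightarrow> prime p" and p: "prime p" "p \<notin> P"
  shows "flag_sum (insert p P) E \<phi> = (\<Sum>i\<in>UNIV. \<Sum>j\<in>UNIV. \<Sum>k\<in>UNIV. \<Sum>l\<in>UNIV.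
      E p i j k l * flag_sum P E (\<lambda>x y z u. \<phi> (pick i p * x) (pick j p * y) (pick k p * z) (pick l p * u)))"
proof -
  let ?S = "sqf P"
  have d1: "p dvd pick i p * x \<longleftrightarrow> i" if "x \<in> ?S" for i x
    using sqf_not_dvd[OF that p] by (cases i) auto
  have d2: "q dvd pick i p * x \<longleftrightarrow> q dvd x" if "q \<in> P" for q i x
  proof -
    have "prime q" "q \<noteq> p" using that P p by auto
    then have "\<not> q dvd p" using p(1) primes_dvd_imp_eq by blast
    then show ?thesis using \<open>prime q\<close> by (cases i) (auto simp: prime_dvd_mult_iff)
  qed
  have step: "(\<Sum>q\<in>sqf (insert p P). f q) = (\<Sum>i\<in>UNIV. \<Sum>q\<in>sqf P. f (pick i p * q))"
    for f :: "nat \<Rightarrow> real"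
    by (rule sum_sqf_insert_pick) (use P p in auto)
  define F where "F i j k l x y z u = (\<Prod>q\<in>P. E q (q dvd x) (q dvd y) (q dvd z) (q dvd u)) *
      \<phi> (pick i p * x) (pick j p * y) (pick k p * z) (pick l p * u)" for i j k l x y z u
  have "flag_sum (insert p P) E \<phi> = (\<Sum>i\<in>UNIV. \<Sum>x\<in>?S. \<Sum>j\<in>UNIV. \<Sum>y\<in>?S. \<Sum>k\<in>UNIV. \<Sum>z\<in>?S.
      \<Sum>l\<in>UNIV. \<Sum>u\<in>?S. E p i j k l * F i j k l x y z u)"
    unfolding flag_sum_def step F_def
    using P p by (intro sum.cong refl) (simp add: d1 d2)
  also have "\<dots> = (\<Sum>i\<in>UNIV. \<Sum>j\<in>UNIV. \<Sum>k\<in>UNIV. \<Sum>l\<in>UNIV. \<Sum>x\<in>?S. \<Sum>y\<in>?S. \<Sum>z\<in>?S.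
      \<Sum>u\<in>?S. E p i j k l * F i j k l x y z u)"
    by (simp only: sum.swap[of _ "UNIV :: bool set" ?S])
  also have "\<dots> = (\<Sum>i\<in>UNIV. \<Sum>j\<in>UNIV. \<Sum>k\<in>UNIV. \<Sum>l\<in>UNIV.
      E p i j k l * flag_sum P E (\<lambda>x y z u. \<phi> (pick i p * x) (pick j p * y) (pick k p * z) (pick l p * u)))"
    by (simp add: flag_sum_def sum_distrib_left F_def)
  finally show ?thesis .
qed

definition flag_ops :: "(nat \<Rightarrow> bool \<Rightarrow> bool \<Rightarrow> bool \<Rightarrow> bool \<Rightarrow> real) \<Rightarrow> nat \<Rightarrow> (real \<times> vec4) list" where
  "flag_ops E p = [(E p i j k l, ln4 (pick i p) (pick j p) (pick k p) (pick l p)).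
     i \<leftarrow> [False, True], j \<leftarrow> [False, True], k \<leftarrow> [False, True], l \<leftarrow> [False, True]]"

lemma shift_op_flag_ops:
  "shift_op (flag_ops E p) \<Phi> v = (\<Sum>i\<in>UNIV. \<Sum>j\<in>UNIV. \<Sum>k\<in>UNIV. \<Sum>l\<in>UNIV.
     E p i j k l * \<Phi> (v + ln4 (pick i p) (pick j p) (pick k p) (pick l p)))"
  by (simp add: flag_ops_def UNIV_bool)

lemma ln4_mult:
  "x > 0 \<Longrightarrow> y > 0 \<Longrightarrow> z > 0 \<Longrightarrow> u > 0 \<Longrightarrow> x' > 0 \<Longrightarrow> y' > 0 \<Longrightarrow> z' > 0 \<Longrightarrow> u' > 0 \<Longrightarrow>
    ln4 (x * x') (y * y') (z * z') (u * u') = ln4 x y z u + ln4 x' y' z' u'"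
  by (simp add: ln4_def ln_mult)

text \<open>In logarithmic coordinates the sixteen flag patterns of a prime are sixteen
  translations, so admitting one more prime into the sum means applying one more local
  factor.\<close>

lemma flag_sum_prod_op:
  assumes "distinct ps" "\<And>p. p \<in> set ps \<Longrightarrow> prime p"
  shows "flag_sum (set ps) E (\<lambda>x y z u. \<Phi> (v + ln4 x y z u)) = prod_op (flag_ops E) ps \<Phi> v"
  using assms
proof (induction ps arbitrary: v)
  case Nil
  then show ?case by (simp add: flag_sum_def ln4_def flip: zero_prod_def)
next
  case (Cons p ps)
  have p: "prime p" "p \<notin> set ps" using Cons.prems by auto
  have pos: "pick i p > 0" for i using p(1) prime_gt_0_nat by (cases i) auto
  have eq: "flag_sum (set ps) E (\<lambda>x y z u. \<Phi> (v + ln4 (pick i p * x) (pick j p * y) (pick k p * z) (pick l p * u)))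
     = prod_op (flag_ops E) ps \<Phi> (v + ln4 (pick i p) (pick j p) (pick k p) (pick l p))" for i j k l
  proof -
    have "flag_sum (set ps) E (\<lambda>x y z u. \<Phi> (v + ln4 (pick i p * x) (pick j p * y) (pick k p * z) (pick l p * u)))
      = flag_sum (set ps) E (\<lambda>x y z u. \<Phi> ((v + ln4 (pick i p) (pick j p) (pick k p) (pick l p)) + ln4 x y z u))"
      unfolding flag_sum_def
      by (intro sum.cong refl) (simp add: ln4_mult pos sqf_pos add.assoc)
    then show ?thesis using Cons by simp
  qed
  show ?case
    using Cons.prems p by (simp only: list.set prod_op.simps)
      (subst flag_sum_insert, auto simp add: eq shift_op_flag_ops)
qed

text \<open>The multiplicative function on squarefree numbers with prescribed values at primes; at
  any other \<open>q\<close> it sees only the radical.\<close>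

definition wprod :: "(nat \<Rightarrow> real) \<Rightarrow> nat \<Rightarrow> real" where
  "wprod w q = (\<Prod>p\<in>prime_factors q. w p)"

lemma wprod_1 [simp]: "wprod w 1 = 1" "wprod w (Suc 0) = 1"
  by (simp_all add: wprod_def)

lemma wprod_mult:
  assumes "coprime a b" "a > 0" "b > 0"
  shows "wprod w (a * b) = wprod w a * wprod w b"
proof -
  have "prime_factors a \<inter> prime_factors b = {}"
    using assms(1) by (auto simp: in_prime_factors_iff dest: coprime_common_divisor)
  then show ?thesis using assms
    by (simp add: wprod_def prime_factorization_mult prod.union_disjoint)
qed

lemma wprod_prime: "prime p \<Longrightarrow> wprod w p = w p"
  by (simp add: wprod_def prime_prime_factors)

lemma wprod_prime_mult:
  assumes "prime p" "\<not> p dvd b" "b > 0"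
  shows "wprod w (p * b) = w p * wprod w b"
  using assms by (simp add: wprod_mult prime_imp_coprime prime_gt_0_nat wprod_prime)

lemma wprod_nonneg: "(\<And>p. prime p \<Longrightarrow> 0 \<le> w p) \<Longrightarrow> 0 \<le> wprod w q"
  unfolding wprod_def by (intro prod_nonneg) auto

lemma wprod_mono:
  assumes "\<And>p. prime p \<Longrightarrow> 0 \<le> f p" "\<And>p. prime p \<Longrightarrow> f p \<le> g p"
  shows "wprod f q \<le> wprod g q"
  unfolding wprod_def using assms by (intro prod_mono) auto

lemma abs_wprod: "\<bar>wprod w q\<bar> = wprod (\<lambda>p. \<bar>w p\<bar>) q"
  by (simp add: wprod_def abs_prod)

lemma wprod_times: "wprod (\<lambda>p. f p * g p) q = wprod f q * wprod g q"
  by (simp add: wprod_def prod.distrib)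

lemma wprod_eq_flags:
  assumes "q \<in> sqf P" "finite P" "\<And>p. p \<in> P \<Longrightarrow> prime p"
  shows "wprod w q = (\<Prod>p\<in>P. if p dvd q then w p else 1)"
proof -
  have "q > 0" using assms sqf_pos by blast
  then have "prime_factors q = {p\<in>P. p dvd q}"
    using assms by (auto simp: in_prime_factors_iff sqf_def)
  then show ?thesis using assms(2) by (simp add: wprod_def prod.inter_filter)
qed

text \<open>The one-variable analogue. The direction \<open>e\<close> is arbitrary because a single
  variable may move several moduli at once.\<close>

lemma sum_wprod_prod_op:
  fixes \<Phi> :: "'v::real_vector \<Rightarrow> real"
  assumes "distinct ps" "\<And>p. p \<in> set ps \<Longrightarrow> prime p"
  shows "(\<Sum>q\<in>sqf (set ps). wprod w q * \<Phi> (v + ln (real q) *\<^sub>R e))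
    = prod_op (\<lambda>p. [(1, 0), (w p, ln (real p) *\<^sub>R e)]) ps \<Phi> v"
  using assms
proof (induction ps arbitrary: v)
  case (Cons p ps)
  have p: "prime p" "p \<notin> set ps" using Cons.prems by auto
  have eq: "wprod w (p * q) * \<Phi> (v + ln (real (p * q)) *\<^sub>R e)
      = w p * (wprod w q * \<Phi> ((v + ln (real p) *\<^sub>R e) + ln (real q) *\<^sub>R e))"
    if "q \<in> sqf (set ps)" for q
    using that p sqf_not_dvd[OF that p] sqf_pos[OF that] prime_gt_0_nat[OF p(1)]
    by (simp add: wprod_prime_mult ln_mult scaleR_add_left add.assoc mult.assoc del: One_nat_def)
  have "(\<Sum>q\<in>sqf (insert p (set ps)). wprod w q * \<Phi> (v + ln (real q) *\<^sub>R e))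
      = (\<Sum>q\<in>sqf (set ps). wprod w q * \<Phi> (v + ln (real q) *\<^sub>R e))
        + w p * (\<Sum>q\<in>sqf (set ps). wprod w q * \<Phi> ((v + ln (real p) *\<^sub>R e) + ln (real q) *\<^sub>R e))"
    using Cons.prems p
    by (subst sum_sqf_insert) (auto simp: sum.distrib sum_distrib_left eq simp del: of_nat_mult cong: sum.cong)
  then show ?case using Cons by simp
qed simp

lemma sum_wprod_expand:
  assumes "finite P" "\<And>p. p \<in> P \<Longrightarrow> prime p"
  shows "(\<Sum>q\<in>sqf P. wprod w q) = (\<Prod>p\<in>P. 1 + w p)"
  using assms
proof (induction P)
  case (insert p P)
  have "(\<Sum>q\<in>sqf P. wprod w (p * q)) = w p * (\<Sum>q\<in>sqf P. wprod w q)"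
    using insert.prems insert.hyps
    by (simp add: sum_distrib_left wprod_prime_mult sqf_not_dvd sqf_pos cong: sum.cong)
  then show ?case using insert
    by (simp add: sum_sqf_insert sum.distrib algebra_simps)
qed simp

lemma sqf_prime_factors: "squarefree q \<Longrightarrow> d dvd q \<Longrightarrow> d \<in> sqf (prime_factors q)"
  by (auto simp: sqf_def in_prime_factors_iff squarefree_def intro: dvd_trans)

lemma dvd_iff_sqf_prime_factors:
  assumes "squarefree q"
  shows "d dvd q \<longleftrightarrow> d \<in> sqf (prime_factors q)"
proof
  assume d: "d \<in> sqf (prime_factors q)"
  have q: "q > 0" using assms by (auto intro!: Nat.gr0I)
  show "d dvd q"
  proof (rule multiplicity_le_imp_dvd)
    show "d \<noteq> 0" using sqf_pos[OF d] by simp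
    fix p :: nat assume p: "prime p"
    show "multiplicity p d \<le> multiplicity p q"
    proof (cases "p dvd d")
      case True
      then have "p dvd q" using d p by (auto simp: sqf_def in_prime_factors_iff)
      then have "multiplicity p q \<ge> 1" using q p by (intro multiplicity_geI) auto
      moreover have "multiplicity p d \<le> 1"
        using d p True sqf_pos[OF d] by (auto simp: sqf_def squarefree_factorial_semiring' in_prime_factors_iff)
      ultimately show ?thesis by linarith
    qed (simp add: not_dvd_imp_multiplicity_0)
  qed
qed (use assms sqf_prime_factors in auto)

lemma sum_dvd_wprod:
  assumes "squarefree q"
  shows "(\<Sum>d | d dvd q. wprod w d) = wprod (\<lambda>p. 1 + w p) q"
  using sum_wprod_expand[of "prime_factors q" w, OF _ in_prime_factors_imp_prime] assms
  by (simp add: wprod_def[of "\<lambda>p. 1 + w p"] dvd_iff_sqf_prime_factors)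

section \<open>Periodicity of the truncated divisor sum\<close>

lemma squarefree_imp_dvd:
  fixes d n :: nat
  assumes "squarefree d" "\<And>p. prime p \<Longrightarrow> p dvd d \<Longrightarrow> p dvd n"
  shows "d dvd n"
proof (cases "n = 0")
  case False
  have d: "d > 0" using assms(1) by (auto intro!: Nat.gr0I)
  show ?thesis
  proof (rule multiplicity_le_imp_dvd)
    show "d \<noteq> 0" using d by simp
    fix p :: nat assume p: "prime p"
    show "multiplicity p d \<le> multiplicity p n"
    proof (cases "p dvd d")
      case True
      then have "multiplicity p n \<ge> 1" using False p assms(2) by (intro multiplicity_geI) auto
      moreover have "multiplicity p d \<le> 1"
        using d p True assms(1) by (auto simp: squarefree_factorial_semiring' in_prime_factors_iff)
      ultimately show ?thesis by linarith
    qed (simp add: not_dvd_imp_multiplicity_0)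
  qed
qed simp

lemma int_div_succ:
  fixes m l :: int
  assumes "l > 0"
  shows "(m + 1) div l = m div l + (if l dvd m + 1 then 1 else 0)"
proof (cases "l dvd m + 1")
  case True
  then obtain k where k: "m + 1 = l * k" by blast
  then have "m = l * (k - 1) + (l - 1)" by (simp add: algebra_simps)
  from int_div_pos_eq[OF this] have "m div l = k - 1" using assms by simp
  then show ?thesis using True k assms by simp
next
  case False
  define r where "r = (m + 1) mod l"
  have r: "0 \<le> r" "r < l" "r \<noteq> 0" using assms False by (auto simp: r_def dvd_eq_mod_eq_0)
  have "m = l * ((m + 1) div l) + (r - 1)"
    using mult_div_mod_eq[of l "m + 1"] unfolding r_def by linarith
  from int_div_pos_eq[OF this] have "m div l = (m + 1) div l" using r by linarith
  then show ?thesis using False by simp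
qed

text \<open>The quotient by \<open>l\<close> jumps exactly at multiples of \<open>l\<close>, so the
  count telescopes. Integer \<open>div\<close> rounds down, which keeps this valid for negative
  arguments.\<close>

lemma card_residue_class:
  fixes z l :: int
  assumes l: "l > 0"
  shows "int (card {n \<in> {a<..b}. l dvd int n - z}) = (if a \<le> b then (int b - z) div l - (int a - z) div l else 0)"
proof (induction b)
  case 0
  show ?case by simp
next
  case (Suc b)
  show ?case
  proof (cases "a \<le> b")
    case True
    then have "{a<..Suc b} = insert (Suc b) {a<..b}" by auto
    then have "{n \<in> {a<..Suc b}. l dvd int n - z} = (if l dvd int (Suc b) - z
        then insert (Suc b) {n \<in> {a<..b}. l dvd int n - z} else {n \<in> {a<..b}. l dvd int n - z})"
      by auto
    then show ?thesis using Suc True int_div_succ[OF l, of "int b - z"] by (auto simp: algebra_simps)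
  next
    case False
    then have "{a<..Suc b} = {}" if "a \<noteq> Suc b" using that by auto
    then show ?thesis using False by (cases "a = Suc b") auto
  qed
qed

text \<open>Three congruences are either incompatible or cut out a single class modulo the lcm of
  the moduli, and a class has length over lcm elements in an interval, up to an error of 1. Stating
  the density as a frequency over a period \<open>Q\<close> treats the insoluble case on the same
  footing and is the form summed later.\<close>

lemma card_common_residues:
  fixes h1 h2 h3 :: int
  assumes d: "d1 dvd Q" "d2 dvd Q" "d3 dvd Q" and Q: "Q > 0" and ab: "a \<le> b"
  defines "Z \<equiv> \<lambda>n. int d1 dvd int n + h1 \<and> int d2 dvd int n + h2 \<and> int d3 dvd int n + h3"
  shows "\<bar>real (card {n \<in> {a<..b}. Z n}) - (real b - real a) * (real (card {n \<in> {0<..Q}. Z n}) / real Q)\<bar> \<le> 1"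
proof (cases "\<exists>z. Z z")
  case False
  then show ?thesis by simp
next
  case True
  then obtain z where z: "Z z" by blast
  define l where "l = lcm (int d1) (lcm (int d2) (int d3))"
  have d0: "d1 > 0" "d2 > 0" "d3 > 0" using d Q by (auto intro!: Nat.gr0I)
  then have l: "l > 0" unfolding l_def by (intro lcm_pos_int) (auto simp: lcm_eq_0_iff)
  have lQ: "l dvd int Q" using d by (simp add: l_def)
  have Z: "Z n \<longleftrightarrow> l dvd int n - int z" for n
  proof -
    have *: "int k dvd int n + h \<longleftrightarrow> int k dvd int n - int z" if "int k dvd int z + h" for k h
    proof -
      have "int n + h = (int n - int z) + (int z + h)" by simp
      then show ?thesis using that dvd_add_left_iff by metis
    qed
    show ?thesis using z unfolding Z_def l_def lcm_least_iff by (simp add: *)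
  qed
  obtain k where k: "int Q = l * k" using lQ by blast
  have kpos: "k > 0" using k Q l by (metis of_nat_0_less_iff zero_less_mult_pos)
  have "(int Q - int z) div l = k + (- int z) div l"
  proof -
    have "int Q - int z = - int z + k * l" using k by simp
    then show ?thesis using l by (simp only: div_mult_self1)
  qed
  then have "int (card {n \<in> {0<..Q}. Z n}) = k"
    using card_residue_class[OF l, of 0 Q "int z"] by (simp add: Z)
  then have cQ: "real (card {n \<in> {0<..Q}. Z n}) = real_of_int k" by (metis of_int_of_nat_eq)
  have "real Q = real_of_int l * real_of_int k" using k by (metis of_int_mult of_int_of_nat_eq)
  then have frac: "real (card {n \<in> {0<..Q}. Z n}) / real Q = 1 / real_of_int l"
    using cQ kpos l by (simp add: field_simps)
  have cab: "real (card {n \<in> {a<..b}. Z n}) = real_of_int ((int b - int z) div l - (int a - int z) div l)"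
  proof -
    have "int (card {n \<in> {a<..b}. Z n}) = (int b - int z) div l - (int a - int z) div l"
      using card_residue_class[OF l, of a b "int z"] ab by (simp add: Z)
    then show ?thesis by (metis of_int_of_nat_eq)
  qed
  have fl: "real_of_int (m div l) \<le> real_of_int m / real_of_int l"
    "real_of_int m / real_of_int l < real_of_int (m div l) + 1" for m
    unfolding floor_divide_of_int_eq[of m l, where 'a = real, symmetric] by linarith+
  have "(real b - real a) * (1 / real_of_int l) = real_of_int (int b - int z) / real_of_int l - real_of_int (int a - int z) / real_of_int l"
    by (simp add: diff_divide_distrib[symmetric])
  then show ?thesis unfolding frac cab of_int_diff abs_le_iff
    using fl[of "int b - int z"] fl[of "int a - int z"] by (simp only: of_int_diff) linarith
qed

text \<open>Opening the three divisor sums leaves one counting problem per triple of divisors, each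
  with error at most 1. The absolute values of the coefficients then factor, and this product is the
  origin of the final error \<open>R ^ k\<close>.\<close>

lemma interval_mean_divisor_sums:
  fixes c :: "'x \<Rightarrow> real" and D :: "'x \<Rightarrow> nat" and h1 h2 h3 :: int
  assumes fin: "finite X1" "finite X2" "finite X3"
    and D: "\<And>x. x \<in> X1 \<union> X2 \<union> X3 \<Longrightarrow> D x dvd Q" and Q: "Q > 0" and ab: "a \<le> b"
  defines "f \<equiv> \<lambda>X (m::int). \<Sum>x\<in>X. c x * of_bool (int (D x) dvd m)"
  defines "G \<equiv> \<lambda>n. f X1 (int n + h1) * f X2 (int n + h2) * f X3 (int n + h3)"
  shows "\<bar>(\<Sum>n\<in>{a<..b}. G n) - (real b - real a) * ((\<Sum>n\<in>{0<..Q}. G n) / real Q)\<bar>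
    \<le> (\<Sum>x\<in>X1. \<bar>c x\<bar>) * (\<Sum>x\<in>X2. \<bar>c x\<bar>) * (\<Sum>x\<in>X3. \<bar>c x\<bar>)"
proof -
  define Z where "Z x y z n \<longleftrightarrow> int (D x) dvd int n + h1 \<and> int (D y) dvd int n + h2 \<and> int (D z) dvd int n + h3" for x y z n
  have G: "G n = (\<Sum>x\<in>X1. \<Sum>y\<in>X2. \<Sum>z\<in>X3. c x * c y * c z * of_bool (Z x y z n))" for n
  proof -
    have "G n = (\<Sum>x\<in>X1. \<Sum>y\<in>X2. \<Sum>z\<in>X3. c x * of_bool (int (D x) dvd int n + h1) *
        (c y * of_bool (int (D y) dvd int n + h2)) * (c z * of_bool (int (D z) dvd int n + h3)))"
      unfolding G_def f_def by (simp only: sum_distrib_left[symmetric] sum_distrib_right[symmetric])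
    then show ?thesis by (simp add: Z_def of_bool_conj mult_ac)
  qed
  have S: "(\<Sum>n\<in>A. G n) = (\<Sum>x\<in>X1. \<Sum>y\<in>X2. \<Sum>z\<in>X3. c x * c y * c z * real (card {n\<in>A. Z x y z n}))"
    if A: "finite A" for A
  proof -
    have "(\<Sum>n\<in>A. G n) = (\<Sum>x\<in>X1. \<Sum>y\<in>X2. \<Sum>z\<in>X3. \<Sum>n\<in>A. c x * c y * c z * of_bool (Z x y z n))"
      unfolding G by (simp only: sum.swap[of _ A])
    moreover have "(\<Sum>n\<in>A. c x * c y * c z * of_bool (Z x y z n)) = c x * c y * c z * real (card {n\<in>A. Z x y z n})" for x y z
    proof -
      have "(\<Sum>n\<in>A. of_bool (Z x y z n)) = real (card {n\<in>A. Z x y z n})"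
        using A by (simp add: Int_def)
      then show ?thesis by (simp only: sum_distrib_left[symmetric])
    qed
    ultimately show ?thesis by simp
  qed
  have "(\<Sum>n\<in>{a<..b}. G n) - (real b - real a) * ((\<Sum>n\<in>{0<..Q}. G n) / real Q)
      = (\<Sum>x\<in>X1. \<Sum>y\<in>X2. \<Sum>z\<in>X3. c x * c y * c z * (real (card {n\<in>{a<..b}. Z x y z n})
          - (real b - real a) * (real (card {n\<in>{0<..Q}. Z x y z n}) / real Q)))"
    by (simp add: S right_diff_distrib sum_subtractf sum_distrib_left sum_divide_distrib mult_ac)
  also have "\<bar>\<dots>\<bar> \<le> (\<Sum>x\<in>X1. \<Sum>y\<in>X2. \<Sum>z\<in>X3. \<bar>c x\<bar> * \<bar>c y\<bar> * \<bar>c z\<bar>)"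
  proof (intro order_trans[OF sum_abs] sum_mono)
    fix x y z assume xyz: "x \<in> X1" "y \<in> X2" "z \<in> X3"
    have "\<bar>real (card {n\<in>{a<..b}. Z x y z n}) - (real b - real a) * (real (card {n\<in>{0<..Q}. Z x y z n}) / real Q)\<bar> \<le> 1"
      unfolding Z_def using D xyz Q ab by (intro card_common_residues) auto
    from mult_left_mono[OF this, of "\<bar>c x\<bar> * \<bar>c y\<bar> * \<bar>c z\<bar>"]
    show "\<bar>c x * c y * c z * (real (card {n\<in>{a<..b}. Z x y z n})
          - (real b - real a) * (real (card {n\<in>{0<..Q}. Z x y z n}) / real Q))\<bar> \<le> \<bar>c x\<bar> * \<bar>c y\<bar> * \<bar>c z\<bar>"
      by (simp add: abs_mult)
  qed
  also have "\<dots> = (\<Sum>x\<in>X1. \<bar>c x\<bar>) * (\<Sum>x\<in>X2. \<bar>c x\<bar>) * (\<Sum>x\<in>X3. \<bar>c x\<bar>)"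
    by (simp add: sum_distrib_left[symmetric] sum_distrib_right[symmetric])
  finally show ?thesis .
qed

text \<open>By the Chinese remainder theorem the residues modulo the primes of \<open>P\<close> run
  independently over a full period.\<close>

lemma sum_prod_periodic:
  fixes F :: "nat \<Rightarrow> nat \<Rightarrow> real"
  assumes "finite P" "\<And>p. p \<in> P \<Longrightarrow> prime p" "\<And>p n. p \<in> P \<Longrightarrow> F p (n mod p) = F p n"
  shows "(\<Sum>n<\<Prod>P. \<Prod>p\<in>P. F p n) = (\<Prod>p\<in>P. \<Sum>n<p. F p n)"
  using assms
proof (induction P)
  case empty
  have "{..<Suc 0} = {0}" by auto
  then show ?case by simp
next
  case (insert p P)
  define Q where "Q = \<Prod>P"
  have Q: "Q > 0" unfolding Q_def using insert.prems by (intro prod_pos) (auto intro: prime_gt_0_nat)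
  have p0: "p > 0" using insert.prems by (auto intro: prime_gt_0_nat)
  have cop: "coprime p Q" unfolding Q_def
    using insert.prems insert.hyps by (intro prod_coprime_right) (auto intro: primes_coprime)
  define f where "f n = (\<Prod>q\<in>P. F q n)" for n
  have f: "f (n mod Q) = f n" for n
    unfolding f_def
  proof (intro prod.cong refl)
    fix q assume q: "q \<in> P"
    then have "q dvd Q" unfolding Q_def using insert.hyps by (intro dvd_prodI) auto
    then have "n mod Q mod q = n mod q" by (rule mod_mod_cancel)
    then show "F q (n mod Q) = F q n" using insert.prems(2)[of q] q by (metis insertCI)
  qed
  have bij: "bij_betw (\<lambda>n. (n mod p, n mod Q)) {..<p * Q} ({..<p} \<times> {..<Q})"
    unfolding bij_betw_def
  proof
    show inj: "inj_on (\<lambda>n. (n mod p, n mod Q)) {..<p * Q}"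
    proof (rule inj_onI)
      fix x y assume xy: "x \<in> {..<p * Q}" "y \<in> {..<p * Q}" "(x mod p, x mod Q) = (y mod p, y mod Q)"
      then have "[x = y] (mod p)" "[x = y] (mod Q)" by (simp_all add: Cong.cong_def)
      then have "[x = y] (mod (p * Q))" using cop by (rule coprime_cong_mult_nat)
      then have "x mod (p * Q) = y mod (p * Q)" by (simp only: Cong.cong_def)
      then show "x = y" using xy by simp
    qed
    have "(\<lambda>n. (n mod p, n mod Q)) ` {..<p * Q} \<subseteq> {..<p} \<times> {..<Q}" using p0 Q by auto
    moreover have "card ((\<lambda>n. (n mod p, n mod Q)) ` {..<p * Q}) = card ({..<p} \<times> {..<Q})"
      using inj by (simp add: card_image)
    ultimately show "(\<lambda>n. (n mod p, n mod Q)) ` {..<p * Q} = {..<p} \<times> {..<Q}"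
      by (intro card_subset_eq) auto
  qed
  have "(\<Sum>n<\<Prod>(insert p P). \<Prod>q\<in>insert p P. F q n) = (\<Sum>n<p * Q. F p (n mod p) * f (n mod Q))"
    using insert.hyps insert.prems by (simp add: f f_def[symmetric] Q_def[symmetric])
  also have "\<dots> = (\<Sum>x\<in>{..<p} \<times> {..<Q}. F p (fst x) * f (snd x))"
    using sum.reindex_bij_betw[OF bij, of "\<lambda>x. F p (fst x) * f (snd x)"] by simp
  also have "\<dots> = (\<Sum>n<p. F p n) * (\<Sum>n<Q. f n)"
    by (simp add: sum.cartesian_product' sum_product)
  also have "(\<Sum>n<Q. f n) = (\<Prod>q\<in>P. \<Sum>n<q. F q n)"
    unfolding Q_def f_def using insert by auto
  finally show ?case using insert.hyps by simp
qed

lemma sum_filter_of_bool: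
  fixes g :: "'a \<Rightarrow> real"
  assumes "finite A"
  shows "(\<Sum>q\<in>{q\<in>A. P q}. g q) = (\<Sum>q\<in>A. of_bool (P q) * g q)"
  unfolding sum.inter_filter[OF assms] by (intro sum.cong) auto

text \<open>The local factor of the sum of \<open>d * mu(d)\<close> over the common divisors
  \<open>d\<close> of \<open>q\<close> and \<open>m\<close>. It takes the values 1 and
  \<open>1 - p\<close> and has mean zero over a period.\<close>

definition sieve_factor :: "nat \<Rightarrow> int \<Rightarrow> real" where
  "sieve_factor p m = 1 - real p * of_bool (int p dvd m)"

text \<open>\<open>lam 1\<close> continues \<open>lambda_R\<close> periodically from the positive
  integers to all integers. The values used for \<open>u\<close> are 0 and 1: with
  \<open>u = 0\<close> only \<open>q = 1\<close> survives and the weight is constantly 1, so that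
  products of one or two weights are special cases of products of three.\<close>

definition lam :: "real \<Rightarrow> nat set \<Rightarrow> real \<Rightarrow> int \<Rightarrow> real" where
  "lam u P R m = (\<Sum>q\<in>sqf P. of_bool (real q \<le> R) *
      (wprod (\<lambda>p. u / (real p - 1)) q * wprod (\<lambda>p. sieve_factor p m) q))"

lemma squarefree_prod_id:
  fixes q :: nat
  assumes "squarefree q"
  shows "real q = wprod real q"
proof -
  have q: "q > 0" using assms by (auto intro!: Nat.gr0I)
  have "q = (\<Prod>p\<in>prime_factors q. p ^ multiplicity p q)"
    using prod_prime_factors[of q] q by simp
  also have "\<dots> = (\<Prod>p\<in>prime_factors q. p)"
    using assms q by (intro prod.cong) (auto simp: squarefree_factorial_semiring')
  finally have "real q = real (\<Prod>p\<in>prime_factors q. p)" by (rule arg_cong)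
  then show ?thesis by (simp add: wprod_def)
qed

lemma totient_squarefree:
  fixes q :: nat
  assumes "squarefree q"
  shows "real (totient q) = wprod (\<lambda>p. real p - 1) q"
proof -
  have q: "q > 0" using assms by (auto intro!: Nat.gr0I)
  have "totient q = (\<Prod>p\<in>prime_factors q. p ^ (multiplicity p q - 1) * (p - 1))"
    using q by (rule totient_formula1)
  also have "\<dots> = (\<Prod>p\<in>prime_factors q. p - 1)"
    using assms q by (intro prod.cong) (auto simp: squarefree_factorial_semiring')
  finally have "real (totient q) = real (\<Prod>p\<in>prime_factors q. p - 1)" by (rule arg_cong)
  also have "\<dots> = wprod (\<lambda>p. real p - 1) q"
    unfolding wprod_def of_nat_prod by (intro prod.cong refl) (auto simp: of_nat_diff dest!: in_prime_factors_imp_prime prime_ge_1_nat)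
  finally show ?thesis .
qed

text \<open>For squarefree \<open>q\<close> the divisor sum over \<open>gcd q m\<close> factors over
  the primes of \<open>q\<close>. The set \<open>P\<close> must contain every prime up to
  \<open>R\<close> for \<open>sqf P\<close> to contain every squarefree
  \<open>q \<le> R\<close>.\<close>

lemma lambda_R_eq_lam:
  assumes m: "m > 0" and P: "finite P" "\<And>p. p \<in> P \<Longrightarrow> prime p" "\<And>p. prime p \<Longrightarrow> real p \<le> R \<Longrightarrow> p \<in> P"
  shows "lambda_R R m = lam 1 P R m"
proof -
  have fin: "finite {q. 1 \<le> q \<and> real q \<le> R}"
    by (rule finite_subset[of _ "{..nat \<lfloor>R\<rfloor>}"]) (auto simp: le_nat_floor)
  have inner: "(moebius_mu q)\<^sup>2 / real (totient q) * (\<Sum>d | d dvd gcd q (nat m). real d * moebius_mu d)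
      = wprod (\<lambda>p. 1 / (real p - 1)) q * wprod (\<lambda>p. sieve_factor p m) q" if q: "squarefree q" for q
  proof -
    define g where "g = gcd q (nat m)"
    have q0: "q > 0" using q by (auto intro!: Nat.gr0I)
    have g: "squarefree g" using q unfolding g_def by (rule squarefree_mono[rotated]) simp
    have mu: "(moebius_mu q)\<^sup>2 = 1" using q by (simp add: moebius_mu_def power_mult[symmetric])
    have "(\<Sum>d | d dvd g. real d * moebius_mu d) = (\<Sum>d | d dvd g. wprod (\<lambda>p. - real p) d)"
    proof (intro sum.cong refl)
      fix d assume "d \<in> {d. d dvd g}"
      then have d: "squarefree d" using g squarefree_mono by auto
      have "wprod (\<lambda>p. - real p) d = wprod (\<lambda>p. -1 * real p) d" by simp
      also have "\<dots> = wprod (\<lambda>_. -1) d * real d"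
        by (simp only: wprod_times squarefree_prod_id[OF d, symmetric])
      also have "wprod (\<lambda>_. -1) d = moebius_mu d" using d by (simp add: moebius_mu_def wprod_def)
      finally show "real d * moebius_mu d = wprod (\<lambda>p. - real p) d" by simp
    qed
    also have "\<dots> = wprod (\<lambda>p. 1 + - real p) g" by (rule sum_dvd_wprod[OF g])
    also have "\<dots> = wprod (\<lambda>p. sieve_factor p m) q"
    proof -
      have "int p dvd m \<longleftrightarrow> p dvd nat m" for p
        using of_nat_dvd_iff[of p "nat m", where 'a = int] m by simp
      then have dv: "p dvd g \<longleftrightarrow> p dvd q \<and> int p dvd m" for p by (simp add: g_def)
      have "g \<noteq> 0" using q0 by (simp add: g_def)
      then have "prime_factors g = {p \<in> prime_factors q. int p dvd m}"
        using q0 unfolding set_eq_iff mem_Collect_eq in_prime_factors_iff dv by blast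
      then show ?thesis
        unfolding wprod_def by (simp add: prod.inter_filter sieve_factor_def) (intro prod.cong refl, auto)
    qed
    moreover have "1 / real (totient q) = wprod (\<lambda>p. 1 / (real p - 1)) q"
      by (simp add: totient_squarefree[OF q] wprod_def prod_dividef)
    ultimately show ?thesis by (simp add: mu g_def)
  qed
  have "lambda_R R m = (\<Sum>q | 1 \<le> q \<and> real q \<le> R. (moebius_mu q)\<^sup>2 / real (totient q) * (\<Sum>d | d dvd gcd q (nat m). real d * moebius_mu d))"
    using m by (simp add: lambda_R_def)
  also have "\<dots> = (\<Sum>q \<in> {q\<in>sqf P. real q \<le> R}. wprod (\<lambda>p. 1 / (real p - 1)) q * wprod (\<lambda>p. sieve_factor p m) q)"
  proof (rule sum.mono_neutral_cong_right[OF fin])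
    show "{q \<in> sqf P. real q \<le> R} \<subseteq> {q. 1 \<le> q \<and> real q \<le> R}" using sqf_pos by force
    have "q \<in> sqf P" if "squarefree q" "1 \<le> q" "real q \<le> R" for q
    proof -
      have "p \<in> P" if "prime p" "p dvd q" for p
        using P(3)[OF that(1)] dvd_imp_le[OF that(2)] \<open>1 \<le> q\<close> \<open>real q \<le> R\<close> by linarith
      then show ?thesis using that by (simp add: sqf_def)
    qed
    then show "\<forall>q\<in>{q. 1 \<le> q \<and> real q \<le> R} - {q \<in> sqf P. real q \<le> R}.
        (moebius_mu q)\<^sup>2 / real (totient q) * (\<Sum>d | d dvd gcd q (nat m). real d * moebius_mu d) = 0"
      by (auto simp: moebius_mu_def)
    fix q assume "q \<in> {q\<in>sqf P. real q \<le> R}"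
    then show "(moebius_mu q)\<^sup>2 / real (totient q) * (\<Sum>d | d dvd gcd q (nat m). real d * moebius_mu d)
      = wprod (\<lambda>p. 1 / (real p - 1)) q * wprod (\<lambda>p. sieve_factor p m) q"
      by (intro inner) (simp add: sqf_def)
  qed
  also have "\<dots> = lam 1 P R m"
    using finite_sqf[OF P(1,2)] by (simp add: lam_def sum_filter_of_bool)
  finally show ?thesis .
qed

text \<open>Counting in intervals needs coefficients times divisibility conditions, whereas mean
  values need the product form; this passes from the second to the first.\<close>

lemma wprod_sieve_factor:
  assumes "squarefree q"
  shows "wprod (\<lambda>p. sieve_factor p m) q = (\<Sum>d | d dvd q. wprod (\<lambda>p. - real p) d * of_bool (int d dvd m))"
proof -
  have "wprod (\<lambda>p. sieve_factor p m) q = wprod (\<lambda>p. 1 + (- real p * of_bool (int p dvd m))) q"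
    by (simp add: sieve_factor_def)
  also have "\<dots> = (\<Sum>d | d dvd q. wprod (\<lambda>p. - real p * of_bool (int p dvd m)) d)"
    using assms by (rule sum_dvd_wprod[symmetric])
  also have "\<dots> = (\<Sum>d | d dvd q. wprod (\<lambda>p. - real p) d * of_bool (int d dvd m))"
  proof (intro sum.cong refl)
    fix d assume "d \<in> {d. d dvd q}"
    then have d: "squarefree d" using assms squarefree_mono by auto
    then have d0: "d > 0" by (auto intro!: Nat.gr0I)
    have "wprod (\<lambda>p. of_bool (int p dvd m)) d = (of_bool (int d dvd m) :: real)"
    proof (cases "int d dvd m")
      case True
      then have "int p dvd m" if "p \<in> prime_factors d" for p
        using that by (meson dvd_trans in_prime_factors_imp_dvd of_nat_dvd_iff)
      then show ?thesis using True by (simp add: wprod_def)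
    next
      case False
      have "\<exists>p. prime p \<and> p dvd d \<and> \<not> int p dvd m"
      proof (rule ccontr)
        assume n: "\<not> ?thesis"
        have "d dvd nat \<bar>m\<bar>"
        proof (rule squarefree_imp_dvd[OF d])
          fix p assume "prime p" "p dvd d"
          then have "int p dvd m" using n by blast
          then show "p dvd nat \<bar>m\<bar>" by simp
        qed
        then have "int d dvd m" by simp
        then show False using False by blast
      qed
      then obtain p where "prime p" "p dvd d" "\<not> int p dvd m" by blast
      then have "p \<in> prime_factors d" using d0 by (auto simp: in_prime_factors_iff)
      then have "wprod (\<lambda>p. of_bool (int p dvd m) :: real) d = 0"
        unfolding wprod_def using \<open>\<not> int p dvd m\<close> by (subst prod_zero_iff) auto
      then show ?thesis using False by simp
    qed
    then show "wprod (\<lambda>p. - real p * of_bool (int p dvd m)) d = wprod (\<lambda>p. - real p) d * of_bool (int d dvd m)"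
      by (simp only: wprod_times)
  qed
  finally show ?thesis .
qed

text \<open>The sum of the absolute coefficients of \<open>lam\<close> after opening the sieve
  factors: the divisors of \<open>q\<close> sum to the product of \<open>p + 1\<close>, which is
  divided by the product of \<open>p - 1\<close>.\<close>

definition lam_err :: "real \<Rightarrow> nat set \<Rightarrow> real \<Rightarrow> real" where
  "lam_err u P R = (\<Sum>q\<in>sqf P. of_bool (real q \<le> R) * wprod (\<lambda>p. u * (real p + 1) / (real p - 1)) q)"

lemma interval_mean_lam:
  fixes R :: real and h1 h2 h3 :: int
  assumes P: "finite P" "\<And>p. p \<in> P \<Longrightarrow> prime p" and u: "0 \<le> u1" "0 \<le> u2" "0 \<le> u3" and ab: "a \<le> b"
  defines "G \<equiv> \<lambda>n. lam u1 P R (int n + h1) * lam u2 P R (int n + h2) * lam u3 P R (int n + h3)"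
  shows "\<bar>(\<Sum>n\<in>{a<..b}. G n) - (real b - real a) * ((\<Sum>n\<in>{0<..\<Prod>P}. G n) / real (\<Prod>P))\<bar>
    \<le> lam_err u1 P R * lam_err u2 P R * lam_err u3 P R"
proof -
  \<comment> \<open>A term of \<open>lam u\<close> is indexed by \<open>q\<close> and a divisor
    \<open>d\<close> of \<open>q\<close>. The weight \<open>u\<close> is carried inside the index so
    that a single coefficient function \<open>c\<close> serves all three factors, as
    \<open>interval_mean_divisor_sums\<close> demands.\<close>
  define Y where "Y = Sigma {q\<in>sqf P. real q \<le> R} (\<lambda>q. {d. d dvd q})"
  define c where "c x = (case x of (u, q, d) \<Rightarrow> wprod (\<lambda>p. u / (real p - 1)) q * wprod (\<lambda>p. - real p) d)" for x :: "real \<times> nat \<times> nat"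
  define X where "X u = {u} \<times> Y" for u :: real
  have fS: "finite (sqf P)" using P by (rule finite_sqf)
  have finY: "finite Y" unfolding Y_def
    using fS sqf_pos by (intro finite_SigmaI) auto
  have sumX: "(\<Sum>x\<in>X u. g x) = (\<Sum>q\<in>sqf P. of_bool (real q \<le> R) * (\<Sum>d | d dvd q. g (u, q, d)))" for u and g :: "_ \<Rightarrow> real"
  proof -
    have "(\<Sum>x\<in>X u. g x) = (\<Sum>y\<in>Y. g (u, y))"
      unfolding X_def using sum.cartesian_product'[of "\<lambda>x. g x" "{u}" Y] by simp
    also have "\<dots> = (\<Sum>q\<in>{q\<in>sqf P. real q \<le> R}. \<Sum>d | d dvd q. g (u, q, d))"
      unfolding Y_def using fS sqf_pos by (subst sum.Sigma) auto
    also have "\<dots> = (\<Sum>q\<in>sqf P. of_bool (real q \<le> R) * (\<Sum>d | d dvd q. g (u, q, d)))"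
      using fS by (rule sum_filter_of_bool)
    finally show ?thesis .
  qed
  have lam: "lam u P R m = (\<Sum>x\<in>X u. c x * of_bool (int (snd (snd x)) dvd m))" for u m
    unfolding sumX lam_def
    by (intro sum.cong refl) (simp add: wprod_sieve_factor sqf_def c_def sum_distrib_left mult_ac)
  have err: "(\<Sum>x\<in>X u. \<bar>c x\<bar>) = lam_err u P R" if "u \<ge> 0" for u
    unfolding sumX lam_err_def
  proof (intro sum.cong refl)
    fix q assume q: "q \<in> sqf P"
    have "(\<Sum>d | d dvd q. \<bar>c (u, q, d)\<bar>) = wprod (\<lambda>p. \<bar>u / (real p - 1)\<bar>) q * (\<Sum>d | d dvd q. wprod (\<lambda>p. real p) d)"
      by (simp add: c_def abs_mult abs_wprod sum_distrib_left)
    also have "\<dots> = wprod (\<lambda>p. \<bar>u / (real p - 1)\<bar> * (1 + real p)) q"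
    proof -
      have "squarefree q" using q by (simp add: sqf_def)
      then show ?thesis by (simp only: wprod_times sum_dvd_wprod)
    qed
    also have "\<dots> = wprod (\<lambda>p. u * (real p + 1) / (real p - 1)) q"
      unfolding wprod_def using that
    proof (intro prod.cong refl)
      fix p assume "p \<in> prime_factors q"
      then have "p \<ge> 2" using in_prime_factors_imp_prime prime_ge_2_nat by blast
      then have "\<bar>u / (real p - 1)\<bar> = u / (real p - 1)" using that by (intro abs_of_nonneg) auto
      then show "\<bar>u / (real p - 1)\<bar> * (1 + real p) = u * (real p + 1) / (real p - 1)"
        by (simp add: add.commute)
    qed
    finally show "of_bool (real q \<le> R) * (\<Sum>d | d dvd q. \<bar>c (u, q, d)\<bar>)
      = of_bool (real q \<le> R) * wprod (\<lambda>p. u * (real p + 1) / (real p - 1)) q" by simp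
  qed
  have dvd: "snd (snd x) dvd \<Prod>P" if "x \<in> X u1 \<union> X u2 \<union> X u3" for x
  proof -
    obtain u q d where x: "x = (u, q, d)" by (cases x)
    have q: "q \<in> sqf P" "d dvd q" using that x by (auto simp: X_def Y_def)
    have "q dvd \<Prod>P"
    proof (rule squarefree_imp_dvd)
      show "squarefree q" using q(1) by (simp add: sqf_def)
      show "p dvd \<Prod>P" if "prime p" "p dvd q" for p
        using q(1) that P(1) by (intro dvd_prodI) (auto simp: sqf_def)
    qed
    then show ?thesis using x q by (auto intro: dvd_trans)
  qed
  have pos: "\<Prod>P > 0" using P by (intro prod_pos) (auto intro: prime_gt_0_nat)
  show ?thesis
    unfolding G_def lam err[OF u(1), symmetric] err[OF u(2), symmetric] err[OF u(3), symmetric]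
    by (rule interval_mean_divisor_sums[where D = "\<lambda>x. snd (snd x)"]) (use finY dvd pos ab in \<open>auto simp: X_def\<close>)
qed

definition local_mean :: "int \<Rightarrow> int \<Rightarrow> int \<Rightarrow> nat \<Rightarrow> bool \<Rightarrow> bool \<Rightarrow> bool \<Rightarrow> real" where
  "local_mean h1 h2 h3 p i j k = (\<Sum>n<p. (if i then sieve_factor p (int n + h1) else 1) *
     (if j then sieve_factor p (int n + h2) else 1) * (if k then sieve_factor p (int n + h3) else 1)) / real p"

text \<open>The value 0 for a set fourth flag confines the fourth variable of
  \<open>flag_sum\<close> to 1.\<close>

definition corr_wt :: "real \<Rightarrow> real \<Rightarrow> real \<Rightarrow> int \<Rightarrow> int \<Rightarrow> int \<Rightarrow> nat \<Rightarrow> bool \<Rightarrow> bool \<Rightarrow> bool \<Rightarrow> bool \<Rightarrow> real" where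
  "corr_wt u1 u2 u3 h1 h2 h3 p i j k l = (if l then 0 else
     (if i then u1 / (real p - 1) else 1) * (if j then u2 / (real p - 1) else 1) *
     (if k then u3 / (real p - 1) else 1) * local_mean h1 h2 h3 p i j k)"

lemma sieve_factor_mod: "sieve_factor p (int (n mod p) + h) = sieve_factor p (int n + h)"
proof -
  have "int p dvd int (n mod p) + h \<longleftrightarrow> int p dvd int n + h"
    by (simp add: dvd_eq_mod_eq_0 zmod_int mod_add_left_eq)
  then show ?thesis by (simp add: sieve_factor_def)
qed

text \<open>For fixed moduli the product of sieve factors is a product of functions periodic modulo
  single primes, so its mean splits into local means; the cutoffs stay outside as the test
  function.\<close>

lemma mean_lam_eq_flag_sum:
  fixes R u1 u2 u3 :: real and h1 h2 h3 :: int
  assumes P: "finite P" "\<And>p. p \<in> P \<Longrightarrow> prime p"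
  defines "G \<equiv> \<lambda>n. lam u1 P R (int n + h1) * lam u2 P R (int n + h2) * lam u3 P R (int n + h3)"
  shows "(\<Sum>n\<in>{0<..\<Prod>P}. G n) / real (\<Prod>P)
    = flag_sum P (corr_wt u1 u2 u3 h1 h2 h3) (\<lambda>x y z u. of_bool (real x \<le> R \<and> real y \<le> R \<and> real z \<le> R))"
proof -
  let ?Q = "\<Prod>P" and ?S = "sqf P"
  have pos: "?Q > 0" using P by (intro prod_pos) (auto intro: prime_gt_0_nat)
  have fS: "finite ?S" using P by (rule finite_sqf)
  define s where "s q h n = wprod (\<lambda>p. sieve_factor p (int n + h)) q" for q h n
  define g where "g u q = of_bool (real q \<le> R) * wprod (\<lambda>p. u / (real p - 1)) q" for u q
  have lam: "lam u P R (int n + h) = (\<Sum>q\<in>?S. g u q * s q h n)" for u h n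
    by (simp add: lam_def g_def s_def mult_ac)
  have "sieve_factor p (int ?Q + h) = sieve_factor p (int 0 + h)" if "p \<in> P" for p h
  proof -
    have "p dvd ?Q" using that P by (intro dvd_prodI) auto
    then have "?Q mod p = 0" by simp
    then show ?thesis using sieve_factor_mod[of p ?Q h] sieve_factor_mod[of p 0 h] by simp
  qed
  then have "s q h ?Q = s q h 0" if "q \<in> ?S" for q h
    unfolding s_def wprod_def using that by (intro prod.cong refl) (auto simp: sqf_def in_prime_factors_iff)
  \<comment> \<open>Interval counts run from 1 to the period, the product formula from 0 to one
    less; periodicity identifies the two end points.\<close>
  then have GQ: "G ?Q = G 0" unfolding G_def lam by (simp cong: sum.cong)
  have *: "(\<Sum>x\<in>?S. g u1 x * s x h1 n) * (\<Sum>x\<in>?S. g u2 x * s x h2 n) * (\<Sum>x\<in>?S. g u3 x * s x h3 n)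
     = (\<Sum>x\<in>?S. \<Sum>y\<in>?S. \<Sum>z\<in>?S. g u1 x * g u2 y * g u3 z * (s x h1 n * s y h2 n * s z h3 n))" for n
  proof -
    have "(\<Sum>x\<in>?S. g u1 x * s x h1 n) * (\<Sum>x\<in>?S. g u2 x * s x h2 n) * (\<Sum>x\<in>?S. g u3 x * s x h3 n)
     = (\<Sum>x\<in>?S. \<Sum>y\<in>?S. \<Sum>z\<in>?S. g u1 x * s x h1 n * (g u2 y * s y h2 n) * (g u3 z * s z h3 n))"
      by (simp only: sum_distrib_left[symmetric] sum_distrib_right[symmetric])
    then show ?thesis by (simp add: mult_ac)
  qed
  have "(\<Sum>n\<in>{0<..?Q}. G n) = (\<Sum>n<?Q. G n)"
  proof -
    have "{0<..?Q} = insert ?Q {0<..<?Q}" "{..<?Q} = insert 0 {0<..<?Q}" using pos by auto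
    then show ?thesis using GQ by simp
  qed
  also have "\<dots> = (\<Sum>n<?Q. \<Sum>x\<in>?S. \<Sum>y\<in>?S. \<Sum>z\<in>?S. g u1 x * g u2 y * g u3 z * (s x h1 n * s y h2 n * s z h3 n))"
    unfolding G_def lam by (intro sum.cong refl, rule *)
  also have "\<dots> = (\<Sum>x\<in>?S. \<Sum>y\<in>?S. \<Sum>z\<in>?S. g u1 x * g u2 y * g u3 z * (\<Sum>n<?Q. s x h1 n * s y h2 n * s z h3 n))"
    by (simp only: sum.swap[of _ "{..<?Q}"] sum_distrib_left)
  finally have 1: "(\<Sum>n\<in>{0<..?Q}. G n) / real ?Q
     = (\<Sum>x\<in>?S. \<Sum>y\<in>?S. \<Sum>z\<in>?S. g u1 x * g u2 y * g u3 z * ((\<Sum>n<?Q. s x h1 n * s y h2 n * s z h3 n) / real ?Q))"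
    by (simp only: sum_divide_distrib[of _ ?S] times_divide_eq_right)
  have mean: "(\<Sum>n<?Q. s x h1 n * s y h2 n * s z h3 n) / real ?Q = (\<Prod>p\<in>P. local_mean h1 h2 h3 p (p dvd x) (p dvd y) (p dvd z))"
    if xyz: "x \<in> ?S" "y \<in> ?S" "z \<in> ?S" for x y z
  proof -
    define F where "F p n = (if p dvd x then sieve_factor p (int n + h1) else 1) *
     (if p dvd y then sieve_factor p (int n + h2) else 1) * (if p dvd z then sieve_factor p (int n + h3) else 1)" for p n
    have "s x h1 n * s y h2 n * s z h3 n = (\<Prod>p\<in>P. F p n)" for n
      unfolding s_def F_def using xyz P by (simp add: wprod_eq_flags prod.distrib)
    then have "(\<Sum>n<?Q. s x h1 n * s y h2 n * s z h3 n) = (\<Prod>p\<in>P. \<Sum>n<p. F p n)"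
      using P by (simp add: sum_prod_periodic F_def sieve_factor_mod)
    then show ?thesis by (simp add: local_mean_def F_def prod_dividef of_nat_prod)
  qed
  have 2: "g u1 x * g u2 y * g u3 z * (\<Prod>p\<in>P. local_mean h1 h2 h3 p (p dvd x) (p dvd y) (p dvd z))
     = (\<Prod>p\<in>P. corr_wt u1 u2 u3 h1 h2 h3 p (p dvd x) (p dvd y) (p dvd z) False) * of_bool (real x \<le> R \<and> real y \<le> R \<and> real z \<le> R)"
    if xyz: "x \<in> ?S" "y \<in> ?S" "z \<in> ?S" for x y z
    unfolding g_def using xyz P by (simp add: wprod_eq_flags corr_wt_def prod.distrib of_bool_conj)
  \<comment> \<open>Any prime dividing \<open>u\<close> contributes the factor 0, so the fourth sum
    reduces to \<open>u = 1\<close>.\<close>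
  have 3: "(\<Sum>u\<in>?S. (\<Prod>p\<in>P. corr_wt u1 u2 u3 h1 h2 h3 p (i p) (j p) (k p) (p dvd u)) * c)
     = (\<Prod>p\<in>P. corr_wt u1 u2 u3 h1 h2 h3 p (i p) (j p) (k p) False) * c" for i j k and c :: real
  proof -
    have one: "1 \<in> ?S" by (auto simp: sqf_def)
    have z: "(\<Prod>p\<in>P. corr_wt u1 u2 u3 h1 h2 h3 p (i p) (j p) (k p) (p dvd u)) = 0" if u: "u \<in> ?S" "u \<noteq> 1" for u
    proof -
      obtain p where p: "prime p" "p dvd u" using u(2) prime_factor_nat by blast
      then have "p \<in> P" using u by (simp add: sqf_def)
      then show ?thesis using P p by (subst prod_zero_iff) (auto simp: corr_wt_def)
    qed
    have "(\<Sum>u\<in>?S. (\<Prod>p\<in>P. corr_wt u1 u2 u3 h1 h2 h3 p (i p) (j p) (k p) (p dvd u)) * c)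
        = (\<Sum>u\<in>{1}. (\<Prod>p\<in>P. corr_wt u1 u2 u3 h1 h2 h3 p (i p) (j p) (k p) (p dvd u)) * c)"
      using fS one z by (intro sum.mono_neutral_right) auto
    also have "\<dots> = (\<Prod>p\<in>P. corr_wt u1 u2 u3 h1 h2 h3 p (i p) (j p) (k p) False) * c"
    proof -
      have "\<not> p dvd 1" if "p \<in> P" for p using P(2)[OF that] not_prime_unit by blast
      then show ?thesis by (simp cong: prod.cong)
    qed
    finally show ?thesis .
  qed
  show ?thesis
    unfolding 1 flag_sum_def by (simp only: 3) (intro sum.cong refl, simp only: mean 2)
qed

section \<open>Sums of the Moebius function\<close>

definition upto_real :: "real \<Rightarrow> nat set" where
  "upto_real y = {n. 1 \<le> n \<and> real n \<le> y}"

lemma upto_real_eq: "upto_real y = {1..nat \<lfloor>y\<rfloor>}"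
proof -
  have "n \<le> nat \<lfloor>y\<rfloor> \<longleftrightarrow> real n \<le> y" if "n \<ge> 1" for n
  proof (cases "y \<ge> 0")
    case True
    then have "real (nat \<lfloor>y\<rfloor>) \<le> y" by simp
    then have "real n \<le> y" if "n \<le> nat \<lfloor>y\<rfloor>"
      using that by (meson of_nat_mono order_trans)
    then show ?thesis using le_nat_floor[of n y] by blast
  qed (use that in auto)
  then show ?thesis by (auto simp: upto_real_def)
qed

lemma finite_upto_real [simp]: "finite (upto_real y)"
  by (simp add: upto_real_eq)

lemma upto_real_empty: "y < 1 \<Longrightarrow> upto_real y = {}"
  by (auto simp: upto_real_def)

lemma mem_upto_real: "n \<in> upto_real y \<longleftrightarrow> 1 \<le> n \<and> real n \<le> y"
  by (simp add: upto_real_def)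

text \<open>The sequences \<open>x - a\<close> and \<open>x + a\<close> are monotone in opposite
  directions with gap tending to 0, so they enclose a common limit. This yields constants such as
  Euler's together with a rate.\<close>

lemma limit_of_telescoping_bound:
  fixes x a :: "nat \<Rightarrow> real"
  assumes inc: "\<And>n. n \<ge> 1 \<Longrightarrow> \<bar>x (Suc n) - x n\<bar> \<le> a n - a (Suc n)" and lim: "a \<longlonglongrightarrow> 0"
  obtains l where "\<And>n. n \<ge> 1 \<Longrightarrow> \<bar>x n - l\<bar> \<le> a n"
proof -
  define f where "f n = x (Suc n) - a (Suc n)" for n
  define g where "g n = x (Suc n) + a (Suc n)" for n
  have f: "incseq f"
  proof (rule incseq_SucI)
    show "f n \<le> f (Suc n)" for n using inc[of "Suc n"] by (simp add: f_def abs_le_iff)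
  qed
  have g: "decseq g"
  proof (rule decseq_SucI)
    show "g (Suc n) \<le> g n" for n using inc[of "Suc n"] by (simp add: g_def abs_le_iff)
  qed
  have d: "(\<lambda>n. g n - f n) \<longlonglongrightarrow> 0"
    using tendsto_mult[OF tendsto_const[of 2] LIMSEQ_Suc[OF lim]] by (simp add: f_def g_def)
  have "decseq (\<lambda>n. g n - f n)" using f g by (auto simp: decseq_def incseq_def intro: diff_mono)
  then have fg: "f n \<le> g n" for n using decseq_ge[OF _ d, of n] by simp
  have "f n \<le> g 0" for n using fg[of n] decseqD[OF g, of 0 n] by simp
  then obtain l where l: "f \<longlonglongrightarrow> l" using incseq_convergent[OF f] by blast
  have "(\<lambda>n. f n + (g n - f n)) \<longlonglongrightarrow> l + 0" by (intro tendsto_add l d)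
  then have lg: "g \<longlonglongrightarrow> l" by simp
  have "\<bar>x n - l\<bar> \<le> a n" if "n \<ge> 1" for n
    using incseq_le[OF f l, of "n - 1"] decseq_ge[OF g lg, of "n - 1"] that
    by (simp add: f_def g_def abs_le_iff)
  then show ?thesis using that by blast
qed

lemma ln_succ_bounds:
  assumes "n \<ge> 1"
  shows "1 / real (Suc n) \<le> ln (real (Suc n)) - ln (real n)" "ln (real (Suc n)) - ln (real n) \<le> 1 / real n"
proof -
  have "ln (real n / real (Suc n)) \<le> real n / real (Suc n) - 1"
    using assms by (intro ln_le_minus_one) auto
  also have "\<dots> = - (1 / real (Suc n))" by (simp add: field_simps)
  finally show "1 / real (Suc n) \<le> ln (real (Suc n)) - ln (real n)"
    using assms by (simp add: ln_div)
  have "ln (real (Suc n) / real n) \<le> real (Suc n) / real n - 1"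
    using assms by (intro ln_le_minus_one) auto
  also have "\<dots> = 1 / real n" using assms by (simp add: field_simps)
  finally show "ln (real (Suc n)) - ln (real n) \<le> 1 / real n"
    using assms by (simp add: ln_div)
qed

lemma ln_le_2_sqrt: "y > 0 \<Longrightarrow> ln y \<le> 2 * sqrt y - (2::real)"
  using ln_le_minus_one[of "sqrt y"] by (simp add: ln_sqrt)

lemma floor_bounds:
  assumes "y \<ge> (1::real)"
  defines "n \<equiv> nat \<lfloor>y\<rfloor>"
  shows "n \<ge> 1" "real n \<le> y" "y < real n + 1" "y \<le> 2 * real n" "ln y - ln (real n) \<le> 1 / real n"
    "ln (real n) \<le> ln y"
proof -
  show n: "n \<ge> 1" using assms by (simp add: le_nat_iff)
  have "\<lfloor>y\<rfloor> = int n" using assms by simp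
  then show le: "real n \<le> y" and lt: "y < real n + 1" by linarith+
  then show "y \<le> 2 * real n" using n by linarith
  show "ln (real n) \<le> ln y" using n le by simp
  have "ln y \<le> ln (real (Suc n))" using lt assms(1) by (intro ln_mono) linarith+
  then show "ln y - ln (real n) \<le> 1 / real n" using ln_succ_bounds(2)[OF n] by linarith
qed

section \<open>Harmonic sums and their logarithmic analogues\<close>

definition hsum :: "real \<Rightarrow> real" where
  "hsum y = (\<Sum>n\<in>upto_real y. 1 / real n)"

lemma hsum_asymp:
  obtains \<gamma> where "\<And>y. y \<ge> 1 \<Longrightarrow> \<bar>hsum y - ln y - \<gamma>\<bar> \<le> 4 / y"
proof -
  obtain \<gamma> where g: "\<And>n. n \<ge> 1 \<Longrightarrow> \<bar>((\<Sum>i=1..n. 1 / real i) - ln (real n)) - \<gamma>\<bar> \<le> 1 / real n"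
  proof (rule limit_of_telescoping_bound)
    fix n :: nat assume "n \<ge> 1"
    then show "\<bar>((\<Sum>i=1..Suc n. 1 / real i) - ln (real (Suc n))) - ((\<Sum>i=1..n. 1 / real i) - ln (real n))\<bar>
        \<le> 1 / real n - 1 / real (Suc n)"
      using ln_succ_bounds[of n] by simp
  next
    show "(\<lambda>n. 1 / real n) \<longlonglongrightarrow> 0" by real_asymp
  qed blast
  have "\<bar>hsum y - ln y - \<gamma>\<bar> \<le> 4 / y" if y: "y \<ge> 1" for y
  proof -
    define n where "n = nat \<lfloor>y\<rfloor>"
    note n = floor_bounds[OF y, folded n_def]
    have "hsum y = (\<Sum>i=1..n. 1 / real i)" by (simp add: hsum_def upto_real_eq n_def)
    then have "\<bar>hsum y - ln y - \<gamma>\<bar> \<le> 2 / real n"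
      using g[OF n(1)] n(5,6) by (simp add: abs_le_iff)
    also have "\<dots> \<le> 4 / y" using n(1,4) y by (simp add: field_simps)
    finally show ?thesis .
  qed
  then show ?thesis using that by blast
qed

lemma hsum_bounds:
  assumes "y \<ge> 1"
  shows "ln y \<le> hsum y" "hsum y \<le> ln y + 1"
proof -
  have *: "ln (real (Suc n)) \<le> (\<Sum>i=1..n. 1 / real i) \<and> (n \<ge> 1 \<longrightarrow> (\<Sum>i=1..n. 1 / real i) \<le> ln (real n) + 1)" for n
  proof (induction n)
    case (Suc n)
    then show ?case using ln_succ_bounds(2)[of "Suc n"] ln_succ_bounds(1)[of n]
      by (cases "n = 0") auto
  qed simp
  define n where "n = nat \<lfloor>y\<rfloor>"
  note n = floor_bounds[OF assms, folded n_def]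
  have h: "hsum y = (\<Sum>i=1..n. 1 / real i)" by (simp add: hsum_def upto_real_eq n_def)
  have "ln y \<le> ln (real (Suc n))" using n(3) assms by (intro ln_mono) linarith+
  then show "ln y \<le> hsum y" "hsum y \<le> ln y + 1" using *[of n] n(1,6) h by linarith+
qed

text \<open>The increments have size \<open>ln n / n\<^sup>2\<close>; the rate
  \<open>1 / sqrt n\<close> absorbs the logarithm and still suffices for
  \<open>mobius_smooth_error\<close>.\<close>

lemma sum_ln_over_n_asymp:
  obtains c where "\<And>y. y \<ge> 1 \<Longrightarrow> \<bar>(\<Sum>n\<in>upto_real y. ln (real n) / real n) - (ln y)\<^sup>2 / 2 - c\<bar> \<le> 16 / sqrt y"
proof -
  obtain c where g: "\<And>n. n \<ge> 1 \<Longrightarrow> \<bar>((\<Sum>i=1..n. ln (real i) / real i) - (ln (real n))\<^sup>2 / 2) - c\<bar> \<le> 8 / sqrt (real n)"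
  proof (rule limit_of_telescoping_bound)
    fix n :: nat assume n: "n \<ge> 1"
    define \<delta> where "\<delta> = ln (real (Suc n)) - ln (real n)"
    have \<delta>: "1 / real (Suc n) \<le> \<delta>" "\<delta> \<le> 1 / real n" unfolding \<delta>_def using ln_succ_bounds[OF n] by auto
    have \<delta>0: "0 \<le> \<delta>" using \<delta>(1) order_trans[of 0 "1 / real (Suc n)"] by simp
    define u where "u = ln (real (Suc n))"
    have u: "0 \<le> u" "u \<le> 2 * sqrt (real (Suc n))" unfolding u_def using ln_le_2_sqrt[of "real (Suc n)"] by auto
    define s t where "s = sqrt (real n)" and "t = sqrt (real (Suc n))"
    have st: "s * s = real n" "t * t = real n + 1" "s \<ge> 1" "t > 0" "s \<le> t"
      using n by (auto simp: s_def t_def)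
    have "t \<le> sqrt (9 / 4 * real n)" using n unfolding t_def by simp
    then have t_le: "t \<le> 3 / 2 * s" by (simp add: s_def real_sqrt_mult real_sqrt_divide)
    \<comment> \<open>\<open>w\<close> measures both parts of the increment: three copies bound the
      linear part and one the quadratic part, and four copies telescope into differences of
      \<open>8 / sqrt n\<close>.\<close>
    define w where "w = 1 / (s * (real n + 1))"
    have sn: "s \<le> real n" using st(1) mult_left_mono[of 1 s s] st(3) by simp
    have "u * (\<delta> - 1 / real (Suc n)) \<le> (2 * t) * (1 / real n - 1 / real (Suc n))"
      using \<delta> u unfolding t_def by (intro mult_mono) auto
    also have "\<dots> = 2 * t / (real n * (real n + 1))" using n by (simp add: field_simps)
    also have "\<dots> \<le> 3 * s / (real n * (real n + 1))" using t_le n by (intro divide_right_mono) auto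
    also have "\<dots> = 3 * w" using st(3) unfolding w_def st(1)[symmetric]
      by (simp add: divide_simps)
    finally have 1: "u * (\<delta> - 1 / real (Suc n)) \<le> 3 * w" .
    have "\<delta>\<^sup>2 \<le> (1 / real n)\<^sup>2" using \<delta> \<delta>0 by (intro power_mono) auto
    then have "\<delta>\<^sup>2 / 2 \<le> 1 / (2 * real n * real n)" by (simp add: power2_eq_square)
    also have "\<dots> \<le> 1 / (s * (real n + 1))"
    proof -
      have "s * (real n + 1) \<le> real n * (2 * real n)" using sn n st by (intro mult_mono) auto
      moreover have "0 < s * (real n + 1)" using st by simp
      moreover have "0 < 2 * real n * real n" using n by simp
      ultimately show ?thesis by (intro frac_le) (auto simp: mult.assoc mult.left_commute)
    qed
    finally have 2: "\<delta>\<^sup>2 / 2 \<le> w" by (simp add: w_def)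
    have 3: "4 * w \<le> 8 / s - 8 / t"
    proof -
      have "(t - s) * (t + s) = 1" using st by (simp add: algebra_simps)
      moreover have "(t - s) * (t + s) \<le> (t - s) * (2 * t)" using st by (intro mult_left_mono) auto
      ultimately have "1 \<le> (t - s) * (2 * t)" by simp
      then have "4 * (1 / (s * (t * t))) \<le> 4 * ((t - s) * (2 * t) / (s * (t * t)))"
        using st by (intro mult_left_mono divide_right_mono) auto
      also have "\<dots> = 8 / s - 8 / t" using st(3,4) by (simp add: field_simps)
      finally show ?thesis using st by (simp add: w_def)
    qed
    have "((\<Sum>i=1..Suc n. ln (real i) / real i) - (ln (real (Suc n)))\<^sup>2 / 2) - ((\<Sum>i=1..n. ln (real i) / real i) - (ln (real n))\<^sup>2 / 2)
       = - (u * (\<delta> - 1 / real (Suc n))) + \<delta>\<^sup>2 / 2"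
      unfolding \<delta>_def u_def by (simp add: power2_eq_square field_simps)
    moreover have "0 \<le> u * (\<delta> - 1 / real (Suc n))" using u \<delta> by (intro mult_nonneg_nonneg) auto
    moreover have "0 \<le> \<delta>\<^sup>2 / 2" "0 \<le> w" using st by (auto simp: w_def)
    ultimately show "\<bar>((\<Sum>i=1..Suc n. ln (real i) / real i) - (ln (real (Suc n)))\<^sup>2 / 2) - ((\<Sum>i=1..n. ln (real i) / real i) - (ln (real n))\<^sup>2 / 2)\<bar>
        \<le> 8 / sqrt (real n) - 8 / sqrt (real (Suc n))"
      using 1 2 3 unfolding s_def t_def abs_le_iff by linarith
  next
    show "(\<lambda>n. 8 / sqrt (real n)) \<longlonglongrightarrow> 0" by real_asymp
  qed blast
  have "\<bar>(\<Sum>n\<in>upto_real y. ln (real n) / real n) - (ln y)\<^sup>2 / 2 - c\<bar> \<le> 16 / sqrt y" if y: "y \<ge> 1" for y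
  proof -
    define n where "n = nat \<lfloor>y\<rfloor>"
    note n = floor_bounds[OF y, folded n_def]
    have h: "(\<Sum>n\<in>upto_real y. ln (real n) / real n) = (\<Sum>i=1..n. ln (real i) / real i)"
      by (simp add: upto_real_eq n_def)
    have s: "sqrt y > 0" "sqrt y * sqrt y = y" using y by auto
    have "8 / sqrt (real n) \<le> 12 / sqrt y"
    proof -
      have "sqrt y \<le> sqrt (9 / 4 * real n)" using n by simp
      also have "\<dots> = 3 / 2 * sqrt (real n)" by (simp add: real_sqrt_mult real_sqrt_divide)
      finally show ?thesis using n(1) y by (simp add: field_simps)
    qed
    moreover have "\<bar>(ln y)\<^sup>2 / 2 - (ln (real n))\<^sup>2 / 2\<bar> \<le> 4 / sqrt y"
    proof -
      have "(ln y)\<^sup>2 / 2 - (ln (real n))\<^sup>2 / 2 = (ln y - ln (real n)) * ((ln y + ln (real n)) / 2)"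
        by (simp add: power2_eq_square algebra_simps)
      moreover have "0 \<le> (ln y - ln (real n)) * ((ln y + ln (real n)) / 2)"
        using n y by (intro mult_nonneg_nonneg) auto
      moreover have "(ln y - ln (real n)) * ((ln y + ln (real n)) / 2) \<le> (1 / real n) * ln y"
        using n y by (intro mult_mono) auto
      moreover have "(1 / real n) * ln y \<le> (2 / y) * (2 * sqrt y)"
        using n(1,4) y ln_le_2_sqrt[of y] by (intro mult_mono) (auto simp: field_simps)
      moreover have "(2 / y) * (2 * sqrt y) = 4 / sqrt y"
        using s y by (simp add: field_simps)
      ultimately show ?thesis unfolding abs_le_iff by linarith
    qed
    ultimately show ?thesis using g[OF n(1)] h by (simp add: abs_le_iff)
  qed
  then show ?thesis using that by blast
qed

definition lsum :: "real \<Rightarrow> real" where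
  "lsum y = (\<Sum>n\<in>upto_real y. ln (y / real n) / real n)"

text \<open>Splitting \<open>ln (y / n)\<close> expresses \<open>lsum\<close> through
  \<open>hsum\<close> and the preceding sum. The coefficient of \<open>ln y\<close> is the same
  \<open>\<gamma>\<close> as in the expansion of \<open>hsum\<close>, hence the joint
  statement.\<close>

lemma lsum_asymp:
  obtains \<gamma> c where "\<And>y. y \<ge> 1 \<Longrightarrow> \<bar>hsum y - ln y - \<gamma>\<bar> \<le> 4 / y"
    "\<And>y. y \<ge> 1 \<Longrightarrow> \<bar>lsum y - ((ln y)\<^sup>2 / 2 + \<gamma> * ln y + c)\<bar> \<le> 24 / sqrt y"
proof -
  obtain \<gamma> where g: "\<And>y. y \<ge> 1 \<Longrightarrow> \<bar>hsum y - ln y - \<gamma>\<bar> \<le> 4 / y" using hsum_asymp by blast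
  obtain c where c: "\<And>y. y \<ge> 1 \<Longrightarrow> \<bar>(\<Sum>n\<in>upto_real y. ln (real n) / real n) - (ln y)\<^sup>2 / 2 - c\<bar> \<le> 16 / sqrt y"
    using sum_ln_over_n_asymp by blast
  have "\<bar>lsum y - ((ln y)\<^sup>2 / 2 + \<gamma> * ln y + (- c))\<bar> \<le> 24 / sqrt y" if y: "y \<ge> 1" for y
  proof -
    have "lsum y = (\<Sum>n\<in>upto_real y. ln y * (1 / real n) - ln (real n) / real n)"
      unfolding lsum_def using y by (intro sum.cong) (auto simp: upto_real_def ln_div diff_divide_distrib)
    then have l: "lsum y = ln y * hsum y - (\<Sum>n\<in>upto_real y. ln (real n) / real n)"
      by (simp add: sum_subtractf sum_distrib_left hsum_def)
    have s: "sqrt y > 0" "sqrt y * sqrt y = y" using y by auto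
    have "\<bar>ln y * (hsum y - ln y - \<gamma>)\<bar> \<le> (2 * sqrt y) * (4 / y)"
      unfolding abs_mult using g[OF y] y ln_le_2_sqrt[of y] by (intro mult_mono) auto
    also have "\<dots> = 8 / sqrt y" using s y by (simp add: field_simps)
    finally have "\<bar>ln y * (hsum y - ln y - \<gamma>)\<bar> \<le> 8 / sqrt y" .
    moreover have "lsum y - ((ln y)\<^sup>2 / 2 + \<gamma> * ln y + (- c))
       = ln y * (hsum y - ln y - \<gamma>) - ((\<Sum>n\<in>upto_real y. ln (real n) / real n) - (ln y)\<^sup>2 / 2 - c)"
      by (simp add: l power2_eq_square algebra_simps)
    ultimately show ?thesis using c[OF y] by (simp add: abs_le_iff)
  qed
  then show ?thesis using that g by blast
qed

section \<open>Moebius inversion and bounded Moebius sums\<close>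

lemma sum_moebius:
  assumes "n \<ge> 1"
  shows "(\<Sum>d | d dvd n. moebius_mu d) = (if n = 1 then 1 else 0)"
proof -
  have fin: "finite {d. d dvd n}" using assms by auto
  have eq: "{d. d dvd n \<and> squarefree d} = sqf (prime_factors n)"
    using assms by (auto simp: sqf_def in_prime_factors_iff intro: dvd_trans squarefree_imp_dvd)
  have "(\<Sum>d | d dvd n. moebius_mu d) = (\<Sum>d | d dvd n \<and> squarefree d. moebius_mu d)"
    using fin by (intro sum.mono_neutral_right) (auto simp: moebius_mu_def)
  also have "\<dots> = (\<Sum>d\<in>sqf (prime_factors n). wprod (\<lambda>_. -1) d)"
    unfolding eq by (intro sum.cong) (auto simp: moebius_mu_def wprod_def sqf_def)
  also have "\<dots> = (\<Prod>p\<in>prime_factors n. 1 + (-1))"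
    by (intro sum_wprod_expand) auto
  also have "\<dots> = (if n = 1 then 1 else 0)"
  proof (cases "n = 1")
    case False
    then obtain p where "prime p" "p dvd n" using prime_factor_nat by blast
    then have "p \<in> prime_factors n" using assms by (auto simp: in_prime_factors_iff)
    then have "(\<Prod>p\<in>prime_factors n. 1 + (-1 :: real)) = 0" by (subst prod_zero_iff) auto
    then show ?thesis using False by simp
  qed simp
  finally show ?thesis .
qed

lemma abs_moebius_le_1: "\<bar>moebius_mu d\<bar> \<le> 1"
  by (simp add: moebius_mu_def power_abs)

lemma hyperbola_swap:
  fixes F :: "nat \<Rightarrow> nat \<Rightarrow> real"
  assumes "y \<ge> 0"
  shows "(\<Sum>d\<in>upto_real y. \<Sum>b\<in>upto_real (y / real d). F d b) = (\<Sum>b\<in>upto_real y. \<Sum>d\<in>upto_real (y / real b). F d b)"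
proof -
  have eq: "upto_real (y / real d) = {b \<in> upto_real y. real d * real b \<le> y}" if "d \<in> upto_real y" for d
  proof -
    have "real b \<le> y" if "real d * real b \<le> y" "b \<ge> 1" for b
    proof -
      have "1 * real b \<le> real d * real b" using \<open>d \<in> upto_real y\<close> by (intro mult_right_mono) (auto simp: upto_real_def)
      then show ?thesis using that by linarith
    qed
    then show ?thesis using that assms by (auto simp: upto_real_def field_simps)
  qed
  have "(\<Sum>d\<in>upto_real y. \<Sum>b\<in>upto_real (y / real d). F d b) = (\<Sum>d\<in>upto_real y. \<Sum>b | b \<in> upto_real y \<and> real d * real b \<le> y. F d b)"
    by (intro sum.cong refl) (simp add: eq)
  also have "\<dots> = (\<Sum>b\<in>upto_real y. \<Sum>d | d \<in> upto_real y \<and> real d * real b \<le> y. F d b)"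
    by (rule sum.swap_restrict) auto
  also have "\<dots> = (\<Sum>b\<in>upto_real y. \<Sum>d\<in>upto_real (y / real b). F d b)"
    by (intro sum.cong refl) (simp add: eq mult.commute)
  finally show ?thesis .
qed

lemma hyperbola_divisor_sum:
  fixes F :: "nat \<Rightarrow> nat \<Rightarrow> real"
  shows "(\<Sum>d\<in>upto_real y. \<Sum>b\<in>upto_real (y / real d). F d (d * b)) = (\<Sum>n\<in>upto_real y. \<Sum>d | d dvd n. F d n)"
proof -
  have "(\<Sum>d\<in>upto_real y. \<Sum>b\<in>upto_real (y / real d). F d (d * b))
      = (\<Sum>x\<in>Sigma (upto_real y) (\<lambda>d. upto_real (y / real d)). F (fst x) (fst x * snd x))"
    by (subst sum.Sigma) (auto simp: case_prod_unfold)
  also have "\<dots> = (\<Sum>x\<in>Sigma (upto_real y) (\<lambda>n. {d. d dvd n}). F (snd x) (fst x))"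
  proof (rule sum.reindex_bij_witness[where i = "\<lambda>x. (snd x, fst x div snd x)" and j = "\<lambda>x. (fst x * snd x, fst x)"])
    fix x assume "x \<in> Sigma (upto_real y) (\<lambda>n. {d. d dvd n})"
    then obtain n d k where x: "x = (n, d)" "n = d * k" "n \<ge> 1" "real n \<le> y"
      by (cases x) (auto simp: upto_real_def)
    then have "d \<ge> 1" "k \<ge> 1" by (auto intro!: Suc_leI Nat.gr0I)
    moreover have "real d * 1 \<le> real d * real k" using \<open>k \<ge> 1\<close> by (intro mult_left_mono) auto
    moreover have "real d * real k \<le> y" using x by simp
    ultimately have "real d \<le> y" by linarith
    then show "(snd x, fst x div snd x) \<in> Sigma (upto_real y) (\<lambda>d. upto_real (y / real d))"
      using x \<open>d \<ge> 1\<close> \<open>k \<ge> 1\<close> by (auto simp: upto_real_def field_simps)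
  next
    fix x assume "x \<in> Sigma (upto_real y) (\<lambda>d. upto_real (y / real d))"
    then show "(fst x * snd x, fst x) \<in> Sigma (upto_real y) (\<lambda>n. {d. d dvd n})"
      by (auto simp: upto_real_def field_simps)
  qed (auto simp: upto_real_def)
  also have "\<dots> = (\<Sum>n\<in>upto_real y. \<Sum>d | d dvd n. F d n)"
    by (subst sum.Sigma) (auto simp: case_prod_unfold mem_upto_real)
  finally show ?thesis .
qed

text \<open>The cutoff \<open>w\<close> is kept apart from the scale \<open>y\<close> because tails
  of convolutions stop at \<open>y / z\<close> while the argument remains
  \<open>y / d\<close>.\<close>

definition mobius_smooth :: "(real \<Rightarrow> real) \<Rightarrow> real \<Rightarrow> real \<Rightarrow> real" where
  "mobius_smooth f w y = (\<Sum>d\<in>upto_real w. moebius_mu d / real d * f (y / real d))"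

text \<open>Grouping by \<open>n = d * b\<close> leaves the sum of the Moebius function over the
  divisors of \<open>n\<close>. The choices 1, \<open>n\<close> and \<open>ln (v / n)\<close> of the
  test function give the exact identities from which the bounds below are derived.\<close>

lemma mobius_hyperbola:
  assumes "y \<ge> 1"
  shows "(\<Sum>d\<in>upto_real y. moebius_mu d / real d * (\<Sum>b\<in>upto_real (y / real d). \<phi> (d * b) / real b)) = \<phi> 1"
proof -
  have "(\<Sum>d\<in>upto_real y. moebius_mu d / real d * (\<Sum>b\<in>upto_real (y / real d). \<phi> (d * b) / real b))
      = (\<Sum>d\<in>upto_real y. \<Sum>b\<in>upto_real (y / real d). moebius_mu d * (\<phi> (d * b) / real (d * b)))"
    by (simp add: sum_distrib_left)
  also have "\<dots> = (\<Sum>n\<in>upto_real y. \<phi> n / real n * (\<Sum>d | d dvd n. moebius_mu d))"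
    by (subst hyperbola_divisor_sum) (simp add: sum_distrib_left mult.commute)
  also have "\<dots> = (\<Sum>n\<in>upto_real y. if n = 1 then \<phi> 1 else 0)"
    by (intro sum.cong refl) (auto simp: sum_moebius upto_real_def)
  also have "\<dots> = (if 1 \<in> upto_real y then \<phi> 1 else 0)" by (rule sum.delta) (rule finite_upto_real)
  also have "\<dots> = \<phi> 1" using assms by (simp add: upto_real_def)
  finally show ?thesis .
qed

lemma sum_inverse_sqrt_le:
  assumes "w \<ge> 0"
  shows "(\<Sum>d\<in>upto_real w. 1 / sqrt (real d)) \<le> 2 * sqrt w"
proof -
  have "(\<Sum>i=1..n. 1 / sqrt (real i)) \<le> 2 * sqrt (real n)" for n
  proof (induction n)
    case (Suc n)
    have "1 / sqrt (real (Suc n)) \<le> 2 * (sqrt (real (Suc n)) - sqrt (real n))"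
    proof -
      define a b where "a = sqrt (real (Suc n))" and "b = sqrt (real n)"
      have ab: "a * a = real n + 1" "b * b = real n" "a > 0" "b \<ge> 0" "b \<le> a"
        by (auto simp: a_def b_def)
      have "0 \<le> (a - b) * (a - b)" by simp
      then have "1 \<le> 2 * (a - b) * a" using ab by (simp add: algebra_simps)
      then show ?thesis using ab unfolding a_def[symmetric] b_def[symmetric] by (simp add: field_simps)
    qed
    then show ?case using Suc by simp
  qed simp
  then have "(\<Sum>d\<in>upto_real w. 1 / sqrt (real d)) \<le> 2 * sqrt (real (nat \<lfloor>w\<rfloor>))"
    by (simp add: upto_real_eq)
  also have "\<dots> \<le> 2 * sqrt w" using assms by simp
  finally show ?thesis .
qed

text \<open>An error \<open>1 / sqrt (y / d)\<close> is \<open>sqrt d / sqrt y\<close>, and the sum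
  of \<open>1 / sqrt d\<close> up to \<open>w\<close> is at most \<open>2 * sqrt w\<close>. A
  remainder with a power saving thus tolerates absolute values inside the Moebius sum.\<close>

lemma mobius_smooth_error:
  assumes "\<And>y. y \<ge> 1 \<Longrightarrow> \<bar>f y\<bar> \<le> C / sqrt y" and "0 < w" "w \<le> y" "0 \<le> C"
  shows "\<bar>mobius_smooth f w y\<bar> \<le> 2 * C * sqrt (w / y)"
proof -
  have "\<bar>mobius_smooth f w y\<bar> \<le> (\<Sum>d\<in>upto_real w. \<bar>moebius_mu d / real d * f (y / real d)\<bar>)"
    unfolding mobius_smooth_def by (rule sum_abs)
  also have "\<dots> \<le> (\<Sum>d\<in>upto_real w. C / sqrt y * (1 / sqrt (real d)))"
  proof (intro sum_mono)
    fix d assume d: "d \<in> upto_real w"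
    have d0: "real d > 0" "y / real d \<ge> 1" using d assms by (auto simp: upto_real_def)
    have "\<bar>moebius_mu d / real d * f (y / real d)\<bar> \<le> (1 / real d) * (C / sqrt (y / real d))"
      unfolding abs_mult using assms(1)[OF d0(2)] abs_moebius_le_1[of d] d0
      by (intro mult_mono) (auto simp: divide_right_mono)
    also have "\<dots> = C / sqrt y * (1 / sqrt (real d))"
    proof -
      have "sqrt (real d) * sqrt (real d) = real d" by simp
      then show ?thesis using d0 assms by (simp add: real_sqrt_divide field_simps)
    qed
    finally show "\<bar>moebius_mu d / real d * f (y / real d)\<bar> \<le> C / sqrt y * (1 / sqrt (real d))" .
  qed
  also have "\<dots> = C / sqrt y * (\<Sum>d\<in>upto_real w. 1 / sqrt (real d))" by (simp add: sum_distrib_left)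
  also have "\<dots> \<le> C / sqrt y * (2 * sqrt w)"
    using assms sum_inverse_sqrt_le[of w] by (intro mult_left_mono) auto
  also have "\<dots> = 2 * C * sqrt (w / y)" by (simp add: real_sqrt_divide)
  finally show ?thesis .
qed

definition mobius_sum :: "real \<Rightarrow> real" where
  "mobius_sum y = (\<Sum>d\<in>upto_real y. moebius_mu d / real d)"

definition mobius_log :: "real \<Rightarrow> real" where
  "mobius_log y = (\<Sum>d\<in>upto_real y. moebius_mu d / real d * ln (y / real d))"

text \<open>The sum of \<open>mu(d)\<close> times the floor of \<open>y / d\<close> equals 1.
  Replacing floors by quotients turns it into \<open>y * mobius_sum y\<close> and costs at most 1
  for each \<open>d \<le> y\<close>.\<close>

lemma mobius_sum_bound: "\<bar>mobius_sum y\<bar> \<le> 2"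
proof (cases "y \<ge> 1")
  case True
  have "(\<Sum>d\<in>upto_real y. moebius_mu d / real d * (\<Sum>b\<in>upto_real (y / real d). real (d * b) / real b)) = real 1"
    by (rule mobius_hyperbola[OF True])
  also have "(\<Sum>d\<in>upto_real y. moebius_mu d / real d * (\<Sum>b\<in>upto_real (y / real d). real (d * b) / real b))
      = (\<Sum>d\<in>upto_real y. moebius_mu d * real (card (upto_real (y / real d))))"
  proof (intro sum.cong refl)
    fix d assume d: "d \<in> upto_real y"
    have "(\<Sum>b\<in>upto_real (y / real d). real (d * b) / real b) = (\<Sum>b\<in>upto_real (y / real d). real d)"
      by (intro sum.cong refl) (auto simp: upto_real_def)
    then show "moebius_mu d / real d * (\<Sum>b\<in>upto_real (y / real d). real (d * b) / real b)
        = moebius_mu d * real (card (upto_real (y / real d)))"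
      using d by (simp add: upto_real_def)
  qed
  finally have 1: "(\<Sum>d\<in>upto_real y. moebius_mu d * real (card (upto_real (y / real d)))) = 1" by simp
  have "y * mobius_sum y - 1 = (\<Sum>d\<in>upto_real y. moebius_mu d * (y / real d - real (card (upto_real (y / real d)))))"
    unfolding 1[symmetric] by (simp add: mobius_sum_def sum_distrib_left sum_subtractf algebra_simps)
  also have "\<bar>\<dots>\<bar> \<le> (\<Sum>d\<in>upto_real y. 1)"
  proof (rule order_trans[OF sum_abs], intro sum_mono)
    fix d assume d: "d \<in> upto_real y"
    have "y / real d \<ge> 1" using d by (auto simp: upto_real_def)
    then have "\<bar>y / real d - real (card (upto_real (y / real d)))\<bar> \<le> 1"
      using floor_bounds(2,3)[of "y / real d"] by (simp add: upto_real_eq) linarith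
    then have "\<bar>moebius_mu d\<bar> * \<bar>y / real d - real (card (upto_real (y / real d)))\<bar> \<le> 1 * 1"
      using abs_moebius_le_1[of d] by (intro mult_mono) auto
    then show "\<bar>moebius_mu d * (y / real d - real (card (upto_real (y / real d))))\<bar> \<le> 1"
      by (simp add: abs_mult)
  qed
  also have "\<dots> \<le> y" using floor_bounds[OF True] by (simp add: upto_real_eq)
  finally have "\<bar>y * mobius_sum y - 1\<bar> \<le> y" .
  then have "\<bar>y * mobius_sum y\<bar> \<le> y * 2" using True by linarith
  then show ?thesis using True by (simp add: abs_mult)
qed (simp add: mobius_sum_def upto_real_empty)

text \<open>The Moebius transform of \<open>hsum\<close> is exactly 1, and \<open>hsum\<close> is a
  logarithm plus a constant plus a small remainder. The bound collects 1 from the identity,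
  \<open>2 * \<bar>\<gamma>\<bar>\<close> from \<open>mobius_sum\<close> and 8 from the
  remainder.\<close>

lemma mobius_log_bound:
  obtains C where "C \<ge> 0" "\<And>y. \<bar>mobius_log y\<bar> \<le> C"
proof -
  obtain \<gamma> where g: "\<And>y. y \<ge> 1 \<Longrightarrow> \<bar>hsum y - ln y - \<gamma>\<bar> \<le> 4 / y" using hsum_asymp by blast
  have "\<bar>mobius_log y\<bar> \<le> 9 + 2 * \<bar>\<gamma>\<bar>" for y
  proof (cases "y \<ge> 1")
    case True
    have 1: "(\<Sum>d\<in>upto_real y. moebius_mu d / real d * hsum (y / real d)) = 1"
      using mobius_hyperbola[OF True, of "\<lambda>_. 1"] by (simp add: hsum_def)
    have r: "\<bar>hsum y - ln y - \<gamma>\<bar> \<le> 4 / sqrt y" if "y \<ge> 1" for y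
    proof -
      have "sqrt y \<le> y" using that by (intro real_le_lsqrt) (auto simp: power2_eq_square)
      then have "4 / y \<le> 4 / sqrt y" using that by (intro divide_left_mono) auto
      then show ?thesis using g[OF that] by linarith
    qed
    have "mobius_log y = (\<Sum>d\<in>upto_real y. moebius_mu d / real d * hsum (y / real d)) - \<gamma> * mobius_sum y
       - mobius_smooth (\<lambda>y. hsum y - ln y - \<gamma>) y y"
      by (simp add: mobius_log_def mobius_sum_def mobius_smooth_def sum_distrib_left sum_subtractf[symmetric] algebra_simps)
    moreover have "\<bar>mobius_smooth (\<lambda>y. hsum y - ln y - \<gamma>) y y\<bar> \<le> 2 * 4 * sqrt (y / y)"
      using True r by (intro mobius_smooth_error) auto
    moreover have "\<bar>\<gamma> * mobius_sum y\<bar> \<le> \<bar>\<gamma>\<bar> * 2"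
      unfolding abs_mult by (intro mult_left_mono mobius_sum_bound) auto
    ultimately show ?thesis using True unfolding 1 by (simp add: abs_le_iff)
  qed (simp add: mobius_log_def upto_real_empty)
  then show ?thesis using that[of "9 + 2 * \<bar>\<gamma>\<bar>"] by auto
qed

lemma inverse_le_inverse_sqrt: "y \<ge> 1 \<Longrightarrow> 1 / y \<le> 1 / sqrt y"
proof -
  assume y: "y \<ge> (1::real)"
  have "sqrt y \<le> y" using y by (intro real_le_lsqrt) (auto simp: power2_eq_square)
  then show ?thesis using y by (intro divide_left_mono) auto
qed

lemma sum_upto_real_split:
  fixes f :: "nat \<Rightarrow> real"
  assumes "t \<le> y"
  shows "(\<Sum>n\<in>upto_real y. f n) = (\<Sum>n\<in>upto_real t. f n) + (\<Sum>n | n \<in> upto_real y \<and> t < real n. f n)"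
proof -
  have "upto_real y = upto_real t \<union> {n \<in> upto_real y. t < real n}" using assms by (auto simp: upto_real_def)
  moreover have "upto_real t \<inter> {n \<in> upto_real y. t < real n} = {}" by (auto simp: upto_real_def)
  ultimately show ?thesis
    using sum.union_disjoint[of "upto_real t" "{n \<in> upto_real y. t < real n}" f] by simp
qed

lemma hyperbola_swap_tail:
  fixes F :: "nat \<Rightarrow> nat \<Rightarrow> real"
  assumes "z \<ge> 1" "y \<ge> z"
  shows "(\<Sum>c | c \<in> upto_real y \<and> z < real c. \<Sum>d\<in>upto_real (y / real c). F d c)
     = (\<Sum>d\<in>upto_real (y / z). \<Sum>c | c \<in> upto_real (y / real d) \<and> z < real c. F d c)"
proof -
  have 1: "upto_real (y / real c) = {d \<in> upto_real (y / z). real d * real c \<le> y}"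
    if "c \<in> {c \<in> upto_real y. z < real c}" for c
  proof -
    have "real d * z \<le> y" if "real d * real c \<le> y" for d
      using mult_left_mono[of z "real c" "real d"] that \<open>c \<in> _\<close> by auto
    then show ?thesis using that assms by (auto simp: upto_real_def field_simps)
  qed
  have 2: "{c \<in> upto_real (y / real d). z < real c} = {c \<in> {c \<in> upto_real y. z < real c}. real d * real c \<le> y}"
    if "d \<in> upto_real (y / z)" for d
  proof -
    have "real c \<le> y" if "real d * real c \<le> y" for c
      using mult_right_mono[of 1 "real d" "real c"] that \<open>d \<in> _\<close> by (auto simp: upto_real_def)
    then show ?thesis using that assms by (auto simp: upto_real_def field_simps)
  qed
  have "(\<Sum>c | c \<in> upto_real y \<and> z < real c. \<Sum>d\<in>upto_real (y / real c). F d c)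
     = (\<Sum>c\<in>{c \<in> upto_real y. z < real c}. \<Sum>d | d \<in> upto_real (y / z) \<and> real d * real c \<le> y. F d c)"
    by (intro sum.cong refl) (simp add: 1)
  also have "\<dots> = (\<Sum>d\<in>upto_real (y / z). \<Sum>c | c \<in> {c \<in> upto_real y. z < real c} \<and> real d * real c \<le> y. F d c)"
    by (rule sum.swap_restrict) auto
  also have "\<dots> = (\<Sum>d\<in>upto_real (y / z). \<Sum>c | c \<in> upto_real (y / real d) \<and> z < real c. F d c)"
    by (intro sum.cong refl) (simp add: 2)
  finally show ?thesis .
qed

lemma sum_mobius_sum_full:
  assumes "y \<ge> 1"
  shows "(\<Sum>c\<in>upto_real y. mobius_sum (y / real c) / real c) = 1"
proof -
  have "(\<Sum>c\<in>upto_real y. mobius_sum (y / real c) / real c)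
     = (\<Sum>c\<in>upto_real y. \<Sum>d\<in>upto_real (y / real c). moebius_mu d / real d / real c)"
    by (simp add: mobius_sum_def sum_divide_distrib)
  also have "\<dots> = (\<Sum>d\<in>upto_real y. \<Sum>c\<in>upto_real (y / real d). moebius_mu d / real d / real c)"
    using assms by (subst hyperbola_swap) auto
  also have "\<dots> = 1"
    using mobius_hyperbola[OF assms, of "\<lambda>_. 1"] by (simp add: sum_distrib_left)
  finally show ?thesis .
qed

lemma sum_mobius_log_full:
  assumes "v \<ge> 1"
  shows "(\<Sum>b\<in>upto_real v. mobius_log (v / real b) / real b) = ln v"
proof -
  have "(\<Sum>c\<in>upto_real v. mobius_log (v / real c) / real c)
     = (\<Sum>c\<in>upto_real v. \<Sum>d\<in>upto_real (v / real c). moebius_mu d / real d * (ln (v / real (d * c)) / real c))"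
    by (simp add: mobius_log_def sum_divide_distrib mult.commute)
  also have "\<dots> = (\<Sum>d\<in>upto_real v. \<Sum>c\<in>upto_real (v / real d). moebius_mu d / real d * (ln (v / real (d * c)) / real c))"
    using assms by (subst hyperbola_swap) auto
  also have "\<dots> = ln v"
    using mobius_hyperbola[OF assms, of "\<lambda>n. ln (v / real n)"] by (simp add: sum_distrib_left)
  finally show ?thesis .
qed

text \<open>Extended to all \<open>c \<le> y\<close> the sum is exactly 1, so only the tail
  \<open>c > z\<close> matters. After exchanging the sums its inner harmonic sum is
  \<open>ln (w / d)\<close> with \<open>w = y / z\<close>, up to remainders, and the tail becomes
  \<open>mobius_log w\<close>. For \<open>y < z\<close> there is no tail and
  \<open>mobius_log (y / z)\<close> is 0.\<close>

lemma sum_mobius_sum_asymp: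
  obtains C where "C \<ge> 0" "\<And>y z. z \<ge> 1 \<Longrightarrow> y > 0 \<Longrightarrow>
    \<bar>(\<Sum>c\<in>upto_real z. mobius_sum (y / real c) / real c) - of_bool (y \<ge> 1) + mobius_log (y / z)\<bar> \<le> C / sqrt z"
proof -
  obtain \<gamma> where g: "\<And>y. y \<ge> 1 \<Longrightarrow> \<bar>hsum y - ln y - \<gamma>\<bar> \<le> 4 / y" using hsum_asymp by blast
  define r where "r y = hsum y - ln y - \<gamma>" for y
  have r: "\<bar>r y\<bar> \<le> 4 / sqrt y" if "y \<ge> 1" for y
    using g[OF that] inverse_le_inverse_sqrt[OF that] by (simp add: r_def)
  have "\<bar>(\<Sum>c\<in>upto_real z. mobius_sum (y / real c) / real c) - of_bool (y \<ge> 1) + mobius_log (y / z)\<bar> \<le> 16 / sqrt z"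
    if z: "z \<ge> 1" and y: "y > 0" for y z
  proof (cases "y < z")
    case True
    have 0: "mobius_log (y / z) = 0" using True z by (simp add: mobius_log_def upto_real_empty)
    have "(\<Sum>c\<in>upto_real z. mobius_sum (y / real c) / real c) = (\<Sum>c\<in>upto_real y. mobius_sum (y / real c) / real c)"
    proof (rule sum.mono_neutral_right)
      show "\<forall>c\<in>upto_real z - upto_real y. mobius_sum (y / real c) / real c = 0"
        by (auto simp: mem_upto_real mobius_sum_def upto_real_empty divide_less_eq not_le)
    qed (use True in \<open>auto simp: mem_upto_real\<close>)
    also have "\<dots> = of_bool (y \<ge> 1)"
      using sum_mobius_sum_full[of y] upto_real_empty[of y] by (cases "y \<ge> 1") auto
    finally show ?thesis using 0 z by simp
  next
    case False
    then have yz: "z \<le> y" "y \<ge> 1" using z by auto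
    define w where "w = y / z"
    have w: "w \<ge> 1" "w \<le> y" using yz z by (auto simp: w_def field_simps)
    have "(\<Sum>c\<in>upto_real z. mobius_sum (y / real c) / real c)
        = 1 - (\<Sum>c | c \<in> upto_real y \<and> z < real c. mobius_sum (y / real c) / real c)"
      using sum_mobius_sum_full[OF yz(2)] sum_upto_real_split[OF yz(1)] by simp
    also have "(\<Sum>c | c \<in> upto_real y \<and> z < real c. mobius_sum (y / real c) / real c)
        = (\<Sum>c | c \<in> upto_real y \<and> z < real c. \<Sum>d\<in>upto_real (y / real c). moebius_mu d / real d * (1 / real c))"
      by (simp add: mobius_sum_def sum_divide_distrib)
    also have "\<dots> = (\<Sum>d\<in>upto_real w. \<Sum>c | c \<in> upto_real (y / real d) \<and> z < real c. moebius_mu d / real d * (1 / real c))"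
      unfolding w_def using z yz by (intro hyperbola_swap_tail) auto
    also have "\<dots> = (\<Sum>d\<in>upto_real w. moebius_mu d / real d * (ln (w / real d) + r (y / real d) - r z))"
    proof (intro sum.cong refl)
      fix d assume d: "d \<in> upto_real w"
      have d': "z \<le> y / real d" "real d > 0" using d z by (auto simp: upto_real_def w_def field_simps)
      have "(\<Sum>c | c \<in> upto_real (y / real d) \<and> z < real c. 1 / real c) = hsum (y / real d) - hsum z"
        unfolding hsum_def using sum_upto_real_split[OF d'(1)] by simp
      also have "\<dots> = ln (w / real d) + r (y / real d) - r z"
        using d' z yz by (simp add: r_def w_def ln_div ln_mult)
      finally show "(\<Sum>c | c \<in> upto_real (y / real d) \<and> z < real c. moebius_mu d / real d * (1 / real c))
          = moebius_mu d / real d * (ln (w / real d) + r (y / real d) - r z)"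
        by (simp only: sum_distrib_left[symmetric])
    qed
    also have "\<dots> = mobius_log w + mobius_smooth r w y - r z * mobius_sum w"
      by (simp add: mobius_log_def mobius_sum_def mobius_smooth_def sum_distrib_left
          sum_subtractf[symmetric] sum.distrib[symmetric] algebra_simps)
    finally have eq: "(\<Sum>c\<in>upto_real z. mobius_sum (y / real c) / real c) - 1 + mobius_log w
        = r z * mobius_sum w - mobius_smooth r w y" by simp
    have "\<bar>mobius_smooth r w y\<bar> \<le> 2 * 4 * sqrt (w / y)"
      using w r by (intro mobius_smooth_error) auto
    also have "\<dots> = 8 / sqrt z" using yz z by (simp add: w_def real_sqrt_divide)
    finally have "\<bar>mobius_smooth r w y\<bar> \<le> 8 / sqrt z" .
    moreover have "\<bar>r z * mobius_sum w\<bar> \<le> (4 / sqrt z) * 2"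
      unfolding abs_mult using r[OF z] z by (intro mult_mono mobius_sum_bound) auto
    ultimately show ?thesis using eq yz by (simp add: w_def abs_le_iff)
  qed
  then show ?thesis using that[of 16] by auto
qed

lemma lsum_tail:
  assumes "1 \<le> t" "t \<le> V"
  shows "(\<Sum>b | b \<in> upto_real V \<and> t < real b. ln (V / real b) / real b) = lsum V - ln (V / t) * hsum t - lsum t"
proof -
  have "(\<Sum>b | b \<in> upto_real V \<and> t < real b. ln (V / real b) / real b)
      = lsum V - (\<Sum>b\<in>upto_real t. ln (V / real b) / real b)"
    unfolding lsum_def using sum_upto_real_split[OF assms(2)] by simp
  also have "(\<Sum>b\<in>upto_real t. ln (V / real b) / real b) = (\<Sum>b\<in>upto_real t. ln (V / t) * (1 / real b) + ln (t / real b) / real b)"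
    using assms by (intro sum.cong refl) (auto simp: upto_real_def ln_div add_divide_distrib[symmetric])
  finally show ?thesis by (simp add: sum.distrib sum_distrib_left hsum_def lsum_def)
qed

text \<open>The previous argument one logarithm higher: the full sum is \<open>ln v\<close>, and the
  tail \<open>b > t\<close> is a Moebius sum with quadratic logarithmic weight, which is
  \<open>ln (v / t)\<close> up to a bounded error.\<close>

lemma sum_mobius_log_asymp:
  obtains C where "C \<ge> 0" "\<And>t v. t \<ge> 1 \<Longrightarrow> v > 0 \<Longrightarrow>
    \<bar>(\<Sum>b\<in>upto_real t. mobius_log (v / real b) / real b) - max 0 (ln v) + max 0 (ln (v / t))\<bar> \<le> C"
proof -
  obtain \<gamma> c where g: "\<And>y. y \<ge> 1 \<Longrightarrow> \<bar>hsum y - ln y - \<gamma>\<bar> \<le> 4 / y"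
    and a: "\<And>y. y \<ge> 1 \<Longrightarrow> \<bar>lsum y - ((ln y)\<^sup>2 / 2 + \<gamma> * ln y + c)\<bar> \<le> 24 / sqrt y"
    using lsum_asymp by blast
  obtain K where K: "K \<ge> 0" "\<And>y. \<bar>mobius_log y\<bar> \<le> K" using mobius_log_bound by blast
  define \<rho> where "\<rho> y = lsum y - ((ln y)\<^sup>2 / 2 + \<gamma> * ln y + c)" for y
  have \<rho>: "\<bar>\<rho> y\<bar> \<le> 24 / sqrt y" if "y \<ge> 1" for y using a[OF that] by (simp add: \<rho>_def)
  define Q where "Q v = (\<Sum>d\<in>upto_real v. moebius_mu d / real d * ((ln (v / real d))\<^sup>2 / 2))" for v
  \<comment> \<open>The Moebius transform of \<open>lsum\<close> is exactly \<open>ln v\<close>. Its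
    lower order terms give multiples of \<open>mobius_log\<close> and \<open>mobius_sum\<close>,
    which are bounded, so the quadratic term must account for \<open>ln v\<close>.\<close>
  have Q: "\<bar>Q v - ln v\<bar> \<le> \<bar>\<gamma>\<bar> * K + \<bar>c\<bar> * 2 + 48" if v: "v \<ge> 1" for v
  proof -
    have "ln v = (\<Sum>d\<in>upto_real v. moebius_mu d / real d * lsum (v / real d))"
      using mobius_hyperbola[OF v, of "\<lambda>n. ln (v / real n)"] by (simp add: lsum_def)
    also have "\<dots> = Q v + \<gamma> * mobius_log v + c * mobius_sum v + mobius_smooth \<rho> v v"
      by (simp add: Q_def mobius_log_def mobius_sum_def mobius_smooth_def \<rho>_def sum_distrib_left
          sum_subtractf[symmetric] sum.distrib[symmetric] algebra_simps)
    finally have "ln v = \<dots>" .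
    moreover have "\<bar>mobius_smooth \<rho> v v\<bar> \<le> 2 * 24 * sqrt (v / v)"
      using v \<rho> by (intro mobius_smooth_error) auto
    moreover have "\<bar>\<gamma> * mobius_log v\<bar> \<le> \<bar>\<gamma>\<bar> * K" unfolding abs_mult by (intro mult_left_mono K) auto
    moreover have "\<bar>c * mobius_sum v\<bar> \<le> \<bar>c\<bar> * 2" unfolding abs_mult by (intro mult_left_mono mobius_sum_bound) auto
    ultimately show ?thesis using v by (simp add: abs_le_iff)
  qed
  define C where "C = \<bar>\<gamma>\<bar> * K + \<bar>c\<bar> * 2 + 48 + 4 * K + 48 + 4 * \<bar>c\<bar> + 48"
  have C0: "C \<ge> 0" using K(1) unfolding C_def by (intro add_nonneg_nonneg mult_nonneg_nonneg) auto
  have "\<bar>(\<Sum>b\<in>upto_real t. mobius_log (v / real b) / real b) - max 0 (ln v) + max 0 (ln (v / t))\<bar> \<le> C"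
    if t: "t \<ge> 1" and v: "v > 0" for t v
  proof (cases "v < t")
    case True
    have l: "ln (v / t) \<le> 0" using True v by simp
    have "(\<Sum>b\<in>upto_real t. mobius_log (v / real b) / real b) = (\<Sum>b\<in>upto_real v. mobius_log (v / real b) / real b)"
    proof (rule sum.mono_neutral_right)
      show "\<forall>c\<in>upto_real t - upto_real v. mobius_log (v / real c) / real c = 0"
        by (auto simp: mem_upto_real mobius_log_def upto_real_empty divide_less_eq not_le)
    qed (use True in \<open>auto simp: mem_upto_real\<close>)
    also have "\<dots> = max 0 (ln v)"
      using sum_mobius_log_full[of v] upto_real_empty[of v] v by (cases "v \<ge> 1") (auto simp: max_def)
    finally show ?thesis using l C0 by simp
  next
    case False
    then have vt: "t \<le> v" "v \<ge> 1" using t by auto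
    define w where "w = v / t"
    have w: "w \<ge> 1" "w \<le> v" using vt t by (auto simp: w_def field_simps)
    \<comment> \<open>\<open>e\<close> and \<open>\<eta>\<close> are the errors of the expansions of
      \<open>lsum\<close> and \<open>hsum\<close> at the fixed point \<open>t\<close>. They are
      multiplied by bounded Moebius sums, so it is enough that they are bounded.\<close>
    define e where "e = (ln t)\<^sup>2 / 2 + \<gamma> * ln t + c - lsum t"
    have e: "\<bar>e\<bar> \<le> 24"
    proof -
      have "24 / sqrt t \<le> 24" using t by (simp add: field_simps)
      then show ?thesis using a[OF t] by (simp add: e_def abs_le_iff)
    qed
    define \<eta> where "\<eta> = hsum t - ln t - \<gamma>"
    have \<eta>: "\<bar>\<eta>\<bar> \<le> 4"
    proof -
      have "4 / t \<le> 4" using t by (simp add: field_simps)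
      then show ?thesis using g[OF t] by (simp add: \<eta>_def)
    qed
    have "(\<Sum>b\<in>upto_real t. mobius_log (v / real b) / real b)
        = ln v - (\<Sum>b | b \<in> upto_real v \<and> t < real b. mobius_log (v / real b) / real b)"
      using sum_mobius_log_full[OF vt(2)] sum_upto_real_split[OF vt(1)] by simp
    also have "(\<Sum>b | b \<in> upto_real v \<and> t < real b. mobius_log (v / real b) / real b)
        = (\<Sum>b | b \<in> upto_real v \<and> t < real b. \<Sum>d\<in>upto_real (v / real b). moebius_mu d / real d * (ln (v / real d / real b) / real b))"
      by (simp add: mobius_log_def sum_divide_distrib mult.commute)
    also have "\<dots> = (\<Sum>d\<in>upto_real w. \<Sum>b | b \<in> upto_real (v / real d) \<and> t < real b. moebius_mu d / real d * (ln (v / real d / real b) / real b))"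
      unfolding w_def using t vt by (intro hyperbola_swap_tail) auto
    also have "\<dots> = (\<Sum>d\<in>upto_real w. moebius_mu d / real d * ((ln (w / real d))\<^sup>2 / 2 - \<eta> * ln (w / real d) + e + \<rho> (v / real d)))"
    proof (intro sum.cong refl)
      fix d assume d: "d \<in> upto_real w"
      have d': "t \<le> v / real d" "real d > 0" using d t by (auto simp: upto_real_def w_def field_simps)
      have lw: "ln (w / real d) = ln (v / real d) - ln t" "ln (v / real d / t) = ln (v / real d) - ln t"
        using d' t vt by (auto simp: w_def ln_div ln_mult)
      have "(\<Sum>b | b \<in> upto_real (v / real d) \<and> t < real b. ln (v / real d / real b) / real b)
          = (ln (w / real d))\<^sup>2 / 2 - \<eta> * ln (w / real d) + e + \<rho> (v / real d)"
        unfolding lsum_tail[OF t d'(1)] lw \<rho>_def e_def \<eta>_def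
        by (simp add: power2_eq_square algebra_simps add_divide_distrib diff_divide_distrib)
      then show "(\<Sum>b | b \<in> upto_real (v / real d) \<and> t < real b. moebius_mu d / real d * (ln (v / real d / real b) / real b))
          = moebius_mu d / real d * ((ln (w / real d))\<^sup>2 / 2 - \<eta> * ln (w / real d) + e + \<rho> (v / real d))"
        by (simp only: sum_distrib_left[symmetric])
    qed
    also have "\<dots> = Q w - \<eta> * mobius_log w + e * mobius_sum w + mobius_smooth \<rho> w v"
      by (simp add: Q_def mobius_log_def mobius_sum_def mobius_smooth_def sum_distrib_left
          sum_subtractf[symmetric] sum.distrib[symmetric] algebra_simps)
    finally have eq: "(\<Sum>b\<in>upto_real t. mobius_log (v / real b) / real b) - ln v + ln w
        = (ln w - Q w) + \<eta> * mobius_log w - e * mobius_sum w - mobius_smooth \<rho> w v" by simp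
    have maxs: "max 0 (ln v) = ln v" "max 0 (ln (v / t)) = ln w" using vt w by (auto simp: w_def)
    have four: "\<bar>x1 + x2 - x3 - x4\<bar> \<le> y1 + y2 + y3 + y4"
      if "\<bar>x1\<bar> \<le> y1" "\<bar>x2\<bar> \<le> y2" "\<bar>x3\<bar> \<le> y3" "\<bar>x4\<bar> \<le> y4" for x1 x2 x3 x4 y1 y2 y3 y4 :: real
      using that by linarith
    have "\<bar>mobius_smooth \<rho> w v\<bar> \<le> 2 * 24 * sqrt (w / v)"
      using w \<rho> by (intro mobius_smooth_error) auto
    also have "\<dots> \<le> 48" using w by simp
    finally have "\<bar>mobius_smooth \<rho> w v\<bar> \<le> 48" .
    moreover have "\<bar>\<eta> * mobius_log w\<bar> \<le> 4 * K" unfolding abs_mult using \<eta> K by (intro mult_mono) auto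
    moreover have "\<bar>e * mobius_sum w\<bar> \<le> 24 * 2" unfolding abs_mult using e by (intro mult_mono mobius_sum_bound) auto
    moreover have "\<bar>ln w - Q w\<bar> \<le> \<bar>\<gamma>\<bar> * K + \<bar>c\<bar> * 2 + 48" using Q[OF w(1)] by (simp add: abs_minus_commute)
    ultimately have "\<bar>(ln w - Q w) + \<eta> * mobius_log w - e * mobius_sum w - mobius_smooth \<rho> w v\<bar>
        \<le> (\<bar>\<gamma>\<bar> * K + \<bar>c\<bar> * 2 + 48) + 4 * K + 24 * 2 + 48"
      by (intro four)
    also have "\<dots> \<le> C" by (simp add: C_def)
    finally show ?thesis using eq maxs by simp
  qed
  then show ?thesis using that C0 by blast
qed

text \<open>Summation over \<open>c\<close> turns \<open>mobius_sum\<close> into an indicator minus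
  \<open>mobius_log\<close>; summation over \<open>b\<close> turns these into
  \<open>ln (min t1 x)\<close> and a difference of positive parts of logarithms. Up to a constant
  everything cancels if \<open>t1 * t2 \<le> x\<close>, and otherwise at most the overshoot
  remains.\<close>

lemma triple_mobius_bound:
  obtains C where "C \<ge> 0" "\<And>t1 t2 x. t1 > 0 \<Longrightarrow> t2 > 0 \<Longrightarrow> x > 0 \<Longrightarrow>
    \<bar>\<Sum>b\<in>upto_real t1. \<Sum>c\<in>upto_real t2. mobius_sum (x / (real b * real c)) / (real b * real c)\<bar>
      \<le> C + max 0 (ln (t1 * t2 / x))"
proof -
  obtain C1 where C1: "C1 \<ge> 0" "\<And>y z. z \<ge> 1 \<Longrightarrow> y > 0 \<Longrightarrow>
    \<bar>(\<Sum>c\<in>upto_real z. mobius_sum (y / real c) / real c) - of_bool (y \<ge> 1) + mobius_log (y / z)\<bar> \<le> C1 / sqrt z"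
    using sum_mobius_sum_asymp by blast
  obtain C2 where C2: "C2 \<ge> 0" "\<And>t v. t \<ge> 1 \<Longrightarrow> v > 0 \<Longrightarrow>
    \<bar>(\<Sum>b\<in>upto_real t. mobius_log (v / real b) / real b) - max 0 (ln v) + max 0 (ln (v / t))\<bar> \<le> C2"
    using sum_mobius_log_asymp by blast
  define U where "U t1 t2 x = (\<Sum>b\<in>upto_real t1. \<Sum>c\<in>upto_real t2. mobius_sum (x / (real b * real c)) / (real b * real c))" for t1 t2 x
  have sym: "U t1 t2 x = U t2 t1 x" for t1 t2 x
    unfolding U_def by (subst sum.swap) (simp add: mult.commute)
  \<comment> \<open>Every \<open>b\<close> carries an error \<open>C1 / sqrt t2\<close>, and the
    harmonic sum over \<open>b \<le> t1\<close> must not spoil it. Hence the longer range is summed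
    first; the other case follows by symmetry.\<close>
  have main: "\<bar>U t1 t2 x\<bar> \<le> 2 * C1 + C2 + 1 + max 0 (ln (t1 * t2 / x))"
    if t: "1 \<le> t1" "t1 \<le> t2" and x: "x \<ge> 1" for t1 t2 x
  proof -
    define v where "v = x / t2"
    have v: "v > 0" using x t by (simp add: v_def)
    define E where "E b = (\<Sum>c\<in>upto_real t2. mobius_sum (x / real b / real c) / real c) - of_bool (x / real b \<ge> 1) + mobius_log (v / real b)" for b
    have E: "\<bar>E b\<bar> \<le> C1 / sqrt t2" if "b \<in> upto_real t1" for b
      using C1(2)[of t2 "x / real b"] that t x by (simp add: E_def v_def upto_real_def mult.commute)
    have "U t1 t2 x = (\<Sum>b\<in>upto_real t1. (\<Sum>c\<in>upto_real t2. mobius_sum (x / real b / real c) / real c) / real b)"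
      by (simp add: U_def sum_divide_distrib mult.commute)
    also have "\<dots> = (\<Sum>b\<in>upto_real t1. of_bool (x / real b \<ge> 1) / real b - mobius_log (v / real b) / real b + E b / real b)"
      by (intro sum.cong refl) (simp add: E_def add_divide_distrib diff_divide_distrib)
    also have "\<dots> = (\<Sum>b\<in>upto_real t1. of_bool (x / real b \<ge> 1) / real b)
        - (\<Sum>b\<in>upto_real t1. mobius_log (v / real b) / real b) + (\<Sum>b\<in>upto_real t1. E b / real b)"
      by (simp add: sum.distrib sum_subtractf)
    also have "(\<Sum>b\<in>upto_real t1. of_bool (x / real b \<ge> 1) / real b) = hsum (min t1 x)"
      unfolding hsum_def by (rule sum.mono_neutral_cong_right) (auto simp: mem_upto_real field_simps)
    finally have eq: "U t1 t2 x = hsum (min t1 x) - (\<Sum>b\<in>upto_real t1. mobius_log (v / real b) / real b)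
        + (\<Sum>b\<in>upto_real t1. E b / real b)" .
    have "\<bar>\<Sum>b\<in>upto_real t1. E b / real b\<bar> \<le> (\<Sum>b\<in>upto_real t1. C1 / sqrt t2 * (1 / real b))"
    proof (rule order_trans[OF sum_abs], intro sum_mono)
      fix b assume "b \<in> upto_real t1"
      from divide_right_mono[OF E[OF this], of "real b"]
      show "\<bar>E b / real b\<bar> \<le> C1 / sqrt t2 * (1 / real b)" by simp
    qed
    also have "\<dots> = C1 / sqrt t2 * hsum t1" by (simp add: sum_distrib_left hsum_def)
    also have "\<dots> \<le> C1 / sqrt t2 * (2 * sqrt t2)"
    proof (intro mult_left_mono)
      have "hsum t1 \<le> 2 * sqrt t1" using hsum_bounds(2)[OF t(1)] ln_le_2_sqrt[of t1] t by linarith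
      also have "\<dots> \<le> 2 * sqrt t2" using t by simp
      finally show "hsum t1 \<le> 2 * sqrt t2" .
    qed (use C1 t in auto)
    also have "\<dots> = 2 * C1" using t by simp
    finally have e1: "\<bar>\<Sum>b\<in>upto_real t1. E b / real b\<bar> \<le> 2 * C1" .
    have e2: "ln (min t1 x) \<le> hsum (min t1 x)" "hsum (min t1 x) \<le> ln (min t1 x) + 1"
      using hsum_bounds[of "min t1 x"] t x by auto
    have lns: "ln v = ln x - ln t2" "ln (v / t1) = ln x - ln t2 - ln t1" "ln (t1 * t2 / x) = ln t1 + ln t2 - ln x"
      "ln (min t1 x) = min (ln t1) (ln x)" "0 \<le> ln t1" "ln t1 \<le> ln t2" "0 \<le> ln x"
      using t x by (auto simp: v_def ln_div ln_mult min_def)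
    have "\<bar>ln (min t1 x) - max 0 (ln v) + max 0 (ln (v / t1))\<bar> \<le> max 0 (ln (t1 * t2 / x))"
      using lns(5-7) unfolding lns(1-4) by (auto simp: min_def max_def abs_le_iff)
    then show ?thesis using eq e1 e2 C2(2)[OF t(1) v] by (simp add: abs_le_iff)
  qed
  have "\<bar>U t1 t2 x\<bar> \<le> 2 * C1 + C2 + 1 + max 0 (ln (t1 * t2 / x))"
    if p: "t1 > 0" "t2 > 0" "x > 0" for t1 t2 x
  proof (cases "t1 \<ge> 1 \<and> t2 \<ge> 1 \<and> x \<ge> 1")
    case True
    then show ?thesis using main[of t1 t2 x] main[of t2 t1 x] sym[of t1 t2 x]
      by (cases "t1 \<le> t2") (auto simp: mult.commute)
  next
    case False
    have "mobius_sum (x / (real b * real c)) = 0" if "x < 1" "b \<ge> 1" "c \<ge> 1" for b c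
    proof -
      have "1 * 1 \<le> real b * real c" using that by (intro mult_mono) auto
      then have "x / (real b * real c) < 1" using that by (simp add: divide_less_eq)
      then show ?thesis by (simp add: mobius_sum_def upto_real_empty)
    qed
    then have "U t1 t2 x = 0" using False
      by (auto simp: U_def not_le upto_real_empty intro!: sum.neutral) (auto simp: upto_real_def)
    then show ?thesis using C1(1) C2(1) by simp
  qed
  then show ?thesis using that[of "2 * C1 + C2 + 1"] C1(1) C2(1) unfolding U_def by auto
qed

section \<open>Sums and products over primes\<close>

lemma prod_primes_dvd:
  fixes m :: nat
  assumes "finite A" "\<And>p. p \<in> A \<Longrightarrow> prime p" "\<And>p. p \<in> A \<Longrightarrow> p dvd m"
  shows "\<Prod>A dvd m"
  using assms
proof (induction A)
  case (insert p A)
  have "coprime p (\<Prod>A)"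
    using insert.prems insert.hyps by (intro prod_coprime_right) (auto intro: primes_coprime)
  then show ?case using insert by (simp add: divides_mult)
qed simp

text \<open>Primes with \<open>A \<le> p powr \<zeta>\<close> pay for their own factor
  \<open>A\<close>; at most \<open>T\<close> smaller ones remain and cost a constant. This is the
  usual argument for the size of the divisor function.\<close>

lemma prime_divisors_pow_bound:
  fixes A :: real
  assumes "A \<ge> 1" "\<zeta> > 0"
  obtains K where "K \<ge> 1" "\<And>P n. finite P \<Longrightarrow> (\<And>p. p \<in> P \<Longrightarrow> prime p) \<Longrightarrow> n > 0 \<Longrightarrow>
     (\<And>p. p \<in> P \<Longrightarrow> p dvd n) \<Longrightarrow> A ^ card P \<le> K * real n powr \<zeta>"
proof -
  define T where "T = nat \<lceil>A powr (1 / \<zeta>)\<rceil>"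
  have T: "A \<le> real p powr \<zeta>" if "p \<ge> T" for p
  proof -
    have "A powr (1 / \<zeta>) \<le> real p" using that by (simp add: T_def le_nat_iff)
    then have "(A powr (1 / \<zeta>)) powr \<zeta> \<le> real p powr \<zeta>" using assms by (intro powr_mono2) auto
    then show ?thesis using assms by (simp add: powr_powr)
  qed
  have "A ^ card P \<le> A ^ T * real n powr \<zeta>"
    if P: "finite P" "\<And>p. p \<in> P \<Longrightarrow> prime p" and n: "n > 0" and d: "\<And>p. p \<in> P \<Longrightarrow> p dvd n" for P n
  proof -
    have "A ^ card P = (\<Prod>p\<in>P. A)" by simp
    also have "\<dots> \<le> (\<Prod>p\<in>P. (if p < T then A else 1) * real p powr \<zeta>)"
    proof (intro prod_mono conjI)
      fix p assume p: "p \<in> P"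
      have "1 \<le> real p powr \<zeta>" using prime_gt_0_nat[OF P(2)[OF p]] assms by (intro ge_one_powr_ge_zero) auto
      then show "A \<le> (if p < T then A else 1) * real p powr \<zeta>"
        using T[of p] assms mult_left_mono[of 1 "real p powr \<zeta>" A] by auto
    qed (use assms in auto)
    also have "\<dots> = (\<Prod>p\<in>P. if p < T then A else 1) * real (\<Prod>P) powr \<zeta>"
      by (simp add: prod.distrib of_nat_prod prod_powr_distrib)
    also have "\<dots> \<le> A ^ T * real n powr \<zeta>"
    proof (intro mult_mono)
      have "(\<Prod>p\<in>P. if p < T then A else 1) = (\<Prod>p\<in>{p\<in>P. p < T}. A)"
        using P by (simp only: prod.inter_filter)
      also have "\<dots> = A ^ card {p\<in>P. p < T}" by simp
      also have "card {p\<in>P. p < T} \<le> card {..<T}" by (intro card_mono) auto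
      then have "A ^ card {p\<in>P. p < T} \<le> A ^ T" using assms by (intro power_increasing) auto
      finally show "(\<Prod>p\<in>P. if p < T then A else 1) \<le> A ^ T" .
      have "\<Prod>P dvd n" using P d by (rule prod_primes_dvd)
      then have "\<Prod>P \<le> n" using n by (rule dvd_imp_le)
      then have "real (\<Prod>P) \<le> real n" by (rule of_nat_mono)
      then show "real (\<Prod>P) powr \<zeta> \<le> real n powr \<zeta>"
        using assms by (intro powr_mono2) (auto intro: prod_nonneg)
    qed (use assms in auto)
    finally show ?thesis .
  qed
  moreover have "A ^ T \<ge> 1" using assms by simp
  ultimately show ?thesis using that by blast
qed

text \<open>Chebyshev's argument: with \<open>n = 2 ^ i\<close>, the primes between \<open>n\<close>
  and \<open>2 * n\<close> all divide the central binomial coefficient, which is at most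
  \<open>4 ^ n\<close>, while each of them exceeds \<open>n\<close>.\<close>

lemma card_primes_dyadic:
  fixes i :: nat
  assumes i: "i \<ge> 1"
  shows "real (card {p::nat. prime p \<and> 2 ^ i < p \<and> p \<le> 2 ^ Suc i}) \<le> 2 ^ Suc i / real i"
proof -
  define n :: nat where "n = 2 ^ i"
  define A where "A = {p::nat. prime p \<and> 2 ^ i < p \<and> p \<le> 2 ^ Suc i}"
  have A: "finite A" unfolding A_def by (rule finite_subset[of _ "{..2 ^ Suc i}"]) auto
  have "\<Prod>A dvd (2 * n) choose n"
  proof (rule prod_primes_dvd[OF A])
    fix p assume p: "p \<in> A"
    then have pp: "prime p" "n < p" "p \<le> 2 * n" by (auto simp: A_def n_def)
    have "fact n * fact n * ((2 * n) choose n) = (fact (2 * n) :: nat)"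
      using binomial_fact_lemma[of n "2 * n"] by simp
    moreover have "p dvd fact (2 * n)" using pp by (simp add: prime_dvd_fact_iff)
    moreover have "\<not> p dvd fact n" using pp by (simp add: prime_dvd_fact_iff)
    ultimately show "p dvd (2 * n) choose n" using pp(1) by (metis prime_dvd_mult_iff)
  qed (auto simp: A_def)
  then have "\<Prod>A \<le> (2 * n) choose n" by (rule dvd_imp_le) simp
  also have "\<dots> \<le> 2 ^ (2 * n)" by (rule binomial_le_pow2)
  finally have le: "\<Prod>A \<le> 2 ^ (2 * n)" .
  have "(2 ^ i) ^ card A = (\<Prod>p\<in>A. 2 ^ i :: nat)" by simp
  also have "\<dots> \<le> \<Prod>A" by (intro prod_mono) (auto simp: A_def)
  also note le
  finally have "(2 :: nat) ^ (i * card A) \<le> 2 ^ (2 * n)" by (simp add: power_mult)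
  then have "i * card A \<le> 2 * n" by (subst (asm) power_increasing_iff) auto
  then have "real i * real (card A) \<le> 2 * real n" by (metis of_nat_le_iff of_nat_mult of_nat_numeral)
  then show ?thesis using i by (simp add: A_def n_def field_simps)
qed

text \<open>The dyadic block above \<open>2 ^ i\<close> contributes at most \<open>2 / i\<close> by
  the preceding count, and the harmonic sum over the blocks gives the doubly logarithmic growth
  known from Mertens.\<close>

lemma sum_inverse_primes_dyadic:
  assumes k: "k \<ge> 1"
  shows "(\<Sum>p | prime p \<and> p \<le> 2 ^ k. 1 / real p) \<le> 3 + 2 * ln (real k)"
proof -
  have fin: "finite {p::nat. prime p \<and> p \<le> 2 ^ k}" for k by (rule finite_subset[of _ "{..2 ^ k}"]) auto
  have "(\<Sum>p | prime p \<and> p \<le> 2 ^ Suc k. 1 / real p) \<le> 1 + 2 * (\<Sum>i=1..k. 1 / real i)" for k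
  proof (induction k)
    case 0
    have "{p::nat. prime p \<and> p \<le> 2} = {2}" by (auto dest: prime_ge_2_nat)
    then show ?case by simp
  next
    case (Suc k)
    define B where "B = {p::nat. prime p \<and> 2 ^ Suc k < p \<and> p \<le> 2 ^ Suc (Suc k)}"
    have B: "finite B" unfolding B_def by (rule finite_subset[of _ "{..2 ^ Suc (Suc k)}"]) auto
    have "{p::nat. prime p \<and> p \<le> 2 ^ Suc (Suc k)} = {p. prime p \<and> p \<le> 2 ^ Suc k} \<union> B"
      by (auto simp: B_def)
    moreover have "{p. prime p \<and> p \<le> 2 ^ Suc k} \<inter> B = {}" by (auto simp: B_def)
    ultimately have "(\<Sum>p | prime p \<and> p \<le> 2 ^ Suc (Suc k). 1 / real p)
        = (\<Sum>p | prime p \<and> p \<le> 2 ^ Suc k. 1 / real p) + (\<Sum>p\<in>B. 1 / real p)"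
      using fin B by (simp only: sum.union_disjoint)
    also have "(\<Sum>p\<in>B. 1 / real p) \<le> (\<Sum>p\<in>B. 1 / 2 ^ Suc k)"
    proof (rule sum_mono)
      fix p assume "p \<in> B"
      then have "(2::nat) ^ Suc k \<le> p" by (simp add: B_def)
      then have "real (2 ^ Suc k) \<le> real p" by (rule of_nat_mono)
      then show "1 / real p \<le> 1 / 2 ^ Suc k" by (intro frac_le) auto
    qed
    also have "\<dots> = real (card B) / 2 ^ Suc k" by simp
    also have "\<dots> \<le> (2 ^ Suc (Suc k) / real (Suc k)) / 2 ^ Suc k"
      unfolding B_def by (intro divide_right_mono card_primes_dyadic) auto
    also have "\<dots> = 2 * (1 / real (Suc k))" by (simp del: of_nat_Suc)
    finally show ?case using Suc by simp
  qed
  from this[of "k - 1"] have "(\<Sum>p | prime p \<and> p \<le> 2 ^ k. 1 / real p) \<le> 1 + 2 * (\<Sum>i=1..k - 1. 1 / real i)"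
    using k by simp
  also have "(\<Sum>i=1..k - 1. 1 / real i) \<le> (\<Sum>i=1..k. 1 / real i)" by (intro sum_mono2) auto
  also have "\<dots> = hsum (real k)" by (simp add: hsum_def upto_real_eq)
  also have "\<dots> \<le> ln (real k) + 1" using k by (intro hsum_bounds) auto
  finally show ?thesis by simp
qed

text \<open>Primes up to \<open>2 ^ k\<close> are covered by the dyadic estimate. Of the larger ones
  there are at most \<open>2 powr (k / 2)\<close>, each with a reciprocal of at most
  \<open>2 powr (- k)\<close>; squaring the cardinality in the hypothesis leaves room for the extra
  logarithm in the second sum.\<close>

lemma sum_prime_divisors_bound:
  assumes A: "finite A" "\<And>p. p \<in> A \<Longrightarrow> prime p" and k: "k \<ge> 1" and card: "(real (card A))\<^sup>2 \<le> 2 ^ k"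
  shows "(\<Sum>p\<in>A. 1 / real p) \<le> 4 + 2 * ln (real k)"
    "(\<Sum>p\<in>A. ln (real p) / real p) \<le> real k * (3 + 2 * ln (real k)) + 2"
proof -
  define S T where "S = {p\<in>A. p \<le> 2 ^ k}" and "T = {p\<in>A. \<not> p \<le> 2 ^ k}"
  define q where "q = sqrt (2 ^ k)"
  have q: "q * q = 2 ^ k" "q \<ge> 1" by (simp_all add: q_def)
  have "real (card A) \<le> q" using card unfolding q_def by (intro real_le_rsqrt)
  moreover have "card T \<le> card A" unfolding T_def using A by (intro card_mono) auto
  ultimately have cT: "real (card T) \<le> q" by linarith
  have split: "(\<Sum>p\<in>A. f p) = (\<Sum>p\<in>S. f p) + (\<Sum>p\<in>T. f p)" for f :: "nat \<Rightarrow> real"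
    unfolding S_def T_def using A(1) by (simp add: sum.inter_filter sum.distrib[symmetric]) (intro sum.cong refl, auto)
  have fS: "finite {p::nat. prime p \<and> p \<le> 2 ^ k}" by (rule finite_subset[of _ "{..2 ^ k}"]) auto
  have S1: "(\<Sum>p\<in>S. 1 / real p) \<le> 3 + 2 * ln (real k)"
  proof -
    have "(\<Sum>p\<in>S. 1 / real p) \<le> (\<Sum>p | prime p \<and> p \<le> 2 ^ k. 1 / real p)"
      using A fS by (intro sum_mono2) (auto simp: S_def)
    then show ?thesis using sum_inverse_primes_dyadic[OF k] by linarith
  qed
  have T0: "real p \<ge> 2 ^ k" "real p > 0" if "p \<in> T" for p
  proof -
    have "(2::nat) ^ k \<le> p" using that by (simp add: T_def)
    then have "real (2 ^ k) \<le> real p" by (rule of_nat_mono)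
    then show "real p \<ge> 2 ^ k" by simp
    moreover have "(2::real) ^ k > 0" by simp
    ultimately show "real p > 0" by linarith
  qed
  have T2: "ln (real p) / real p \<le> 2 / q" if "p \<in> T" for p
  proof -
    have s: "sqrt (real p) \<ge> q" "sqrt (real p) * sqrt (real p) = real p" using T0[OF that] by (auto simp: q_def)
    have "ln (real p) / real p \<le> 2 * sqrt (real p) / real p"
      using ln_le_2_sqrt[of "real p"] T0[OF that] by (intro divide_right_mono) auto
    also have "\<dots> = 2 / sqrt (real p)" using s T0[OF that] by (simp add: field_simps)
    also have "\<dots> \<le> 2 / q" using s q by (intro frac_le) auto
    finally show ?thesis .
  qed
  have "(\<Sum>p\<in>T. 1 / real p) \<le> (\<Sum>p\<in>T. 1 / q)"
  proof (rule sum_mono)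
    fix p assume p: "p \<in> T"
    have "q * 1 \<le> q * q" using q(2) by (intro mult_left_mono) auto
    then have "q \<le> real p" using T0[OF p] q by linarith
    then show "1 / real p \<le> 1 / q" using q by (intro frac_le) auto
  qed
  also have "\<dots> \<le> 1" using cT q by (simp add: field_simps)
  finally show "(\<Sum>p\<in>A. 1 / real p) \<le> 4 + 2 * ln (real k)" unfolding split using S1 by linarith
  have "(\<Sum>p\<in>S. ln (real p) / real p) \<le> (\<Sum>p\<in>S. real k * (1 / real p))"
  proof (rule sum_mono)
    fix p assume "p \<in> S"
    then have p: "p > 0" "p \<le> 2 ^ k" using A prime_gt_0_nat by (auto simp: S_def)
    then have "real p \<le> real (2 ^ k)" by (intro of_nat_mono)
    then have "ln (real p) \<le> ln (2 ^ k)" using p by simp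
    also have "\<dots> \<le> real k * 1" unfolding ln_realpow by (intro mult_left_mono) (use ln_le_minus_one[of 2] in auto)
    finally show "ln (real p) / real p \<le> real k * (1 / real p)" using p by (simp add: field_simps)
  qed
  also have "\<dots> \<le> real k * (3 + 2 * ln (real k))" unfolding sum_distrib_left[symmetric] using S1 by (intro mult_left_mono) auto
  finally have "(\<Sum>p\<in>S. ln (real p) / real p) \<le> real k * (3 + 2 * ln (real k))" .
  moreover have "(\<Sum>p\<in>T. ln (real p) / real p) \<le> (\<Sum>p\<in>T. 2 / q)" by (intro sum_mono T2)
  moreover have "(\<Sum>p\<in>T. 2 / q) \<le> 2" using cT q by (simp add: field_simps)
  ultimately show "(\<Sum>p\<in>A. ln (real p) / real p) \<le> real k * (3 + 2 * ln (real k)) + 2"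
    unfolding split by linarith
qed

lemma prod_one_plus_le_exp:
  fixes f :: "nat \<Rightarrow> real"
  assumes "finite P" "\<And>p. p \<in> P \<Longrightarrow> 0 \<le> f p"
  shows "(\<Prod>p\<in>P. 1 + f p) \<le> exp (\<Sum>p\<in>P. f p)"
proof -
  have "(\<Prod>p\<in>P. 1 + f p) \<le> (\<Prod>p\<in>P. exp (f p))"
    using assms(2) by (intro prod_mono) (auto simp: add_nonneg_nonneg)
  then show ?thesis using assms(1) by (simp add: exp_sum)
qed

lemma sum_powr_bound:
  fixes s :: real
  assumes "s > 1"
  obtains K where "K \<ge> 0" "\<And>P. finite P \<Longrightarrow> (\<Sum>p\<in>P. real p powr (- s)) \<le> K"
proof -
  have "summable (\<lambda>n. real n powr (- s))" using assms by (simp add: summable_real_powr_iff)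
  then have "(\<Sum>p\<in>P. real p powr (- s)) \<le> suminf (\<lambda>n. real n powr (- s))" if "finite P" for P
    using that by (intro sum_le_suminf) auto
  moreover have "suminf (\<lambda>n. real n powr (- s)) \<ge> 0"
    using calculation[of "{}"] by simp
  ultimately show ?thesis using that by blast
qed

lemma prod_one_plus_powr_bound:
  fixes C s :: real
  assumes "C \<ge> 0" "s > 1"
  obtains K where "K \<ge> 1" "\<And>P. finite P \<Longrightarrow> (\<Prod>p\<in>P. 1 + C * real p powr (- s)) \<le> K"
proof -
  obtain K where K: "K \<ge> 0" "\<And>P. finite P \<Longrightarrow> (\<Sum>p\<in>P. real p powr (- s)) \<le> K"
    using sum_powr_bound[OF assms(2)] by blast
  have "(\<Prod>p\<in>P. 1 + C * real p powr (- s)) \<le> exp (C * K)" if "finite P" for P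
  proof -
    have "(\<Prod>p\<in>P. 1 + C * real p powr (- s)) \<le> exp (\<Sum>p\<in>P. C * real p powr (- s))"
      using assms that by (intro prod_one_plus_le_exp) auto
    also have "\<dots> \<le> exp (C * K)" unfolding sum_distrib_left[symmetric] using K(2)[OF that] assms
      by (simp add: mult_left_mono)
    finally show ?thesis .
  qed
  then show ?thesis using that[of "exp (C * K)"] assms K by simp
qed

text \<open>A finite form of the product of \<open>\<zeta>(s)\<close> and its inverse. It is exact
  since \<open>F\<close> vanishes beyond \<open>M\<close> and \<open>P\<close> consists of all
  primes up to \<open>M\<close>, so neither truncation loses anything.\<close>

lemma mobius_inversion_sum:
  fixes F :: "nat \<Rightarrow> real" and s :: nat
  assumes P: "P = {p. prime p \<and> p \<le> M}" and M: "M \<ge> 1" and F: "\<And>n. n > M \<Longrightarrow> F n = 0"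
  shows "(\<Sum>d\<in>sqf P. wprod (\<lambda>p. - (1 / real p ^ s)) d * (\<Sum>n=1..M. 1 / real n ^ s * F (d * n))) = F 1"
proof -
  have fP: "finite P" unfolding P by (rule finite_subset[of _ "{..M}"]) auto
  have fS: "finite (sqf P)" using fP P by (intro finite_sqf) auto
  define G where "G d m = moebius_mu d * (1 / real m ^ s * F m)" for d m
  have w: "wprod (\<lambda>p. - (1 / real p ^ s)) d = moebius_mu d * (1 / real d ^ s)" if d: "squarefree d" for d
  proof -
    have "wprod (\<lambda>p. - (1 / real p ^ s)) d = (\<Prod>p\<in>prime_factors d. -1 * (1 / real p ^ s))"
      by (simp add: wprod_def)
    also have "\<dots> = moebius_mu d * (1 / (\<Prod>p\<in>prime_factors d. real p) ^ s)"
      using d by (simp only: prod.distrib) (simp add: moebius_mu_def prod_dividef prod_power_distrib)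
    also have "(\<Prod>p\<in>prime_factors d. real p) = real d" using squarefree_prod_id[OF d] by (simp add: wprod_def)
    finally show ?thesis .
  qed
  have inner: "wprod (\<lambda>p. - (1 / real p ^ s)) d * (\<Sum>n=1..M. 1 / real n ^ s * F (d * n))
      = (\<Sum>n\<in>upto_real (real M / real d). G d (d * n))" if d: "squarefree d" for d
  proof -
    have d0: "d > 0" using d by (auto intro!: Nat.gr0I)
    have "wprod (\<lambda>p. - (1 / real p ^ s)) d * (\<Sum>n=1..M. 1 / real n ^ s * F (d * n)) = (\<Sum>n=1..M. G d (d * n))"
      by (simp add: w[OF d] G_def sum_distrib_left power_mult_distrib)
    also have "\<dots> = (\<Sum>n\<in>upto_real (real M / real d). G d (d * n))"
    proof (rule sum.mono_neutral_right)
      show "upto_real (real M / real d) \<subseteq> {1..M}"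
      proof
        fix n assume "n \<in> upto_real (real M / real d)"
        then have n: "1 \<le> n" "real n * real d \<le> real M" using d0 by (auto simp: mem_upto_real field_simps)
        have "real n * 1 \<le> real n * real d" using d0 by (intro mult_left_mono) auto
        then have "real n \<le> real M" using n by linarith
        then show "n \<in> {1..M}" using n by simp
      qed
      show "\<forall>n\<in>{1..M} - upto_real (real M / real d). G d (d * n) = 0"
      proof
        fix n assume "n \<in> {1..M} - upto_real (real M / real d)"
        then have "real (d * n) > real M" using d0 by (auto simp: mem_upto_real field_simps)
        then have "d * n > M" by linarith
        then show "G d (d * n) = 0" using F by (simp add: G_def)
      qed
    qed simp
    finally show ?thesis .
  qed
  have "(\<Sum>d\<in>sqf P. wprod (\<lambda>p. - (1 / real p ^ s)) d * (\<Sum>n=1..M. 1 / real n ^ s * F (d * n)))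
      = (\<Sum>d\<in>sqf P. \<Sum>n\<in>upto_real (real M / real d). G d (d * n))"
    by (intro sum.cong refl inner) (simp add: sqf_def)
  also have "\<dots> = (\<Sum>d\<in>sqf P \<inter> {..M}. \<Sum>n\<in>upto_real (real M / real d). G d (d * n))"
  proof (rule sum.mono_neutral_right[OF fS])
    show "\<forall>d\<in>sqf P - sqf P \<inter> {..M}. (\<Sum>n\<in>upto_real (real M / real d). G d (d * n)) = 0"
    proof
      fix d assume d: "d \<in> sqf P - sqf P \<inter> {..M}"
      then have "real M / real d < 1" by (auto simp: divide_less_eq)
      then show "(\<Sum>n\<in>upto_real (real M / real d). G d (d * n)) = 0" by (simp add: upto_real_empty)
    qed
  qed auto
  also have "\<dots> = (\<Sum>d\<in>upto_real (real M). \<Sum>n\<in>upto_real (real M / real d). G d (d * n))"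
  proof (rule sum.mono_neutral_left)
    show "sqf P \<inter> {..M} \<subseteq> upto_real (real M)" using sqf_pos by (auto simp: mem_upto_real Suc_le_eq)
    show "\<forall>d\<in>upto_real (real M) - sqf P \<inter> {..M}. (\<Sum>n\<in>upto_real (real M / real d). G d (d * n)) = 0"
    proof
      fix d assume d: "d \<in> upto_real (real M) - sqf P \<inter> {..M}"
      have "\<not> squarefree d"
      proof
        assume sd: "squarefree d"
        have "p \<in> P" if "prime p" "p dvd d" for p
          using dvd_imp_le[OF that(2)] d that(1) unfolding P by (auto simp: mem_upto_real)
        then show False using sd d by (auto simp: sqf_def mem_upto_real)
      qed
      then show "(\<Sum>n\<in>upto_real (real M / real d). G d (d * n)) = 0" by (simp add: G_def moebius_mu_def)
    qed
  qed simp
  also have "\<dots> = (\<Sum>m\<in>upto_real (real M). \<Sum>d | d dvd m. G d m)" by (rule hyperbola_divisor_sum)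
  also have "\<dots> = (\<Sum>m\<in>upto_real (real M). if m = 1 then F 1 else 0)"
  proof (intro sum.cong refl)
    fix m assume m: "m \<in> upto_real (real M)"
    have "(\<Sum>d | d dvd m. G d m) = (\<Sum>d | d dvd m. moebius_mu d) * (1 / real m ^ s * F m)"
      unfolding G_def by (simp only: sum_distrib_right)
    also have "\<dots> = (if m = 1 then F 1 else 0)" using m by (simp add: sum_moebius mem_upto_real)
    finally show "(\<Sum>d | d dvd m. G d m) = (if m = 1 then F 1 else 0)" .
  qed
  also have "\<dots> = (if 1 \<in> upto_real (real M) then F 1 else 0)" by (rule sum.delta) (rule finite_upto_real)
  also have "\<dots> = F 1" using M by (simp add: mem_upto_real)
  finally show ?thesis .
qed

text \<open>The operator of the Dirichlet series \<open>\<zeta>(s)\<close> along the direction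
  \<open>e\<close>; on functions that vanish far out along \<open>e\<close> the truncation at
  \<open>M\<close> is invisible.\<close>

definition line_sum :: "nat \<Rightarrow> nat \<Rightarrow> 'v::real_vector \<Rightarrow> ('v \<Rightarrow> real) \<Rightarrow> 'v \<Rightarrow> real" where
  "line_sum M s e \<phi> v = (\<Sum>n=1..M. 1 / real n ^ s * \<phi> (v + ln (real n) *\<^sub>R e))"

text \<open>The inverse Euler factors undo the zeta sum. Read from right to left, this writes a
  cutoff as an inverse zeta product applied to a smoother function, which is how a large local
  weight is absorbed.\<close>

lemma prod_op_line_sum:
  fixes e :: "'v::real_vector"
  assumes ps: "distinct ps" "set ps = {p. prime p \<and> p \<le> M}" and M: "M \<ge> 1"
    and \<phi>: "\<And>n. n > M \<Longrightarrow> \<phi> (v + ln (real n) *\<^sub>R e) = 0"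
  shows "prod_op (\<lambda>p. [(1, 0), (- (1 / real p ^ s), ln (real p) *\<^sub>R e)]) ps (line_sum M s e \<phi>) v = \<phi> v"
proof -
  have "prod_op (\<lambda>p. [(1, 0), (- (1 / real p ^ s), ln (real p) *\<^sub>R e)]) ps (line_sum M s e \<phi>) v
      = (\<Sum>d\<in>sqf (set ps). wprod (\<lambda>p. - (1 / real p ^ s)) d * line_sum M s e \<phi> (v + ln (real d) *\<^sub>R e))"
    using ps by (intro sum_wprod_prod_op[symmetric]) auto
  also have "\<dots> = (\<Sum>d\<in>sqf (set ps). wprod (\<lambda>p. - (1 / real p ^ s)) d *
      (\<Sum>n=1..M. 1 / real n ^ s * \<phi> (v + ln (real (d * n)) *\<^sub>R e)))"
    unfolding line_sum_def
  proof (intro sum.cong refl arg_cong2[where f = "(*)"])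
    fix d n assume "d \<in> sqf (set ps)" "n \<in> {1..M}"
    then have "d > 0" "n > 0" using sqf_pos by auto
    then show "\<phi> (v + ln (real d) *\<^sub>R e + ln (real n) *\<^sub>R e) = \<phi> (v + ln (real (d * n)) *\<^sub>R e)"
      by (simp add: ln_mult scaleR_add_left add.assoc)
  qed
  also have "\<dots> = \<phi> (v + ln (real 1) *\<^sub>R e)"
    using mobius_inversion_sum[OF ps(2) M, of "\<lambda>n. \<phi> (v + ln (real n) *\<^sub>R e)" s] \<phi> by simp
  finally show ?thesis by simp
qed

text \<open>The shifts never leave \<open>C\<close>, so values outside it are never seen. The
  inversion formulas hold only at points with nonnegative coordinates and are substituted by means
  of this rule.\<close>

lemma prod_op_cong_cone:
  assumes "\<And>p k s v. p \<in> set ps \<Longrightarrow> (k, s) \<in> set (X p) \<Longrightarrow> C v \<Longrightarrow> C (v + s)"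
    and "\<And>v. C v \<Longrightarrow> \<phi> v = \<psi> v" and "C v"
  shows "prod_op X ps \<phi> v = prod_op X ps \<psi> v"
proof -
  have "\<bar>prod_op X ps (\<lambda>v. \<phi> v - \<psi> v) v\<bar> \<le> (\<Prod>p\<leftarrow>ps. 0) * 0"
    by (rule prod_op_bound[where C = C and W = "\<lambda>_. 0"]) (use assms in auto)
  then show ?thesis by (simp add: prod_op_diff)
qed

section \<open>Mean values of correlations\<close>

definition dvd_ind :: "int \<Rightarrow> nat \<Rightarrow> real" where
  "dvd_ind h p = of_bool (int p dvd h)"

lemma sum_residue_indicator:
  assumes "p > 0"
  shows "(\<Sum>n<p. dvd_ind (int n + h) p) = 1"
proof -
  define r where "r = nat ((- h) mod int p)"
  have r: "int r = (- h) mod int p" using assms by (simp add: r_def)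
  have "r < p" using assms r by (metis of_nat_0_less_iff of_nat_less_iff pos_mod_bound)
  have "int p dvd int n + h \<longleftrightarrow> n = r" if "n < p" for n
  proof -
    have "int p dvd int n + h \<longleftrightarrow> int n mod int p = (- h) mod int p"
      using mod_eq_dvd_iff[of "int n" "int p" "- h"] by simp
    also have "\<dots> \<longleftrightarrow> int n = int r" using that r by simp
    finally show ?thesis by simp
  qed
  then have "(\<Sum>n<p. dvd_ind (int n + h) p) = (\<Sum>n<p. if n = r then 1 else 0)"
    by (intro sum.cong refl) (auto simp: dvd_ind_def)
  then show ?thesis using \<open>r < p\<close> by simp
qed

text \<open>Two residue conditions modulo \<open>p\<close> coincide if \<open>p\<close> divides the
  difference of the shifts, and exclude each other otherwise.\<close>

lemma dvd_ind_mult: "dvd_ind (m + h) p * dvd_ind (m + h') p = dvd_ind (h - h') p * dvd_ind (m + h) p"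
proof -
  have "int p dvd m + h' \<longleftrightarrow> int p dvd h - h'" if "int p dvd m + h"
  proof -
    have "m + h' = (m + h) - (h - h')" by simp
    then show ?thesis using that dvd_diff_right_iff[of "int p" "m + h" "h - h'"] by simp
  qed
  then show ?thesis by (auto simp: dvd_ind_def)
qed

text \<open>Products of residue indicators collapse to multiples of a single one, whose sum over a
  period is 1. The mean zero of a single sieve factor is what forces every prime to divide at least
  two of the moduli.\<close>

lemma local_mean_values:
  fixes h1 h2 h3 :: int
  assumes p: "p > 0"
  defines "d12 \<equiv> dvd_ind (h1 - h2) p" and "d13 \<equiv> dvd_ind (h1 - h3) p" and "d23 \<equiv> dvd_ind (h2 - h3) p"
  shows "local_mean h1 h2 h3 p False False False = 1"
    "local_mean h1 h2 h3 p True False False = 0"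
    "local_mean h1 h2 h3 p False True False = 0"
    "local_mean h1 h2 h3 p False False True = 0"
    "local_mean h1 h2 h3 p True True False = real p * d12 - 1"
    "local_mean h1 h2 h3 p True False True = real p * d13 - 1"
    "local_mean h1 h2 h3 p False True True = real p * d23 - 1"
    "local_mean h1 h2 h3 p True True True = real p * (d12 + d13 + d23) - 2 - (real p)\<^sup>2 * d12 * d13"
proof -
  define x where "x h n = dvd_ind (int n + h) p" for h n
  have sf: "sieve_factor p (int n + h) = 1 - real p * x h n" for n h
    by (simp add: sieve_factor_def x_def dvd_ind_def)
  have xx: "x h n * x h' n = dvd_ind (h - h') p * x h n" for h h' n
    unfolding x_def by (rule dvd_ind_mult)
  have s: "(\<Sum>n<p. x h n) = 1" for h unfolding x_def using p by (rule sum_residue_indicator)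
  have p0: "real p > 0" using p by simp
  show "local_mean h1 h2 h3 p False False False = 1" using p by (simp add: local_mean_def)
  have one: "(\<Sum>n<p. 1 - real p * x h n) = 0" for h
    by (simp add: sum_subtractf sum_distrib_left[symmetric] s)
  show "local_mean h1 h2 h3 p True False False = 0" "local_mean h1 h2 h3 p False True False = 0"
    "local_mean h1 h2 h3 p False False True = 0"
    by (simp_all add: local_mean_def sf one)
  have two: "(\<Sum>n<p. (1 - real p * x h n) * (1 - real p * x h' n)) / real p = real p * dvd_ind (h - h') p - 1" for h h'
  proof -
    have "(1 - real p * x h n) * (1 - real p * x h' n) = 1 - real p * x h n - real p * x h' n + (real p)\<^sup>2 * dvd_ind (h - h') p * x h n" for n
    proof -
      have "(1 - real p * x h n) * (1 - real p * x h' n) = 1 - real p * x h n - real p * x h' n + (real p)\<^sup>2 * (x h n * x h' n)"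
        by (simp add: algebra_simps power2_eq_square)
      then show ?thesis by (simp only: xx mult.assoc)
    qed
    then have "(\<Sum>n<p. (1 - real p * x h n) * (1 - real p * x h' n)) = - real p + (real p)\<^sup>2 * dvd_ind (h - h') p"
      by (simp add: sum.distrib sum_subtractf sum_distrib_left[symmetric] s)
    then show ?thesis using p0 by (simp add: field_simps power2_eq_square)
  qed
  show "local_mean h1 h2 h3 p True True False = real p * d12 - 1"
    "local_mean h1 h2 h3 p True False True = real p * d13 - 1"
    "local_mean h1 h2 h3 p False True True = real p * d23 - 1"
    by (simp_all add: local_mean_def sf two d12_def d13_def d23_def)
  have "(1 - real p * x h1 n) * (1 - real p * x h2 n) * (1 - real p * x h3 n)
      = 1 - real p * x h1 n - real p * x h2 n - real p * x h3 n + (real p)\<^sup>2 * d12 * x h1 n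
        + (real p)\<^sup>2 * d13 * x h1 n + (real p)\<^sup>2 * d23 * x h2 n - (real p) ^ 3 * d12 * d13 * x h1 n" for n
  proof -
    have "x h1 n * x h2 n * x h3 n = d12 * (x h1 n * x h3 n)" by (simp add: xx d12_def)
    then have xxx: "x h1 n * x h2 n * x h3 n = d12 * d13 * x h1 n" by (simp only: xx d13_def mult.assoc)
    have "(1 - real p * x h1 n) * (1 - real p * x h2 n) * (1 - real p * x h3 n)
      = 1 - real p * x h1 n - real p * x h2 n - real p * x h3 n + (real p)\<^sup>2 * (x h1 n * x h2 n)
        + (real p)\<^sup>2 * (x h1 n * x h3 n) + (real p)\<^sup>2 * (x h2 n * x h3 n) - (real p) ^ 3 * (x h1 n * x h2 n * x h3 n)"
      by (simp add: algebra_simps power2_eq_square power3_eq_cube)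
    then show ?thesis by (simp only: xxx xx d12_def d13_def d23_def mult.assoc)
  qed
  then have "(\<Sum>n<p. (1 - real p * x h1 n) * (1 - real p * x h2 n) * (1 - real p * x h3 n))
      = real p - 3 * real p + (real p)\<^sup>2 * (d12 + d13 + d23) - (real p) ^ 3 * d12 * d13"
    by (simp only: sum.distrib sum_subtractf sum_distrib_left[symmetric] s) (simp add: algebra_simps)
  also have "\<dots> = real p * (real p * (d12 + d13 + d23) - 2 - (real p)\<^sup>2 * d12 * d13)"
    by (simp add: algebra_simps power2_eq_square power3_eq_cube)
  finally show "local_mean h1 h2 h3 p True True True = real p * (d12 + d13 + d23) - 2 - (real p)\<^sup>2 * d12 * d13"
    using p0 by (simp add: local_mean_def sf)
qed

definition pair_wt :: "real \<Rightarrow> int \<Rightarrow> nat \<Rightarrow> real" where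
  "pair_wt u h p = u * (real p * dvd_ind h p - 1) / (real p - 1)\<^sup>2"

definition triple_wt :: "real \<Rightarrow> int \<Rightarrow> int \<Rightarrow> int \<Rightarrow> nat \<Rightarrow> real" where
  "triple_wt u h1 h2 h3 p = u * (real p * (dvd_ind (h1 - h2) p + dvd_ind (h1 - h3) p + dvd_ind (h2 - h3) p)
     - 2 - (real p)\<^sup>2 * dvd_ind (h1 - h2) p * dvd_ind (h1 - h3) p) / (real p - 1) ^ 3"

definition vec12 :: vec4 where "vec12 = (1, 1, 0, 0)"
definition vec13 :: vec4 where "vec13 = (1, 0, 1, 0)"
definition vec23 :: vec4 where "vec23 = (0, 1, 1, 0)"
definition vec123 :: vec4 where "vec123 = (1, 1, 1, 0)"
lemmas vec_defs = vec12_def vec13_def vec23_def vec123_def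

text \<open>The vectors record which of the three moduli contain \<open>p\<close>; patterns with
  exactly one modulus have mean zero and are absent.\<close>

definition four_ops :: "(nat \<Rightarrow> real) \<Rightarrow> (nat \<Rightarrow> real) \<Rightarrow> (nat \<Rightarrow> real) \<Rightarrow> (nat \<Rightarrow> real) \<Rightarrow> nat \<Rightarrow> (real \<times> vec4) list" where
  "four_ops a b c d p = [(1, 0), (a p, ln (real p) *\<^sub>R vec12), (b p, ln (real p) *\<^sub>R vec13),
     (c p, ln (real p) *\<^sub>R vec23), (d p, ln (real p) *\<^sub>R vec123)]"

lemma shift_op_corr_wt:
  assumes "p > 0"
  shows "shift_op (flag_ops (corr_wt u1 u2 u3 h1 h2 h3) p) \<Phi> v
    = shift_op (four_ops (pair_wt (u1 * u2) (h1 - h2)) (pair_wt (u1 * u3) (h1 - h3)) (pair_wt (u2 * u3) (h2 - h3))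
        (triple_wt (u1 * u2 * u3) h1 h2 h3) p) \<Phi> v"
  unfolding shift_op_flag_ops
  by (simp add: UNIV_bool corr_wt_def local_mean_values[OF assms] four_ops_def pair_wt_def triple_wt_def
      ln4_def vec_defs zero_prod_def power2_eq_square power3_eq_cube)

definition box_ind :: "real \<Rightarrow> vec4 \<Rightarrow> real" where
  "box_ind L v = of_bool (fst v \<le> L \<and> fst (snd v) \<le> L \<and> fst (snd (snd v)) \<le> L)"

definition cone4 :: "vec4 \<Rightarrow> bool" where
  "cone4 v \<longleftrightarrow> 0 \<le> fst v \<and> 0 \<le> fst (snd v) \<and> 0 \<le> fst (snd (snd v)) \<and> 0 \<le> snd (snd (snd v))"

lemma cone4_0 [simp]: "cone4 0" by (simp add: cone4_def)

lemma cone4_add: "cone4 u \<Longrightarrow> cone4 v \<Longrightarrow> cone4 (u + v)" by (simp add: cone4_def)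

lemma cone4_scale: "cone4 v \<Longrightarrow> c \<ge> 0 \<Longrightarrow> cone4 (c *\<^sub>R v)" by (simp add: cone4_def)

lemma cone4_vecs [simp]: "cone4 vec12" "cone4 vec13" "cone4 vec23" "cone4 vec123"
  by (simp_all add: cone4_def vec_defs)

definition corr_mean :: "real \<Rightarrow> real \<Rightarrow> real \<Rightarrow> int \<Rightarrow> int \<Rightarrow> int \<Rightarrow> nat set \<Rightarrow> real \<Rightarrow> real" where
  "corr_mean u1 u2 u3 h1 h2 h3 P R = flag_sum P (corr_wt u1 u2 u3 h1 h2 h3)
     (\<lambda>x y z u. of_bool (real x \<le> R \<and> real y \<le> R \<and> real z \<le> R))"

definition corr_ops :: "real \<Rightarrow> real \<Rightarrow> real \<Rightarrow> int \<Rightarrow> int \<Rightarrow> int \<Rightarrow> nat \<Rightarrow> (real \<times> vec4) list" where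
  "corr_ops u1 u2 u3 h1 h2 h3 = four_ops (pair_wt (u1 * u2) (h1 - h2)) (pair_wt (u1 * u3) (h1 - h3))
     (pair_wt (u2 * u3) (h2 - h3)) (triple_wt (u1 * u2 * u3) h1 h2 h3)"

lemma corr_mean_eq_prod_op:
  assumes "distinct ps" "\<And>p. p \<in> set ps \<Longrightarrow> prime p" "R \<ge> 1"
  shows "corr_mean u1 u2 u3 h1 h2 h3 (set ps) R = prod_op (corr_ops u1 u2 u3 h1 h2 h3) ps (box_ind (ln R)) 0"
proof -
  have "corr_mean u1 u2 u3 h1 h2 h3 (set ps) R
      = flag_sum (set ps) (corr_wt u1 u2 u3 h1 h2 h3) (\<lambda>x y z u. box_ind (ln R) (0 + ln4 x y z u))"
    unfolding corr_mean_def flag_sum_def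
  proof (intro sum.cong refl arg_cong2[where f = "(*)"])
    fix x y z assume "x \<in> sqf (set ps)" "y \<in> sqf (set ps)" "z \<in> sqf (set ps)"
    then have "x > 0" "y > 0" "z > 0" using sqf_pos by auto
    then show "of_bool (real x \<le> R \<and> real y \<le> R \<and> real z \<le> R) = box_ind (ln R) (0 + ln4 x y z u)" for u
      using assms(3) by (simp add: box_ind_def ln4_def)
  qed
  also have "\<dots> = prod_op (flag_ops (corr_wt u1 u2 u3 h1 h2 h3)) ps (box_ind (ln R)) 0"
    using assms by (intro flag_sum_prod_op) auto
  also have "\<dots> = prod_op (corr_ops u1 u2 u3 h1 h2 h3) ps (box_ind (ln R)) 0"
  proof (rule fun_cong[OF prod_op_cong])
    fix p \<phi> v assume "p \<in> set ps"
    then have "p > 0" using assms(2) prime_gt_0_nat by blast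
    then show "shift_op (flag_ops (corr_wt u1 u2 u3 h1 h2 h3) p) \<phi> v = shift_op (corr_ops u1 u2 u3 h1 h2 h3 p) \<phi> v"
      unfolding corr_ops_def by (rule shift_op_corr_wt)
  qed
  finally show ?thesis .
qed

definition local_sum :: "real \<Rightarrow> real \<Rightarrow> real \<Rightarrow> int \<Rightarrow> int \<Rightarrow> int \<Rightarrow> nat \<Rightarrow> real" where
  "local_sum u1 u2 u3 h1 h2 h3 p = 1 + pair_wt (u1 * u2) (h1 - h2) p + pair_wt (u1 * u3) (h1 - h3) p
     + pair_wt (u2 * u3) (h2 - h3) p + triple_wt (u1 * u2 * u3) h1 h2 h3 p"

definition local_abs :: "real \<Rightarrow> real \<Rightarrow> real \<Rightarrow> int \<Rightarrow> int \<Rightarrow> int \<Rightarrow> nat \<Rightarrow> real" where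
  "local_abs u1 u2 u3 h1 h2 h3 p = \<bar>pair_wt (u1 * u2) (h1 - h2) p\<bar> + \<bar>pair_wt (u1 * u3) (h1 - h3) p\<bar>
     + \<bar>pair_wt (u2 * u3) (h2 - h3) p\<bar> + \<bar>triple_wt (u1 * u2 * u3) h1 h2 h3 p\<bar>"

lemma closed_four_ops:
  assumes "(k, s) \<in> set (four_ops a b c d p)" "cone4 v" "p \<ge> 1"
  shows "cone4 (v + s)"
  using assms by (auto simp: four_ops_def intro!: cone4_add cone4_scale)

lemma prod_list_eq_prod: "distinct ps \<Longrightarrow> (\<Prod>p\<leftarrow>ps. f p) = (\<Prod>p\<in>set ps. f p)"
  by (simp add: prod.distinct_set_conv_list)

lemma sum_list_eq_sum: "distinct ps \<Longrightarrow> (\<Sum>p\<leftarrow>ps. f p) = (\<Sum>p\<in>set ps. f p)"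
  by (simp add: sum.distinct_set_conv_list)

lemma exp_half_ln: "p > 0 \<Longrightarrow> exp (ln (real p) / 2) = sqrt (real p)"
  by (simp add: powr_half_sqrt[symmetric] powr_def)

text \<open>Rankin's trick: where the box indicator vanishes, one of the moduli exceeds \<open>R\<close>, so
  \<open>exp (l v) \<ge> R powr (1 / 6)\<close> for the functional \<open>l\<close> below.\<close>

lemma corr_mean_complete:
  assumes P: "finite P" "\<And>p. p \<in> P \<Longrightarrow> prime p" and R: "R \<ge> 1"
  shows "\<bar>corr_mean u1 u2 u3 h1 h2 h3 P R - (\<Prod>p\<in>P. local_sum u1 u2 u3 h1 h2 h3 p)\<bar>
    \<le> R powr (- 1 / 6) * (\<Prod>p\<in>P. 1 + sqrt (real p) * local_abs u1 u2 u3 h1 h2 h3 p)"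
proof -
  define ps where "ps = sorted_list_of_set P"
  have ps: "distinct ps" "set ps = P" using P by (auto simp: ps_def)
  let ?X = "corr_ops u1 u2 u3 h1 h2 h3"
  \<comment> \<open>With denominator 6 the heaviest shift, which moves all three moduli, costs
    exactly \<open>sqrt p\<close>, so that weights of size \<open>1 / p\<^sup>2\<close> still give a
    convergent product.\<close>
  define l :: "vec4 \<Rightarrow> real" where "l v = (fst v + fst (snd v) + fst (snd (snd v))) / 6" for v
  have "corr_mean u1 u2 u3 h1 h2 h3 P R - (\<Prod>p\<in>P. local_sum u1 u2 u3 h1 h2 h3 p)
      = prod_op ?X ps (box_ind (ln R)) 0 - prod_op ?X ps (\<lambda>_. 1) 0"
    using corr_mean_eq_prod_op[of ps R] ps P R
    by (simp add: prod_op_const prod_list_eq_prod[OF ps(1)] local_sum_def corr_ops_def four_ops_def algebra_simps)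
  also have "\<dots> = prod_op ?X ps (\<lambda>v. box_ind (ln R) v - 1) 0" by (rule prod_op_diff[symmetric])
  also have "\<bar>\<dots>\<bar> \<le> (\<Prod>p\<leftarrow>ps. 1 + sqrt (real p) * local_abs u1 u2 u3 h1 h2 h3 p) * (R powr (- 1 / 6) * exp (l 0))"
  proof (rule prod_op_bound_exp[where C = cone4])
    show "cone4 (v + s)" if "p \<in> set ps" "(k, s) \<in> set (?X p)" "cone4 v" for p k s v
      using that P(2)[of p] ps prime_ge_1_nat unfolding corr_ops_def by (intro closed_four_ops) auto
    show "\<bar>box_ind (ln R) v - 1\<bar> \<le> R powr (- 1 / 6) * exp (l v)" if "cone4 v" for v
    proof (cases "box_ind (ln R) v = 1")
      case False
      then have "ln R \<le> 6 * l v" using that by (auto simp: box_ind_def cone4_def l_def split: if_splits)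
      then have "1 \<le> exp (l v - ln R / 6)" by simp
      also have "\<dots> = R powr (- 1 / 6) * exp (l v)" using R
        by (simp add: powr_def mult_exp_exp algebra_simps diff_divide_distrib)
      finally show ?thesis by (simp add: box_ind_def)
    qed simp
    show "l (u + v) = l u + l v" for u v by (simp add: l_def add_divide_distrib)
    fix p assume p: "p \<in> set ps"
    then have p2: "p \<ge> 2" using P ps prime_ge_2_nat by auto
    have e: "exp (l (ln (real p) *\<^sub>R vec123)) = sqrt (real p)" using p2 exp_half_ln[of p] by (simp add: l_def vec_defs)
    have "0 \<le> ln (real p)" using p2 by simp
    then have e': "exp (l (ln (real p) *\<^sub>R e)) \<le> sqrt (real p)" if "e \<in> {vec12, vec13, vec23, vec123}" for e
      using that unfolding e[symmetric] by (auto simp: l_def vec_defs)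
    have m: "\<bar>x\<bar> * exp (l (ln (real p) *\<^sub>R e)) \<le> \<bar>x\<bar> * sqrt (real p)" if "e \<in> {vec12, vec13, vec23, vec123}" for x e
      by (intro mult_left_mono e' that) auto
    show "(\<Sum>x\<leftarrow>?X p. \<bar>fst x\<bar> * exp (l (snd x))) \<le> 1 + sqrt (real p) * local_abs u1 u2 u3 h1 h2 h3 p"
      using m[of vec12 "pair_wt (u1 * u2) (h1 - h2) p"] m[of vec13 "pair_wt (u1 * u3) (h1 - h3) p"]
        m[of vec23 "pair_wt (u2 * u3) (h2 - h3) p"] m[of vec123 "triple_wt (u1 * u2 * u3) h1 h2 h3 p"]
      by (simp add: corr_ops_def four_ops_def local_abs_def algebra_simps l_def zero_prod_def)
  qed auto
  finally show ?thesis by (simp add: prod_list_eq_prod[OF ps(1)] ps(2) l_def mult.commute)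
qed

section \<open>Sizes of the local weights at good and bad primes\<close>

definition bad_prime :: "real \<Rightarrow> real \<Rightarrow> real \<Rightarrow> int \<Rightarrow> int \<Rightarrow> int \<Rightarrow> nat \<Rightarrow> bool" where
  "bad_prime u1 u2 u3 h1 h2 h3 p \<longleftrightarrow> (u1 * u2 \<noteq> 0 \<and> int p dvd h1 - h2) \<or> (u1 * u3 \<noteq> 0 \<and> int p dvd h1 - h3)
     \<or> (u2 * u3 \<noteq> 0 \<and> int p dvd h2 - h3)"

lemma prime_inverse_bounds:
  assumes "p \<ge> 2"
  shows "1 / (real p - 1) \<le> 2 / real p" "1 / (real p - 1)\<^sup>2 \<le> 4 / (real p)\<^sup>2" "1 / (real p - 1) ^ 3 \<le> 1 / (real p - 1)\<^sup>2"
proof -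
  have p: "real p \<ge> 2" using assms by simp
  then show 1: "1 / (real p - 1) \<le> 2 / real p" by (simp add: field_simps)
  have "(1 / (real p - 1))\<^sup>2 \<le> (2 / real p)\<^sup>2" using 1 p by (intro power_mono) auto
  then show "1 / (real p - 1)\<^sup>2 \<le> 4 / (real p)\<^sup>2" by (simp add: power_divide)
  have "(real p - 1)\<^sup>2 \<le> (real p - 1) ^ 3" using p by (intro power_increasing) auto
  then show "1 / (real p - 1) ^ 3 \<le> 1 / (real p - 1)\<^sup>2" using p by (intro frac_le) auto
qed

lemma abs_pair_wt:
  assumes p: "p \<ge> 2" and u: "u = 0 \<or> u = 1"
  shows "\<bar>pair_wt u h p\<bar> \<le> (if u \<noteq> 0 \<and> int p dvd h then 2 / real p else 4 / (real p)\<^sup>2)"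
proof -
  have p2: "real p \<ge> 2" using p by simp
  consider "u = 0" | "u = 1" "int p dvd h" | "u = 1" "\<not> int p dvd h" using u by blast
  then show ?thesis
  proof cases
    case 2
    then have "pair_wt u h p = (real p - 1) / (real p - 1)\<^sup>2" by (simp add: pair_wt_def dvd_ind_def)
    also have "\<dots> = 1 / (real p - 1)" using p2 by (simp add: power2_eq_square)
    finally show ?thesis using 2 prime_inverse_bounds(1)[OF p] p2 by simp
  next
    case 3
    then have "\<bar>pair_wt u h p\<bar> = 1 / (real p - 1)\<^sup>2" by (simp add: pair_wt_def dvd_ind_def)
    then show ?thesis using 3 prime_inverse_bounds(2)[OF p] by simp
  qed (simp add: pair_wt_def)
qed

text \<open>Any two of the three divisibilities imply the third, which leaves five of the eight
  patterns.\<close>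

lemma triple_wt_cases:
  fixes h1 h2 h3 :: int
  obtains "int p dvd h1 - h2" "int p dvd h1 - h3" "int p dvd h2 - h3" | "int p dvd h1 - h2" "\<not> int p dvd h1 - h3" "\<not> int p dvd h2 - h3"
    | "\<not> int p dvd h1 - h2" "int p dvd h1 - h3" "\<not> int p dvd h2 - h3" | "\<not> int p dvd h1 - h2" "\<not> int p dvd h1 - h3" "int p dvd h2 - h3"
    | "\<not> int p dvd h1 - h2" "\<not> int p dvd h1 - h3" "\<not> int p dvd h2 - h3"
proof -
  have a: "h1 - h3 = (h1 - h2) + (h2 - h3)" "h2 - h3 = (h1 - h3) - (h1 - h2)" "h1 - h2 = (h1 - h3) - (h2 - h3)" by auto
  have "int p dvd h1 - h2 \<Longrightarrow> int p dvd h2 - h3 \<Longrightarrow> int p dvd h1 - h3" by (subst a(1)) (rule dvd_add)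
  moreover have "int p dvd h1 - h3 \<Longrightarrow> int p dvd h1 - h2 \<Longrightarrow> int p dvd h2 - h3" by (subst a(2)) (rule dvd_diff)
  moreover have "int p dvd h1 - h3 \<Longrightarrow> int p dvd h2 - h3 \<Longrightarrow> int p dvd h1 - h2" by (subst a(3)) (rule dvd_diff)
  ultimately show ?thesis using that by blast
qed

lemma abs_triple_wt:
  assumes p: "p \<ge> 2" and u: "u = 0 \<or> u = 1"
  shows "\<bar>triple_wt u h1 h2 h3 p\<bar> \<le> (if u \<noteq> 0 \<and> (int p dvd h1 - h2 \<or> int p dvd h1 - h3 \<or> int p dvd h2 - h3) then 2 / real p else 8 / (real p)\<^sup>2)"
proof (cases "u = 0")
  case True
  then show ?thesis by (simp add: triple_wt_def)
next
  case False
  then have u1: "u = 1" using u by simp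
  have p2: "real p \<ge> 2" using p by simp
  define q where "q = real p - 1"
  have q: "q \<ge> 1" "real p = q + 1" using p2 by (auto simp: q_def)
  have q2: "1 / q \<le> 2 / real p" using prime_inverse_bounds(1)[OF p] by (simp add: q_def)
  have one: "(real p - 2) / q ^ 3 \<le> 1 / q"
  proof -
    have "q * 1 \<le> q * q" using q by (intro mult_left_mono) auto
    then have "real p - 2 \<le> q * q" using q by linarith
    then have "(real p - 2) / q ^ 3 \<le> q * q / q ^ 3" using q by (intro divide_right_mono) auto
    then show ?thesis using q by (simp add: power3_eq_cube)
  qed
  have one': "\<bar>triple_wt u h1 h2 h3 p\<bar> \<le> 2 / real p" if "triple_wt u h1 h2 h3 p = (real p - 2) / q ^ 3"
  proof -
    have "0 \<le> triple_wt u h1 h2 h3 p" using that p2 q by simp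
    then show ?thesis using that one q2 by simp
  qed
  show ?thesis
  proof (cases rule: triple_wt_cases[of p h1 h2 h3])
    case 1
    have "triple_wt u h1 h2 h3 p = (real p * 3 - 2 - (real p)\<^sup>2) / q ^ 3"
      using 1 u1 by (simp add: triple_wt_def dvd_ind_def q_def)
    also have "\<dots> = - (q * (q - 1)) / q ^ 3" unfolding q(2) by (simp add: power2_eq_square algebra_simps)
    also have "\<dots> = - ((q - 1) / q\<^sup>2)" using q by (simp add: power2_eq_square power3_eq_cube)
    finally have "\<bar>triple_wt u h1 h2 h3 p\<bar> = (q - 1) / q\<^sup>2" using q by simp
    also have "\<dots> \<le> q / q\<^sup>2" using q by (intro divide_right_mono) auto
    also have "\<dots> = 1 / q" using q by (simp add: power2_eq_square)
    finally show ?thesis using q2 1 u1 by simp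
  next
    case 2
    have "triple_wt u h1 h2 h3 p = (real p - 2) / q ^ 3" using 2 u1 by (simp add: triple_wt_def dvd_ind_def q_def)
    from one'[OF this] show ?thesis using 2 u1 by simp
  next
    case 3
    have "triple_wt u h1 h2 h3 p = (real p - 2) / q ^ 3" using 3 u1 by (simp add: triple_wt_def dvd_ind_def q_def)
    from one'[OF this] show ?thesis using 3 u1 by simp
  next
    case 4
    have "triple_wt u h1 h2 h3 p = (real p - 2) / q ^ 3" using 4 u1 by (simp add: triple_wt_def dvd_ind_def q_def)
    from one'[OF this] show ?thesis using 4 u1 by simp
  next
    case 5
    have "triple_wt u h1 h2 h3 p = - 2 / q ^ 3" using 5 u1 by (simp add: triple_wt_def dvd_ind_def q_def)
    then have "\<bar>triple_wt u h1 h2 h3 p\<bar> = 2 * (1 / q ^ 3)" using q(1) by simp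
    also have "\<dots> \<le> 2 * (4 / (real p)\<^sup>2)" using prime_inverse_bounds(2,3)[OF p] by (simp add: q_def)
    finally show ?thesis using 5 by simp
  qed
qed

lemma local_abs_bound:
  assumes p: "p \<ge> 2" and u: "u1 = 0 \<or> u1 = 1" "u2 = 0 \<or> u2 = 1" "u3 = 0 \<or> u3 = 1"
  shows "local_abs u1 u2 u3 h1 h2 h3 p \<le> (if bad_prime u1 u2 u3 h1 h2 h3 p then 20 / real p else 20 / (real p)\<^sup>2)"
proof -
  have p2: "real p \<ge> 2" using p by simp
  have up: "u1 * u2 = 0 \<or> u1 * u2 = 1" "u1 * u3 = 0 \<or> u1 * u3 = 1" "u2 * u3 = 0 \<or> u2 * u3 = 1" "u1 * u2 * u3 = 0 \<or> u1 * u2 * u3 = 1"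
    using u by auto
  note b = abs_pair_wt[OF p up(1), of "h1 - h2"] abs_pair_wt[OF p up(2), of "h1 - h3"] abs_pair_wt[OF p up(3), of "h2 - h3"]
    abs_triple_wt[OF p up(4), of h1 h2 h3]
  show ?thesis
  proof (cases "bad_prime u1 u2 u3 h1 h2 h3 p")
    case True
    have q: "1 / (real p)\<^sup>2 \<le> (1 / 2) * (1 / real p)" using p2 by (simp add: power2_eq_square field_simps)
    define x where "x = 1 / real p"
    have x: "x \<ge> 0" "4 / (real p)\<^sup>2 \<le> 2 * x" "8 / (real p)\<^sup>2 \<le> 4 * x" "2 / real p = 2 * x" "20 / real p = 20 * x" using q by (auto simp: x_def)
    have "\<bar>pair_wt (u1 * u2) (h1 - h2) p\<bar> \<le> 2 * x" "\<bar>pair_wt (u1 * u3) (h1 - h3) p\<bar> \<le> 2 * x"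
      "\<bar>pair_wt (u2 * u3) (h2 - h3) p\<bar> \<le> 2 * x" "\<bar>triple_wt (u1 * u2 * u3) h1 h2 h3 p\<bar> \<le> 4 * x"
      unfolding atomize_conj using order_trans[OF b(1), of "2 * x"] order_trans[OF b(2), of "2 * x"]
        order_trans[OF b(3), of "2 * x"] order_trans[OF b(4), of "4 * x"] x by simp
    then show ?thesis using True x unfolding local_abs_def by simp
  next
    case False
    then have n: "\<not> (u1 * u2 \<noteq> 0 \<and> int p dvd h1 - h2)" "\<not> (u1 * u3 \<noteq> 0 \<and> int p dvd h1 - h3)"
      "\<not> (u2 * u3 \<noteq> 0 \<and> int p dvd h2 - h3)"
      "\<not> (u1 * u2 * u3 \<noteq> 0 \<and> (int p dvd h1 - h2 \<or> int p dvd h1 - h3 \<or> int p dvd h2 - h3))"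
      unfolding bad_prime_def by auto
    have "\<bar>pair_wt (u1 * u2) (h1 - h2) p\<bar> \<le> 4 / (real p)\<^sup>2" "\<bar>pair_wt (u1 * u3) (h1 - h3) p\<bar> \<le> 4 / (real p)\<^sup>2"
      "\<bar>pair_wt (u2 * u3) (h2 - h3) p\<bar> \<le> 4 / (real p)\<^sup>2" "\<bar>triple_wt (u1 * u2 * u3) h1 h2 h3 p\<bar> \<le> 8 / (real p)\<^sup>2"
      using b unfolding n[THEN if_not_P] by blast+
    then show ?thesis using False unfolding local_abs_def by simp
  qed
qed

section \<open>Two equal shifts\<close>

definition primes_upto :: "nat \<Rightarrow> nat set" where
  "primes_upto M = {p. prime p \<and> p \<le> M}"

lemma finite_primes_upto [simp]: "finite (primes_upto M)"
  unfolding primes_upto_def by (rule finite_subset[of _ "{..M}"]) auto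

lemma prime_primes_upto: "p \<in> primes_upto M \<Longrightarrow> prime p"
  by (simp add: primes_upto_def)

text \<open>Along \<open>vec12\<close> the box is left once \<open>ln n\<close> exceeds
  \<open>L - max a b\<close>, so inside the box the sum is a harmonic sum of about that size.
  Outside, the sum is 0 and \<open>L\<close> itself lies below a coordinate of \<open>v\<close>. In
  both cases the deviation from the constant \<open>L\<close> is at most linear.\<close>

lemma line_sum_box_ind:
  assumes v: "cone4 v" and M: "exp L \<le> real M" and L: "L \<ge> 0"
  shows "\<bar>line_sum M 1 vec12 (box_ind L) v - L\<bar> \<le> 1 + (fst v + fst (snd v) + fst (snd (snd v)))"
proof -
  obtain a b c d where v_eq: "v = (a, b, c, d)" by (cases v)
  have pos: "a \<ge> 0" "b \<ge> 0" "c \<ge> 0" using v by (auto simp: v_eq cone4_def)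
  define m where "m = max a b"
  have ls: "line_sum M 1 vec12 (box_ind L) v = (\<Sum>n=1..M. 1 / real n * of_bool (m + ln (real n) \<le> L \<and> c \<le> L))"
    unfolding line_sum_def by (intro sum.cong refl) (auto simp: v_eq vec_defs box_ind_def m_def)
  show ?thesis
  proof (cases "m \<le> L \<and> c \<le> L")
    case True
    define y where "y = exp (L - m)"
    have m0: "m \<ge> 0" using pos by (simp add: m_def)
    have y: "y \<ge> 1" "y \<le> real M" using True M m0 exp_le_cancel_iff[of "L - m" L] by (auto simp: y_def simp del: exp_le_cancel_iff)
    have "(\<Sum>n=1..M. 1 / real n * of_bool (m + ln (real n) \<le> L \<and> c \<le> L)) = hsum y"
      unfolding hsum_def
    proof (rule sum.mono_neutral_cong_right)
      have le: "m + ln (real n) \<le> L \<longleftrightarrow> real n \<le> y" if "n \<ge> 1" for n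
        using that ln_le_cancel_iff[of "real n" y] by (auto simp: y_def algebra_simps)
      show "upto_real y \<subseteq> {1..M}" using y by (auto simp: mem_upto_real)
      show "\<forall>n\<in>{1..M} - upto_real y. 1 / real n * of_bool (m + ln (real n) \<le> L \<and> c \<le> L) = 0"
        using le by (auto simp: mem_upto_real)
      show "1 / real n * of_bool (m + ln (real n) \<le> L \<and> c \<le> L) = 1 / real n" if "n \<in> upto_real y" for n
        using le that True by (auto simp: mem_upto_real)
    qed simp
    then have "line_sum M 1 vec12 (box_ind L) v = hsum y" using ls by simp
    moreover have "ln y = L - m" by (simp add: y_def)
    ultimately have "\<bar>line_sum M 1 vec12 (box_ind L) v - L\<bar> \<le> 1 + m"
      using hsum_bounds[OF y(1)] m0 by (simp add: abs_le_iff)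
    then show ?thesis using pos by (simp add: v_eq m_def)
  next
    case False
    have "line_sum M 1 vec12 (box_ind L) v = 0"
      unfolding ls
    proof (rule sum.neutral, rule ballI)
      fix n assume "n \<in> {1..M}"
      then have "ln (real n) \<ge> 0" by simp
      then show "1 / real n * of_bool (m + ln (real n) \<le> L \<and> c \<le> L) = 0" using False by auto
    qed
    then show ?thesis using False L pos by (auto simp: v_eq m_def)
  qed
qed

text \<open>The expansion of \<open>corr_ops\<close> at equal first shifts times the factor
  \<open>1 - 1 / p\<close> along \<open>vec12\<close>. The large weight \<open>1 / (p - 1)\<close>
  drops to \<open>1 / (p * (p - 1))\<close>, and apart from primes dividing \<open>h - h3\<close>
  every nontrivial weight is now \<open>O(1 / p\<^sup>2)\<close>.\<close>

definition pair_ops :: "real \<Rightarrow> int \<Rightarrow> int \<Rightarrow> nat \<Rightarrow> (real \<times> vec4) list" where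
  "pair_ops u3 h h3 p = (let l = ln (real p); b = pair_wt u3 (h - h3) p; d = triple_wt u3 h h h3 p in
    [(1, 0), (1 / (real p * (real p - 1)), l *\<^sub>R vec12), (- 1 / (real p * (real p - 1)), (2 * l) *\<^sub>R vec12),
     (b, l *\<^sub>R vec13), (- b / real p, l *\<^sub>R (vec13 + vec12)), (b, l *\<^sub>R vec23), (- b / real p, l *\<^sub>R (vec23 + vec12)),
     (d, l *\<^sub>R vec123), (- d / real p, l *\<^sub>R (vec123 + vec12))])"

lemma pair_wt_diag: "p \<ge> 2 \<Longrightarrow> pair_wt 1 0 p = 1 / (real p - 1)"
  by (simp add: pair_wt_def dvd_ind_def power2_eq_square)

lemma shift_op_pair_ops:
  assumes "p \<ge> 2"
  shows "shift_op (op_comp (corr_ops 1 1 u3 h h h3 p) [(1, 0), (- (1 / real p ^ 1), ln (real p) *\<^sub>R vec12)]) \<phi> v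
    = shift_op (pair_ops u3 h h3 p) \<phi> v"
proof -
  have p: "real p - 1 \<noteq> 0" "real p \<noteq> 0" using assms by auto
  have "1 / (real p - 1) - 1 / real p = 1 / (real p * (real p - 1))" using p by (simp add: field_simps)
  then have "x * (1 / (real p - 1) - 1 / real p) = x * (1 / (real p * (real p - 1)))" for x by simp
  then have a: "x / (real p - 1) - x / real p = x / (real p * (real p - 1))" for x
    by (simp add: right_diff_distrib)
  have 2: "ln (real p) *\<^sub>R vec12 + ln (real p) *\<^sub>R vec12 = (2 * ln (real p)) *\<^sub>R vec12"
    by (simp add: scaleR_add_left[symmetric])
  show ?thesis
    using a[of "\<phi> (v + ln (real p) *\<^sub>R vec12)"]
    by (simp add: op_comp_def corr_ops_def four_ops_def pair_ops_def Let_def pair_wt_diag[OF assms] 2 scaleR_add_right algebra_simps)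
qed

lemma local_abs_pair:
  assumes p: "p \<ge> 2" and u: "u3 = 0 \<or> u3 = 1"
  shows "2 * \<bar>pair_wt u3 (h - h3) p\<bar> + \<bar>triple_wt u3 h h h3 p\<bar> \<le> (if u3 \<noteq> 0 \<and> int p dvd h - h3 then 12 / real p else 12 / (real p)\<^sup>2)"
proof -
  have p2: "real p \<ge> 2" using p by simp
  define q where "q = real p - 1"
  have q: "q \<ge> 1" "real p = q + 1" using p2 by (auto simp: q_def)
  show ?thesis
  proof (cases "u3 \<noteq> 0 \<and> int p dvd h - h3")
    case True
    have "\<bar>triple_wt u3 h h h3 p\<bar> \<le> 2 / real p"
      using abs_triple_wt[OF p u, of h h h3] True by simp
    moreover have "\<bar>pair_wt u3 (h - h3) p\<bar> \<le> 2 / real p"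
      using abs_pair_wt[OF p u, of "h - h3"] True by simp
    ultimately have "2 * \<bar>pair_wt u3 (h - h3) p\<bar> + \<bar>triple_wt u3 h h h3 p\<bar> \<le> 2 * (2 / real p) + 2 / real p"
      by linarith
    also have "\<dots> \<le> 12 / real p" by (simp add: add_divide_distrib[symmetric] divide_right_mono)
    finally show ?thesis using True by simp
  next
    case False
    have t: "\<bar>triple_wt u3 h h h3 p\<bar> \<le> 4 / (real p)\<^sup>2"
    proof (cases "u3 = 0")
      case False
      then have u1: "u3 = 1" "\<not> int p dvd h - h3" using u \<open>\<not> (u3 \<noteq> 0 \<and> int p dvd h - h3)\<close> by auto
      then have "triple_wt u3 h h h3 p = (q - 1) / q ^ 3" by (simp add: triple_wt_def dvd_ind_def q_def)
      then have "\<bar>triple_wt u3 h h h3 p\<bar> = (q - 1) / q ^ 3" using q(1) by simp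
      also have "\<dots> \<le> q / q ^ 3" using q(1) by (intro divide_right_mono) auto
      also have "\<dots> = 1 / q\<^sup>2" using q(1) by (simp add: power2_eq_square power3_eq_cube)
      also have "\<dots> = 1 / (real p - 1)\<^sup>2" by (simp add: q_def)
      also have "\<dots> \<le> 4 / (real p)\<^sup>2" by (rule prime_inverse_bounds(2)[OF p])
      finally show ?thesis .
    qed (simp add: triple_wt_def)
    have "\<bar>pair_wt u3 (h - h3) p\<bar> \<le> 4 / (real p)\<^sup>2"
      using abs_pair_wt[OF p u, of "h - h3"] unfolding if_not_P[OF False] .
    then have "2 * \<bar>pair_wt u3 (h - h3) p\<bar> + \<bar>triple_wt u3 h h h3 p\<bar> \<le> 2 * (4 / (real p)\<^sup>2) + 4 / (real p)\<^sup>2"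
      using t by linarith
    also have "\<dots> = 12 / (real p)\<^sup>2" by (simp add: add_divide_distrib[symmetric])
    finally show ?thesis unfolding if_not_P[OF False] .
  qed
qed

text \<open>22 arises at good primes as \<open>2 * 2 + (3 / 2) * 12\<close>: two weights
  \<open>1 / (p * (p - 1))\<close> of at most 2 units each, and the other weights, 12 units by
  \<open>local_abs_pair\<close>, enlarged by their copies divided by
  \<open>p \<ge> 2\<close>.\<close>

definition pair_bad :: "real \<Rightarrow> int \<Rightarrow> int \<Rightarrow> nat \<Rightarrow> real" where
  "pair_bad u3 h h3 p = (if u3 \<noteq> 0 \<and> int p dvd h - h3 then 22 / real p else 22 / (real p)\<^sup>2)"

lemma pair_ops_bounds:
  assumes p: "p \<ge> 2" and u: "u3 = 0 \<or> u3 = 1"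
  shows "(\<Sum>x\<leftarrow>pair_ops u3 h h3 p. \<bar>fst x\<bar>) \<le> 1 + pair_bad u3 h h3 p"
    "(\<Sum>x\<leftarrow>pair_ops u3 h h3 p. \<bar>fst x\<bar> * (fst (snd x) + fst (snd (snd x)) + fst (snd (snd (snd x))))) \<le> 5 * ln (real p) * pair_bad u3 h h3 p"
proof -
  have p2: "real p \<ge> 2" using p by simp
  define b d where "b = \<bar>pair_wt u3 (h - h3) p\<bar>" and "d = \<bar>triple_wt u3 h h h3 p\<bar>"
  have bd0: "b \<ge> 0" "d \<ge> 0" by (auto simp: b_def d_def)
  define a where "a = 1 / (real p * (real p - 1))"
  have a0: "a \<ge> 0" using p2 by (simp add: a_def)
  have "real p * (real p / 2) \<le> real p * (real p - 1)" using p2 by (intro mult_left_mono) auto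
  then have "a \<le> 1 / (real p * (real p / 2))" unfolding a_def using p2 by (intro frac_le) auto
  then have a: "a \<le> 2 / (real p)\<^sup>2" by (simp add: power2_eq_square)
  define S where "S = 2 * b + d"
  have S0: "S \<ge> 0" using bd0 by (simp add: S_def)
  have "S / real p \<le> S / 2" using p2 S0 by (intro frac_le) auto
  then have Sp: "S + S / real p \<le> 3 / 2 * S" by simp
  have tot: "2 * a + (S + S / real p) \<le> pair_bad u3 h h3 p"
  proof (cases "u3 \<noteq> 0 \<and> int p dvd h - h3")
    case True
    have "S \<le> 12 / real p" using local_abs_pair[OF p u, of h h3] True by (simp add: S_def b_def d_def)
    moreover have "2 / (real p)\<^sup>2 \<le> 1 / real p" using p2 by (simp add: power2_eq_square field_simps)
    ultimately have "2 * a + (S + S / real p) \<le> 2 * (1 / real p) + 3 / 2 * (12 / real p)" using a Sp by linarith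
    also have "\<dots> \<le> 22 / real p" using p2 by (simp add: field_simps)
    finally show ?thesis using True by (simp add: pair_bad_def)
  next
    case False
    have "S \<le> 12 / (real p)\<^sup>2" using local_abs_pair[OF p u, of h h3] False by (auto simp: S_def b_def d_def)
    then have "2 * a + (S + S / real p) \<le> 2 * (2 / (real p)\<^sup>2) + 3 / 2 * (12 / (real p)\<^sup>2)" using a Sp by linarith
    also have "\<dots> = 22 / (real p)\<^sup>2" by (simp add: add_divide_distrib[symmetric])
    finally show ?thesis using False by (auto simp: pair_bad_def)
  qed
  have ab: "\<bar>1 / (real p * (real p - 1))\<bar> = a" "\<bar>- 1 / (real p * (real p - 1))\<bar> = a"
    using p2 by (auto simp: a_def)
  have div: "\<bar>- pair_wt u3 (h - h3) p / real p\<bar> = b / real p" "\<bar>- triple_wt u3 h h h3 p / real p\<bar> = d / real p"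
    by (auto simp: b_def d_def)
  have sum: "(\<Sum>x\<leftarrow>pair_ops u3 h h3 p. \<bar>fst x\<bar>) = 1 + (2 * a + (S + S / real p))"
    by (simp only: pair_ops_def Let_def list.map sum_list.Cons sum_list.Nil fst_conv snd_conv ab div
        b_def[symmetric] d_def[symmetric]) (simp add: S_def add_divide_distrib)
  then show "(\<Sum>x\<leftarrow>pair_ops u3 h h3 p. \<bar>fst x\<bar>) \<le> 1 + pair_bad u3 h h3 p" using tot by simp
  define l where "l = ln (real p)"
  have l0: "l \<ge> 0" using p2 by (simp add: l_def)
  have "(\<Sum>x\<leftarrow>pair_ops u3 h h3 p. \<bar>fst x\<bar> * (fst (snd x) + fst (snd (snd x)) + fst (snd (snd (snd x)))))
      = (2 * l) * a + (4 * l) * a + (2 * l) * b + (4 * l) * (b / real p) + (2 * l) * b + (4 * l) * (b / real p) + (3 * l) * d + (5 * l) * (d / real p)"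
    by (simp only: pair_ops_def Let_def list.map sum_list.Cons sum_list.Nil fst_conv snd_conv ab div
        b_def[symmetric] d_def[symmetric]) (simp add: vec_defs l_def algebra_simps)
  \<comment> \<open>No shift has total height above \<open>5 * ln p\<close>; the maximum is attained
    at \<open>vec123 + vec12\<close>.\<close>
  also have "\<dots> \<le> (5 * l) * a + (5 * l) * a + (5 * l) * b + (5 * l) * (b / real p) + (5 * l) * b + (5 * l) * (b / real p) + (5 * l) * d + (5 * l) * (d / real p)"
    using l0 a0 bd0 p2 by (intro add_mono mult_right_mono) auto
  also have "\<dots> = 5 * l * (2 * a + (S + S / real p))" by (simp add: S_def algebra_simps add_divide_distrib)
  also have "\<dots> \<le> 5 * l * pair_bad u3 h h3 p" using l0 tot by (intro mult_left_mono) auto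
  finally show "(\<Sum>x\<leftarrow>pair_ops u3 h h3 p. \<bar>fst x\<bar> * (fst (snd x) + fst (snd (snd x)) + fst (snd (snd (snd x))))) \<le> 5 * ln (real p) * pair_bad u3 h h3 p"
    by (simp add: l_def)
qed

text \<open>The box is an inverse zeta product applied to \<open>line_sum\<close>, which is nearly
  the constant \<open>ln R\<close>. The constant yields the Euler product, each mass carrying the
  factor \<open>1 - 1 / p\<close>; the deviation grows linearly and is controlled by first
  moments.\<close>

lemma pair_mean_asymp:
  assumes M: "R \<le> real M" and R: "R \<ge> 1" and u: "u3 = 0 \<or> u3 = 1"
  shows "\<bar>corr_mean 1 1 u3 h h h3 (primes_upto M) R
      - ln R * (\<Prod>p\<in>primes_upto M. (1 - 1 / real p) * local_sum 1 1 u3 h h h3 p)\<bar>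
    \<le> (\<Prod>p\<in>primes_upto M. 1 + pair_bad u3 h h3 p) * (1 + (\<Sum>p\<in>primes_upto M. 5 * ln (real p) * pair_bad u3 h h3 p))"
proof -
  define P where "P = primes_upto M"
  define ps where "ps = sorted_list_of_set P"
  have ps: "distinct ps" "set ps = P" by (auto simp: ps_def P_def)
  have pr: "prime p" "p \<ge> 2" if "p \<in> set ps" for p
    using that ps prime_primes_upto prime_ge_2_nat by (auto simp: P_def)
  define L where "L = ln R"
  have L: "L \<ge> 0" "exp L \<le> real M" using R M by (auto simp: L_def)
  have M1: "M \<ge> 1" using M R by linarith
  let ?X = "corr_ops 1 1 u3 h h h3" and ?Y = "\<lambda>p. [(1, 0), (- (1 / real p ^ 1), ln (real p) *\<^sub>R vec12)]"
  let ?U = "line_sum M 1 vec12 (box_ind L)"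
  \<comment> \<open>As \<open>M \<ge> R\<close>, a translate by \<open>ln n\<close> with
    \<open>n > M\<close> along \<open>vec12\<close> lies outside the box, so the truncated zeta sum
    is inverted exactly.\<close>
  have inv: "prod_op ?Y ps ?U v = box_ind L v" if v: "cone4 v" for v
  proof (rule prod_op_line_sum[OF ps(1) _ M1])
    show "set ps = {p. prime p \<and> p \<le> M}" using ps by (simp add: P_def primes_upto_def)
    fix n assume n: "n > M"
    then have "exp L < real n" using L by linarith
    then have "L < ln (real n)" using n by (metis exp_less_cancel_iff exp_ln le_less_trans of_nat_0_le_iff exp_gt_zero less_trans)
    then show "box_ind L (v + ln (real n) *\<^sub>R vec12) = 0" using v by (auto simp: box_ind_def cone4_def vec_defs)
  qed
  have H: "prod_op ?X ps (box_ind L) 0 = prod_op (pair_ops u3 h h3) ps ?U 0"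
  proof -
    have "prod_op ?X ps (box_ind L) 0 = prod_op ?X ps (prod_op ?Y ps ?U) 0"
    proof (rule prod_op_cong_cone[where C = cone4])
      show "cone4 (v + s)" if "p \<in> set ps" "(k, s) \<in> set (?X p)" "cone4 v" for p k s v
        using that pr[of p] unfolding corr_ops_def by (intro closed_four_ops) auto
    qed (use inv in auto)
    also have "\<dots> = prod_op (\<lambda>p. op_comp (?X p) (?Y p)) ps ?U 0" by (rule fun_cong[OF prod_op_comp[symmetric]])
    also have "\<dots> = prod_op (pair_ops u3 h h3) ps ?U 0"
    proof (rule fun_cong[OF prod_op_cong])
      fix p \<phi> v assume "p \<in> set ps"
      from shift_op_pair_ops[OF pr(2)[OF this]]
      show "shift_op (op_comp (?X p) (?Y p)) \<phi> v = shift_op (pair_ops u3 h h3 p) \<phi> v" .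
    qed
    finally show ?thesis .
  qed
  have sum: "(\<Sum>x\<leftarrow>pair_ops u3 h h3 p. fst x) = (1 - 1 / real p) * local_sum 1 1 u3 h h h3 p" if "p \<in> set ps" for p
  proof -
    have p: "real p - 1 \<noteq> 0" "real p \<noteq> 0" using pr[OF that] by auto
    have "(1 - 1 / real p) * (1 + 1 / (real p - 1)) = 1" using p by (simp add: field_simps)
    then show ?thesis using p
      by (simp add: pair_ops_def Let_def local_sum_def pair_wt_diag[OF pr(2)[OF that]] algebra_simps)
  qed
  have "corr_mean 1 1 u3 h h h3 P R - L * (\<Prod>p\<in>P. (1 - 1 / real p) * local_sum 1 1 u3 h h h3 p)
      = prod_op (pair_ops u3 h h3) ps ?U 0 - prod_op (pair_ops u3 h h3) ps (\<lambda>_. L) 0"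
    using corr_mean_eq_prod_op[of ps R 1 1 u3 h h h3] ps pr R H sum
    by (simp add: prod_op_const L_def prod_list_eq_prod[OF ps(1)] cong: prod.cong)
  also have "\<dots> = prod_op (pair_ops u3 h h3) ps (\<lambda>v. ?U v - L) 0" by (rule prod_op_diff[symmetric])
  also have "\<bar>\<dots>\<bar> \<le> (\<Prod>p\<leftarrow>ps. 1 + pair_bad u3 h h3 p) *
     (1 + (\<Sum>p\<leftarrow>ps. 5 * ln (real p) * pair_bad u3 h h3 p) + (\<lambda>v. fst v + fst (snd v) + fst (snd (snd v))) (0 :: vec4))"
  proof (rule prod_op_bound_linear[where C = cone4])
    show "cone4 (v + s)" if "p \<in> set ps" "(k, s) \<in> set (pair_ops u3 h h3 p)" "cone4 v" for p k s v
    proof -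
      have "0 \<le> ln (real p)" using pr[OF that(1)] by simp
      then show ?thesis using that by (auto simp: pair_ops_def Let_def intro!: cone4_add cone4_scale)
    qed
    show "\<bar>?U v - L\<bar> \<le> 1 + (fst v + fst (snd v) + fst (snd (snd v)))" if "cone4 v" for v
      using line_sum_box_ind[OF that L(2,1)] .
    fix p assume p: "p \<in> set ps"
    show "(\<Sum>x\<leftarrow>pair_ops u3 h h3 p. \<bar>fst x\<bar>) \<le> 1 + pair_bad u3 h h3 p"
      by (rule pair_ops_bounds(1)[OF pr(2)[OF p] u])
    show "(\<Sum>x\<leftarrow>pair_ops u3 h h3 p. \<bar>fst x\<bar> * (fst (snd x) + fst (snd (snd x)) + fst (snd (snd (snd x))))) \<le> 5 * ln (real p) * pair_bad u3 h h3 p"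
      by (rule pair_ops_bounds(2)[OF pr(2)[OF p] u])
    show "0 \<le> pair_bad u3 h h3 p" by (simp add: pair_bad_def)
    then show "0 \<le> 5 * ln (real p) * pair_bad u3 h h3 p" using pr[OF p] by simp
  qed (auto simp: cone4_def)
  finally show ?thesis
    by (simp add: prod_list_eq_prod[OF ps(1)] sum_list_eq_sum[OF ps(1)] ps(2) P_def L_def)
qed

section \<open>Error products, uniformly in the shifts\<close>

lemma prod_bad_split:
  fixes f g :: "nat \<Rightarrow> real"
  assumes "finite P" "\<And>p. p \<in> P \<Longrightarrow> 0 \<le> f p" "\<And>p. p \<in> P \<Longrightarrow> 0 \<le> g p"
  shows "(\<Prod>p\<in>P. 1 + (if Q p then f p else g p)) \<le> (\<Prod>p\<in>P. 1 + g p) * (\<Prod>p\<in>{p\<in>P. Q p}. 1 + f p)"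
proof -
  have "(\<Prod>p\<in>P. 1 + (if Q p then f p else g p)) \<le> (\<Prod>p\<in>P. (1 + g p) * (if Q p then 1 + f p else 1))"
  proof (rule prod_mono)
    fix p assume p: "p \<in> P"
    have "1 * (1 + f p) \<le> (1 + g p) * (1 + f p)" using assms(2,3)[OF p] by (intro mult_right_mono) auto
    then show "0 \<le> 1 + (if Q p then f p else g p) \<and> 1 + (if Q p then f p else g p) \<le> (1 + g p) * (if Q p then 1 + f p else 1)"
      using assms(2,3)[OF p] by auto
  qed
  also have "\<dots> = (\<Prod>p\<in>P. 1 + g p) * (\<Prod>p\<in>{p\<in>P. Q p}. 1 + f p)"
    using assms(1) by (simp only: prod.distrib prod.inter_filter)
  finally show ?thesis .
qed

lemma sqrt_div_square: "p \<ge> 1 \<Longrightarrow> sqrt (real p) / (real p)\<^sup>2 = real p powr (- (3 / 2))"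
proof -
  assume p: "p \<ge> 1"
  then have "sqrt (real p) / (real p)\<^sup>2 = real p powr (1 / 2) / real p powr 2"
    by (simp add: powr_half_sqrt)
  also have "\<dots> = real p powr (1 / 2 - 2)" by (rule powr_diff[symmetric])
  finally show ?thesis by simp
qed

lemma log_prime_power_bound: "p \<ge> 1 \<Longrightarrow> ln (real p) / (real p)\<^sup>2 \<le> 2 * real p powr (- (3 / 2))"
proof -
  assume p: "p \<ge> 1"
  have "ln (real p) / (real p)\<^sup>2 \<le> 2 * sqrt (real p) / (real p)\<^sup>2"
    using p ln_le_2_sqrt[of "real p"] by (intro divide_right_mono) auto
  also have "\<dots> = 2 * (sqrt (real p) / (real p)\<^sup>2)" by simp
  also have "\<dots> = 2 * real p powr (- (3 / 2))" by (simp only: sqrt_div_square[OF p])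
  finally show ?thesis .
qed

text \<open>At most \<open>log 2 \<bar>h - h3\<bar>\<close> primes divide \<open>h - h3\<close>, so
  \<open>k\<close> can be taken of the size of a double logarithm. The reciprocals of these primes
  sum to at most \<open>4 + 2 * ln k\<close>, which makes the product \<open>O(k ^ 44)\<close>, and
  the first moments contribute \<open>O(k ^ 2)\<close>.\<close>

lemma pair_error_bound:
  obtains K where "K \<ge> 1"
    "\<And>u3 h h3 M. u3 = 0 \<Longrightarrow> (\<Prod>p\<in>primes_upto M. 1 + pair_bad u3 h h3 p) * (1 + (\<Sum>p\<in>primes_upto M. 5 * ln (real p) * pair_bad u3 h h3 p)) \<le> K"
    "\<And>u3 h h3 M k. h \<noteq> h3 \<Longrightarrow> k \<ge> 1 \<Longrightarrow> (log 2 (real_of_int \<bar>h - h3\<bar>))\<^sup>2 \<le> 2 ^ k \<Longrightarrow>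
       (\<Prod>p\<in>primes_upto M. 1 + pair_bad u3 h h3 p) * (1 + (\<Sum>p\<in>primes_upto M. 5 * ln (real p) * pair_bad u3 h h3 p)) \<le> K * real k ^ 46"
proof -
  obtain K1 where K1: "K1 \<ge> 1" "\<And>P. finite P \<Longrightarrow> (\<Prod>p\<in>P. 1 + 22 * real p powr (- 2)) \<le> K1"
    using prod_one_plus_powr_bound[of 22 2] by auto
  obtain K2 where K2: "K2 \<ge> 0" "\<And>P. finite P \<Longrightarrow> (\<Sum>p\<in>P. real p powr (- (3 / 2))) \<le> K2"
    using sum_powr_bound[of "3 / 2"] by auto
  \<comment> \<open>\<open>exp 88\<close> is \<open>exp (22 * 4)\<close>, and 770 bounds
    \<open>110 * (k * (3 + 2 * ln k) + 2)\<close> as a multiple of \<open>k ^ 2\<close> by means of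
    \<open>ln k \<le> k\<close>.\<close>
  define K where "K = K1 * exp 88 * (1 + 220 * K2 + 770)"
  have main: "(\<Prod>p\<in>primes_upto M. 1 + pair_bad u3 h h3 p) * (1 + (\<Sum>p\<in>primes_upto M. 5 * ln (real p) * pair_bad u3 h h3 p))
      \<le> (K1 * exp (22 * s)) * (1 + 220 * K2 + 110 * t)"
    if A: "A = {p\<in>primes_upto M. u3 \<noteq> 0 \<and> int p dvd h - h3}" and s: "(\<Sum>p\<in>A. 1 / real p) \<le> s" and t: "(\<Sum>p\<in>A. ln (real p) / real p) \<le> t"
    for u3 h h3 M A s t
  proof -
    have fA: "finite A" using A by simp
    have "(\<Prod>p\<in>primes_upto M. 1 + pair_bad u3 h h3 p) \<le> (\<Prod>p\<in>primes_upto M. 1 + 22 / (real p)\<^sup>2) * (\<Prod>p\<in>A. 1 + 22 / real p)"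
      unfolding A pair_bad_def by (rule prod_bad_split) auto
    also have "\<dots> \<le> K1 * exp (22 * s)"
    proof (rule mult_mono)
      have "(\<Prod>p\<in>primes_upto M. 1 + 22 / (real p)\<^sup>2) = (\<Prod>p\<in>primes_upto M. 1 + 22 * real p powr (- 2))"
        by (intro prod.cong refl) (auto simp: powr_minus powr_numeral divide_inverse dest!: prime_primes_upto prime_gt_0_nat)
      then show "(\<Prod>p\<in>primes_upto M. 1 + 22 / (real p)\<^sup>2) \<le> K1" using K1(2)[of "primes_upto M"] by simp
      have "(\<Prod>p\<in>A. 1 + 22 / real p) \<le> exp (\<Sum>p\<in>A. 22 / real p)" using fA by (intro prod_one_plus_le_exp) auto
      also have "(\<Sum>p\<in>A. 22 / real p) = 22 * (\<Sum>p\<in>A. 1 / real p)" by (simp add: sum_distrib_left)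
      also have "exp (22 * (\<Sum>p\<in>A. 1 / real p)) \<le> exp (22 * s)" using s by simp
      finally show "(\<Prod>p\<in>A. 1 + 22 / real p) \<le> exp (22 * s)" .
      show "0 \<le> K1" using K1(1) by simp
      show "0 \<le> (\<Prod>p\<in>A. 1 + 22 / real p)" by (intro prod_nonneg) (simp add: add_nonneg_nonneg)
    qed
    finally have 1: "(\<Prod>p\<in>primes_upto M. 1 + pair_bad u3 h h3 p) \<le> K1 * exp (22 * s)" .
    have "(\<Sum>p\<in>primes_upto M. 5 * ln (real p) * pair_bad u3 h h3 p)
        \<le> (\<Sum>p\<in>primes_upto M. 220 * real p powr (- (3 / 2)) + (if u3 \<noteq> 0 \<and> int p dvd h - h3 then 110 * (ln (real p) / real p) else 0))"
    proof (rule sum_mono)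
      fix p assume "p \<in> primes_upto M"
      then have p: "p \<ge> 1" using prime_primes_upto prime_ge_1_nat by blast
      have y: "110 * (ln (real p) / (real p)\<^sup>2) \<le> 220 * real p powr (- (3 / 2))"
        using log_prime_power_bound[OF p] by linarith
      show "5 * ln (real p) * pair_bad u3 h h3 p \<le> 220 * real p powr (- (3 / 2)) + (if u3 \<noteq> 0 \<and> int p dvd h - h3 then 110 * (ln (real p) / real p) else 0)"
      proof (cases "u3 \<noteq> 0 \<and> int p dvd h - h3")
        case True
        then have "5 * ln (real p) * pair_bad u3 h h3 p = 110 * (ln (real p) / real p)" by (simp add: pair_bad_def)
        then show ?thesis using True by simp
      next
        case False
        then have "5 * ln (real p) * pair_bad u3 h h3 p = 110 * (ln (real p) / (real p)\<^sup>2)"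
          unfolding pair_bad_def by (simp only: if_not_P) simp
        then show ?thesis using y unfolding if_not_P[OF False] by linarith
      qed
    qed
    also have "\<dots> = 220 * (\<Sum>p\<in>primes_upto M. real p powr (- (3 / 2))) + 110 * (\<Sum>p\<in>A. ln (real p) / real p)"
    proof -
      have "(\<Sum>p\<in>A. 110 * (ln (real p) / real p)) = (\<Sum>p\<in>primes_upto M. if u3 \<noteq> 0 \<and> int p dvd h - h3 then 110 * (ln (real p) / real p) else 0)"
        unfolding A by (rule sum.inter_filter) simp
      then show ?thesis by (simp add: sum.distrib sum_distrib_left)
    qed
    also have "\<dots> \<le> 220 * K2 + 110 * t" using K2(2)[of "primes_upto M"] t by (intro add_mono mult_left_mono) auto
    finally have 2: "1 + (\<Sum>p\<in>primes_upto M. 5 * ln (real p) * pair_bad u3 h h3 p) \<le> 1 + 220 * K2 + 110 * t" by simp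
    have nn: "0 \<le> 5 * ln (real p) * pair_bad u3 h h3 p" if "p \<in> primes_upto M" for p
      using prime_ge_1_nat[OF prime_primes_upto[OF that]] by (simp add: pair_bad_def)
    have "0 \<le> (\<Sum>p\<in>primes_upto M. 5 * ln (real p) * pair_bad u3 h h3 p)" by (intro sum_nonneg nn)
    moreover have "0 \<le> K1 * exp (22 * s)" using K1(1) by simp
    ultimately show ?thesis by (intro mult_mono[OF 1 2]) simp_all
  qed
  have K0: "K \<ge> 1"
  proof -
    have "1 * 1 * 1 \<le> K1 * exp 88 * (1 + 220 * K2 + 770)" using K1 K2 by (intro mult_mono) auto
    then show ?thesis by (simp add: K_def)
  qed
  show ?thesis
  proof (rule that[OF K0])
    fix u3 :: real and h h3 :: int and M assume "u3 = 0"
    then have "(\<Prod>p\<in>primes_upto M. 1 + pair_bad u3 h h3 p) * (1 + (\<Sum>p\<in>primes_upto M. 5 * ln (real p) * pair_bad u3 h h3 p))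
      \<le> (K1 * exp (22 * 0)) * (1 + 220 * K2 + 110 * 0)" by (intro main[where A = "{}"]) auto
    also have "\<dots> \<le> K" unfolding K_def using K1 K2 by (intro mult_mono) auto
    finally show "(\<Prod>p\<in>primes_upto M. 1 + pair_bad u3 h h3 p) * (1 + (\<Sum>p\<in>primes_upto M. 5 * ln (real p) * pair_bad u3 h h3 p)) \<le> K" .
  next
    fix u3 :: real and h h3 :: int and M k :: nat
    assume h: "h \<noteq> h3" and k: "k \<ge> 1" and lg: "(log 2 (real_of_int \<bar>h - h3\<bar>))\<^sup>2 \<le> 2 ^ k"
    define A where "A = {p\<in>primes_upto M. u3 \<noteq> 0 \<and> int p dvd h - h3}"
    have fA: "finite A" and pA: "\<And>p. p \<in> A \<Longrightarrow> prime p" by (auto simp: A_def primes_upto_def)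
    define D where "D = nat \<bar>h - h3\<bar>"
    have D: "D > 0" "real D = real_of_int \<bar>h - h3\<bar>" using h by (auto simp: D_def)
    have "\<Prod>A dvd D" using fA pA by (rule prod_primes_dvd) (auto simp: A_def D_def)
    then have le: "\<Prod>A \<le> D" using D by (intro dvd_imp_le)
    have "2 ^ card A = (\<Prod>p\<in>A. 2 :: nat)" by simp
    also have "\<dots> \<le> \<Prod>A" using prime_ge_2_nat[OF pA] by (intro prod_mono) auto
    finally have "2 ^ card A \<le> D" using le by linarith
    then have "real (2 ^ card A) \<le> real D" by (rule of_nat_mono)
    then have "log 2 (2 ^ card A) \<le> log 2 (real D)" by (intro log_mono) auto
    then have "real (card A) \<le> log 2 (real D)" by simp
    then have "(real (card A))\<^sup>2 \<le> (log 2 (real D))\<^sup>2" by (intro power_mono) auto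
    then have c: "(real (card A))\<^sup>2 \<le> 2 ^ k" using lg[folded D(2)] by (rule order_trans)
    note b = sum_prime_divisors_bound[OF fA pA k c]
    have k0: "real k \<ge> 1" using k by simp
    have lk: "0 \<le> ln (real k)" "ln (real k) \<le> real k" using k0 ln_le_minus_one[of "real k"] by auto
    have "(\<Prod>p\<in>primes_upto M. 1 + pair_bad u3 h h3 p) * (1 + (\<Sum>p\<in>primes_upto M. 5 * ln (real p) * pair_bad u3 h h3 p))
      \<le> (K1 * exp (22 * (4 + 2 * ln (real k)))) * (1 + 220 * K2 + 110 * (real k * (3 + 2 * ln (real k)) + 2))"
      using A_def b by (intro main)
    also have "exp (22 * (4 + 2 * ln (real k))) = exp 88 * real k ^ 44"
    proof -
      have "exp (22 * (4 + 2 * ln (real k))) = exp 88 * exp (real 44 * ln (real k))"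
        by (simp add: exp_add[symmetric])
      also have "exp (real 44 * ln (real k)) = exp (ln (real k)) ^ 44" by (rule exp_of_nat_mult)
      finally show ?thesis using k0 by simp
    qed
    also have "1 + 220 * K2 + 110 * (real k * (3 + 2 * ln (real k)) + 2) \<le> (1 + 220 * K2 + 770) * real k ^ 2"
    proof -
      have kk: "1 \<le> real k ^ 2" using k0 by simp
      have "real k * (3 + 2 * ln (real k)) \<le> real k * (5 * real k)" using lk k0 by (intro mult_left_mono) auto
      then have "110 * (real k * (3 + 2 * ln (real k)) + 2) \<le> 550 * real k ^ 2 + 220" by (simp add: power2_eq_square)
      also have "\<dots> \<le> 770 * real k ^ 2" using kk by linarith
      finally have "110 * (real k * (3 + 2 * ln (real k)) + 2) \<le> 770 * real k ^ 2" .
      moreover have "(1 + 220 * K2) * 1 \<le> (1 + 220 * K2) * real k ^ 2" using kk K2 by (intro mult_left_mono) auto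
      ultimately show ?thesis by (simp add: algebra_simps)
    qed
    finally have "(\<Prod>p\<in>primes_upto M. 1 + pair_bad u3 h h3 p) * (1 + (\<Sum>p\<in>primes_upto M. 5 * ln (real p) * pair_bad u3 h h3 p))
      \<le> K1 * (exp 88 * real k ^ 44) * ((1 + 220 * K2 + 770) * real k ^ 2)"
      using K1 by (simp add: mult_left_mono)
    also have "\<dots> = K * real k ^ 46" by (simp add: K_def power_add[symmetric])
    finally show "(\<Prod>p\<in>primes_upto M. 1 + pair_bad u3 h h3 p) * (1 + (\<Sum>p\<in>primes_upto M. 5 * ln (real p) * pair_bad u3 h h3 p)) \<le> K * real k ^ 46" .
  qed
qed

text \<open>All bad primes divide a product \<open>D \<le> X * X * X\<close> of differences and cost
  a factor of at most 21 each, altogether a small power of \<open>X\<close>; the threefold product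
  explains the exponent \<open>\<zeta> / 3\<close>. Good primes contribute
  \<open>1 + O(p powr (- 3 / 2))\<close>.\<close>

lemma distinct_error_bound:
  assumes \<zeta>: "\<zeta> > 0"
  obtains K where "K \<ge> 1" "\<And>u1 u2 u3 h1 h2 h3 M X. u1 = 0 \<or> u1 = 1 \<Longrightarrow> u2 = 0 \<or> u2 = 1 \<Longrightarrow> u3 = 0 \<or> u3 = 1 \<Longrightarrow>
     (u1 * u2 \<noteq> 0 \<Longrightarrow> h1 \<noteq> h2 \<and> real_of_int \<bar>h1 - h2\<bar> \<le> X) \<Longrightarrow> (u1 * u3 \<noteq> 0 \<Longrightarrow> h1 \<noteq> h3 \<and> real_of_int \<bar>h1 - h3\<bar> \<le> X) \<Longrightarrow>
     (u2 * u3 \<noteq> 0 \<Longrightarrow> h2 \<noteq> h3 \<and> real_of_int \<bar>h2 - h3\<bar> \<le> X) \<Longrightarrow> X \<ge> 1 \<Longrightarrow>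
     (\<Prod>p\<in>primes_upto M. 1 + sqrt (real p) * local_abs u1 u2 u3 h1 h2 h3 p) \<le> K * X powr \<zeta>"
proof -
  obtain K1 where K1: "K1 \<ge> 1" "\<And>P. finite P \<Longrightarrow> (\<Prod>p\<in>P. 1 + 20 * real p powr (- (3 / 2))) \<le> K1"
    using prod_one_plus_powr_bound[of 20 "3 / 2"] by auto
  obtain K2 where K2: "K2 \<ge> 1" "\<And>P n. finite P \<Longrightarrow> (\<And>p. p \<in> P \<Longrightarrow> prime p) \<Longrightarrow> n > 0 \<Longrightarrow>
     (\<And>p. p \<in> P \<Longrightarrow> p dvd n) \<Longrightarrow> (21::real) ^ card P \<le> K2 * real n powr (\<zeta> / 3)"
    using prime_divisors_pow_bound[of 21 "\<zeta> / 3"] \<zeta> by auto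
  show ?thesis
  proof (rule that)
    have "1 * 1 \<le> K1 * K2" using K1 K2 by (intro mult_mono) auto
    then show "1 \<le> K1 * K2" by simp
    fix u1 u2 u3 :: real and h1 h2 h3 :: int and M :: nat and X :: real
    assume u: "u1 = 0 \<or> u1 = 1" "u2 = 0 \<or> u2 = 1" "u3 = 0 \<or> u3 = 1"
      and h12: "u1 * u2 \<noteq> 0 \<Longrightarrow> h1 \<noteq> h2 \<and> real_of_int \<bar>h1 - h2\<bar> \<le> X" and h13: "u1 * u3 \<noteq> 0 \<Longrightarrow> h1 \<noteq> h3 \<and> real_of_int \<bar>h1 - h3\<bar> \<le> X"
      and h23: "u2 * u3 \<noteq> 0 \<Longrightarrow> h2 \<noteq> h3 \<and> real_of_int \<bar>h2 - h3\<bar> \<le> X" and X: "X \<ge> 1"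
    \<comment> \<open>A pair of slots with weight 0 imposes no condition on its shifts, which may
      coincide, and is represented by the divisor 1.\<close>
    define d where "d u h = (if u \<noteq> 0 then nat \<bar>h\<bar> else 1)" for u :: real and h :: int
    define D where "D = d (u1 * u2) (h1 - h2) * d (u1 * u3) (h1 - h3) * d (u2 * u3) (h2 - h3)"
    have d1: "d (u1 * u2) (h1 - h2) > 0" "real (d (u1 * u2) (h1 - h2)) \<le> X" using h12 X by (auto simp: d_def)
    have d2: "d (u1 * u3) (h1 - h3) > 0" "real (d (u1 * u3) (h1 - h3)) \<le> X" using h13 X by (auto simp: d_def)
    have d3: "d (u2 * u3) (h2 - h3) > 0" "real (d (u2 * u3) (h2 - h3)) \<le> X" using h23 X by (auto simp: d_def)
    have D0: "D > 0" using d1 d2 d3 by (simp add: D_def)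
    have "real D \<le> X * X * X" unfolding D_def of_nat_mult using d1 d2 d3 X by (intro mult_mono) auto
    then have "real D powr (\<zeta> / 3) \<le> (X * X * X) powr (\<zeta> / 3)" using \<zeta> D0 by (intro powr_mono2) auto
    also have "\<dots> = X powr \<zeta>" using X by (simp add: powr_mult powr_add[symmetric])
    finally have DX: "real D powr (\<zeta> / 3) \<le> X powr \<zeta>" .
    define A where "A = {p\<in>primes_upto M. bad_prime u1 u2 u3 h1 h2 h3 p}"
    have dd: "p dvd d u h" if "u \<noteq> 0" "int p dvd h" for p u h using that by (simp add: d_def)
    have pD: "p dvd D" if pA: "p \<in> A" for p
    proof -
      consider "u1 * u2 \<noteq> 0 \<and> int p dvd h1 - h2" | "u1 * u3 \<noteq> 0 \<and> int p dvd h1 - h3" | "u2 * u3 \<noteq> 0 \<and> int p dvd h2 - h3"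
        using pA unfolding A_def bad_prime_def by blast
      then show ?thesis
      proof cases
        case 1
        then have "p dvd d (u1 * u2) (h1 - h2)" using dd by blast
        then show ?thesis unfolding D_def by (rule dvd_mult2[OF dvd_mult2])
      next
        case 2
        then have "p dvd d (u1 * u3) (h1 - h3)" using dd by blast
        then show ?thesis unfolding D_def by (rule dvd_mult2[OF dvd_mult])
      next
        case 3
        then have "p dvd d (u2 * u3) (h2 - h3)" using dd by blast
        then show ?thesis unfolding D_def by (rule dvd_mult)
      qed
    qed
    have "(\<Prod>p\<in>primes_upto M. 1 + sqrt (real p) * local_abs u1 u2 u3 h1 h2 h3 p)
        \<le> (\<Prod>p\<in>primes_upto M. 1 + (if bad_prime u1 u2 u3 h1 h2 h3 p then 20 else 20 * real p powr (- (3 / 2))))"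
    proof (rule prod_mono)
      fix p assume "p \<in> primes_upto M"
      then have p: "p \<ge> 2" using prime_primes_upto prime_ge_2_nat by blast
      have s: "sqrt (real p) \<ge> 1" "sqrt (real p) * sqrt (real p) = real p" using p by auto
      have nn: "0 \<le> local_abs u1 u2 u3 h1 h2 h3 p" by (simp add: local_abs_def)
      have "sqrt (real p) * local_abs u1 u2 u3 h1 h2 h3 p \<le> (if bad_prime u1 u2 u3 h1 h2 h3 p then 20 else 20 * real p powr (- (3 / 2)))"
      proof (cases "bad_prime u1 u2 u3 h1 h2 h3 p")
        case True
        have "sqrt (real p) * local_abs u1 u2 u3 h1 h2 h3 p \<le> sqrt (real p) * (20 / real p)"
          using local_abs_bound[OF p u, of h1 h2 h3] True by (intro mult_left_mono) auto
        also have "\<dots> = 20 / sqrt (real p)" using s p by (simp add: field_simps)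
        also have "\<dots> \<le> 20" using s by (simp add: field_simps)
        finally show ?thesis using True by simp
      next
        case False
        have "sqrt (real p) * local_abs u1 u2 u3 h1 h2 h3 p \<le> sqrt (real p) * (20 / (real p)\<^sup>2)"
          using local_abs_bound[OF p u, of h1 h2 h3] False by (intro mult_left_mono) auto
        also have "\<dots> = 20 * (sqrt (real p) / (real p)\<^sup>2)" by simp
        also have "\<dots> = 20 * real p powr (- (3 / 2))" using p by (simp only: sqrt_div_square)
        finally show ?thesis using False by simp
      qed
      then show "0 \<le> 1 + sqrt (real p) * local_abs u1 u2 u3 h1 h2 h3 p \<and> 1 + sqrt (real p) * local_abs u1 u2 u3 h1 h2 h3 p
          \<le> 1 + (if bad_prime u1 u2 u3 h1 h2 h3 p then 20 else 20 * real p powr (- (3 / 2)))" using nn s by auto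
    qed
    also have "\<dots> \<le> (\<Prod>p\<in>primes_upto M. 1 + 20 * real p powr (- (3 / 2))) * (\<Prod>p\<in>A. 1 + 20)"
      unfolding A_def by (rule prod_bad_split) auto
    also have "\<dots> \<le> K1 * (K2 * X powr \<zeta>)"
    proof (rule mult_mono)
      have "(\<Prod>p\<in>A. 1 + 20) = (21::real) ^ card A" by simp
      also have "\<dots> \<le> K2 * real D powr (\<zeta> / 3)"
        using pD D0 by (intro K2) (auto simp: A_def primes_upto_def)
      also have "\<dots> \<le> K2 * X powr \<zeta>" using DX K2 by (intro mult_left_mono) auto
      finally show "(\<Prod>p\<in>A. 1 + 20) \<le> K2 * X powr \<zeta>" .
      show "0 \<le> K1" using K1(1) by simp
      show "(\<Prod>p\<in>primes_upto M. 1 + 20 * real p powr (- (3 / 2))) \<le> K1" by (rule K1(2)) simp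
    qed simp
    finally show "(\<Prod>p\<in>primes_upto M. 1 + sqrt (real p) * local_abs u1 u2 u3 h1 h2 h3 p) \<le> K1 * K2 * X powr \<zeta>"
      by (simp add: mult.assoc)
  qed
qed

section \<open>Sums over intervals and the singular series\<close>

lemma sqf_upto_eq:
  assumes "\<And>p. prime p \<Longrightarrow> real p \<le> R \<Longrightarrow> p \<in> P"
  shows "{q\<in>sqf P. real q \<le> R} = {q. squarefree q \<and> real q \<le> R}"
proof -
  have "q \<in> sqf P" if q: "squarefree q" "real q \<le> R" for q
  proof -
    have q0: "q > 0" using q by (auto intro!: Nat.gr0I)
    have "p \<in> P" if p: "prime p" "p dvd q" for p
    proof (rule assms[OF p(1)])
      have "p \<le> q" using p(2) q0 by (rule dvd_imp_le)
      then show "real p \<le> R" using q(2) by linarith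
    qed
    then show ?thesis using q by (simp add: sqf_def)
  qed
  then show ?thesis by (auto simp: sqf_def)
qed

lemma lam_indep:
  assumes P: "finite P" "\<And>p. p \<in> P \<Longrightarrow> prime p" "\<And>p. prime p \<Longrightarrow> real p \<le> R \<Longrightarrow> p \<in> P"
  shows "lam u P R m = (\<Sum>q | squarefree q \<and> real q \<le> R. wprod (\<lambda>p. u / (real p - 1)) q * wprod (\<lambda>p. sieve_factor p m) q)"
proof -
  have eq: "{q\<in>sqf P. real q \<le> R} = {q. squarefree q \<and> real q \<le> R}"
    by (rule sqf_upto_eq) (rule P(3))
  show ?thesis unfolding lam_def eq[symmetric]
    by (rule sum_filter_of_bool[symmetric]) (use P in \<open>auto intro: finite_sqf\<close>)
qed

lemma corr_mean_interval:
  assumes P: "finite P" "\<And>p. p \<in> P \<Longrightarrow> prime p" and u: "0 \<le> u1" "0 \<le> u2" "0 \<le> u3" and ab: "a \<le> b"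
  shows "\<bar>(\<Sum>n\<in>{a<..b}. lam u1 P R (int n + h1) * lam u2 P R (int n + h2) * lam u3 P R (int n + h3))
      - (real b - real a) * corr_mean u1 u2 u3 h1 h2 h3 P R\<bar>
    \<le> lam_err u1 P R * lam_err u2 P R * lam_err u3 P R"
  using interval_mean_lam[OF P u ab, of R h1 h2 h3] mean_lam_eq_flag_sum[OF P, of u1 R h1 u2 h2 u3 h3]
  by (simp only: corr_mean_def)

text \<open>Both values are limits of averages of one and the same function, since
  \<open>lam\<close> depends on \<open>P\<close> only through the primes up to \<open>R\<close>.
  With \<open>R\<close> fixed, the set of primes may therefore grow until the Euler product is
  complete.\<close>

lemma corr_mean_indep:
  assumes P: "finite P" "\<And>p. p \<in> P \<Longrightarrow> prime p" "\<And>p. prime p \<Longrightarrow> real p \<le> R \<Longrightarrow> p \<in> P"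
    and Q: "finite Q" "\<And>p. p \<in> Q \<Longrightarrow> prime p" "\<And>p. prime p \<Longrightarrow> real p \<le> R \<Longrightarrow> p \<in> Q"
    and u: "0 \<le> u1" "0 \<le> u2" "0 \<le> u3"
  shows "corr_mean u1 u2 u3 h1 h2 h3 P R = corr_mean u1 u2 u3 h1 h2 h3 Q R"
proof (rule ccontr)
  assume ne: "\<not> ?thesis"
  have lam: "lam u P R m = lam u Q R m" for u m using lam_indep[OF P] lam_indep[OF Q] by simp
  define x y where "x = corr_mean u1 u2 u3 h1 h2 h3 P R" and "y = corr_mean u1 u2 u3 h1 h2 h3 Q R"
  define E where "E = lam_err u1 P R * lam_err u2 P R * lam_err u3 P R + lam_err u1 Q R * lam_err u2 Q R * lam_err u3 Q R"
  have le: "real b * \<bar>x - y\<bar> \<le> E" for b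
  proof -
    define S where "S = (\<Sum>n\<in>{0<..b}. lam u1 P R (int n + h1) * lam u2 P R (int n + h2) * lam u3 P R (int n + h3))"
    have 1: "\<bar>S - real b * x\<bar> \<le> lam_err u1 P R * lam_err u2 P R * lam_err u3 P R"
      using corr_mean_interval[OF P(1,2) u, of 0 b R h1 h2 h3] by (simp only: S_def x_def le0 of_nat_0 diff_zero)
    have 2: "\<bar>S - real b * y\<bar> \<le> lam_err u1 Q R * lam_err u2 Q R * lam_err u3 Q R"
      using corr_mean_interval[OF Q(1,2) u, of 0 b R h1 h2 h3] by (simp only: S_def y_def lam le0 of_nat_0 diff_zero)
    have tri: "\<bar>s - t\<bar> \<le> e1 + e2" if "\<bar>w - s\<bar> \<le> e1" "\<bar>w - t\<bar> \<le> e2" for w s t e1 e2 :: real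
      using that by linarith
    have "real b * \<bar>x - y\<bar> = \<bar>real b * x - real b * y\<bar>"
      unfolding right_diff_distrib[symmetric] by (simp only: abs_mult abs_of_nat)
    also have "\<dots> \<le> E" unfolding E_def by (rule tri[OF 1 2])
    finally show ?thesis .
  qed
  have "\<bar>x - y\<bar> > 0" using ne by (simp add: x_def y_def)
  then obtain n where "E < real n * \<bar>x - y\<bar>" using reals_Archimedean3 by blast
  with le[of n] show False by linarith
qed

lemma lam_zero: "R \<ge> 1 \<Longrightarrow> finite P \<Longrightarrow> (\<And>p. p \<in> P \<Longrightarrow> prime p) \<Longrightarrow> lam 0 P R m = 1"
  and lam_err_zero: "R \<ge> 1 \<Longrightarrow> finite P \<Longrightarrow> (\<And>p. p \<in> P \<Longrightarrow> prime p) \<Longrightarrow> lam_err 0 P R = 1"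
proof -
  assume R: "R \<ge> 1" and P: "finite P" "\<And>p. p \<in> P \<Longrightarrow> prime p"
  have one: "1 \<in> sqf P" by (auto simp: sqf_def)
  have z: "wprod (\<lambda>p. 0) q = 0" if q: "q \<in> sqf P" "q \<noteq> 1" for q
  proof -
    obtain p where "prime p" "p dvd q" using q(2) prime_factor_nat by blast
    then have "p \<in> prime_factors q" using sqf_pos[OF q(1)] by (simp add: in_prime_factors_iff)
    then show ?thesis unfolding wprod_def by (subst prod_zero_iff) auto
  qed
  have "lam 0 P R m = (\<Sum>q\<in>sqf P. if q = 1 then 1 else 0)"
    unfolding lam_def using R z by (intro sum.cong refl) auto
  then show "lam 0 P R m = 1" using one finite_sqf[of P] P by simp
  have "lam_err 0 P R = (\<Sum>q\<in>sqf P. if q = 1 then 1 else 0)"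
    unfolding lam_err_def using R z by (intro sum.cong refl) auto
  then show "lam_err 0 P R = 1" using one finite_sqf[of P] P by simp
qed

section \<open>Size of the error for intervals\<close>

definition sqf_sum :: "nat set \<Rightarrow> (nat \<Rightarrow> real) \<Rightarrow> real \<Rightarrow> real" where
  "sqf_sum P F x = (\<Sum>q\<in>sqf P. of_bool (real q \<le> x) * wprod F q)"

text \<open>Expanding \<open>1 + f\<close> writes the summand as a convolution over
  \<open>q = d * m\<close> with coprime factors. All terms are nonnegative, so dropping coprimality
  gives an upper bound.\<close>

lemma sqf_sum_convolution:
  assumes P: "finite P" "\<And>p. p \<in> P \<Longrightarrow> prime p"
    and F: "\<And>p. prime p \<Longrightarrow> 0 \<le> F p" and f: "\<And>p. prime p \<Longrightarrow> 0 \<le> f p"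
  shows "sqf_sum P (\<lambda>p. F p * (1 + f p)) x \<le> (\<Sum>d\<in>sqf P. wprod (\<lambda>p. F p * f p) d * sqf_sum P F (x / real d))"
proof -
  have fS: "finite (sqf P)" using P by (rule finite_sqf)
  define T where "T = Sigma (sqf P) (\<lambda>q. {d. d dvd q})"
  define j where "j x = (snd x, fst x div snd x)" for x :: "nat \<times> nat"
  define g where "g y = wprod (\<lambda>p. F p * f p) (fst y) * (of_bool (real (snd y) \<le> x / real (fst y)) * wprod F (snd y))" for y :: "nat \<times> nat"
  have finT: "finite T" unfolding T_def using fS sqf_pos by (intro finite_SigmaI) auto
  have T: "d \<in> sqf P \<and> m \<in> sqf P \<and> coprime d m \<and> d > 0 \<and> m > 0 \<and> q div d = m" if "q = d * m" "q \<in> sqf P" for q d m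
  proof -
    have q: "squarefree (d * m)" "d * m > 0" using that sqf_pos[OF that(2)] by (auto simp: sqf_def)
    have "squarefree d" "squarefree m" using q(1) squarefree_multD by blast+
    moreover have "coprime d m"
    proof (rule coprimeI)
      fix c assume "c dvd d" "c dvd m"
      then have "c ^ 2 dvd d * m" unfolding power2_eq_square by (rule mult_dvd_mono)
      then show "c dvd 1" using q(1) unfolding squarefree_def by blast
    qed
    moreover have "p \<in> P" if p: "prime p" "p dvd d \<or> p dvd m" for p
    proof -
      have "p dvd q" using p(2) unfolding \<open>q = d * m\<close> by (elim disjE) (simp_all only: dvd_mult dvd_mult2)
      then show ?thesis using p(1) \<open>q \<in> sqf P\<close> unfolding sqf_def by blast
    qed
    ultimately show ?thesis using q that by (auto simp: sqf_def)
  qed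
  have inj: "inj_on j T"
  proof (rule inj_onI)
    fix y z assume "y \<in> T" "z \<in> T" "j y = j z"
    then have "snd y = snd z" "fst y div snd y = fst z div snd z" "snd y dvd fst y" "snd z dvd fst z"
      by (auto simp: T_def j_def)
    then have "fst y = fst z" by (metis dvd_mult_div_cancel)
    then show "y = z" using \<open>snd y = snd z\<close> by (rule prod_eqI)
  qed
  have jT: "j ` T \<subseteq> sqf P \<times> sqf P"
  proof
    fix y assume "y \<in> j ` T"
    then obtain z where z: "z \<in> T" "y = j z" by blast
    define q d where "q = fst z" and "d = snd z"
    have qd: "q \<in> sqf P" "d dvd q" "y = (d, q div d)" using z by (auto simp: T_def j_def q_def d_def)
    from qd(2) obtain m where m: "q = d * m" by (rule dvdE)
    from T[OF this qd(1)] show "y \<in> sqf P \<times> sqf P" unfolding qd(3) by simp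
  qed
  have gj: "of_bool (real (fst y) \<le> x) * wprod F (fst y) * wprod f (snd y) = g (j y)" if "y \<in> T" for y
  proof -
    obtain q d where qd: "y = (q, d)" by (cases y)
    then have "d dvd q" "q \<in> sqf P" using \<open>y \<in> T\<close> by (simp_all add: T_def)
    then obtain m where y: "q = d * m" "q \<in> sqf P" "y = (q, d)" using qd by (elim dvdE) blast
    note t = T[OF y(1,2)]
    have "wprod F q = wprod F d * wprod F m" using t y by (simp add: wprod_mult)
    moreover have "real q \<le> x \<longleftrightarrow> real m \<le> x / real d" using t y by (simp add: field_simps)
    ultimately show ?thesis using t y by (simp add: g_def j_def wprod_times mult_ac)
  qed
  have "sqf_sum P (\<lambda>p. F p * (1 + f p)) x = (\<Sum>q\<in>sqf P. \<Sum>d | d dvd q. of_bool (real q \<le> x) * wprod F q * wprod f d)"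
    unfolding sqf_sum_def
  proof (intro sum.cong refl)
    fix q assume "q \<in> sqf P"
    then have "squarefree q" by (simp add: sqf_def)
    then show "of_bool (real q \<le> x) * wprod (\<lambda>p. F p * (1 + f p)) q = (\<Sum>d | d dvd q. of_bool (real q \<le> x) * wprod F q * wprod f d)"
      by (simp only: wprod_times sum_dvd_wprod[symmetric] sum_distrib_left mult.assoc)
  qed
  also have "\<dots> = (\<Sum>y\<in>T. of_bool (real (fst y) \<le> x) * wprod F (fst y) * wprod f (snd y))"
    unfolding T_def using fS sqf_pos by (subst sum.Sigma) (auto simp: case_prod_unfold)
  also have "\<dots> = (\<Sum>y\<in>T. g (j y))" by (intro sum.cong refl gj)
  also have "\<dots> = (\<Sum>y\<in>j ` T. g y)" by (simp add: sum.reindex[OF inj])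
  also have "\<dots> \<le> (\<Sum>y\<in>sqf P \<times> sqf P. g y)"
  proof (rule sum_mono2)
    show "0 \<le> g y" for y unfolding g_def using F f by (intro mult_nonneg_nonneg wprod_nonneg) auto
  qed (use fS jT in auto)
  also have "\<dots> = (\<Sum>d\<in>sqf P. wprod (\<lambda>p. F p * f p) d * sqf_sum P F (x / real d))"
    by (simp add: sum.cartesian_product' g_def sqf_sum_def sum_distrib_left)
  finally show ?thesis .
qed

lemma sqf_sum_card_le:
  assumes P: "finite P" "\<And>p. p \<in> P \<Longrightarrow> prime p" and y: "y \<ge> 0"
  shows "sqf_sum P (\<lambda>_. 1) y \<le> y"
proof -
  have fS: "finite (sqf P)" using P by (rule finite_sqf)
  have "sqf_sum P (\<lambda>_. 1) y = (\<Sum>q\<in>{q\<in>sqf P. real q \<le> y}. 1)"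
    unfolding sqf_sum_def sum_filter_of_bool[OF fS] by (simp add: wprod_def)
  also have "\<dots> \<le> (\<Sum>q\<in>upto_real y. 1)" using sqf_pos by (intro sum_mono2) (auto simp: mem_upto_real Suc_le_eq)
  also have "\<dots> \<le> y" using y by (simp add: upto_real_eq)
  finally show ?thesis .
qed

text \<open>The coefficient at \<open>q\<close> is the product of
  \<open>(p + 1) / (p - 1) = 1 + 2 / (p - 1)\<close>, which is bounded on average: the convolution
  bound leaves a product of factors \<open>1 + O(1 / p\<^sup>2)\<close>. Each weight thus
  contributes one factor \<open>R\<close> to the error.\<close>

lemma lam_err_one_bound:
  obtains B where "B \<ge> 1" "\<And>P R. finite P \<Longrightarrow> (\<And>p. p \<in> P \<Longrightarrow> prime p) \<Longrightarrow> R \<ge> 1 \<Longrightarrow> lam_err 1 P R \<le> B * R"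
proof -
  obtain B where B: "B \<ge> 1" "\<And>P. finite P \<Longrightarrow> (\<Prod>p\<in>P. 1 + 4 * real p powr (- 2)) \<le> B"
    using prod_one_plus_powr_bound[of 4 2] by auto
  have "lam_err 1 P R \<le> B * R" if P: "finite P" "\<And>p. p \<in> P \<Longrightarrow> prime p" and R: "R \<ge> 1" for P R
  proof -
    define f where "f p = 2 / (real p - 1)" for p :: nat
    have f0: "0 \<le> f p" if "prime p" for p using prime_ge_2_nat[OF that] by (simp add: f_def)
    have "lam_err 1 P R = sqf_sum P (\<lambda>p. 1 * (1 + f p)) R"
      unfolding lam_err_def sqf_sum_def wprod_def
    proof (intro sum.cong refl arg_cong2[where f = "(*)"] prod.cong)
      fix q p :: nat assume "p \<in> prime_factors q"
      then have "p \<ge> 2" using in_prime_factors_imp_prime prime_ge_2_nat by blast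
      then show "1 * (real p + 1) / (real p - 1) = 1 * (1 + f p)" by (simp add: f_def field_simps)
    qed
    also have "\<dots> \<le> (\<Sum>d\<in>sqf P. wprod (\<lambda>p. 1 * f p) d * sqf_sum P (\<lambda>_. 1) (R / real d))"
      using P f0 by (intro sqf_sum_convolution) auto
    also have "\<dots> \<le> (\<Sum>d\<in>sqf P. wprod f d * (R / real d))"
      using P R f0 by (intro sum_mono mult_mono sqf_sum_card_le wprod_nonneg) (auto intro: sum_nonneg simp: sqf_sum_def wprod_nonneg)
    also have "\<dots> = (\<Sum>d\<in>sqf P. R * wprod (\<lambda>p. f p * (1 / real p)) d)"
    proof (intro sum.cong refl)
      fix d assume "d \<in> sqf P"
      then have "squarefree d" by (simp add: sqf_def)
      from squarefree_prod_id[OF this] have "wprod (\<lambda>p. 1 / real p) d = 1 / real d"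
        by (simp add: wprod_def prod_dividef)
      then show "wprod f d * (R / real d) = R * wprod (\<lambda>p. f p * (1 / real p)) d" unfolding wprod_times by simp
    qed
    also have "\<dots> = R * (\<Prod>p\<in>P. 1 + f p * (1 / real p))"
      using P by (simp only: sum_distrib_left[symmetric] sum_wprod_expand)
    also have "\<dots> \<le> R * (\<Prod>p\<in>P. 1 + 4 * real p powr (- 2))"
    proof (intro mult_left_mono prod_mono conjI)
      fix p assume "p \<in> P"
      then have p: "p \<ge> 2" using P prime_ge_2_nat by auto
      have "f p * (1 / real p) \<le> (4 / real p) * (1 / real p)"
        using prime_inverse_bounds(1)[OF p] by (intro mult_right_mono) (auto simp: f_def)
      also have "\<dots> = 4 * real p powr (- 2)" using p by (simp add: powr_minus powr_numeral power2_eq_square divide_inverse)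
      finally show "1 + f p * (1 / real p) \<le> 1 + 4 * real p powr (- 2)" by simp
      show "0 \<le> 1 + f p * (1 / real p)" using p by (simp add: f_def)
    qed (use R in auto)
    also have "\<dots> \<le> R * B" using B(2)[OF P(1)] R by (intro mult_left_mono) auto
    finally show ?thesis by (simp add: mult.commute)
  qed
  then show ?thesis using that B(1) by blast
qed

section \<open>Local masses and the singular series\<close>

lemma prodinf_primes_LIMSEQ:
  fixes F :: "nat \<Rightarrow> real"
  assumes "\<And>p. prime p \<Longrightarrow> p > n0 \<Longrightarrow> \<bar>F p - 1\<bar> \<le> C / (real p)\<^sup>2"
  shows "(\<lambda>M. \<Prod>p\<in>primes_upto M. F p) \<longlonglongrightarrow> (\<Prod>p. if prime p then F p else 1)"
proof -
  define f where "f p = (if prime p then F p else 1)" for p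
  have "summable (\<lambda>p. norm (f p - 1))"
  proof (rule summable_comparison_test_ev)
    show "\<forall>\<^sub>F p in sequentially. norm (norm (f p - 1)) \<le> \<bar>C\<bar> * (1 / real p ^ 2)"
    proof (rule eventually_mono[OF eventually_gt_at_top[of n0]])
      fix p assume p: "p > n0"
      have "C / (real p)\<^sup>2 \<le> \<bar>C\<bar> * (1 / real p ^ 2)" by (simp add: divide_right_mono)
      then show "norm (norm (f p - 1)) \<le> \<bar>C\<bar> * (1 / real p ^ 2)" using assms[of p] p by (auto simp: f_def)
    qed
    show "summable (\<lambda>p. \<bar>C\<bar> * (1 / real p ^ 2))"
      using inverse_power_summable[of 2, where 'a = real] by (intro summable_mult) (simp add: inverse_eq_divide)
  qed
  then have "abs_convergent_prod f" by (simp add: abs_convergent_prod_conv_summable)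
  then have "convergent_prod f" by (rule abs_convergent_prod_imp_convergent_prod)
  then have "(\<lambda>M. \<Prod>p\<le>M. f p) \<longlonglongrightarrow> prodinf f" by (rule convergent_prod_LIMSEQ)
  moreover have "(\<Prod>p\<le>M. f p) = (\<Prod>p\<in>primes_upto M. F p)" for M
  proof -
    have "(\<Prod>p\<in>{p\<in>{..M}. prime p}. F p) = (\<Prod>p\<le>M. f p)"
      unfolding f_def by (rule prod.inter_filter) simp
    moreover have "{p\<in>{..M}. prime p} = primes_upto M" by (auto simp: primes_upto_def)
    ultimately show ?thesis by simp
  qed
  moreover have "f = (\<lambda>p. if prime p then F p else 1)" by (simp add: f_def fun_eq_iff)
  ultimately show ?thesis by simp
qed

definition series_factor :: "int list \<Rightarrow> nat \<Rightarrow> real" where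
  "series_factor js p = (1 - 1 / real p) powi (- int (length js)) * (1 - real (nu_p p js) / real p)"

lemma singular_series_alt: "singular_series js = (\<Prod>p. if prime p then series_factor js p else 1)"
  unfolding singular_series_def series_factor_def by (rule refl)

lemma mod_eq_iff_dvd: "a mod int p = b mod int p \<longleftrightarrow> int p dvd a - b"
  by (rule mod_eq_dvd_iff)

lemma nu_p_two: "nu_p p [a, b] = (if int p dvd a - b then 1 else 2)"
  by (simp add: nu_p_def mod_eq_iff_dvd card_insert_if)

lemma nu_p_three: "nu_p p [a, b, c] = (if int p dvd b - c then (if int p dvd a - b \<or> int p dvd a - c then 1 else 2)
    else if int p dvd a - b \<or> int p dvd a - c then 2 else 3)"
  by (simp add: nu_p_def mod_eq_iff_dvd card_insert_if)

lemma series_factor_one: "p \<ge> 2 \<Longrightarrow> series_factor [a] p = 1"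
proof -
  assume "p \<ge> 2"
  then have "1 - 1 / real p \<noteq> 0" by (simp add: field_simps)
  then show ?thesis by (simp add: series_factor_def nu_p_def power_int_minus)
qed

text \<open>For distinct shifts the local masses are the factors of the singular series. If the
  first two shifts agree, the factor \<open>1 - 1 / p\<close> split off with the zeta sum reduces
  the mass to the factor of the series in which the repeated shift is listed once.\<close>

lemma local_sum_values:
  assumes p: "p \<ge> 2"
  shows "local_sum 1 0 0 a b c p = 1"
    and "local_sum 1 1 0 a b c p = series_factor [a, b] p"
    and "local_sum 1 1 1 a b c p = series_factor [a, b, c] p"
    and "(1 - 1 / real p) * local_sum 1 1 0 a a c p = 1"
    and "(1 - 1 / real p) * local_sum 1 1 1 a a c p = series_factor [a, c] p"
proof -
  define q where "q = real p - 1"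
  have q: "q > 0" and pq: "real p = q + 1" using p by (auto simp: q_def)
  have q1: "q + 1 > 0" using q by simp
  have f: "1 - 1 / (q + 1) = q / (q + 1)" using q by (simp add: field_simps)
  have F2: "((q + 1) / q)\<^sup>2 * (1 - k / (q + 1)) = (q + 1) * (q + 1 - k) / q\<^sup>2" for k
  proof -
    have "1 - k / (q + 1) = (q + 1 - k) / (q + 1)" using q1 by (simp add: diff_divide_distrib)
    then show ?thesis using q1 by (simp add: power_divide power2_eq_square)
  qed
  have F3: "((q + 1) / q) ^ 3 * (1 - k / (q + 1)) = (q + 1)\<^sup>2 * (q + 1 - k) / q ^ 3" for k
  proof -
    have "1 - k / (q + 1) = (q + 1 - k) / (q + 1)" using q1 by (simp add: diff_divide_distrib)
    then show ?thesis using q1 by (simp add: power_divide power2_eq_square power3_eq_cube mult.assoc)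
  qed
  have s2: "series_factor [a, b] p = (q + 1) * (q + 1 - (if int p dvd a - b then 1 else 2)) / q\<^sup>2" for a b
    unfolding series_factor_def nu_p_two pq f F2[symmetric] using q
    by (simp add: power_int_minus power_divide inverse_eq_divide power2_eq_square)
  have s3: "series_factor [a, b, c] p = (q + 1)\<^sup>2 * (q + 1 - real (nu_p p [a, b, c])) / q ^ 3"
    unfolding series_factor_def pq f F3[symmetric] using q
    by (simp add: power_int_minus power_divide inverse_eq_divide power3_eq_cube)
  show "local_sum 1 0 0 a b c p = 1" by (simp add: local_sum_def pair_wt_def triple_wt_def)
  show "local_sum 1 1 0 a b c p = series_factor [a, b] p"
    unfolding s2 using q
    by (simp add: local_sum_def pair_wt_def triple_wt_def dvd_ind_def pq field_simps power2_eq_square)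
  show "local_sum 1 1 1 a b c p = series_factor [a, b, c] p"
    unfolding s3 using q
    by (cases rule: triple_wt_cases[of p a b c])
      (simp_all add: nu_p_three local_sum_def pair_wt_def triple_wt_def dvd_ind_def pq field_simps power2_eq_square power3_eq_cube)
  have "local_sum 1 1 0 a a c p = (q + 1) / q"
    using q by (simp add: local_sum_def pair_wt_def triple_wt_def dvd_ind_def pq field_simps power2_eq_square)
  then show "(1 - 1 / real p) * local_sum 1 1 0 a a c p = 1"
    unfolding pq f using q q1 by simp
  have "local_sum 1 1 1 a a c p = (q + 1) / q * ((q + 1) * (q + 1 - (if int p dvd a - c then 1 else 2)) / q\<^sup>2)"
    using q by (simp add: local_sum_def pair_wt_def triple_wt_def dvd_ind_def pq field_simps power2_eq_square power3_eq_cube)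
  then show "(1 - 1 / real p) * local_sum 1 1 1 a a c p = series_factor [a, c] p"
    unfolding s2 pq f using q q1 by simp
qed

section \<open>Three equal shifts\<close>

definition op_norm :: "('v \<Rightarrow> real) \<Rightarrow> (real \<times> 'v::comm_monoid_add) list \<Rightarrow> real" where
  "op_norm l xs = (\<Sum>x\<leftarrow>xs. \<bar>fst x\<bar> * exp (l (snd x)))"

lemma op_norm_simps [simp]: "op_norm l [] = 0" "op_norm l (x # xs) = \<bar>fst x\<bar> * exp (l (snd x)) + op_norm l xs"
  by (simp_all add: op_norm_def)

lemma op_norm_nonneg: "0 \<le> op_norm l xs"
  unfolding op_norm_def by (rule sum_list_nonneg) auto

lemma op_norm_append: "op_norm l (xs @ ys) = op_norm l xs + op_norm l ys"
  by (simp add: op_norm_def)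

text \<open>Equality holds because \<open>op_comp\<close> collects no equal shifts and the
  exponential of an additive functional is multiplicative.\<close>

lemma op_norm_comp:
  assumes "\<And>u v. l (u + v) = l u + l v"
  shows "op_norm l (op_comp xs ys) = op_norm l xs * op_norm l ys"
proof -
  have *: "op_norm l (map (\<lambda>y. (k * fst y, s + snd y)) ys) = \<bar>k\<bar> * exp (l s) * op_norm l ys" for k s
    by (induction ys) (simp_all add: assms exp_add abs_mult algebra_simps)
  show ?thesis
    by (induction xs) (simp_all add: op_comp_def op_norm_append * algebra_simps)
qed

definition ax1 :: vec4 where "ax1 = (1, 0, 0, 0)"
definition ax2 :: vec4 where "ax2 = (0, 1, 0, 0)"
definition ax3 :: vec4 where "ax3 = (0, 0, 1, 0)"
definition ax4 :: vec4 where "ax4 = (0, 0, 0, 1)"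
lemmas ax_defs = ax1_def ax2_def ax3_def ax4_def

lemma cone4_axes [simp]: "cone4 ax1" "cone4 ax2" "cone4 ax3" "cone4 ax4"
  by (simp_all add: cone4_def ax_defs)

definition phi_wt :: "nat \<Rightarrow> real" where "phi_wt p = 1 / (real p - 1)"
text \<open>This is \<open>triple_wt\<close> at three equal shifts, whose numerator
  \<open>3 * p - 2 - p\<^sup>2\<close> factors as \<open>- (p - 1) * (p - 2)\<close>.\<close>

definition diag_wt :: "nat \<Rightarrow> real" where "diag_wt p = - (real p - 2) / (real p - 1)\<^sup>2"

lemma phi_wt_nonneg: "prime p \<Longrightarrow> 0 \<le> phi_wt p"
  using prime_ge_2_nat[of p] by (simp add: phi_wt_def)

lemma diag_wt_le: "prime p \<Longrightarrow> \<bar>diag_wt p\<bar> \<le> phi_wt p"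
proof -
  assume "prime p"
  then have p: "real p \<ge> 2" using prime_ge_2_nat[of p] by simp
  have "\<bar>diag_wt p\<bar> = (real p - 2) / (real p - 1)\<^sup>2" using p by (simp add: diag_wt_def abs_divide)
  also have "\<dots> \<le> (real p - 1) / (real p - 1)\<^sup>2" by (intro divide_right_mono) auto
  also have "\<dots> = phi_wt p" using p by (simp add: phi_wt_def power2_eq_square)
  finally show ?thesis .
qed

text \<open>The algebraic source of the square: where a condition involves \<open>c\<close> and
  \<open>d\<close> only through \<open>c * d\<close>, their joint weight at \<open>p\<close> is the
  square of \<open>1 / \<phi>(p)\<close>, and this is also the weight of a common prime in the
  square of a totient sum.\<close>

lemma phi_plus_diag: "prime p \<Longrightarrow> phi_wt p + diag_wt p = phi_wt p * phi_wt p"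
proof -
  assume "prime p"
  then have "p \<ge> 2" by (rule prime_ge_2_nat)
  define q where "q = real p - 1"
  have q: "q \<noteq> 0" "real p = q + 1" using \<open>p \<ge> 2\<close> by (auto simp: q_def)
  show ?thesis unfolding phi_wt_def diag_wt_def q(2) using q(1) by (simp add: field_simps power2_eq_square)
qed

text \<open>The three axes stand here for \<open>b\<close>, \<open>c\<close> and \<open>d\<close>
  with \<open>a\<close> held fixed; a prime of \<open>a\<close> may divide none of them.\<close>

definition square_ops :: "nat \<Rightarrow> nat \<Rightarrow> (real \<times> vec4) list" where
  "square_ops a p = (if p dvd a then [(1, 0)] else
     [(1, 0), (phi_wt p, ln (real p) *\<^sub>R ax1), (phi_wt p, ln (real p) *\<^sub>R ax2), (diag_wt p, ln (real p) *\<^sub>R ax3)])"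

definition lin_op :: "real \<Rightarrow> vec4 \<Rightarrow> (real \<times> vec4) list" where
  "lin_op k s = [(1, 0), (k, s)]"

text \<open>Formally \<open>(1 - x / p) * (1 - y / p) * (1 + z / p)\<close>: it removes the poles
  caused by \<open>b\<close> and \<open>c\<close> and compensates the alternating weight of
  \<open>d\<close>.\<close>

definition base_ops :: "nat \<Rightarrow> (real \<times> vec4) list" where
  "base_ops p = (let l = ln (real p); r = 1 / real p in
     op_comp (lin_op (- r) (l *\<^sub>R ax1)) (op_comp (lin_op (- r) (l *\<^sub>R ax2)) (lin_op r (l *\<^sub>R ax3))))"

text \<open>\<open>(1 + x/p)(1 + y/p)(1 - z/p)\<close> is an approximate inverse of \<^term>\<open>base_ops p\<close>; this is the
  remainder of \<^term>\<open>square_ops a p\<close>.\<close>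

definition rem_ops :: "nat \<Rightarrow> (real \<times> vec4) list" where
  "rem_ops p = (let l = ln (real p); r = 1 / real p in
     [(phi_wt p - r, l *\<^sub>R ax1), (phi_wt p - r, l *\<^sub>R ax2), (diag_wt p + r, l *\<^sub>R ax3),
      (- r\<^sup>2, l *\<^sub>R (ax1 + ax2)), (r\<^sup>2, l *\<^sub>R (ax1 + ax3)), (r\<^sup>2, l *\<^sub>R (ax2 + ax3)), (r ^ 3, l *\<^sub>R (ax1 + ax2 + ax3))])"

text \<open>The product of \<open>base_ops\<close> with its approximate inverse, in which only
  doubled shifts survive.\<close>

definition sq_ops :: "nat \<Rightarrow> (real \<times> vec4) list" where
  "sq_ops p = (let l = ln (real p); r = 1 / real p in
     op_comp (lin_op (- r\<^sup>2) ((2 * l) *\<^sub>R ax1)) (op_comp (lin_op (- r\<^sup>2) ((2 * l) *\<^sub>R ax2)) (lin_op (- r\<^sup>2) ((2 * l) *\<^sub>R ax3))))"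

text \<open>The product of \<open>square_ops\<close> and \<open>base_ops\<close>, regrouped. Away
  from the primes of \<open>a\<close> all nontrivial weights are visibly
  \<open>O(1 / p\<^sup>2)\<close>; in the raw product the terms of size \<open>1 / p\<close> cancel
  only when equal shifts are collected, which \<open>op_norm\<close> does not do.\<close>

definition full_ops :: "nat \<Rightarrow> nat \<Rightarrow> (real \<times> vec4) list" where
  "full_ops a p = (if p dvd a then base_ops p else sq_ops p @ op_comp (rem_ops p) (base_ops p))"

lemma shift_op_full_ops:
  "shift_op (op_comp (square_ops a p) (base_ops p)) \<phi> v = shift_op (full_ops a p) \<phi> v"
proof (cases "p dvd a")
  case True
  then show ?thesis by (simp add: full_ops_def square_ops_def shift_op_comp)
next
  case False
  define l r where "l = ln (real p)" and "r = 1 / real p"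
  define X1 X2 X3 where "X1 = l *\<^sub>R ax1" and "X2 = l *\<^sub>R ax2" and "X3 = l *\<^sub>R ax3"
  have d2: "(2 * l) *\<^sub>R ax1 = X1 + X1" "(2 * l) *\<^sub>R ax2 = X2 + X2" "(2 * l) *\<^sub>R ax3 = X3 + X3"
    by (simp_all add: X1_def X2_def X3_def scaleR_add_left[symmetric])
  have ds: "l *\<^sub>R (ax1 + ax2) = X1 + X2" "l *\<^sub>R (ax1 + ax3) = X1 + X3" "l *\<^sub>R (ax2 + ax3) = X2 + X3" "l *\<^sub>R (ax1 + ax2 + ax3) = X1 + X2 + X3"
    by (simp_all add: X1_def X2_def X3_def scaleR_add_right)
  define g w where "g = phi_wt p" and "w = diag_wt p"
  define Q where "Q = op_comp (lin_op r X1) (op_comp (lin_op r X2) (lin_op (- r) X3))"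
  have sq: "shift_op (op_comp Q (base_ops p)) \<psi> v = shift_op (sq_ops p) \<psi> v" for \<psi> v
  proof -
    have two: "shift_op (lin_op k s) (shift_op (lin_op (- k) s) \<psi>) = shift_op (lin_op (- k\<^sup>2) (s + s)) \<psi>" for k s \<psi>
      by (simp add: fun_eq_iff lin_op_def power2_eq_square algebra_simps)
    let ?A = "\<lambda>k s. shift_op (lin_op k s)"
    have "shift_op (op_comp Q (base_ops p)) \<psi> = ?A r X1 (?A r X2 (?A (- r) X3 (?A (- r) X1 (?A (- r) X2 (?A r X3 \<psi>)))))"
      unfolding Q_def base_ops_def Let_def shift_op_comp l_def[symmetric] r_def[symmetric] X1_def X2_def X3_def by (rule refl)
    also have "\<dots> = ?A r X1 (?A (- r) X1 (?A r X2 (?A (- r) X2 (?A r X3 (?A (- r) X3 \<psi>)))))"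
      by (simp only: shift_op_commute'[of "lin_op (- r) X3"] shift_op_commute'[of "lin_op r X2" "lin_op (- r) X1"])
    also have "\<dots> = ?A (- r\<^sup>2) (X1 + X1) (?A (- r\<^sup>2) (X2 + X2) (?A (- r\<^sup>2) (X3 + X3) \<psi>))"
      by (simp only: two)
    also have "\<dots> = shift_op (sq_ops p) \<psi>"
      unfolding sq_ops_def Let_def shift_op_comp l_def[symmetric] r_def[symmetric] d2 by (rule refl)
    finally show ?thesis by (rule fun_cong)
  qed
  have A: "shift_op (square_ops a p) \<psi> v = shift_op (Q @ rem_ops p) \<psi> v" for \<psi> v
  proof -
    have "square_ops a p = [(1, 0), (g, X1), (g, X2), (w, X3)]"
      using False by (simp add: square_ops_def X1_def X2_def X3_def l_def g_def w_def)
    moreover have "rem_ops p = [(g - r, X1), (g - r, X2), (w + r, X3), (- r\<^sup>2, X1 + X2), (r\<^sup>2, X1 + X3), (r\<^sup>2, X2 + X3), (r ^ 3, X1 + X2 + X3)]"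
      unfolding rem_ops_def Let_def l_def[symmetric] r_def[symmetric] ds g_def w_def X1_def X2_def X3_def by (rule refl)
    ultimately show ?thesis
      by (simp add: Q_def op_comp_def lin_op_def algebra_simps power2_eq_square power3_eq_cube)
  qed
  have "shift_op (op_comp (square_ops a p) (base_ops p)) \<phi> v = shift_op (Q @ rem_ops p) (shift_op (base_ops p) \<phi>) v"
    by (simp only: shift_op_comp A)
  also have "\<dots> = shift_op (op_comp Q (base_ops p)) \<phi> v + shift_op (op_comp (rem_ops p) (base_ops p)) \<phi> v"
    by (simp only: shift_op_append shift_op_comp)
  also have "\<dots> = shift_op (full_ops a p) \<phi> v"
    using False by (simp only: sq full_ops_def if_False shift_op_append)
  finally show ?thesis .
qed

text \<open>Only the third coordinate is weighted, as \<open>smooth_tri\<close> turns out to grow in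
  that direction alone. With the quarter a doubled shift costs \<open>sqrt p\<close>, and
  \<open>sqrt p / p\<^sup>2\<close> is summable.\<close>

definition ht3 :: "vec4 \<Rightarrow> real" where "ht3 v = fst (snd (snd v)) / 4"

lemma ht3_add: "ht3 (u + v) = ht3 u + ht3 v" by (simp add: ht3_def add_divide_distrib)

text \<open>87 is \<open>7 + 10 * 8\<close>: the excess of \<open>sq_ops\<close>, then the bound for
  \<open>rem_ops\<close> times a crude bound for \<open>base_ops\<close>. At a prime of
  \<open>a\<close> only \<open>base_ops\<close> acts, which is worse; the resulting factor is
  averaged over \<open>a\<close> in \<open>weighted_phi_sum\<close>.\<close>

lemma full_ops_norm:
  assumes p: "p \<ge> 2"
  shows "op_norm ht3 (full_ops a p) \<le> (1 + 87 * real p powr (- (3 / 2))) * (if p dvd a then 1 + 7 * real p powr (- (1 / 2)) else 1)"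
proof -
  have p2: "real p \<ge> 2" using p by simp
  define l r z where "l = ln (real p)" and "r = 1 / real p" and "z = real p powr (1 / 4)"
  have r: "0 \<le> r" "r \<le> 1 / 2" using p2 by (auto simp: r_def field_simps)
  have z1: "1 \<le> z" unfolding z_def using p2 by (intro ge_one_powr_ge_zero) auto
  have ez: "exp (ht3 (l *\<^sub>R ax3)) = z" "exp (ht3 ((2 * l) *\<^sub>R ax3)) = z * z" "exp (ht3 (l *\<^sub>R (ax1 + ax3))) = z"
    "exp (ht3 (l *\<^sub>R (ax2 + ax3))) = z" "exp (ht3 (l *\<^sub>R (ax1 + ax2 + ax3))) = z"
    using p2 by (auto simp: ht3_def ax_defs l_def z_def powr_def exp_add[symmetric])
  have e1: "exp (ht3 (l *\<^sub>R ax1)) = 1" "exp (ht3 (l *\<^sub>R ax2)) = 1" "exp (ht3 ((2 * l) *\<^sub>R ax1)) = 1"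
    "exp (ht3 ((2 * l) *\<^sub>R ax2)) = 1" "exp (ht3 (l *\<^sub>R (ax1 + ax2))) = 1" "exp (ht3 0) = 1"
    by (auto simp: ht3_def ax_defs)
  have lin: "op_norm ht3 (lin_op k s) = 1 + \<bar>k\<bar> * exp (ht3 s)" for k s by (simp add: lin_op_def e1)
  have rp: "r = real p powr (- 1)" using p2 by (simp add: r_def powr_minus divide_inverse)
  have r2p: "r\<^sup>2 = real p powr (- 2)" using p2 by (simp add: r_def powr_minus powr_numeral divide_inverse power_inverse)
  have rz: "r * z = real p powr (- (3 / 4))" unfolding rp z_def powr_add[symmetric] by simp
  have r2z: "r\<^sup>2 * z = real p powr (- (7 / 4))" unfolding r2p z_def powr_add[symmetric] by simp
  have r2zz: "r\<^sup>2 * (z * z) = real p powr (- (3 / 2))" unfolding r2p z_def powr_add[symmetric] by simp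
  define s where "s = real p powr (- (3 / 2))"
  define t where "t = real p powr (- (1 / 2))"
  have st0: "0 \<le> s" "0 \<le> t" by (auto simp: s_def t_def)
  have s1: "s \<le> 1" "t \<le> 1" unfolding s_def t_def using p2 powr_mono[of _ 0 "real p"] by auto
  have mono: "real p powr x \<le> real p powr y" if "x \<le> y" for x y using that p2 by (intro powr_mono) auto
  have rt: "r \<le> t" "r * z \<le> t" unfolding rz t_def by (simp_all only: rp) (intro mono, simp)+
  have rs: "r\<^sup>2 \<le> s" "r\<^sup>2 * z \<le> s" "r\<^sup>2 * (z * z) = s"
    unfolding r2z r2zz s_def by (simp_all only: r2p) (intro mono, simp)+
  have base: "op_norm ht3 (base_ops p) = (1 + r) * ((1 + r) * (1 + r * z))"
    unfolding base_ops_def Let_def l_def[symmetric] r_def[symmetric] using r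
    by (simp add: op_norm_comp[OF ht3_add] lin e1 ez)
  have cube: "(1 + u) * ((1 + u) * (1 + u)) \<le> 1 + 7 * u" if "0 \<le> u" "u \<le> 1" for u :: real
  proof -
    have "u * u \<le> u" "u * (u * u) \<le> u * u" using that mult_left_le[of u u] mult_left_le[of u "u * u"] by (auto simp: mult.commute)
    then show ?thesis by (simp add: algebra_simps)
  qed
  show ?thesis
  proof (cases "p dvd a")
    case True
    have "op_norm ht3 (full_ops a p) \<le> (1 + t) * ((1 + t) * (1 + t))"
      unfolding full_ops_def if_P[OF True] base using rt r z1 by (intro mult_mono add_mono) auto
    also have "\<dots> \<le> 1 + 7 * t" by (rule cube[OF st0(2) s1(2)])
    also have "\<dots> \<le> (1 + 87 * s) * (1 + 7 * t)" using st0 mult_right_mono[of 1 "1 + 87 * s" "1 + 7 * t"] by simp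
    finally show ?thesis using True by (simp add: s_def t_def)
  next
    case False
    have sq: "op_norm ht3 (sq_ops p) \<le> 1 + 7 * s"
    proof -
      have "op_norm ht3 (sq_ops p) = (1 + r\<^sup>2) * ((1 + r\<^sup>2) * (1 + r\<^sup>2 * (z * z)))"
        unfolding sq_ops_def Let_def l_def[symmetric] r_def[symmetric]
        by (simp add: op_norm_comp[OF ht3_add] lin e1 ez)
      also have "\<dots> \<le> (1 + s) * ((1 + s) * (1 + s))" using rs st0 z1 by (intro mult_mono add_mono) auto
      also have "\<dots> \<le> 1 + 7 * s" by (rule cube[OF st0(1) s1(1)])
      finally show ?thesis .
    qed
    have "real p * (real p / 2) \<le> real p * (real p - 1)" using p2 by (intro mult_left_mono) auto
    then have "1 / (real p * (real p - 1)) \<le> 1 / (real p * (real p / 2))" using p2 by (intro frac_le) auto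
    also have "\<dots> = 2 * r\<^sup>2" by (simp add: r_def power2_eq_square)
    finally have inv: "1 / (real p * (real p - 1)) \<le> 2 * r\<^sup>2" .
    have g: "\<bar>phi_wt p - r\<bar> \<le> 2 * r\<^sup>2"
    proof -
      have "phi_wt p - r = 1 / (real p * (real p - 1))" using p2 by (simp add: phi_wt_def r_def field_simps)
      then show ?thesis using inv p2 by simp
    qed
    have w: "\<bar>diag_wt p + r\<bar> \<le> 2 * r\<^sup>2"
    proof -
      define q where "q = real p - 1"
      have q: "q \<ge> 1" "real p = q + 1" using p2 by (auto simp: q_def)
      have "diag_wt p + r = 1 / ((q + 1) * (q * q))"
        unfolding diag_wt_def r_def q(2) using q(1) by (simp add: field_simps power2_eq_square)
      moreover have "(q + 1) * q \<le> (q + 1) * (q * q)" using q(1) mult_left_mono[of 1 q q] by (intro mult_left_mono) auto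
      then have "1 / ((q + 1) * (q * q)) \<le> 1 / ((q + 1) * q)" using q(1) by (intro frac_le) auto
      moreover have "0 \<le> 1 / ((q + 1) * (q * q))" using q(1) by simp
      ultimately show ?thesis using inv unfolding q_def[symmetric] q(2) by simp
    qed
    have r3: "r ^ 3 \<le> r\<^sup>2" using r by (intro power_decreasing) auto
    have "op_norm ht3 (rem_ops p) = \<bar>phi_wt p - r\<bar> + \<bar>phi_wt p - r\<bar> + \<bar>diag_wt p + r\<bar> * z + r\<^sup>2 + r\<^sup>2 * z + r\<^sup>2 * z + r ^ 3 * z"
      unfolding rem_ops_def Let_def l_def[symmetric] r_def[symmetric] using r by (simp add: e1 ez)
    also have "\<dots> \<le> 2 * r\<^sup>2 + 2 * r\<^sup>2 + 2 * r\<^sup>2 * z + r\<^sup>2 + r\<^sup>2 * z + r\<^sup>2 * z + r\<^sup>2 * z"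
      using g w r3 z1 by (intro add_mono mult_right_mono) auto
    also have "\<dots> \<le> 10 * s" unfolding mult.assoc using rs(1,2) by linarith
    finally have rem: "op_norm ht3 (rem_ops p) \<le> 10 * s" .
    have b8: "op_norm ht3 (base_ops p) \<le> 2 * (2 * 2)"
      unfolding base using rt s1 r z1 by (intro mult_mono) auto
    have "op_norm ht3 (full_ops a p) = op_norm ht3 (sq_ops p) + op_norm ht3 (rem_ops p) * op_norm ht3 (base_ops p)"
      unfolding full_ops_def if_not_P[OF False] by (simp only: op_norm_append op_norm_comp[OF ht3_add])
    also have "\<dots> \<le> (1 + 7 * s) + (10 * s) * (2 * (2 * 2))"
      using st0 by (intro add_mono sq mult_mono rem b8 op_norm_nonneg) auto
    finally show ?thesis using False by (simp add: s_def)
  qed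
qed

lemma line_sum_eq_shift_op: "line_sum M s e \<phi> = shift_op (map (\<lambda>n. (1 / real n ^ s, ln (real n) *\<^sub>R e)) [1..<Suc M]) \<phi>"
  by (simp add: fun_eq_iff line_sum_def shift_op_def interv_sum_list_conv_sum_set_nat atLeastLessThanSuc_atLeastAtMost comp_def
      del: upt_Suc)

lemma prod_op_line_sum_commute: "prod_op X ps (line_sum M s e \<phi>) = line_sum M s e (prod_op X ps \<phi>)"
  unfolding line_sum_eq_shift_op by (rule prod_op_commute_shift)

lemma line_sum_cong_cone:
  assumes "\<And>v. cone4 v \<Longrightarrow> \<phi> v = \<psi> v" "cone4 v" "cone4 e"
  shows "line_sum M s e \<phi> v = line_sum M s e \<psi> v"
  unfolding line_sum_def
proof (intro sum.cong refl arg_cong2[where f = "(*)"])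
  fix n assume "n \<in> {1..M}"
  then have "0 \<le> ln (real n)" by simp
  from assms(1)[OF cone4_add[OF assms(2) cone4_scale[OF assms(3) this]]]
  show "\<phi> (v + ln (real n) *\<^sub>R e) = \<psi> (v + ln (real n) *\<^sub>R e)" .
qed

text \<open>The region \<open>b, c \<le> t\<close>, \<open>b * c * d \<le> R\<close> in logarithmic
  coordinates, with \<open>\<tau> = ln t\<close> and \<open>L = ln R\<close>.\<close>

definition tri_ind :: "real \<Rightarrow> real \<Rightarrow> vec4 \<Rightarrow> real" where
  "tri_ind \<tau> L v = of_bool (fst v \<le> \<tau> \<and> fst (snd v) \<le> \<tau> \<and> fst v + fst (snd v) + fst (snd (snd v)) \<le> L)"

text \<open>The inverse of \<open>base_ops\<close> applied to \<open>tri_ind\<close>. The factor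
  \<open>1 + z / p\<close> is inverted as \<open>(1 - z / p) / (1 - z\<^sup>2 / p\<^sup>2)\<close>,
  whence the Moebius product along \<open>ax3\<close> and the line sum with exponent 2 along
  \<open>2 *\<^sub>R ax3\<close>. The outcome is a sum over \<open>b\<close> and \<open>c\<close> of
  truncated sums of \<open>mu(d) / d\<close>.\<close>

definition smooth_tri :: "nat \<Rightarrow> nat list \<Rightarrow> real \<Rightarrow> real \<Rightarrow> vec4 \<Rightarrow> real" where
  "smooth_tri M ps \<tau> L = line_sum M 1 ax1 (line_sum M 1 ax2
     (prod_op (\<lambda>p. lin_op (- (1 / real p)) (ln (real p) *\<^sub>R ax3)) ps (line_sum M 2 (2 *\<^sub>R ax3) (tri_ind \<tau> L))))"

text \<open>The three coordinates are undone one at a time. Line sums commute with products over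
  primes, so each inversion acts on \<open>tri_ind\<close> itself, which vanishes beyond
  \<open>M\<close> along every axis.\<close>

lemma prod_op_base_ops:
  assumes ps: "distinct ps" "set ps = primes_upto M" and M: "exp L \<le> real M" and L: "L \<ge> 0" "\<tau> \<le> L"
    and v: "cone4 v"
  shows "prod_op base_ops ps (smooth_tri M ps \<tau> L) v = tri_ind \<tau> L v"
proof -
  have ps': "set ps = {p. prime p \<and> p \<le> M}" using ps by (simp add: primes_upto_def)
  have "1 \<le> exp L" using L by simp
  then have M1: "M \<ge> 1" using M by linarith
  have big: "L < ln (real n)" if n: "n > M" for n
  proof -
    have "exp L < real n" using M n by linarith
    then have "exp L < exp (ln (real n))" using n by simp
    then show ?thesis by simp
  qed
  let ?l = "\<lambda>p. ln (real p)"
  let ?X1 = "\<lambda>p. lin_op (- (1 / real p)) (?l p *\<^sub>R ax1)" and ?X2 = "\<lambda>p. lin_op (- (1 / real p)) (?l p *\<^sub>R ax2)"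
    and ?X3 = "\<lambda>p. lin_op (1 / real p) (?l p *\<^sub>R ax3)" and ?Z = "\<lambda>p. lin_op (- (1 / real p)) (?l p *\<^sub>R ax3)"
  let ?\<phi> = "tri_ind \<tau> L" and ?V = "line_sum M 2 (2 *\<^sub>R ax3) (tri_ind \<tau> L)"
  have c3: "prod_op ?X3 ps (prod_op ?Z ps ?V) v = ?\<phi> v" if v: "cone4 v" for v
  proof -
    have "prod_op ?X3 ps (prod_op ?Z ps ?V) v = prod_op (\<lambda>p. [(1, 0), (- (1 / real p ^ 2), ?l p *\<^sub>R (2 *\<^sub>R ax3))]) ps ?V v"
      unfolding prod_op_comp[symmetric]
    proof (rule fun_cong[OF prod_op_cong])
      fix p :: nat and \<phi> :: "vec4 \<Rightarrow> real" and v
      have "?l p *\<^sub>R ax3 + ?l p *\<^sub>R ax3 = (2 * ?l p) *\<^sub>R ax3" by (simp add: scaleR_add_left[symmetric])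
      then show "shift_op (op_comp (?X3 p) (?Z p)) \<phi> v = shift_op [(1, 0), (- (1 / real p ^ 2), ?l p *\<^sub>R (2 *\<^sub>R ax3))] \<phi> v"
        by (simp add: op_comp_def lin_op_def power2_eq_square mult.commute)
    qed
    also have "\<dots> = ?\<phi> v"
    proof (rule prod_op_line_sum[OF ps(1) ps' M1])
      fix n assume "n > M"
      then show "?\<phi> (v + ln (real n) *\<^sub>R (2 *\<^sub>R ax3)) = 0" using big[of n] v L
        by (auto simp: tri_ind_def ax_defs cone4_def)
    qed
    finally show ?thesis .
  qed
  have c2: "prod_op ?X2 ps (line_sum M 1 ax2 ?\<phi>) v = ?\<phi> v" if v: "cone4 v" for v
  proof -
    have "prod_op (\<lambda>p. [(1, 0), (- (1 / real p ^ 1), ?l p *\<^sub>R ax2)]) ps (line_sum M 1 ax2 ?\<phi>) v = ?\<phi> v"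
    proof (rule prod_op_line_sum[OF ps(1) ps' M1])
      fix n assume "n > M"
      then show "?\<phi> (v + ln (real n) *\<^sub>R ax2) = 0" using big[of n] v L by (auto simp: tri_ind_def ax_defs cone4_def)
    qed
    then show ?thesis by (simp add: lin_op_def)
  qed
  have c1: "prod_op ?X1 ps (line_sum M 1 ax1 ?\<phi>) v = ?\<phi> v" if v: "cone4 v" for v
  proof -
    have "prod_op (\<lambda>p. [(1, 0), (- (1 / real p ^ 1), ?l p *\<^sub>R ax1)]) ps (line_sum M 1 ax1 ?\<phi>) v = ?\<phi> v"
    proof (rule prod_op_line_sum[OF ps(1) ps' M1])
      fix n assume "n > M"
      then show "?\<phi> (v + ln (real n) *\<^sub>R ax1) = 0" using big[of n] v L by (auto simp: tri_ind_def ax_defs cone4_def)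
    qed
    then show ?thesis by (simp add: lin_op_def)
  qed
  have cl: "cone4 (v + s)" if "p \<in> set ps" "(k, s) \<in> set (lin_op k' (?l p *\<^sub>R e))" "cone4 v" "cone4 e" for p k s v k' e
  proof -
    have "0 \<le> ?l p" using that(1) ps' prime_ge_1_nat by auto
    then show ?thesis using that(2-) by (auto simp: lin_op_def intro!: cone4_add cone4_scale)
  qed
  have cl1: "cone4 (v + s)" if "p \<in> set ps" "(k, s) \<in> set (?X1 p)" "cone4 v" for p k s v
    using cl[OF that] by simp
  have cl2: "cone4 (v + s)" if "p \<in> set ps" "(k, s) \<in> set (?X2 p)" "cone4 v" for p k s v
    using cl[OF that] by simp
  have "base_ops = (\<lambda>p. op_comp (?X1 p) (op_comp (?X2 p) (?X3 p)))"
    by (rule ext) (simp add: base_ops_def Let_def)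
  then have "prod_op base_ops ps (smooth_tri M ps \<tau> L) v
      = prod_op (\<lambda>p. op_comp (?X1 p) (op_comp (?X2 p) (?X3 p))) ps (smooth_tri M ps \<tau> L) v"
    by (rule arg_cong)
  also have "\<dots> = prod_op ?X1 ps (prod_op ?X2 ps (prod_op ?X3 ps (smooth_tri M ps \<tau> L))) v"
    by (simp only: prod_op_comp)
  also have "\<dots> = prod_op ?X1 ps (line_sum M 1 ax1 (prod_op ?X2 ps (line_sum M 1 ax2 (prod_op ?X3 ps (prod_op ?Z ps ?V))))) v"
    unfolding smooth_tri_def by (simp only: prod_op_line_sum_commute)
  also have "\<dots> = prod_op ?X1 ps (line_sum M 1 ax1 ?\<phi>) v"
  proof (rule prod_op_cong_cone[where C = cone4, OF cl1 _ v])
    fix v assume v: "cone4 v"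
    show "line_sum M 1 ax1 (prod_op ?X2 ps (line_sum M 1 ax2 (prod_op ?X3 ps (prod_op ?Z ps ?V)))) v = line_sum M 1 ax1 ?\<phi> v"
    proof (rule line_sum_cong_cone[OF _ v])
      fix v assume v: "cone4 v"
      have "prod_op ?X2 ps (line_sum M 1 ax2 (prod_op ?X3 ps (prod_op ?Z ps ?V))) v = prod_op ?X2 ps (line_sum M 1 ax2 ?\<phi>) v"
      proof (rule prod_op_cong_cone[where C = cone4, OF cl2 _ v])
        fix v assume "cone4 v"
        then show "line_sum M 1 ax2 (prod_op ?X3 ps (prod_op ?Z ps ?V)) v = line_sum M 1 ax2 ?\<phi> v"
          by (intro line_sum_cong_cone c3) auto
      qed
      then show "prod_op ?X2 ps (line_sum M 1 ax2 (prod_op ?X3 ps (prod_op ?Z ps ?V))) v = ?\<phi> v" using c2[OF v] by simp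
    qed simp
  qed
  also have "\<dots> = ?\<phi> v" by (rule c1[OF v])
  finally show ?thesis .
qed

text \<open>For each \<open>k\<close> of the line sum with exponent 2, the rest is the triple
  Moebius sum with sides \<open>t1\<close>, \<open>t2\<close> and hyperbola parameter
  \<open>x / k\<^sup>2\<close>. The coordinates \<open>v1\<close>, \<open>v2\<close> shrink box and
  hyperbola alike, so \<open>2 * \<tau> \<le> L\<close> bounds the overshoot by
  \<open>v3 + 2 * ln k\<close>, which is independent of them and summable against
  \<open>1 / k\<^sup>2\<close>.\<close>

lemma smooth_tri_bound:
  obtains C where "C \<ge> 0" "\<And>M ps \<tau> L v. distinct ps \<Longrightarrow> set ps = primes_upto M \<Longrightarrow> exp L \<le> real M \<Longrightarrow> 2 * \<tau> \<le> L \<Longrightarrow> 0 \<le> \<tau> \<Longrightarrow>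
    cone4 v \<Longrightarrow> \<bar>smooth_tri M ps \<tau> L v\<bar> \<le> C * exp (ht3 v)"
proof -
  obtain C0 where C0: "C0 \<ge> 0" "\<And>t1 t2 x. t1 > 0 \<Longrightarrow> t2 > 0 \<Longrightarrow> x > 0 \<Longrightarrow>
    \<bar>\<Sum>b\<in>upto_real t1. \<Sum>c\<in>upto_real t2. mobius_sum (x / (real b * real c)) / (real b * real c)\<bar>
      \<le> C0 + max 0 (ln (t1 * t2 / x))"
    using triple_mobius_bound by blast
  obtain K where K: "K \<ge> 0" "\<And>P. finite P \<Longrightarrow> (\<Sum>p\<in>P. real p powr (- (3 / 2))) \<le> K"
    using sum_powr_bound[of "3 / 2"] by auto
  define C where "C = (C0 + 8) * K"
  have "C \<ge> 0" using C0 K by (simp add: C_def)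
  moreover have "\<bar>smooth_tri M ps \<tau> L v\<bar> \<le> C * exp (ht3 v)"
    if ps: "distinct ps" "set ps = primes_upto M" and M: "exp L \<le> real M" and L: "2 * \<tau> \<le> L" "0 \<le> \<tau>" and v: "cone4 v"
    for M ps \<tau> L v
  proof -
    obtain v1 v2 v3 v4 where v_eq: "v = (v1, v2, v3, v4)" by (cases v)
    have v0: "v1 \<ge> 0" "v2 \<ge> 0" "v3 \<ge> 0" using v by (auto simp: v_eq cone4_def)
    define t1 t2 x where "t1 = exp (\<tau> - v1)" and "t2 = exp (\<tau> - v2)" and "x = exp (L - v1 - v2 - v3)"
    have "\<tau> \<le> L" using L by linarith
    then have tM: "t1 \<le> real M" "t2 \<le> real M" "x \<le> real M" using M v0
      by (auto simp: t1_def t2_def x_def intro!: order_trans[OF _ M])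
    have lnb: "\<tau> \<ge> v1 + ln (real b) \<longleftrightarrow> real b \<le> t1" "\<tau> \<ge> v2 + ln (real b) \<longleftrightarrow> real b \<le> t2" if "b \<ge> 1" for b
      using that ln_le_cancel_iff[of "real b" t1] ln_le_cancel_iff[of "real b" t2] by (auto simp: t1_def t2_def algebra_simps)
    define P where "P = primes_upto M"
    define D where "D b c k = (\<Sum>d\<in>sqf P. wprod (\<lambda>p. - (1 / real p)) d * of_bool (v1 + ln (real b) + (v2 + ln (real c)) + (v3 + ln (real d) + 2 * ln (real k)) \<le> L))" for b c k
    have Z: "prod_op (\<lambda>p. lin_op (- (1 / real p)) (ln (real p) *\<^sub>R ax3)) ps \<psi> u
        = (\<Sum>d\<in>sqf P. wprod (\<lambda>p. - (1 / real p)) d * \<psi> (u + ln (real d) *\<^sub>R ax3))" for \<psi> u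
      unfolding lin_op_def P_def ps(2)[symmetric] using ps prime_primes_upto by (intro sum_wprod_prod_op[symmetric]) auto
    have "smooth_tri M ps \<tau> L v = (\<Sum>b=1..M. \<Sum>c=1..M. \<Sum>d\<in>sqf P. \<Sum>k=1..M. 1 / real b * (1 / real c * (wprod (\<lambda>p. - (1 / real p)) d * (1 / real k ^ 2 *
        of_bool (v1 + ln (real b) \<le> \<tau> \<and> v2 + ln (real c) \<le> \<tau> \<and> v1 + ln (real b) + (v2 + ln (real c)) + (v3 + ln (real d) + 2 * ln (real k)) \<le> L)))))"
      unfolding smooth_tri_def Z
      by (simp add: line_sum_def Z tri_ind_def v_eq ax_defs sum_distrib_left algebra_simps)
    also have "\<dots> = (\<Sum>b=1..M. \<Sum>c=1..M. \<Sum>k=1..M. of_bool (v1 + ln (real b) \<le> \<tau>) * (of_bool (v2 + ln (real c) \<le> \<tau>) * (1 / real k ^ 2 * (D b c k / (real b * real c)))))"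
    proof (rule sum.cong[OF refl], rule sum.cong[OF refl])
      fix b c
      have "(\<Sum>d\<in>sqf P. \<Sum>k=1..M. 1 / real b * (1 / real c * (wprod (\<lambda>p. - (1 / real p)) d * (1 / real k ^ 2 *
          of_bool (v1 + ln (real b) \<le> \<tau> \<and> v2 + ln (real c) \<le> \<tau> \<and> v1 + ln (real b) + (v2 + ln (real c)) + (v3 + ln (real d) + 2 * ln (real k)) \<le> L)))))
        = (\<Sum>k=1..M. \<Sum>d\<in>sqf P. of_bool (v1 + ln (real b) \<le> \<tau>) * (of_bool (v2 + ln (real c) \<le> \<tau>) * (1 / real k ^ 2 *
          (wprod (\<lambda>p. - (1 / real p)) d * of_bool (v1 + ln (real b) + (v2 + ln (real c)) + (v3 + ln (real d) + 2 * ln (real k)) \<le> L) / (real b * real c)))))"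
        by (subst sum.swap) (intro sum.cong refl, simp add: of_bool_conj)
      also have "\<dots> = (\<Sum>k=1..M. of_bool (v1 + ln (real b) \<le> \<tau>) * (of_bool (v2 + ln (real c) \<le> \<tau>) * (1 / real k ^ 2 * (D b c k / (real b * real c)))))"
        unfolding D_def by (simp only: sum_distrib_left[symmetric] sum_divide_distrib[symmetric])
      finally show "(\<Sum>d\<in>sqf P. \<Sum>k=1..M. 1 / real b * (1 / real c * (wprod (\<lambda>p. - (1 / real p)) d * (1 / real k ^ 2 *
          of_bool (v1 + ln (real b) \<le> \<tau> \<and> v2 + ln (real c) \<le> \<tau> \<and> v1 + ln (real b) + (v2 + ln (real c)) + (v3 + ln (real d) + 2 * ln (real k)) \<le> L)))))
        = (\<Sum>k=1..M. of_bool (v1 + ln (real b) \<le> \<tau>) * (of_bool (v2 + ln (real c) \<le> \<tau>) * (1 / real k ^ 2 * (D b c k / (real b * real c)))))" .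
    qed
    also have "\<dots> = (\<Sum>k=1..M. 1 / real k ^ 2 * (\<Sum>b\<in>upto_real t1. \<Sum>c\<in>upto_real t2. D b c k / (real b * real c)))"
    proof -
      have f: "(\<Sum>b=1..M. of_bool (v1 + ln (real b) \<le> \<tau>) * f b) = (\<Sum>b\<in>upto_real t1. f b)" for f :: "nat \<Rightarrow> real"
        using lnb(1) tM(1) by (intro sum.mono_neutral_cong_right) (auto simp: mem_upto_real)
      have g: "(\<Sum>b=1..M. of_bool (v2 + ln (real b) \<le> \<tau>) * f b) = (\<Sum>b\<in>upto_real t2. f b)" for f :: "nat \<Rightarrow> real"
        using lnb(2) tM(2) by (intro sum.mono_neutral_cong_right) (auto simp: mem_upto_real)
      have "(\<Sum>b=1..M. \<Sum>c=1..M. \<Sum>k=1..M. of_bool (v1 + ln (real b) \<le> \<tau>) * (of_bool (v2 + ln (real c) \<le> \<tau>) * (1 / real k ^ 2 * (D b c k / (real b * real c)))))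
          = (\<Sum>k=1..M. \<Sum>b=1..M. \<Sum>c=1..M. of_bool (v1 + ln (real b) \<le> \<tau>) * (of_bool (v2 + ln (real c) \<le> \<tau>) * (1 / real k ^ 2 * (D b c k / (real b * real c)))))"
      proof -
        have "(\<Sum>b\<in>B. \<Sum>c\<in>B. \<Sum>k\<in>B. h b c k) = (\<Sum>k\<in>B. \<Sum>b\<in>B. \<Sum>c\<in>B. h b c k)" for h :: "nat \<Rightarrow> nat \<Rightarrow> nat \<Rightarrow> real" and B
        proof -
          have "(\<Sum>b\<in>B. \<Sum>c\<in>B. \<Sum>k\<in>B. h b c k) = (\<Sum>b\<in>B. \<Sum>k\<in>B. \<Sum>c\<in>B. h b c k)" by (intro sum.cong refl sum.swap)
          also have "\<dots> = (\<Sum>k\<in>B. \<Sum>b\<in>B. \<Sum>c\<in>B. h b c k)" by (rule sum.swap)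
          finally show ?thesis .
        qed
        then show ?thesis .
      qed
      also have "\<dots> = (\<Sum>k=1..M. \<Sum>b\<in>upto_real t1. \<Sum>c\<in>upto_real t2. 1 / real k ^ 2 * (D b c k / (real b * real c)))"
        by (simp only: sum_distrib_left[symmetric] f g)
      finally show ?thesis by (simp only: sum_distrib_left)
    qed
    also have "\<dots> = (\<Sum>k=1..M. 1 / real k ^ 2 * (\<Sum>b\<in>upto_real t1. \<Sum>c\<in>upto_real t2. mobius_sum (x / (real k)\<^sup>2 / (real b * real c)) / (real b * real c)))"
    proof (intro sum.cong refl arg_cong2[where f = "(*)"] arg_cong2[where f = "(/)"])
      fix k b c assume "k \<in> {1..M}" "b \<in> upto_real t1" "c \<in> upto_real t2"
      then have k: "real k \<ge> 1" "real b \<ge> 1" "real c \<ge> 1" by (auto simp: mem_upto_real)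
      define y where "y = x / (real k)\<^sup>2 / (real b * real c)"
      have lny: "y > 0" "ln y = L - v1 - v2 - v3 - 2 * ln (real k) - ln (real b) - ln (real c)"
        using k by (auto simp: y_def x_def ln_div ln_mult ln_realpow)
      \<comment> \<open>This ensures that the squarefree \<open>d \<le> y\<close> all lie in
        \<open>sqf P\<close>, so that the sum over \<open>d\<close> is a complete
        \<open>mobius_sum\<close>.\<close>
      have yM: "y \<le> real M"
      proof -
        have "1 * (1 * 1) \<le> (real k)\<^sup>2 * (real b * real c)" using k by (intro mult_mono) auto
        then have "x / ((real k)\<^sup>2 * (real b * real c)) \<le> x / 1" using k by (intro divide_left_mono) (auto simp: x_def)
        then show ?thesis using tM(3) by (simp add: y_def)
      qed
      have "D b c k = (\<Sum>d\<in>sqf P. of_bool (real d \<le> y) * wprod (\<lambda>p. - (1 / real p)) d)"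
        unfolding D_def
      proof (intro sum.cong refl)
        fix d assume "d \<in> sqf P"
        then have "d > 0" by (rule sqf_pos)
        then have "v1 + ln (real b) + (v2 + ln (real c)) + (v3 + ln (real d) + 2 * ln (real k)) \<le> L \<longleftrightarrow> real d \<le> y"
          using ln_le_cancel_iff[of "real d" y] lny by auto
        then show "wprod (\<lambda>p. - (1 / real p)) d * of_bool (v1 + ln (real b) + (v2 + ln (real c)) + (v3 + ln (real d) + 2 * ln (real k)) \<le> L)
           = of_bool (real d \<le> y) * wprod (\<lambda>p. - (1 / real p)) d" by simp
      qed
      also have "\<dots> = (\<Sum>d\<in>{d\<in>sqf P. real d \<le> y}. wprod (\<lambda>p. - (1 / real p)) d)"
        by (rule sum_filter_of_bool[symmetric]) (simp add: P_def finite_sqf prime_primes_upto)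
      also have "{d\<in>sqf P. real d \<le> y} = {d. squarefree d \<and> real d \<le> y}"
      proof (rule sqf_upto_eq)
        fix p assume p: "prime p" "real p \<le> y"
        then have "real p \<le> real M" using yM by linarith
        then show "p \<in> P" using p by (simp add: P_def primes_upto_def)
      qed
      also have "(\<Sum>d | squarefree d \<and> real d \<le> y. wprod (\<lambda>p. - (1 / real p)) d) = mobius_sum y"
        unfolding mobius_sum_def
      proof (rule sum.mono_neutral_cong_left)
        show "{d. squarefree d \<and> real d \<le> y} \<subseteq> upto_real y" by (auto simp: mem_upto_real Suc_le_eq intro!: Nat.gr0I)
        show "wprod (\<lambda>p. - (1 / real p)) d = moebius_mu d / real d" if "d \<in> {d. squarefree d \<and> real d \<le> y}" for d
        proof -
          have d: "squarefree d" using that by simp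
          have "wprod (\<lambda>p. - (1 / real p)) d = (\<Prod>p\<in>prime_factors d. -1 * (1 / real p))" by (simp add: wprod_def)
          also have "\<dots> = moebius_mu d * (1 / (\<Prod>p\<in>prime_factors d. real p))"
            using d by (simp only: prod.distrib) (simp add: moebius_mu_def prod_dividef)
          also have "(\<Prod>p\<in>prime_factors d. real p) = real d" using squarefree_prod_id[OF d] by (simp add: wprod_def)
          finally show ?thesis by simp
        qed
        show "\<forall>d\<in>upto_real y - {d. squarefree d \<and> real d \<le> y}. moebius_mu d / real d = 0"
          by (auto simp: mem_upto_real moebius_mu_def)
      qed simp
      finally show "D b c k = mobius_sum (x / (real k)\<^sup>2 / (real b * real c))" by (simp add: y_def)
    qed
    finally have eq: "smooth_tri M ps \<tau> L v = \<dots>" .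
    have "\<bar>smooth_tri M ps \<tau> L v\<bar> \<le> (\<Sum>k=1..M. (C0 + 8) * exp (v3 / 4) * real k powr (- (3 / 2)))"
      unfolding eq
    proof (rule order_trans[OF sum_abs], rule sum_mono)
      fix k assume "k \<in> {1..M}"
      then have k: "real k \<ge> 1" by simp
      define U where "U = (\<Sum>b\<in>upto_real t1. \<Sum>c\<in>upto_real t2. mobius_sum (x / (real k)\<^sup>2 / (real b * real c)) / (real b * real c))"
      have "\<bar>U\<bar> \<le> C0 + max 0 (ln (t1 * t2 / (x / (real k)\<^sup>2)))"
        unfolding U_def using k by (intro C0) (auto simp: t1_def t2_def x_def)
      also have "ln (t1 * t2 / (x / (real k)\<^sup>2)) = 2 * \<tau> - L + v3 + 2 * ln (real k)"
        using k by (simp add: t1_def t2_def x_def ln_div ln_mult ln_realpow)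
      also have "C0 + max 0 (2 * \<tau> - L + v3 + 2 * ln (real k)) \<le> C0 + (v3 + 2 * ln (real k))" using L v0 k by simp
      \<comment> \<open>Linear growth in \<open>v3\<close> is traded for the exponential weight of
        \<open>ht3\<close>, and the logarithm for \<open>sqrt k\<close>, which leaves the summable
        \<open>k powr (- (3 / 2))\<close>.\<close>
      also have "v3 + 2 * ln (real k) \<le> 4 * exp (v3 / 4) + 4 * sqrt (real k)"
        using exp_ge_add_one_self[of "v3 / 4"] ln_le_2_sqrt[of "real k"] k by linarith
      also have "C0 + (4 * exp (v3 / 4) + 4 * sqrt (real k)) \<le> (C0 + 8) * (exp (v3 / 4) * sqrt (real k))"
      proof -
        have s1: "sqrt (real k) \<ge> 1" "exp (v3 / 4) \<ge> 1" using k v0 by auto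
        then have "1 * 1 \<le> exp (v3 / 4) * sqrt (real k)" by (intro mult_mono) auto
        then have "C0 * 1 \<le> C0 * (exp (v3 / 4) * sqrt (real k))" using C0 by (intro mult_left_mono) auto
        moreover have "exp (v3 / 4) * 1 \<le> exp (v3 / 4) * sqrt (real k)" using s1 by (intro mult_left_mono) auto
        moreover have "1 * sqrt (real k) \<le> exp (v3 / 4) * sqrt (real k)" using s1 by (intro mult_right_mono) auto
        ultimately show ?thesis unfolding distrib_right mult_1 mult_1_right by linarith
      qed
      finally have "\<bar>U\<bar> \<le> (C0 + 8) * (exp (v3 / 4) * sqrt (real k))" by simp
      then have "\<bar>1 / real k ^ 2 * U\<bar> \<le> 1 / real k ^ 2 * ((C0 + 8) * (exp (v3 / 4) * sqrt (real k)))"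
        unfolding abs_mult using k by (intro mult_mono) auto
      also have "\<dots> = (C0 + 8) * exp (v3 / 4) * (sqrt (real k) / (real k)\<^sup>2)" by simp
      also have "sqrt (real k) / (real k)\<^sup>2 = real k powr (- (3 / 2))" using k by (intro sqrt_div_square) auto
      finally show "\<bar>1 / real k ^ 2 * (\<Sum>b\<in>upto_real t1. \<Sum>c\<in>upto_real t2. mobius_sum (x / (real k)\<^sup>2 / (real b * real c)) / (real b * real c))\<bar>
        \<le> (C0 + 8) * exp (v3 / 4) * real k powr (- (3 / 2))" unfolding U_def .
    qed
    also have "\<dots> = (C0 + 8) * exp (v3 / 4) * (\<Sum>k=1..M. real k powr (- (3 / 2)))" by (simp only: sum_distrib_left)
    also have "\<dots> \<le> (C0 + 8) * exp (v3 / 4) * K" using K(2)[of "{1..M}"] C0 by (intro mult_left_mono) auto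
    also have "\<dots> = C * exp (ht3 v)" by (simp add: C_def ht3_def v_eq)
    finally show ?thesis .
  qed
  ultimately show ?thesis using that by blast
qed

text \<open>\<open>tri_ind\<close> is the product of the \<open>base_ops\<close> applied to the
  slowly growing \<open>smooth_tri\<close>, and the combined local factors \<open>full_ops\<close>
  have norms with convergent product, except at the primes of \<open>a\<close>. Thus the
  cancellation through \<open>d\<close> is used once, inside \<open>smooth_tri\<close>, before
  absolute values are taken.\<close>

lemma square_sum_bound:
  obtains C where "C \<ge> 0" "\<And>M ps \<tau> L a. distinct ps \<Longrightarrow> set ps = primes_upto M \<Longrightarrow> exp L \<le> real M \<Longrightarrow> 2 * \<tau> \<le> L \<Longrightarrow> 0 \<le> \<tau> \<Longrightarrow>
    a \<in> sqf (primes_upto M) \<Longrightarrow> \<bar>prod_op (square_ops a) ps (tri_ind \<tau> L) 0\<bar> \<le> C * wprod (\<lambda>p. 1 + 7 * real p powr (- (1 / 2))) a"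
proof -
  obtain C1 where C1: "C1 \<ge> 0" "\<And>M ps \<tau> L v. distinct ps \<Longrightarrow> set ps = primes_upto M \<Longrightarrow> exp L \<le> real M \<Longrightarrow> 2 * \<tau> \<le> L \<Longrightarrow> 0 \<le> \<tau> \<Longrightarrow>
    cone4 v \<Longrightarrow> \<bar>smooth_tri M ps \<tau> L v\<bar> \<le> C1 * exp (ht3 v)"
    using smooth_tri_bound by blast
  obtain K where K: "K \<ge> 1" "\<And>P. finite P \<Longrightarrow> (\<Prod>p\<in>P. 1 + 87 * real p powr (- (3 / 2))) \<le> K"
    using prod_one_plus_powr_bound[of 87 "3 / 2"] by auto
  have "\<bar>prod_op (square_ops a) ps (tri_ind \<tau> L) 0\<bar> \<le> (K * C1) * wprod (\<lambda>p. 1 + 7 * real p powr (- (1 / 2))) a"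
    if ps: "distinct ps" "set ps = primes_upto M" and M: "exp L \<le> real M" and L: "2 * \<tau> \<le> L" "0 \<le> \<tau>" and a: "a \<in> sqf (primes_upto M)"
    for M ps \<tau> L a
  proof -
    have L': "L \<ge> 0" "\<tau> \<le> L" using L by auto
    have pr: "p \<ge> 2" "0 \<le> ln (real p)" if "p \<in> set ps" for p
    proof -
      show "p \<ge> 2" using that ps prime_primes_upto prime_ge_2_nat by auto
      then show "0 \<le> ln (real p)" by simp
    qed
    have cl: "cone4 (v + s)" if "p \<in> set ps" "(k, s) \<in> set (square_ops a p)" "cone4 v" for p k s v
      using that pr[OF that(1)] by (auto simp: square_ops_def intro!: cone4_add cone4_scale split: if_splits)
    have "prod_op (square_ops a) ps (tri_ind \<tau> L) 0 = prod_op (square_ops a) ps (prod_op base_ops ps (smooth_tri M ps \<tau> L)) 0"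
      using prod_op_base_ops[OF ps M L'] by (intro prod_op_cong_cone[where C = cone4, OF cl]) auto
    also have "\<dots> = prod_op (\<lambda>p. op_comp (square_ops a p) (base_ops p)) ps (smooth_tri M ps \<tau> L) 0"
      by (simp only: prod_op_comp)
    also have "\<dots> = prod_op (full_ops a) ps (smooth_tri M ps \<tau> L) 0"
      by (rule fun_cong[OF prod_op_cong]) (rule shift_op_full_ops)
    also have "\<bar>\<dots>\<bar> \<le> (\<Prod>p\<leftarrow>ps. (1 + 87 * real p powr (- (3 / 2))) * (if p dvd a then 1 + 7 * real p powr (- (1 / 2)) else 1)) * (C1 * exp (ht3 0))"
    proof (rule prod_op_bound_exp[where C = cone4])
      fix p k s v assume p: "p \<in> set ps" and ks: "(k, s) \<in> set (full_ops a p)" and v: "cone4 v"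
      have b: "cone4 s" if "(k, s) \<in> set (base_ops p)" for k s
        using that pr[OF p] by (auto simp: base_ops_def Let_def op_comp_def lin_op_def intro!: cone4_add cone4_scale)
      have q: "cone4 s" if "(k, s) \<in> set (sq_ops p)" for k s
        using that pr[OF p] by (auto simp: sq_ops_def Let_def op_comp_def lin_op_def intro!: cone4_add cone4_scale)
      have r: "cone4 s" if "(k, s) \<in> set (rem_ops p)" for k s
        using that pr[OF p] by (auto simp: rem_ops_def Let_def intro!: cone4_scale cone4_add)
      have rb: "cone4 s" if ks: "(k, s) \<in> set (op_comp (rem_ops p) (base_ops p))" for k s
      proof -
        obtain x y where "x \<in> set (rem_ops p)" "y \<in> set (base_ops p)" "s = snd x + snd y"
          using ks by (auto simp: op_comp_def)
        then show ?thesis using r[of "fst x" "snd x"] b[of "fst y" "snd y"] by (simp add: cone4_add)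
      qed
      have "cone4 s"
      proof (cases "p dvd a")
        case True
        then have "(k, s) \<in> set (base_ops p)" using ks by (simp only: full_ops_def if_True)
        then show ?thesis by (rule b)
      next
        case False
        then have "(k, s) \<in> set (sq_ops p) \<or> (k, s) \<in> set (op_comp (rem_ops p) (base_ops p))"
          using ks by (simp only: full_ops_def if_False set_append Un_iff)
        then show ?thesis using q rb by (elim disjE)
      qed
      then show "cone4 (v + s)" using v by (rule cone4_add[rotated])
    next
      fix v assume "cone4 v"
      then show "\<bar>smooth_tri M ps \<tau> L v\<bar> \<le> C1 * exp (ht3 v)" by (rule C1(2)[OF ps M L])
    next
      fix p assume "p \<in> set ps"
      from full_ops_norm[OF pr(1)[OF this], of a]
      show "(\<Sum>x\<leftarrow>full_ops a p. \<bar>fst x\<bar> * exp (ht3 (snd x))) \<le> (1 + 87 * real p powr (- (3 / 2))) * (if p dvd a then 1 + 7 * real p powr (- (1 / 2)) else 1)"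
        by (simp only: op_norm_def)
    qed (simp_all add: ht3_add C1)
    also have "\<dots> = (\<Prod>p\<in>primes_upto M. 1 + 87 * real p powr (- (3 / 2))) * wprod (\<lambda>p. 1 + 7 * real p powr (- (1 / 2))) a * C1"
      unfolding prod_list_eq_prod[OF ps(1)] ps(2) prod.distrib using a
      by (subst wprod_eq_flags[OF a]) (auto simp: prime_primes_upto ht3_def)
    also have "\<dots> \<le> K * wprod (\<lambda>p. 1 + 7 * real p powr (- (1 / 2))) a * C1"
      using K C1 by (intro mult_right_mono wprod_nonneg) auto
    finally show ?thesis by (simp add: mult_ac)
  qed
  then show ?thesis using that[of "K * C1"] K C1 by auto
qed

text \<open>\<open>1 / (p - 1)\<close> is the pair weight at equal shifts, so the totient sum is the
  mean of the square of \<open>lam 1\<close>, and its asymptotics are those of the case of two equal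
  shifts.\<close>

lemma phi_sum_eq_corr_mean:
  assumes R: "R \<ge> 1"
  shows "sqf_sum (primes_upto M) phi_wt R = corr_mean 1 1 0 h h h3 (primes_upto M) R"
proof -
  define ps where "ps = sorted_list_of_set (primes_upto M)"
  have ps: "distinct ps" "set ps = primes_upto M" by (auto simp: ps_def)
  have pr: "prime p" if "p \<in> set ps" for p using that ps prime_primes_upto by auto
  have "sqf_sum (primes_upto M) phi_wt R = (\<Sum>q\<in>sqf (set ps). wprod phi_wt q * box_ind (ln R) (0 + ln (real q) *\<^sub>R vec12))"
    unfolding sqf_sum_def ps(2)
  proof (intro sum.cong refl)
    fix q assume "q \<in> sqf (primes_upto M)"
    then have "q > 0" by (rule sqf_pos)
    then show "of_bool (real q \<le> R) * wprod phi_wt q = wprod phi_wt q * box_ind (ln R) (0 + ln (real q) *\<^sub>R vec12)"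
      using R by (simp add: box_ind_def vec_defs)
  qed
  also have "\<dots> = prod_op (\<lambda>p. [(1, 0), (phi_wt p, ln (real p) *\<^sub>R vec12)]) ps (box_ind (ln R)) 0"
    using ps pr by (intro sum_wprod_prod_op) auto
  also have "\<dots> = prod_op (corr_ops 1 1 0 h h h3) ps (box_ind (ln R)) 0"
  proof (rule fun_cong[OF prod_op_cong])
    fix p \<phi> v assume "p \<in> set ps"
    then have "p \<ge> 2" using pr prime_ge_2_nat by blast
    then show "shift_op [(1, 0), (phi_wt p, ln (real p) *\<^sub>R vec12)] \<phi> v = shift_op (corr_ops 1 1 0 h h h3 p) \<phi> v"
      by (simp add: corr_ops_def four_ops_def pair_wt_diag phi_wt_def) (simp add: pair_wt_def triple_wt_def)
  qed
  also have "\<dots> = corr_mean 1 1 0 h h h3 (primes_upto M) R"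
    using corr_mean_eq_prod_op[OF ps(1) pr R] ps(2) by simp
  finally show ?thesis .
qed

lemma phi_sum_asymp:
  obtains K where "K \<ge> 1" "\<And>M R. R \<ge> 1 \<Longrightarrow> R \<le> real M \<Longrightarrow> \<bar>sqf_sum (primes_upto M) phi_wt R - ln R\<bar> \<le> K"
proof -
  obtain K where K: "K \<ge> 1"
    "\<And>u3 h h3 M. u3 = 0 \<Longrightarrow> (\<Prod>p\<in>primes_upto M. 1 + pair_bad u3 h h3 p) * (1 + (\<Sum>p\<in>primes_upto M. 5 * ln (real p) * pair_bad u3 h h3 p)) \<le> K"
    using pair_error_bound by metis
  have "\<bar>sqf_sum (primes_upto M) phi_wt R - ln R\<bar> \<le> K" if R: "R \<ge> 1" "R \<le> real M" for M R
  proof -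
    have "(\<Prod>p\<in>primes_upto M. (1 - 1 / real p) * local_sum 1 1 0 0 0 0 p) = 1"
      using local_sum_values(4) prime_ge_2_nat[OF prime_primes_upto] by (intro prod.neutral) blast
    then show ?thesis
      using pair_mean_asymp[OF R(2,1), of 0 0 0] K(2)[of 0 0 0 M] unfolding phi_sum_eq_corr_mean[OF R(1), of M 0 0] by simp
  qed
  then show ?thesis using that K(1) by blast
qed

lemma sum_flag_collapse:
  assumes P: "finite P" "\<And>p. p \<in> P \<Longrightarrow> prime p" and F: "\<And>p. p \<in> P \<Longrightarrow> F p True = (0::real)"
  shows "(\<Sum>u\<in>sqf P. (\<Prod>p\<in>P. F p (p dvd u)) * \<phi> u) = (\<Prod>p\<in>P. F p False) * \<phi> 1"
proof -
  have one: "1 \<in> sqf P" by (auto simp: sqf_def)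
  have z: "(\<Prod>p\<in>P. F p (p dvd u)) = 0" if u: "u \<in> sqf P" "u \<noteq> 1" for u
  proof -
    obtain p where p: "prime p" "p dvd u" using u(2) prime_factor_nat by blast
    then have pP: "p \<in> P" using u(1) by (simp add: sqf_def)
    have "F p (p dvd u) = 0" using F[OF pP] p by simp
    then show ?thesis using pP P(1) by (subst prod_zero_iff) blast+
  qed
  have "(\<Sum>u\<in>sqf P. (\<Prod>p\<in>P. F p (p dvd u)) * \<phi> u) = (\<Sum>u\<in>{1}. (\<Prod>p\<in>P. F p (p dvd u)) * \<phi> u)"
    using one z finite_sqf[OF P] by (intro sum.mono_neutral_right) auto
  also have "\<dots> = (\<Prod>p\<in>P. F p False) * \<phi> 1"
  proof -
    have "\<not> p dvd 1" if "p \<in> P" for p using P(2)[OF that] not_prime_unit by blast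
    then show ?thesis by (simp cong: prod.cong)
  qed
  finally show ?thesis .
qed

section \<open>Coprime quadruples and their recombination\<close>

lemma coprime_sqf_iff:
  assumes "a \<in> sqf P" "\<And>p. p \<in> P \<Longrightarrow> prime p"
  shows "coprime a b \<longleftrightarrow> (\<forall>p\<in>P. \<not> (p dvd a \<and> p dvd b))"
proof
  assume c: "coprime a b"
  show "\<forall>p\<in>P. \<not> (p dvd a \<and> p dvd b)"
  proof
    fix p assume "p \<in> P"
    then have "\<not> p dvd 1" using assms(2) not_prime_unit by blast
    then show "\<not> (p dvd a \<and> p dvd b)" using c coprime_common_divisor by blast
  qed
next
  assume n: "\<forall>p\<in>P. \<not> (p dvd a \<and> p dvd b)"
  show "coprime a b"
  proof (rule ccontr)
    assume "\<not> coprime a b"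
    then have "gcd a b \<noteq> 1" using coprime_iff_gcd_eq_1[of a b] by blast
    then obtain p where p: "prime p" "p dvd gcd a b" using prime_factor_nat by blast
    then have d: "p dvd a" "p dvd b" using gcd_dvd1 gcd_dvd2 dvd_trans by blast+
    then have "p \<in> P" using assms(1) p(1) by (simp add: sqf_def)
    then show False using n d by blast
  qed
qed

definition cop4 :: "nat \<Rightarrow> nat \<Rightarrow> nat \<Rightarrow> nat \<Rightarrow> bool" where
  "cop4 a b c d \<longleftrightarrow> coprime a b \<and> coprime a c \<and> coprime a d \<and> coprime b c \<and> coprime b d \<and> coprime c d"

text \<open>Allowing at most one flag at each prime makes pairwise coprimality a local
  condition.\<close>

definition one_hot :: "(nat \<Rightarrow> real) \<Rightarrow> (nat \<Rightarrow> real) \<Rightarrow> (nat \<Rightarrow> real) \<Rightarrow> (nat \<Rightarrow> real) \<Rightarrow> nat \<Rightarrow> bool \<Rightarrow> bool \<Rightarrow> bool \<Rightarrow> bool \<Rightarrow> real" where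
  "one_hot e f g h p i j k l = (if (i \<and> j) \<or> (i \<and> k) \<or> (i \<and> l) \<or> (j \<and> k) \<or> (j \<and> l) \<or> (k \<and> l) then 0
     else (if i then e p else 1) * (if j then f p else 1) * (if k then g p else 1) * (if l then h p else 1))"

lemma prod_one_hot:
  assumes P: "finite P" "\<And>p. p \<in> P \<Longrightarrow> prime p" and S: "a \<in> sqf P" "b \<in> sqf P" "c \<in> sqf P" "d \<in> sqf P"
  shows "(\<Prod>p\<in>P. one_hot e f g h p (p dvd a) (p dvd b) (p dvd c) (p dvd d))
    = of_bool (cop4 a b c d) * (wprod e a * wprod f b * wprod g c * wprod h d)"
proof (cases "cop4 a b c d")
  case True
  have n: "\<forall>p\<in>P. \<not> (p dvd a \<and> p dvd b)" "\<forall>p\<in>P. \<not> (p dvd a \<and> p dvd c)" "\<forall>p\<in>P. \<not> (p dvd a \<and> p dvd d)"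
    "\<forall>p\<in>P. \<not> (p dvd b \<and> p dvd c)" "\<forall>p\<in>P. \<not> (p dvd b \<and> p dvd d)" "\<forall>p\<in>P. \<not> (p dvd c \<and> p dvd d)"
    using True S coprime_sqf_iff[OF _ P(2)] by (simp_all add: cop4_def)
  have "(\<Prod>p\<in>P. one_hot e f g h p (p dvd a) (p dvd b) (p dvd c) (p dvd d))
     = (\<Prod>p\<in>P. (if p dvd a then e p else 1) * (if p dvd b then f p else 1) * (if p dvd c then g p else 1) * (if p dvd d then h p else 1))"
    using n unfolding one_hot_def by (intro prod.cong refl if_not_P) blast
  also have "\<dots> = wprod e a * wprod f b * wprod g c * wprod h d"
    using S P by (simp add: prod.distrib wprod_eq_flags)
  finally show ?thesis using True by simp
next
  case False
  then obtain p where p: "p \<in> P" "(p dvd a \<and> p dvd b) \<or> (p dvd a \<and> p dvd c) \<or> (p dvd a \<and> p dvd d) \<or> (p dvd b \<and> p dvd c) \<or> (p dvd b \<and> p dvd d) \<or> (p dvd c \<and> p dvd d)"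
    using S coprime_sqf_iff[OF _ P(2)] unfolding cop4_def by metis
  then have "one_hot e f g h p (p dvd a) (p dvd b) (p dvd c) (p dvd d) = 0" unfolding one_hot_def by (rule_tac if_P)
  then have "(\<Prod>p\<in>P. one_hot e f g h p (p dvd a) (p dvd b) (p dvd c) (p dvd d)) = 0"
    using p(1) P(1) by (subst prod_zero_iff) blast+
  then show ?thesis using False by simp
qed

lemma flag_sum_one_hot:
  assumes P: "finite P" "\<And>p. p \<in> P \<Longrightarrow> prime p"
  shows "flag_sum P (one_hot e f g h) \<phi> = (\<Sum>a\<in>sqf P. \<Sum>b\<in>sqf P. \<Sum>c\<in>sqf P. \<Sum>d\<in>sqf P.
    of_bool (cop4 a b c d) * (wprod e a * wprod f b * wprod g c * wprod h d) * \<phi> a b c d)"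
  unfolding flag_sum_def by (intro sum.cong refl) (simp add: prod_one_hot[OF P])

lemma wprod_zero_fun:
  assumes "q \<in> sqf P" "q \<noteq> 1"
  shows "wprod (\<lambda>_. 0) q = 0"
proof -
  obtain p where "prime p" "p dvd q" using assms(2) prime_factor_nat by blast
  then have "p \<in> prime_factors q" using sqf_pos[OF assms(1)] by (simp add: in_prime_factors_iff)
  then show ?thesis unfolding wprod_def by (subst prod_zero_iff) auto
qed

lemma sum_wprod_zero_fun:
  fixes f :: "nat \<Rightarrow> real"
  assumes P: "finite P" "\<And>p. p \<in> P \<Longrightarrow> prime p"
  shows "(\<Sum>q\<in>sqf P. wprod (\<lambda>_. 0) q * f q) = f 1"
proof -
  have one: "1 \<in> sqf P" by (auto simp: sqf_def)
  have "(\<Sum>q\<in>sqf P. wprod (\<lambda>_. 0) q * f q) = (\<Sum>q\<in>sqf P. if q = 1 then f 1 else 0)"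
    using wprod_zero_fun by (intro sum.cong refl) auto
  then show ?thesis using one finite_sqf[OF P] by simp
qed

text \<open>Every prime of \<open>m = c * d\<close> chooses between \<open>c\<close> and
  \<open>d\<close>, which adds the local weights.\<close>

lemma merge_coprime_sum:
  assumes P: "finite P" "\<And>p. p \<in> P \<Longrightarrow> prime p"
  shows "(\<Sum>c\<in>sqf P. \<Sum>d\<in>sqf P. of_bool (coprime c d) * (wprod f c * wprod k d) * \<psi> (c * d)) = (\<Sum>m\<in>sqf P. wprod (\<lambda>p. f p + k p) m * \<psi> m)"
  using P
proof (induction P arbitrary: \<psi>)
  case (insert p P)
  have p: "prime p" "p \<notin> P" using insert by auto
  let ?S = "sqf P"
  have split: "(\<Sum>q\<in>sqf (insert p P). F q) = (\<Sum>q\<in>?S. F q + F (p * q))" for F :: "nat \<Rightarrow> real"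
    using insert p by (intro sum_sqf_insert) auto
  have nd: "\<not> p dvd c" "c > 0" "coprime p c" "coprime c p" if "c \<in> ?S" for c
  proof -
    show "\<not> p dvd c" by (rule sqf_not_dvd[OF that p])
    then show "coprime p c" using p(1) by (rule prime_imp_coprime[rotated])
    then show "coprime c p" by (simp add: coprime_commute)
    show "c > 0" using that by (rule sqf_pos)
  qed
  have w: "wprod F (p * c) = F p * wprod F c" if "c \<in> ?S" for c F
    using nd[OF that] p(1) by (intro wprod_prime_mult) auto
  have IH: "(\<Sum>c\<in>?S. \<Sum>d\<in>?S. of_bool (coprime c d) * (wprod f c * wprod k d) * \<psi> (c * d)) = (\<Sum>m\<in>?S. wprod (\<lambda>p. f p + k p) m * \<psi> m)" for \<psi>
    using insert by auto
  have "(\<Sum>c\<in>sqf (insert p P). \<Sum>d\<in>sqf (insert p P). of_bool (coprime c d) * (wprod f c * wprod k d) * \<psi> (c * d))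
      = (\<Sum>c\<in>?S. \<Sum>d\<in>?S. of_bool (coprime c d) * (wprod f c * wprod k d) * \<psi> (c * d)
         + (f p + k p) * (of_bool (coprime c d) * (wprod f c * wprod k d) * \<psi> (p * (c * d))))"
    unfolding split sum.distrib[symmetric]
    using p(1) not_prime_1
    by (intro sum.cong refl) (auto simp: nd(3,4) w mult.left_commute distrib_left distrib_right mult.assoc)
  also have "\<dots> = (\<Sum>m\<in>?S. wprod (\<lambda>p. f p + k p) m * \<psi> m) + (f p + k p) * (\<Sum>m\<in>?S. wprod (\<lambda>p. f p + k p) m * \<psi> (p * m))"
    by (simp only: sum.distrib sum_distrib_left[symmetric] IH IH[of "\<lambda>m. \<psi> (p * m)"])
  also have "\<dots> = (\<Sum>m\<in>sqf (insert p P). wprod (\<lambda>p. f p + k p) m * \<psi> m)"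
    unfolding split by (simp add: sum.distrib sum_distrib_left w mult.assoc)
  finally show ?case .
qed simp

text \<open>The substitution is \<open>x = m * a\<close>, \<open>y = m * b\<close> with
  \<open>m\<close> the gcd. Prime by prime, a prime dividing both \<open>x\<close> and
  \<open>y\<close> belongs to \<open>m\<close>, and one dividing a single variable belongs to
  \<open>a\<close> or \<open>b\<close>.\<close>

lemma gcd_split_sum:
  assumes P: "finite P" "\<And>p. p \<in> P \<Longrightarrow> prime p"
  shows "(\<Sum>x\<in>sqf P. \<Sum>y\<in>sqf P. wprod f x * wprod f y * \<psi> x y)
    = (\<Sum>m\<in>sqf P. \<Sum>a\<in>sqf P. \<Sum>b\<in>sqf P. of_bool (cop4 m a b 1) * ((wprod f m)\<^sup>2 * (wprod f a * wprod f b)) * \<psi> (m * a) (m * b))"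
proof -
  define E1 where "E1 p i j k l = (if k \<or> l then 0 else (if i then f p else 1) * (if j then f p else 1))" for p and i j k l :: bool
  define E2 where "E2 = one_hot (\<lambda>p. f p * f p) f f (\<lambda>_. 0)"
  have main: "flag_sum P E1 (\<lambda>x y z u. \<psi> x y) = flag_sum P E2 (\<lambda>m a b u. \<psi> (m * a) (m * b))" for \<psi>
    using P
  proof (induction P arbitrary: \<psi>)
    case empty
    show ?case by (simp add: flag_sum_def)
  next
    case (insert p P)
    have p: "prime p" "p \<notin> P" using insert by auto
    have IH: "flag_sum P E1 (\<lambda>x y z u. \<psi> x y) = flag_sum P E2 (\<lambda>m a b u. \<psi> (m * a) (m * b))" for \<psi>
      using insert by auto
    have 1: "flag_sum (insert p P) E \<phi> = (\<Sum>i\<in>UNIV. \<Sum>j\<in>UNIV. \<Sum>k\<in>UNIV. \<Sum>l\<in>UNIV.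
      E p i j k l * flag_sum P E (\<lambda>x y z u. \<phi> (pick i p * x) (pick j p * y) (pick k p * z) (pick l p * u)))" for E \<phi>
      using insert p by (intro flag_sum_insert) auto
    have "flag_sum (insert p P) E1 (\<lambda>x y z u. \<psi> x y) = flag_sum P E1 (\<lambda>x y z u. \<psi> x y) + f p * flag_sum P E1 (\<lambda>x y z u. \<psi> (p * x) y)
      + f p * flag_sum P E1 (\<lambda>x y z u. \<psi> x (p * y)) + f p * f p * flag_sum P E1 (\<lambda>x y z u. \<psi> (p * x) (p * y))"
      unfolding 1 by (simp add: UNIV_bool E1_def)
    also have "\<dots> = flag_sum P E2 (\<lambda>m a b u. \<psi> (m * a) (m * b)) + f p * flag_sum P E2 (\<lambda>m a b u. \<psi> (p * (m * a)) (m * b))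
      + f p * flag_sum P E2 (\<lambda>m a b u. \<psi> (m * a) (p * (m * b))) + f p * f p * flag_sum P E2 (\<lambda>m a b u. \<psi> (p * (m * a)) (p * (m * b)))"
      by (simp only: IH IH[of "\<lambda>x. \<psi> (p * x)"] IH[of "\<lambda>x y. \<psi> x (p * y)"] IH[of "\<lambda>x y. \<psi> (p * x) (p * y)"])
    also have "\<dots> = flag_sum (insert p P) E2 (\<lambda>m a b u. \<psi> (m * a) (m * b))"
      unfolding 1 by (simp add: UNIV_bool E2_def one_hot_def mult.assoc mult.left_commute)
    finally show ?case .
  qed
  have L: "flag_sum P E1 (\<lambda>x y z u. \<psi> x y) = (\<Sum>x\<in>sqf P. \<Sum>y\<in>sqf P. wprod f x * wprod f y * \<psi> x y)"
    unfolding flag_sum_def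
  proof (intro sum.cong refl)
    fix x y assume xy: "x \<in> sqf P" "y \<in> sqf P"
    have "(\<Sum>z\<in>sqf P. \<Sum>u\<in>sqf P. (\<Prod>p\<in>P. E1 p (p dvd x) (p dvd y) (p dvd z) (p dvd u)) * \<psi> x y)
        = (\<Sum>z\<in>sqf P. (\<Prod>p\<in>P. E1 p (p dvd x) (p dvd y) (p dvd z) False) * \<psi> x y)"
      by (intro sum.cong refl sum_flag_collapse[OF P]) (auto simp: E1_def)
    also have "\<dots> = (\<Prod>p\<in>P. E1 p (p dvd x) (p dvd y) False False) * \<psi> x y"
      by (rule sum_flag_collapse[OF P]) (auto simp: E1_def)
    also have "(\<Prod>p\<in>P. E1 p (p dvd x) (p dvd y) False False) = wprod f x * wprod f y"
      using xy P by (simp add: E1_def prod.distrib wprod_eq_flags)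
    finally show "(\<Sum>z\<in>sqf P. \<Sum>u\<in>sqf P. (\<Prod>p\<in>P. E1 p (p dvd x) (p dvd y) (p dvd z) (p dvd u)) * \<psi> x y) = wprod f x * wprod f y * \<psi> x y" .
  qed
  have fo: "flag_sum P (one_hot e f g h) \<phi> = (\<Sum>a\<in>sqf P. \<Sum>b\<in>sqf P. \<Sum>c\<in>sqf P. \<Sum>d\<in>sqf P.
    of_bool (cop4 a b c d) * (wprod e a * wprod f b * wprod g c * wprod h d) * \<phi> a b c d)" for e f g h \<phi>
    by (rule flag_sum_one_hot) (use P in auto)
  have R: "flag_sum P E2 (\<lambda>m a b u. \<psi> (m * a) (m * b))
      = (\<Sum>m\<in>sqf P. \<Sum>a\<in>sqf P. \<Sum>b\<in>sqf P. of_bool (cop4 m a b 1) * ((wprod f m)\<^sup>2 * (wprod f a * wprod f b)) * \<psi> (m * a) (m * b))"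
    unfolding E2_def fo
  proof (intro sum.cong refl)
    fix m a b
    have "(\<Sum>u\<in>sqf P. of_bool (cop4 m a b u) * (wprod (\<lambda>p. f p * f p) m * wprod f a * wprod f b * wprod (\<lambda>_. 0) u) * \<psi> (m * a) (m * b))
       = (\<Sum>u\<in>sqf P. wprod (\<lambda>_. 0) u * (of_bool (cop4 m a b u) * (wprod (\<lambda>p. f p * f p) m * wprod f a * wprod f b) * \<psi> (m * a) (m * b)))"
      by (intro sum.cong refl) simp
    also have "\<dots> = of_bool (cop4 m a b 1) * (wprod (\<lambda>p. f p * f p) m * wprod f a * wprod f b) * \<psi> (m * a) (m * b)"
      by (rule sum_wprod_zero_fun[OF P])
    finally show "(\<Sum>u\<in>sqf P. of_bool (cop4 m a b u) * (wprod (\<lambda>p. f p * f p) m * wprod f a * wprod f b * wprod (\<lambda>_. 0) u) * \<psi> (m * a) (m * b))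
       = of_bool (cop4 m a b 1) * ((wprod f m)\<^sup>2 * (wprod f a * wprod f b)) * \<psi> (m * a) (m * b)"
      by (simp add: wprod_times power2_eq_square mult.assoc)
  qed
  show ?thesis using main L R by simp
qed

definition quad_sum :: "nat set \<Rightarrow> (nat \<Rightarrow> nat \<Rightarrow> nat \<Rightarrow> nat \<Rightarrow> real) \<Rightarrow> real" where
  "quad_sum P \<phi> = flag_sum P (one_hot phi_wt phi_wt phi_wt diag_wt) \<phi>"

text \<open>A prime lies in exactly two moduli or in all three, which gives the four coprime
  variables. The additive map \<open>A\<close> sends their logarithms to those of the moduli, so the
  weights are unchanged and the box becomes three conditions on products.\<close>

lemma corr_mean_diag:
  assumes R: "R \<ge> 1"
  shows "corr_mean 1 1 1 h h h (primes_upto M) R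
    = quad_sum (primes_upto M) (\<lambda>a b c d. of_bool (real (d * a * b) \<le> R \<and> real (d * a * c) \<le> R \<and> real (d * b * c) \<le> R))"
proof -
  define ps where "ps = sorted_list_of_set (primes_upto M)"
  have ps: "distinct ps" "set ps = primes_upto M" by (auto simp: ps_def)
  have pr: "prime p" if "p \<in> set ps" for p using that ps prime_primes_upto by auto
  define A :: "vec4 \<Rightarrow> vec4" where "A v = fst v *\<^sub>R vec12 + fst (snd v) *\<^sub>R vec13 + fst (snd (snd v)) *\<^sub>R vec23 + snd (snd (snd v)) *\<^sub>R vec123" for v
  have A_add: "A (u + v) = A u + A v" for u v by (simp add: A_def algebra_simps)
  define X :: "nat \<Rightarrow> (real \<times> vec4) list" where "X p = [(1, 0), (phi_wt p, ln (real p) *\<^sub>R ax1), (phi_wt p, ln (real p) *\<^sub>R ax2), (phi_wt p, ln (real p) *\<^sub>R ax3), (diag_wt p, ln (real p) *\<^sub>R ax4)]" for p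
  have tw: "triple_wt 1 h h h p = diag_wt p" if "p \<ge> 2" for p
  proof -
    define q where "q = real p - 1"
    have q: "q \<noteq> 0" "real p = q + 1" using that by (auto simp: q_def)
    show ?thesis unfolding triple_wt_def diag_wt_def dvd_ind_def q(2) using q(1)
      by (simp add: field_simps power2_eq_square power3_eq_cube)
  qed
  have map: "map (\<lambda>x. (fst x, A (snd x))) (X p) = corr_ops 1 1 1 h h h p" if "p \<in> set ps" for p
  proof -
    have "p \<ge> 2" using pr[OF that] by (rule prime_ge_2_nat)
    then show ?thesis
      by (simp add: X_def corr_ops_def four_ops_def pair_wt_diag tw phi_wt_def A_def ax_defs vec_defs zero_prod_def)
  qed
  have "corr_mean 1 1 1 h h h (primes_upto M) R = prod_op (corr_ops 1 1 1 h h h) ps (box_ind (ln R)) 0"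
    using corr_mean_eq_prod_op[OF ps(1) pr R] ps(2) by simp
  also have "\<dots> = prod_op (\<lambda>p. map (\<lambda>x. (fst x, A (snd x))) (X p)) ps (box_ind (ln R)) (A 0)"
  proof -
    have "A 0 = 0" by (simp add: A_def)
    moreover have "prod_op (corr_ops 1 1 1 h h h) ps (box_ind (ln R)) = prod_op (\<lambda>p. map (\<lambda>x. (fst x, A (snd x))) (X p)) ps (box_ind (ln R))"
      by (rule prod_op_cong) (simp only: map)
    ultimately show ?thesis by simp
  qed
  also have "\<dots> = prod_op X ps (\<lambda>v. box_ind (ln R) (A v)) 0" by (rule prod_op_map[OF A_add])
  also have "\<dots> = prod_op (flag_ops (one_hot phi_wt phi_wt phi_wt diag_wt)) ps (\<lambda>v. box_ind (ln R) (A v)) 0"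
  proof (rule fun_cong[OF prod_op_cong])
    fix p \<phi> v
    show "shift_op (X p) \<phi> v = shift_op (flag_ops (one_hot phi_wt phi_wt phi_wt diag_wt) p) \<phi> v"
      unfolding shift_op_flag_ops by (simp add: X_def UNIV_bool one_hot_def ln4_def ax_defs zero_prod_def)
  qed
  also have "\<dots> = flag_sum (set ps) (one_hot phi_wt phi_wt phi_wt diag_wt) (\<lambda>x y z u. box_ind (ln R) (A (0 + ln4 x y z u)))"
    using ps pr by (intro flag_sum_prod_op[symmetric]) auto
  also have "\<dots> = quad_sum (primes_upto M) (\<lambda>a b c d. of_bool (real (d * a * b) \<le> R \<and> real (d * a * c) \<le> R \<and> real (d * b * c) \<le> R))"
    unfolding quad_sum_def ps(2) flag_sum_def
  proof (intro sum.cong refl arg_cong2[where f = "(*)"])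
    fix a b c d assume "a \<in> sqf (primes_upto M)" "b \<in> sqf (primes_upto M)" "c \<in> sqf (primes_upto M)" "d \<in> sqf (primes_upto M)"
    then have pos: "a > 0" "b > 0" "c > 0" "d > 0" using sqf_pos by auto
    have "ln (real x) + ln (real y) + ln (real d) \<le> ln R \<longleftrightarrow> real (d * x * y) \<le> R" if "x > 0" "y > 0" for x y
    proof -
      have "ln (real x) + ln (real y) + ln (real d) = ln (real (d * x * y))" using that pos by (simp add: ln_mult)
      moreover have "ln (real (d * x * y)) \<le> ln R \<longleftrightarrow> real (d * x * y) \<le> R"
        using that pos R by (intro ln_le_cancel_iff) auto
      ultimately show ?thesis by simp
    qed
    from this[OF pos(1,2)] this[OF pos(1,3)] this[OF pos(2,3)]
    show "box_ind (ln R) (A (0 + ln4 a b c d)) = of_bool (real (d * a * b) \<le> R \<and> real (d * a * c) \<le> R \<and> real (d * b * c) \<le> R)"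
      by (simp add: box_ind_def A_def ln4_def vec_defs)
  qed
  finally show ?thesis .
qed

lemma quad_sum_alt:
  "quad_sum (primes_upto M) \<phi> = (\<Sum>a\<in>sqf (primes_upto M). \<Sum>b\<in>sqf (primes_upto M). \<Sum>c\<in>sqf (primes_upto M). \<Sum>d\<in>sqf (primes_upto M).
    of_bool (cop4 a b c d) * (wprod phi_wt a * wprod phi_wt b * wprod phi_wt c * wprod diag_wt d) * \<phi> a b c d)"
  unfolding quad_sum_def by (rule flag_sum_one_hot) (auto simp: prime_primes_upto)

lemma quad_sum_cong:
  assumes "\<And>a b c d. a \<ge> 1 \<Longrightarrow> b \<ge> 1 \<Longrightarrow> c \<ge> 1 \<Longrightarrow> d \<ge> 1 \<Longrightarrow> cop4 a b c d \<Longrightarrow> \<phi> a b c d = \<psi> a b c d"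
  shows "quad_sum (primes_upto M) \<phi> = quad_sum (primes_upto M) \<psi>"
  unfolding quad_sum_alt
proof (intro sum.cong refl)
  fix a b c d assume "a \<in> sqf (primes_upto M)" "b \<in> sqf (primes_upto M)" "c \<in> sqf (primes_upto M)" "d \<in> sqf (primes_upto M)"
  then have "a \<ge> 1" "b \<ge> 1" "c \<ge> 1" "d \<ge> 1" using sqf_pos by (auto simp: Suc_le_eq)
  then show "of_bool (cop4 a b c d) * (wprod phi_wt a * wprod phi_wt b * wprod phi_wt c * wprod diag_wt d) * \<phi> a b c d
    = of_bool (cop4 a b c d) * (wprod phi_wt a * wprod phi_wt b * wprod phi_wt c * wprod diag_wt d) * \<psi> a b c d"
    using assms[of a b c d] by (cases "cop4 a b c d") auto
qed

lemma quad_sum_add: "quad_sum P (\<lambda>a b c d. \<phi> a b c d + \<psi> a b c d) = quad_sum P \<phi> + quad_sum P \<psi>"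
  by (simp add: quad_sum_def flag_sum_def distrib_left sum.distrib)

lemma quad_sum_diff: "quad_sum P (\<lambda>a b c d. \<phi> a b c d - \<psi> a b c d) = quad_sum P \<phi> - quad_sum P \<psi>"
  by (simp add: quad_sum_def flag_sum_def right_diff_distrib sum_subtractf)

text \<open>The first three variables carry the same weight; together with the next transposition
  this gives all permutations of \<open>a\<close>, \<open>b\<close>, \<open>c\<close>.\<close>

lemma quad_sum_swap12: "quad_sum (primes_upto M) \<phi> = quad_sum (primes_upto M) (\<lambda>a b c d. \<phi> b a c d)"
proof -
  have "quad_sum (primes_upto M) (\<lambda>a b c d. \<phi> b a c d) = (\<Sum>b\<in>sqf (primes_upto M). \<Sum>a\<in>sqf (primes_upto M). \<Sum>c\<in>sqf (primes_upto M). \<Sum>d\<in>sqf (primes_upto M).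
    of_bool (cop4 a b c d) * (wprod phi_wt a * wprod phi_wt b * wprod phi_wt c * wprod diag_wt d) * \<phi> b a c d)"
    unfolding quad_sum_alt by (rule sum.swap)
  also have "\<dots> = quad_sum (primes_upto M) \<phi>"
    unfolding quad_sum_alt by (intro sum.cong refl) (simp add: cop4_def coprime_commute conj_ac mult_ac)
  finally show ?thesis by simp
qed

lemma quad_sum_swap23: "quad_sum (primes_upto M) \<phi> = quad_sum (primes_upto M) (\<lambda>a b c d. \<phi> a c b d)"
proof -
  have "quad_sum (primes_upto M) (\<lambda>a b c d. \<phi> a c b d) = (\<Sum>a\<in>sqf (primes_upto M). \<Sum>c\<in>sqf (primes_upto M). \<Sum>b\<in>sqf (primes_upto M). \<Sum>d\<in>sqf (primes_upto M).
    of_bool (cop4 a b c d) * (wprod phi_wt a * wprod phi_wt b * wprod phi_wt c * wprod diag_wt d) * \<phi> a c b d)"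
    unfolding quad_sum_alt by (intro sum.cong refl sum.swap)
  also have "\<dots> = quad_sum (primes_upto M) \<phi>"
    unfolding quad_sum_alt by (intro sum.cong refl) (simp add: cop4_def coprime_commute conj_ac mult_ac)
  finally show ?thesis by simp
qed

text \<open>Coprimality to a fixed \<open>a\<close> becomes part of the local weights, so that the
  sum over the other variables is again an operator product.\<close>

lemma wprod_coprime_restrict:
  assumes "b > 0"
  shows "wprod (\<lambda>p. if p dvd a then 0 else f p) b = of_bool (coprime a b) * wprod f b"
proof (cases "coprime a b")
  case True
  have "\<not> p dvd a" if "p \<in> prime_factors b" for p
  proof
    assume "p dvd a"
    moreover have "p dvd b" "prime p" using that by auto
    ultimately have "p dvd 1" using True coprime_common_divisor by blast
    then show False using \<open>prime p\<close> not_prime_unit by blast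
  qed
  then show ?thesis using True by (simp add: wprod_def)
next
  case False
  then have "gcd a b \<noteq> 1" using coprime_iff_gcd_eq_1[of a b] by blast
  then obtain p where p: "prime p" "p dvd gcd a b" using prime_factor_nat by blast
  then have d: "p dvd a" "p dvd b" using gcd_dvd1 gcd_dvd2 dvd_trans by blast+
  then have "p \<in> prime_factors b" using p(1) assms by (simp add: in_prime_factors_iff)
  then have "wprod (\<lambda>p. if p dvd a then 0 else f p) b = 0"
    unfolding wprod_def using d(1) by (subst prod_zero_iff) auto
  then show ?thesis using False by simp
qed

definition square_sum :: "nat \<Rightarrow> real \<Rightarrow> nat \<Rightarrow> real \<Rightarrow> real" where
  "square_sum M R a t = (\<Sum>b\<in>sqf (primes_upto M). \<Sum>c\<in>sqf (primes_upto M). \<Sum>d\<in>sqf (primes_upto M).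
     of_bool (cop4 a b c d) * (wprod phi_wt b * wprod phi_wt c * wprod diag_wt d) * of_bool (real b \<le> t \<and> real c \<le> t \<and> real (d * b * c) \<le> R))"

text \<open>The hypothesis \<open>t\<^sup>2 \<le> R\<close> keeps the box
  \<open>b, c \<le> t\<close> under the hyperbola. Hence the bound depends on \<open>a\<close> alone
  and not on \<open>R\<close> or \<open>t\<close>.\<close>

lemma square_sum_le:
  obtains C where "C \<ge> 0" "\<And>M R a t. t \<ge> 1 \<Longrightarrow> t\<^sup>2 \<le> R \<Longrightarrow> R \<le> real M \<Longrightarrow> a \<in> sqf (primes_upto M) \<Longrightarrow>
    \<bar>square_sum M R a t\<bar> \<le> C * wprod (\<lambda>p. 1 + 7 * real p powr (- (1 / 2))) a"
proof -
  obtain C where C: "C \<ge> 0" "\<And>M ps \<tau> L a. distinct ps \<Longrightarrow> set ps = primes_upto M \<Longrightarrow> exp L \<le> real M \<Longrightarrow> 2 * \<tau> \<le> L \<Longrightarrow> 0 \<le> \<tau> \<Longrightarrow>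
    a \<in> sqf (primes_upto M) \<Longrightarrow> \<bar>prod_op (square_ops a) ps (tri_ind \<tau> L) 0\<bar> \<le> C * wprod (\<lambda>p. 1 + 7 * real p powr (- (1 / 2))) a"
    using square_sum_bound by blast
  show ?thesis
  proof (rule that[OF C(1)])
    fix M :: nat and R t :: real and a :: nat
    assume t: "t \<ge> 1" "t\<^sup>2 \<le> R" and R: "R \<le> real M" and a: "a \<in> sqf (primes_upto M)"
    define P where "P = primes_upto M"
    define ps where "ps = sorted_list_of_set P"
    have ps: "distinct ps" "set ps = P" by (auto simp: ps_def P_def)
    have pr: "prime p" if "p \<in> P" for p using that prime_primes_upto by (simp add: P_def)
    have fP: "finite P" by (simp add: P_def)
    have "1 \<le> t\<^sup>2" using t(1) by simp
    then have R1: "R \<ge> 1" using t(2) by linarith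
    have "ln (t\<^sup>2) \<le> ln R" using t R1 by (intro ln_mono) auto
    then have lt: "2 * ln t \<le> ln R" "0 \<le> ln t" using t(1) by (simp_all add: ln_realpow)
    let ?e = "\<lambda>p. if p dvd a then 0 else phi_wt p" and ?w = "\<lambda>p. if p dvd a then 0 else diag_wt p"
    let ?E = "one_hot ?e ?e ?w (\<lambda>_. 0)"
    define \<phi> where "\<phi> b c d u = tri_ind (ln t) (ln R) (0 + ln4 b c d u)" for b c d u
    have "prod_op (square_ops a) ps (tri_ind (ln t) (ln R)) 0 = prod_op (flag_ops ?E) ps (tri_ind (ln t) (ln R)) 0"
    proof (rule fun_cong[OF prod_op_cong])
      fix p \<phi> v
      show "shift_op (square_ops a p) \<phi> v = shift_op (flag_ops ?E p) \<phi> v"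
        unfolding shift_op_flag_ops by (simp add: square_ops_def UNIV_bool one_hot_def ln4_def ax_defs zero_prod_def)
    qed
    also have "\<dots> = flag_sum (set ps) ?E \<phi>"
      unfolding \<phi>_def using ps pr by (intro flag_sum_prod_op[symmetric]) auto
    also have "\<dots> = (\<Sum>b\<in>sqf P. \<Sum>c\<in>sqf P. \<Sum>d\<in>sqf P. \<Sum>u\<in>sqf P.
       of_bool (cop4 b c d u) * (wprod ?e b * wprod ?e c * wprod ?w d * wprod (\<lambda>_. 0) u) * \<phi> b c d u)"
      unfolding ps(2) by (rule flag_sum_one_hot) (use fP pr in auto)
    also have "\<dots> = square_sum M R a t"
      unfolding square_sum_def P_def[symmetric]
    proof (intro sum.cong refl)
      fix b c d assume S: "b \<in> sqf P" "c \<in> sqf P" "d \<in> sqf P"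
      then have pos: "b > 0" "c > 0" "d > 0" using sqf_pos by auto
      have "(\<Sum>u\<in>sqf P. of_bool (cop4 b c d u) * (wprod ?e b * wprod ?e c * wprod ?w d * wprod (\<lambda>_. 0) u) * \<phi> b c d u)
         = (\<Sum>u\<in>sqf P. wprod (\<lambda>_. 0) u * (of_bool (cop4 b c d u) * (wprod ?e b * wprod ?e c * wprod ?w d) * \<phi> b c d u))"
        by (intro sum.cong refl) simp
      also have "\<dots> = of_bool (cop4 b c d 1) * (wprod ?e b * wprod ?e c * wprod ?w d) * \<phi> b c d 1"
        by (rule sum_wprod_zero_fun) (use fP pr in auto)
      also have "\<phi> b c d 1 = of_bool (real b \<le> t \<and> real c \<le> t \<and> real (d * b * c) \<le> R)"
      proof -
        have "ln (real b) + ln (real c) + ln (real d) = ln (real (d * b * c))" using pos by (simp add: ln_mult)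
        moreover have "ln (real (d * b * c)) \<le> ln R \<longleftrightarrow> real (d * b * c) \<le> R" using pos R1 by (intro ln_le_cancel_iff) auto
        moreover have "ln (real x) \<le> ln t \<longleftrightarrow> real x \<le> t" if "x > 0" for x using that t(1) by (intro ln_le_cancel_iff) auto
        ultimately show ?thesis using pos by (simp add: \<phi>_def tri_ind_def ln4_def)
      qed
      also have "of_bool (cop4 b c d 1) * (wprod ?e b * wprod ?e c * wprod ?w d) = of_bool (cop4 a b c d) * (wprod phi_wt b * wprod phi_wt c * wprod diag_wt d)"
        using pos by (simp add: wprod_coprime_restrict cop4_def of_bool_conj)
      finally show "(\<Sum>u\<in>sqf P. of_bool (cop4 b c d u) * (wprod ?e b * wprod ?e c * wprod ?w d * wprod (\<lambda>_. 0) u) * \<phi> b c d u)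
        = of_bool (cop4 a b c d) * (wprod phi_wt b * wprod phi_wt c * wprod diag_wt d) * of_bool (real b \<le> t \<and> real c \<le> t \<and> real (d * b * c) \<le> R)" .
    qed
    finally have "square_sum M R a t = prod_op (square_ops a) ps (tri_ind (ln t) (ln R)) 0" by simp
    then show "\<bar>square_sum M R a t\<bar> \<le> C * wprod (\<lambda>p. 1 + 7 * real p powr (- (1 / 2))) a"
      using C(2)[OF ps(1) _ _ lt a] ps(2) R R1 by (simp add: P_def)
  qed
qed

lemma sqf_sum_mono: "(\<And>p. prime p \<Longrightarrow> 0 \<le> F p) \<Longrightarrow> x \<le> y \<Longrightarrow> sqf_sum P F x \<le> sqf_sum P F y"
  unfolding sqf_sum_def by (intro sum_mono mult_right_mono wprod_nonneg) auto

lemma sqf_sum_nonneg: "(\<And>p. prime p \<Longrightarrow> 0 \<le> F p) \<Longrightarrow> 0 \<le> sqf_sum P F x"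
  unfolding sqf_sum_def by (intro sum_nonneg mult_nonneg_nonneg wprod_nonneg) auto

text \<open>The factors \<open>1 + 7 / sqrt p\<close> at the primes of \<open>a\<close> are bounded
  on average: with weight \<open>1 / \<phi>(a)\<close> they only change the constant.\<close>

lemma weighted_phi_sum:
  obtains K where "K \<ge> 0" "\<And>M x. x \<ge> 1 \<Longrightarrow> sqf_sum (primes_upto M) (\<lambda>p. phi_wt p * (1 + 7 * real p powr (- (1 / 2)))) x \<le> K * sqf_sum (primes_upto M) phi_wt x"
proof -
  obtain K where K: "K \<ge> 1" "\<And>P. finite P \<Longrightarrow> (\<Prod>p\<in>P. 1 + 14 * real p powr (- (3 / 2))) \<le> K"
    using prod_one_plus_powr_bound[of 14 "3 / 2"] by auto
  have "sqf_sum (primes_upto M) (\<lambda>p. phi_wt p * (1 + 7 * real p powr (- (1 / 2)))) x \<le> K * sqf_sum (primes_upto M) phi_wt x" if x: "x \<ge> 1" for M x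
  proof -
    let ?P = "primes_upto M" and ?f = "\<lambda>p. phi_wt p * (7 * real p powr (- (1 / 2)))"
    have "sqf_sum ?P (\<lambda>p. phi_wt p * (1 + 7 * real p powr (- (1 / 2)))) x \<le> (\<Sum>d\<in>sqf ?P. wprod ?f d * sqf_sum ?P phi_wt (x / real d))"
      by (rule sqf_sum_convolution) (auto simp: prime_primes_upto phi_wt_nonneg)
    also have "\<dots> \<le> (\<Sum>d\<in>sqf ?P. wprod ?f d * sqf_sum ?P phi_wt x)"
    proof (intro sum_mono mult_left_mono sqf_sum_mono phi_wt_nonneg)
      fix d assume "d \<in> sqf ?P"
      then have "real d \<ge> 1" using sqf_pos by fastforce
      then show "x / real d \<le> x" using x by (simp add: field_simps)
    qed (auto intro!: wprod_nonneg simp: phi_wt_nonneg)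
    also have "\<dots> = (\<Prod>p\<in>?P. 1 + ?f p) * sqf_sum ?P phi_wt x"
      unfolding sum_distrib_right[symmetric] by (subst sum_wprod_expand) (auto simp: prime_primes_upto)
    also have "\<dots> \<le> (\<Prod>p\<in>?P. 1 + 14 * real p powr (- (3 / 2))) * sqf_sum ?P phi_wt x"
    proof (intro mult_right_mono prod_mono conjI sqf_sum_nonneg phi_wt_nonneg)
      fix p assume "p \<in> ?P"
      then have p: "prime p" "p \<ge> 2" using prime_primes_upto prime_ge_2_nat by auto
      have "phi_wt p \<le> 2 * real p powr (- 1)" using prime_inverse_bounds(1)[OF p(2)] p by (simp add: phi_wt_def powr_minus divide_inverse)
      then have "?f p \<le> (2 * real p powr (- 1)) * (7 * real p powr (- (1 / 2)))" by (intro mult_right_mono) auto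
      also have "\<dots> = 14 * (real p powr (- 1) * real p powr (- (1 / 2)))" by simp
      also have "real p powr (- 1) * real p powr (- (1 / 2)) = real p powr (- 1 + - (1 / 2))" by (rule powr_add[symmetric])
      finally show "1 + ?f p \<le> 1 + 14 * real p powr (- (3 / 2))" by simp
      show "0 \<le> 1 + ?f p" using phi_wt_nonneg[OF p(1)] by simp
    qed
    also have "\<dots> \<le> K * sqf_sum ?P phi_wt x" by (intro mult_right_mono K sqf_sum_nonneg phi_wt_nonneg) auto
    finally show ?thesis .
  qed
  then show ?thesis using that[of K] K(1) by auto
qed

text \<open>Prepared for comparing two cutoffs. The factor \<open>sqrt q\<close> turns a logarithmic
  sum into one of size \<open>sqrt x\<close>, while a sum with the squared weight still
  converges.\<close>

lemma phi_sqrt_sum: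
  obtains K where "K \<ge> 0" "\<And>M x. x \<ge> 1 \<Longrightarrow> (\<Sum>q\<in>sqf (primes_upto M). of_bool (real q \<le> x) * (wprod phi_wt q * sqrt (real q))) \<le> K * sqrt x"
    "\<And>M. (\<Sum>q\<in>sqf (primes_upto M). (wprod phi_wt q)\<^sup>2 * sqrt (real q)) \<le> K"
proof -
  obtain K1 where K1: "K1 \<ge> 1" "\<And>P. finite P \<Longrightarrow> (\<Prod>p\<in>P. 1 + 2 * real p powr (- 2)) \<le> K1"
    using prod_one_plus_powr_bound[of 2 2] by auto
  obtain K2 where K2: "K2 \<ge> 1" "\<And>P. finite P \<Longrightarrow> (\<Prod>p\<in>P. 1 + 4 * real p powr (- (3 / 2))) \<le> K2"
    using prod_one_plus_powr_bound[of 4 "3 / 2"] by auto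
  define K where "K = 2 * K1 + K2"
  have sq: "sqrt (real q) = wprod (\<lambda>p. sqrt (real p)) q" "1 / sqrt (real q) = wprod (\<lambda>p. 1 / sqrt (real p)) q" if "squarefree q" for q
  proof -
    have "real q = wprod (\<lambda>p. sqrt (real p) * sqrt (real p)) q" using squarefree_prod_id[OF that] by (simp add: wprod_def)
    also have "\<dots> = (wprod (\<lambda>p. sqrt (real p)) q)\<^sup>2" by (simp only: wprod_times power2_eq_square)
    finally have "sqrt (real q) = \<bar>wprod (\<lambda>p. sqrt (real p)) q\<bar>" by simp
    then show s: "sqrt (real q) = wprod (\<lambda>p. sqrt (real p)) q" using wprod_nonneg[of "\<lambda>p. sqrt (real p)" q] by simp
    show "1 / sqrt (real q) = wprod (\<lambda>p. 1 / sqrt (real p)) q" unfolding s by (simp add: wprod_def prod_dividef)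
  qed
  have p_eq: "phi_wt p * sqrt (real p) = 1 / sqrt (real p) * (1 + phi_wt p)" if "prime p" for p
  proof -
    have p: "real p \<ge> 2" using prime_ge_2_nat[OF that] by simp
    have "1 + phi_wt p = real p * phi_wt p" using p by (simp add: phi_wt_def field_simps)
    moreover have "1 / sqrt (real p) * real p = sqrt (real p)" using p by (simp add: real_div_sqrt)
    ultimately show ?thesis by (simp add: mult.assoc[symmetric])
  qed
  have A: "(\<Sum>q\<in>sqf (primes_upto M). of_bool (real q \<le> x) * (wprod phi_wt q * sqrt (real q))) \<le> K * sqrt x" if x: "x \<ge> 1" for M x
  proof -
    let ?P = "primes_upto M" and ?F = "\<lambda>p. 1 / sqrt (real p)"
    have fS: "finite (sqf ?P)" by (intro finite_sqf) (auto simp: prime_primes_upto)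
    have "(\<Sum>q\<in>sqf ?P. of_bool (real q \<le> x) * (wprod phi_wt q * sqrt (real q))) = sqf_sum ?P (\<lambda>p. ?F p * (1 + phi_wt p)) x"
      unfolding sqf_sum_def
    proof (intro sum.cong refl arg_cong2[where f = "(*)"])
      fix q assume "q \<in> sqf ?P"
      then have "squarefree q" by (simp add: sqf_def)
      then have "wprod phi_wt q * sqrt (real q) = wprod (\<lambda>p. phi_wt p * sqrt (real p)) q" by (simp only: sq(1) wprod_times)
      also have "\<dots> = wprod (\<lambda>p. ?F p * (1 + phi_wt p)) q"
        unfolding wprod_def by (intro prod.cong refl p_eq) auto
      finally show "wprod phi_wt q * sqrt (real q) = wprod (\<lambda>p. ?F p * (1 + phi_wt p)) q" .
    qed
    also have "\<dots> \<le> (\<Sum>d\<in>sqf ?P. wprod (\<lambda>p. ?F p * phi_wt p) d * sqf_sum ?P ?F (x / real d))"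
      by (rule sqf_sum_convolution) (auto simp: prime_primes_upto phi_wt_nonneg)
    also have "\<dots> \<le> (\<Sum>d\<in>sqf ?P. wprod (\<lambda>p. ?F p * phi_wt p) d * (2 * sqrt (x / real d)))"
    proof (intro sum_mono mult_left_mono)
      fix d assume "d \<in> sqf ?P"
      define y where "y = x / real d"
      have "sqf_sum ?P ?F y = (\<Sum>q\<in>{q\<in>sqf ?P. real q \<le> y}. 1 / sqrt (real q))"
        unfolding sqf_sum_def sum_filter_of_bool[OF fS] by (intro sum.cong refl) (simp add: sq(2) sqf_def)
      also have "\<dots> \<le> (\<Sum>q\<in>upto_real y. 1 / sqrt (real q))"
        using sqf_pos by (intro sum_mono2) (auto simp: mem_upto_real Suc_le_eq)
      also have "\<dots> \<le> 2 * sqrt y" using x by (intro sum_inverse_sqrt_le) (simp add: y_def)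
      finally show "sqf_sum ?P ?F (x / real d) \<le> 2 * sqrt (x / real d)" by (simp add: y_def)
    qed (auto intro!: wprod_nonneg simp: phi_wt_nonneg)
    also have "\<dots> = (\<Sum>d\<in>sqf ?P. 2 * sqrt x * wprod (\<lambda>p. ?F p * phi_wt p * ?F p) d)"
    proof (intro sum.cong refl)
      fix d assume "d \<in> sqf ?P"
      then have "squarefree d" by (simp add: sqf_def)
      have "sqrt (x / real d) = sqrt x * (1 / sqrt (real d))" by (simp add: real_sqrt_divide)
      then show "wprod (\<lambda>p. ?F p * phi_wt p) d * (2 * sqrt (x / real d)) = 2 * sqrt x * wprod (\<lambda>p. ?F p * phi_wt p * ?F p) d"
        unfolding wprod_times[of "\<lambda>p. ?F p * phi_wt p"] sq(2)[OF \<open>squarefree d\<close>, symmetric] by simp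
    qed
    also have "\<dots> = 2 * sqrt x * (\<Prod>p\<in>?P. 1 + ?F p * phi_wt p * ?F p)"
      unfolding sum_distrib_left[symmetric] by (subst sum_wprod_expand) (auto simp: prime_primes_upto)
    also have "\<dots> \<le> 2 * sqrt x * (\<Prod>p\<in>?P. 1 + 2 * real p powr (- 2))"
    proof (intro mult_left_mono prod_mono conjI)
      fix p assume "p \<in> ?P"
      then have p: "prime p" "p \<ge> 2" using prime_primes_upto prime_ge_2_nat by auto
      have "?F p * phi_wt p * ?F p = phi_wt p * (1 / real p)" by simp
      also have "\<dots> \<le> (2 / real p) * (1 / real p)" using prime_inverse_bounds(1)[OF p(2)] by (intro mult_right_mono) (auto simp: phi_wt_def)
      also have "\<dots> = 2 * real p powr (- 2)" using p by (simp add: powr_minus powr_numeral power2_eq_square divide_inverse)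
      finally show "1 + ?F p * phi_wt p * ?F p \<le> 1 + 2 * real p powr (- 2)" by simp
      show "0 \<le> 1 + ?F p * phi_wt p * ?F p" using phi_wt_nonneg[OF p(1)] by simp
    qed (use x in auto)
    also have "\<dots> \<le> 2 * sqrt x * K1" using K1(2)[of ?P] x by (intro mult_left_mono) auto
    also have "\<dots> \<le> K * sqrt x"
    proof -
      have "2 * K1 * sqrt x \<le> K * sqrt x" using K2 x by (intro mult_right_mono) (auto simp: K_def)
      then show ?thesis by (simp add: mult_ac)
    qed
    finally show ?thesis .
  qed
  have B: "(\<Sum>q\<in>sqf (primes_upto M). (wprod phi_wt q)\<^sup>2 * sqrt (real q)) \<le> K" for M
  proof -
    let ?P = "primes_upto M"
    have "(\<Sum>q\<in>sqf ?P. (wprod phi_wt q)\<^sup>2 * sqrt (real q)) = (\<Sum>q\<in>sqf ?P. wprod (\<lambda>p. phi_wt p * phi_wt p * sqrt (real p)) q)"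
      by (intro sum.cong refl) (simp add: wprod_times power2_eq_square sq(1) sqf_def)
    also have "\<dots> = (\<Prod>p\<in>?P. 1 + phi_wt p * phi_wt p * sqrt (real p))"
      by (rule sum_wprod_expand) (auto simp: prime_primes_upto)
    also have "\<dots> \<le> (\<Prod>p\<in>?P. 1 + 4 * real p powr (- (3 / 2)))"
    proof (intro prod_mono conjI)
      fix p assume "p \<in> ?P"
      then have p: "prime p" "p \<ge> 2" using prime_primes_upto prime_ge_2_nat by auto
      have "phi_wt p * phi_wt p * sqrt (real p) \<le> 4 / (real p)\<^sup>2 * sqrt (real p)"
        using prime_inverse_bounds(2)[OF p(2)] by (intro mult_right_mono) (auto simp: phi_wt_def power2_eq_square)
      also have "\<dots> = 4 * (sqrt (real p) / (real p)\<^sup>2)" by simp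
      also have "\<dots> = 4 * real p powr (- (3 / 2))" using p by (simp only: sqrt_div_square)
      finally show "1 + phi_wt p * phi_wt p * sqrt (real p) \<le> 1 + 4 * real p powr (- (3 / 2))" by simp
      show "0 \<le> 1 + phi_wt p * phi_wt p * sqrt (real p)" by (simp add: add_nonneg_nonneg)
    qed
    also have "\<dots> \<le> K2" by (rule K2) simp
    finally show ?thesis using K1 by (simp add: K_def)
  qed
  show ?thesis using that[of K] A B K1 K2 by (simp add: K_def)
qed

text \<open>Coprime variables tie only at 1, so by symmetry \<open>c\<close> may be taken strictly
  largest, apart from \<open>corner\<close>. Without that restriction the conditions see
  \<open>c\<close> and \<open>d\<close> only through their product, which gives the first term. The
  surplus with \<open>c \<le> max a b\<close> is rearranged, with \<open>a\<close> fixed, into a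
  difference of two box sums in \<open>b\<close> and \<open>c\<close> with sides
  \<open>sqrt R\<close> and \<open>a\<close>. The corner enters once with the first splitting and
  leaves three times with the surplus, hence the coefficient \<open>- 2\<close>.\<close>

lemma quad_sum_diag_split:
  fixes R :: real and M :: nat
  assumes R: "R \<ge> 1"
  defines "Q \<equiv> quad_sum (primes_upto M)"
  defines "corner \<equiv> \<lambda>(a::nat) (b::nat) (c::nat) (d::nat). (of_bool (a = 1 \<and> b = 1 \<and> c = 1 \<and> real d \<le> R) :: real)"
  shows "Q (\<lambda>a b c d. of_bool (real (d * a * b) \<le> R \<and> real (d * a * c) \<le> R \<and> real (d * b * c) \<le> R))
    = 3 * Q (\<lambda>a b c d. of_bool (real (max a b * max a b) \<le> R \<and> real (d * max a b * c) \<le> R))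
      - 3 * Q (\<lambda>a b c d. of_bool (real a \<le> sqrt R) * (of_bool (real b \<le> sqrt R \<and> real c \<le> sqrt R) - of_bool (b \<le> a \<and> c \<le> a)) * of_bool (real (d * b * c) \<le> R))
      - 2 * Q corner"
proof -
  define \<phi> where "\<phi> a b c d \<longleftrightarrow> real (d * a * b) \<le> R \<and> real (d * a * c) \<le> R \<and> real (d * b * c) \<le> R" for a b c d :: nat
  define F where "F a b c d = (of_bool (\<phi> a b c d \<and> a < c \<and> b < c) :: real)" for a b c d
  define T1 where "T1 a b c d = (of_bool (real (max a b * max a b) \<le> R \<and> real (d * max a b * c) \<le> R) :: real)" for a b c d :: nat
  define E where "E a b c d = (of_bool (real (max a b * max a b) \<le> R \<and> c \<le> max a b \<and> real (d * max a b * c) \<le> R) :: real)" for a b c d :: nat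
  define H where "H a b c d = (of_bool (a < b \<and> c < b \<and> real (b * b) \<le> R \<and> real (d * b * c) \<le> R) :: real)" for a b c d :: nat
  define G where "G a b c d = of_bool (real a \<le> sqrt R) * (of_bool (real b \<le> sqrt R \<and> real c \<le> sqrt R) - of_bool (b \<le> a \<and> c \<le> a)) * (of_bool (real (d * b * c) \<le> R) :: real)" for a b c d :: nat
  have ties: "a = b \<longrightarrow> a = 1" "a = c \<longrightarrow> a = 1" "b = c \<longrightarrow> b = 1" if "cop4 a b c d" for a b c d
    using that by (auto simp: cop4_def)
  have sq: "real (b * b) \<le> R \<longleftrightarrow> real b \<le> sqrt R" for b :: nat
    using real_le_rsqrt[of "real b" R] sqrt_le_D[of "(real b)\<^sup>2" R] R
    by (metis (no_types, opaque_lifting) of_nat_0_le_iff of_nat_mult power2_eq_square real_sqrt_le_iff real_sqrt_unique)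
  have s1: "sqrt R \<ge> 1" using R by simp
  have 1: "Q (\<lambda>a b c d. of_bool (\<phi> a b c d)) = Q F + Q (\<lambda>a b c d. F a c b d) + Q (\<lambda>a b c d. F c b a d) + Q corner"
    unfolding Q_def quad_sum_add[symmetric]
  proof (rule quad_sum_cong)
    fix a b c d :: nat assume pos: "a \<ge> 1" "b \<ge> 1" "c \<ge> 1" "d \<ge> 1" and cop: "cop4 a b c d"
    have ex: "(a < c \<and> b < c) \<or> (a < b \<and> c < b) \<or> (c < a \<and> b < a) \<or> (a = 1 \<and> b = 1 \<and> c = 1)"
      using ties[OF cop] pos by arith
    have sym: "\<phi> a c b d = \<phi> a b c d" "\<phi> c b a d = \<phi> a b c d" by (auto simp: \<phi>_def mult_ac)
    show "of_bool (\<phi> a b c d) = F a b c d + F a c b d + F c b a d + corner a b c d"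
      using ex unfolding F_def sym corner_def by (elim disjE) (auto simp: \<phi>_def)
  qed
  have 2: "Q (\<lambda>a b c d. F a c b d) = Q F" unfolding Q_def by (rule quad_sum_swap23[symmetric])
  have 3: "Q (\<lambda>a b c d. F c b a d) = Q F"
  proof -
    have "Q (\<lambda>a b c d. F c b a d) = Q (\<lambda>a b c d. F b c a d)" unfolding Q_def by (rule quad_sum_swap23)
    also have "\<dots> = Q (\<lambda>a b c d. F a c b d)" unfolding Q_def by (rule quad_sum_swap12)
    finally show ?thesis using 2 by simp
  qed
  have 4: "Q F = Q T1 - Q E"
    unfolding Q_def quad_sum_diff[symmetric]
  proof (rule quad_sum_cong)
    fix a b c d :: nat assume pos: "a \<ge> 1" "b \<ge> 1" "c \<ge> 1" "d \<ge> 1"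
    define B where "B = max a b"
    show "F a b c d = T1 a b c d - E a b c d"
    proof (cases "c \<le> B")
      case True
      then show ?thesis unfolding F_def T1_def E_def B_def by auto
    next
      case False
      then have Bc: "a < c" "b < c" "B < c" by (auto simp: B_def)
      have le: "d * a * b \<le> d * B * c" "d * a * c \<le> d * B * c" "d * b * c \<le> d * B * c"
        using Bc by (auto simp: B_def intro!: mult_le_mono)
      \<comment> \<open>While \<open>c\<close> exceeds \<open>B\<close> the condition
        \<open>B * B \<le> R\<close> is automatic. It is written out so that it remains in force, as
        \<open>a, b \<le> sqrt R\<close>, when \<open>c\<close> is set free.\<close>
      have "B * B \<le> d * B * c" using Bc pos mult_le_mono[of "1 * B" "d * B" B c] by auto
      then have le4: "real (B * B) \<le> real (d * B * c)" by (rule of_nat_mono)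
      have eq: "d * B * c = d * a * c \<or> d * B * c = d * b * c" by (auto simp: B_def max_def)
      have "\<phi> a b c d \<longleftrightarrow> real (B * B) \<le> R \<and> real (d * B * c) \<le> R"
      proof
        assume "\<phi> a b c d"
        then have "real (d * B * c) \<le> R" using eq by (auto simp: \<phi>_def simp del: of_nat_mult)
        then show "real (B * B) \<le> R \<and> real (d * B * c) \<le> R" using le4 by linarith
      next
        assume "real (B * B) \<le> R \<and> real (d * B * c) \<le> R"
        then show "\<phi> a b c d" using le[THEN of_nat_mono[where 'a = real]] unfolding \<phi>_def by linarith
      qed
      then show ?thesis using Bc False unfolding F_def T1_def E_def B_def[symmetric] by simp
    qed
  qed
  have 5: "Q E = Q H + Q (\<lambda>a b c d. H b a c d) + Q corner"
    unfolding Q_def quad_sum_add[symmetric]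
  proof (rule quad_sum_cong)
    fix a b c d :: nat assume pos: "a \<ge> 1" "b \<ge> 1" "c \<ge> 1" "d \<ge> 1" and cop: "cop4 a b c d"
    consider "a < b" | "b < a" | "a = 1" "b = 1" using ties[OF cop] by (metis linorder_neqE_nat)
    then show "E a b c d = H a b c d + H b a c d + corner a b c d"
    proof cases
      case 1
      then have "max a b = b" "b \<noteq> 1" using pos by auto
      moreover have "c \<le> b \<longleftrightarrow> c < b" using ties[OF cop] \<open>b \<noteq> 1\<close> by auto
      ultimately show ?thesis using 1 unfolding E_def H_def corner_def by auto
    next
      case 2
      then have "max a b = a" "a \<noteq> 1" using pos by auto
      moreover have "c \<le> a \<longleftrightarrow> c < a" using ties[OF cop] \<open>a \<noteq> 1\<close> by auto
      ultimately show ?thesis using 2 unfolding E_def H_def corner_def by auto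
    next
      case 3
      then show ?thesis using R pos unfolding E_def H_def corner_def by auto
    qed
  qed
  have 6: "Q (\<lambda>a b c d. H b a c d) = Q H" unfolding Q_def by (rule quad_sum_swap12[symmetric])
  \<comment> \<open>The larger of \<open>b\<close> and \<open>c\<close> exceeds \<open>a\<close> and
    is at most \<open>sqrt R\<close>. Letting either of them be the larger one doubles the sum and
    turns the condition into a difference of indicators of squares.\<close>
  have 7: "Q H + Q (\<lambda>a b c d. H a c b d) = Q G"
    unfolding Q_def quad_sum_add[symmetric]
  proof (rule quad_sum_cong)
    fix a b c d :: nat assume pos: "a \<ge> 1" "b \<ge> 1" "c \<ge> 1" "d \<ge> 1" and cop: "cop4 a b c d"
    have lt: "real x \<le> sqrt R" if "x \<le> y" "real y \<le> sqrt R" for x y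
    proof -
      have "real x \<le> real y" using that(1) by simp
      then show ?thesis using that(2) by linarith
    qed
    have dd: "d * c * b = d * b * c" by (simp add: mult_ac)
    consider "c < b" | "b < c" | "b = 1" "c = 1" using ties[OF cop] by (metis linorder_neqE_nat)
    then show "H a b c d + H a c b d = G a b c d"
    proof cases
      case 1
      then have "real b \<le> sqrt R \<and> real c \<le> sqrt R \<longleftrightarrow> real b \<le> sqrt R" "b \<le> a \<and> c \<le> a \<longleftrightarrow> b \<le> a"
        using lt[of c b] by auto
      then show ?thesis using 1 lt[of a b] lt[of b a] unfolding H_def G_def sq dd by (auto simp: not_le)
    next
      case 2
      then have "real b \<le> sqrt R \<and> real c \<le> sqrt R \<longleftrightarrow> real c \<le> sqrt R" "b \<le> a \<and> c \<le> a \<longleftrightarrow> c \<le> a"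
        using lt[of b c] by auto
      then show ?thesis using 2 lt[of a c] lt[of c a] unfolding H_def G_def sq dd by (auto simp: not_le)
    next
      case 3
      then show ?thesis using pos s1 unfolding H_def G_def by auto
    qed
  qed
  have 8: "Q (\<lambda>a b c d. H a c b d) = Q H" unfolding Q_def by (rule quad_sum_swap23[symmetric])
  have "Q (\<lambda>a b c d. of_bool (\<phi> a b c d)) = 3 * Q T1 - 3 * Q G - 2 * Q corner"
    using 1 2 3 4 5 6 7 8 by linarith
  then show ?thesis unfolding \<phi>_def T1_def G_def .
qed

text \<open>Only the first of the three sums has order \<open>(ln R)\<^sup>2\<close>. Its merged
  variable \<open>m = c * d\<close> has weight \<open>1 / \<phi>(m)\<^sup>2\<close>, so
  \<open>m\<close>, \<open>a\<close>, \<open>b\<close> parametrize pairs \<open>m * a\<close>,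
  \<open>m * b\<close> with gcd \<open>m\<close>, exactly as in the square of a totient sum.\<close>

lemma diag_mean_asymp:
  obtains K where "K \<ge> 0" "\<And>M R h. R \<ge> 1 \<Longrightarrow> R \<le> real M \<Longrightarrow>
    \<bar>corr_mean 1 1 1 h h h (primes_upto M) R - 3 / 4 * (ln R)\<^sup>2\<bar> \<le> K * (1 + ln R)"
proof -
  obtain C where C: "C \<ge> 0" "\<And>M R a t. t \<ge> 1 \<Longrightarrow> t\<^sup>2 \<le> R \<Longrightarrow> R \<le> real M \<Longrightarrow> a \<in> sqf (primes_upto M) \<Longrightarrow>
    \<bar>square_sum M R a t\<bar> \<le> C * wprod (\<lambda>p. 1 + 7 * real p powr (- (1 / 2))) a"
    using square_sum_le by blast
  obtain K1 where K1: "K1 \<ge> 0" "\<And>M x. x \<ge> 1 \<Longrightarrow> sqf_sum (primes_upto M) (\<lambda>p. phi_wt p * (1 + 7 * real p powr (- (1 / 2)))) x \<le> K1 * sqf_sum (primes_upto M) phi_wt x"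
    using weighted_phi_sum by blast
  obtain K2 where K2: "K2 \<ge> 0" "\<And>M x. x \<ge> 1 \<Longrightarrow> (\<Sum>q\<in>sqf (primes_upto M). of_bool (real q \<le> x) * (wprod phi_wt q * sqrt (real q))) \<le> K2 * sqrt x"
    "\<And>M. (\<Sum>q\<in>sqf (primes_upto M). (wprod phi_wt q)\<^sup>2 * sqrt (real q)) \<le> K2"
    using phi_sqrt_sum by blast
  obtain K3 where K3: "K3 \<ge> 1" "\<And>M R. R \<ge> 1 \<Longrightarrow> R \<le> real M \<Longrightarrow> \<bar>sqf_sum (primes_upto M) phi_wt R - ln R\<bar> \<le> K3"
    using phi_sum_asymp by blast
  define K where "K = 3 * (2 * K2 * K2) * (1 + K3) + 3 * (2 * C * K1 * (1 + K3)) + 2 * (1 + K3) + 3 * (K3\<^sup>2 + K3)"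
  have "K \<ge> 0" using C(1) K1(1) K2(1) K3(1) by (simp add: K_def)
  moreover have "\<bar>corr_mean 1 1 1 h h h (primes_upto M) R - 3 / 4 * (ln R)\<^sup>2\<bar> \<le> K * (1 + ln R)"
    if R: "R \<ge> 1" "R \<le> real M" for M R h
  proof -
    define P where "P = primes_upto M"
    define S where "S = sqf P"
    have pr: "prime p" if "p \<in> P" for p using that prime_primes_upto by (simp add: P_def)
    have fP: "finite P" by (simp add: P_def)
    have fS: "finite S" unfolding S_def using fP pr by (intro finite_sqf) auto
    have Spos: "q \<ge> 1" if "q \<in> S" for q using sqf_pos[of q P] that by (simp add: S_def)
    let ?g = "wprod phi_wt" and ?w = "wprod diag_wt"
    have g0: "?g q \<ge> 0" for q by (intro wprod_nonneg phi_wt_nonneg)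
    define Y where "Y = sqrt R"
    have Y: "Y \<ge> 1" "Y \<le> R" "Y\<^sup>2 = R"
    proof -
      show "Y \<ge> 1" "Y\<^sup>2 = R" using R by (auto simp: Y_def)
      then show "Y \<le> R" using mult_left_mono[of 1 Y Y] by (simp add: power2_eq_square)
    qed
    define L where "L = ln R"
    have L0: "L \<ge> 0" using R by (simp add: L_def)
    have lnY: "ln Y = L / 2" using R by (simp add: Y_def L_def ln_sqrt)
    define GY where "GY = sqf_sum P phi_wt Y"
    have GY: "\<bar>GY - L / 2\<bar> \<le> K3" "GY \<ge> 0"
      using K3(2)[of Y M] Y R lnY by (auto simp: GY_def P_def intro!: sqf_sum_nonneg phi_wt_nonneg)
    have GYle: "GY \<le> (1 + K3) * (1 + L)"
    proof -
      have "GY \<le> L / 2 + K3" using GY by linarith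
      also have "\<dots> \<le> (1 + K3) * (1 + L)" using L0 K3(1) mult_nonneg_nonneg[of K3 L] by (simp add: algebra_simps)
      finally show ?thesis .
    qed
    have GR: "sqf_sum P phi_wt R \<le> (1 + K3) * (1 + L)"
    proof -
      have "sqf_sum P phi_wt R \<le> L + K3" using K3(2)[of R M] R by (auto simp: P_def L_def abs_le_iff)
      also have "\<dots> \<le> (1 + K3) * (1 + L)" using L0 K3(1) mult_nonneg_nonneg[of K3 L] by (simp add: algebra_simps)
      finally show ?thesis .
    qed
    define Q where "Q = quad_sum P"
    have Qalt: "Q \<phi> = (\<Sum>a\<in>S. \<Sum>b\<in>S. \<Sum>c\<in>S. \<Sum>d\<in>S. of_bool (cop4 a b c d) * (?g a * ?g b * ?g c * ?w d) * \<phi> a b c d)" for \<phi>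
      unfolding Q_def S_def P_def by (rule quad_sum_alt)
    define T1 where "T1 a b c d = (of_bool (real (max a b * max a b) \<le> R \<and> real (d * max a b * c) \<le> R) :: real)" for a b c d :: nat
    define G where "G a b c d = of_bool (real a \<le> Y) * (of_bool (real b \<le> Y \<and> real c \<le> Y) - of_bool (b \<le> a \<and> c \<le> a)) * (of_bool (real (d * b * c) \<le> R) :: real)" for a b c d :: nat
    define U where "U a b c d = (of_bool (a = 1 \<and> b = 1 \<and> c = 1 \<and> real d \<le> R) :: real)" for a b c d :: nat
    have split: "corr_mean 1 1 1 h h h P R = 3 * Q T1 - 3 * Q G - 2 * Q U"
      unfolding P_def corr_mean_diag[OF R(1)] quad_sum_diag_split[OF R(1)] Q_def T1_def G_def U_def Y_def by (rule refl)

    \<comment> \<open>The corner is a single sum over \<open>d\<close>, bounded by a totient sum and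
      hence of logarithmic size.\<close>
    have QU: "\<bar>Q U\<bar> \<le> (1 + K3) * (1 + L)"
    proof -
      have one: "1 \<in> S" by (auto simp: S_def sqf_def)
      have "Q U = (\<Sum>a\<in>S. \<Sum>b\<in>S. \<Sum>c\<in>S. if a = 1 \<and> b = 1 \<and> c = 1 then (\<Sum>d\<in>S. of_bool (real d \<le> R) * ?w d) else 0)"
        unfolding Qalt U_def by (intro sum.cong refl) (auto simp: cop4_def mult.commute)
      also have "\<dots> = (\<Sum>a\<in>S. \<Sum>b\<in>S. if a = 1 \<and> b = 1 then (\<Sum>d\<in>S. of_bool (real d \<le> R) * ?w d) else 0)"
      proof (intro sum.cong refl)
        fix a b
        show "(\<Sum>c\<in>S. if a = 1 \<and> b = 1 \<and> c = 1 then (\<Sum>d\<in>S. of_bool (real d \<le> R) * ?w d) else 0) = (if a = 1 \<and> b = 1 then (\<Sum>d\<in>S. of_bool (real d \<le> R) * ?w d) else 0)"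
          using fS one by (cases "a = 1 \<and> b = 1") auto
      qed
      also have "\<dots> = (\<Sum>a\<in>S. if a = 1 then (\<Sum>d\<in>S. of_bool (real d \<le> R) * ?w d) else 0)"
      proof (intro sum.cong refl)
        fix a
        show "(\<Sum>b\<in>S. if a = 1 \<and> b = 1 then (\<Sum>d\<in>S. of_bool (real d \<le> R) * ?w d) else 0) = (if a = 1 then (\<Sum>d\<in>S. of_bool (real d \<le> R) * ?w d) else 0)"
          using fS one by (cases "a = 1") auto
      qed
      also have "\<dots> = (\<Sum>d\<in>S. of_bool (real d \<le> R) * ?w d)" using fS one by simp
      also have "\<bar>\<dots>\<bar> \<le> (\<Sum>d\<in>S. of_bool (real d \<le> R) * ?g d)"
      proof (rule order_trans[OF sum_abs], rule sum_mono)
        fix d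
        have "\<bar>?w d\<bar> \<le> ?g d" unfolding abs_wprod by (intro wprod_mono diag_wt_le) auto
        then show "\<bar>of_bool (real d \<le> R) * ?w d\<bar> \<le> of_bool (real d \<le> R) * ?g d" by (simp add: abs_mult)
      qed
      also have "\<dots> = sqf_sum P phi_wt R" by (simp add: sqf_sum_def S_def)
      finally show ?thesis using GR by linarith
    qed

    \<comment> \<open>For fixed \<open>a \<le> sqrt R\<close> the two indicators give
      \<open>square_sum\<close> with sides \<open>sqrt R\<close> and \<open>a\<close>; both satisfy
      the uniform bound, so only the sum over \<open>a\<close> costs a logarithm.\<close>
    have QG: "\<bar>Q G\<bar> \<le> 2 * C * K1 * ((1 + K3) * (1 + L))"
    proof -
      have "Q G = (\<Sum>a\<in>S. of_bool (real a \<le> Y) * ?g a * (square_sum M R a Y - square_sum M R a (real a)))"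
        unfolding Qalt square_sum_def P_def[symmetric] S_def[symmetric] G_def sum_subtractf[symmetric] sum_distrib_left
        by (intro sum.cong refl) (simp add: algebra_simps of_bool_conj)
      also have "\<bar>\<dots>\<bar> \<le> (\<Sum>a\<in>S. 2 * C * (of_bool (real a \<le> Y) * wprod (\<lambda>p. phi_wt p * (1 + 7 * real p powr (- (1 / 2)))) a))"
      proof (rule order_trans[OF sum_abs], rule sum_mono)
        fix a assume a: "a \<in> S"
        let ?k = "wprod (\<lambda>p. 1 + 7 * real p powr (- (1 / 2))) a"
        show "\<bar>of_bool (real a \<le> Y) * ?g a * (square_sum M R a Y - square_sum M R a (real a))\<bar>
            \<le> 2 * C * (of_bool (real a \<le> Y) * wprod (\<lambda>p. phi_wt p * (1 + 7 * real p powr (- (1 / 2)))) a)"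
        proof (cases "real a \<le> Y")
          case True
          have aS: "a \<in> sqf (primes_upto M)" using a by (simp add: S_def P_def)
          have "\<bar>square_sum M R a Y\<bar> \<le> C * ?k" using Y R aS by (intro C) auto
          moreover have "\<bar>square_sum M R a (real a)\<bar> \<le> C * ?k"
          proof (rule C(2))
            show "real a \<ge> 1" using Spos[OF a] by simp
            have "(real a)\<^sup>2 \<le> Y\<^sup>2" using True by (intro power_mono) auto
            then show "(real a)\<^sup>2 \<le> R" using Y by simp
          qed (use R aS in auto)
          ultimately have "\<bar>square_sum M R a Y - square_sum M R a (real a)\<bar> \<le> 2 * (C * ?k)" by linarith
          from mult_left_mono[OF this g0[of a]] show ?thesis using True g0[of a]
            by (simp add: abs_mult wprod_times mult_ac)
        qed simp
      qed
      also have "\<dots> = 2 * C * sqf_sum P (\<lambda>p. phi_wt p * (1 + 7 * real p powr (- (1 / 2)))) Y"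
        by (simp add: sqf_sum_def S_def sum_distrib_left)
      also have "\<dots> \<le> 2 * C * (K1 * GY)" unfolding GY_def P_def using C(1) Y by (intro mult_left_mono K1) auto
      also have "\<dots> = 2 * C * K1 * GY" by simp
      also have "\<dots> \<le> 2 * C * K1 * ((1 + K3) * (1 + L))" using GYle C(1) K1(1) by (intro mult_left_mono) auto
      finally show ?thesis .
    qed

    \<comment> \<open>After merging, both quantities are sums of the same terms
      \<open>W m a b\<close> and differ only in the cutoff: \<open>m * max a b\<close> may go up to
      \<open>R\<close> with \<open>max a b \<le> sqrt R\<close> in one, and only up to
      \<open>sqrt R\<close> in the other.\<close>
    have QT: "\<bar>Q T1 - GY\<^sup>2\<bar> \<le> 2 * K2 * K2 * ((1 + K3) * (1 + L))"
    proof -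
      define W where "W m a b = of_bool (cop4 m a b 1) * ((?g m)\<^sup>2 * (?g a * ?g b))" for m a b
      have W0: "W m a b \<ge> 0" for m a b unfolding W_def using g0 by simp
      have "Q T1 = (\<Sum>a\<in>S. \<Sum>b\<in>S. of_bool (coprime a b) * (?g a * ?g b) * (\<Sum>c\<in>S. \<Sum>d\<in>S. of_bool (coprime c d) * (?g c * ?w d) *
          of_bool (coprime a (c * d) \<and> coprime b (c * d) \<and> real (max a b * max a b) \<le> R \<and> real (c * d * max a b) \<le> R)))"
        unfolding Qalt T1_def sum_distrib_left
      proof (intro sum.cong refl)
        fix a b c d :: nat
        have eq: "d * max a b * c = c * d * max a b" by (simp add: mult_ac)
        show "of_bool (cop4 a b c d) * (?g a * ?g b * ?g c * ?w d) * of_bool (real (max a b * max a b) \<le> R \<and> real (d * max a b * c) \<le> R)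
          = of_bool (coprime a b) * (?g a * ?g b) * (of_bool (coprime c d) * (?g c * ?w d) *
            of_bool (coprime a (c * d) \<and> coprime b (c * d) \<and> real (max a b * max a b) \<le> R \<and> real (c * d * max a b) \<le> R))"
          unfolding eq by (auto simp: cop4_def simp del: of_nat_mult)
      qed
      also have "\<dots> = (\<Sum>a\<in>S. \<Sum>b\<in>S. of_bool (coprime a b) * (?g a * ?g b) * (\<Sum>m\<in>S. (?g m)\<^sup>2 *
          of_bool (coprime a m \<and> coprime b m \<and> real (max a b * max a b) \<le> R \<and> real (m * max a b) \<le> R)))"
      proof (rule sum.cong[OF refl], rule sum.cong[OF refl], rule arg_cong2[where f = "(*)", OF refl])
        fix a b :: nat
        define \<psi> where "\<psi> m = (of_bool (coprime a m \<and> coprime b m \<and> real (max a b * max a b) \<le> R \<and> real (m * max a b) \<le> R) :: real)" for m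
        have "(\<Sum>c\<in>S. \<Sum>d\<in>S. of_bool (coprime c d) * (?g c * ?w d) * \<psi> (c * d)) = (\<Sum>m\<in>S. wprod (\<lambda>p. phi_wt p + diag_wt p) m * \<psi> m)"
          unfolding S_def by (rule merge_coprime_sum) (use fP pr in auto)
        also have "\<dots> = (\<Sum>m\<in>S. (?g m)\<^sup>2 * \<psi> m)"
        proof (intro sum.cong refl arg_cong2[where f = "(*)"])
          fix m
          have "wprod (\<lambda>p. phi_wt p + diag_wt p) m = wprod (\<lambda>p. phi_wt p * phi_wt p) m"
            unfolding wprod_def by (intro prod.cong refl phi_plus_diag) auto
          then show "wprod (\<lambda>p. phi_wt p + diag_wt p) m = (?g m)\<^sup>2" by (simp add: wprod_times power2_eq_square)
        qed
        finally show "(\<Sum>c\<in>S. \<Sum>d\<in>S. of_bool (coprime c d) * (?g c * ?w d) * of_bool (coprime a (c * d) \<and> coprime b (c * d) \<and> real (max a b * max a b) \<le> R \<and> real (c * d * max a b) \<le> R))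
          = (\<Sum>m\<in>S. (?g m)\<^sup>2 * of_bool (coprime a m \<and> coprime b m \<and> real (max a b * max a b) \<le> R \<and> real (m * max a b) \<le> R))"
          unfolding \<psi>_def .
      qed
      also have "\<dots> = (\<Sum>a\<in>S. \<Sum>b\<in>S. \<Sum>m\<in>S. W m a b * of_bool (real (max a b * max a b) \<le> R \<and> real (m * max a b) \<le> R))"
        unfolding sum_distrib_left by (intro sum.cong refl) (auto simp: W_def cop4_def coprime_commute simp del: of_nat_mult)
      also have "\<dots> = (\<Sum>m\<in>S. \<Sum>a\<in>S. \<Sum>b\<in>S. W m a b * of_bool (real (max a b * max a b) \<le> R \<and> real (m * max a b) \<le> R))"
      proof -
        have "(\<Sum>b\<in>B. \<Sum>c\<in>B. \<Sum>k\<in>B. f b c k) = (\<Sum>k\<in>B. \<Sum>b\<in>B. \<Sum>c\<in>B. f b c k)" for f :: "nat \<Rightarrow> nat \<Rightarrow> nat \<Rightarrow> real" and B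
        proof -
          have "(\<Sum>b\<in>B. \<Sum>c\<in>B. \<Sum>k\<in>B. f b c k) = (\<Sum>b\<in>B. \<Sum>k\<in>B. \<Sum>c\<in>B. f b c k)" by (intro sum.cong refl sum.swap)
          also have "\<dots> = (\<Sum>k\<in>B. \<Sum>b\<in>B. \<Sum>c\<in>B. f b c k)" by (rule sum.swap)
          finally show ?thesis .
        qed
        then show ?thesis .
      qed
      finally have QT1: "Q T1 = (\<Sum>m\<in>S. \<Sum>a\<in>S. \<Sum>b\<in>S. W m a b * of_bool (real (max a b * max a b) \<le> R \<and> real (m * max a b) \<le> R))" .
      have "GY\<^sup>2 = (\<Sum>x\<in>S. \<Sum>y\<in>S. (of_bool (real x \<le> Y) * ?g x) * (of_bool (real y \<le> Y) * ?g y))"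
        unfolding GY_def sqf_sum_def S_def power2_eq_square by (rule sum_product)
      also have "\<dots> = (\<Sum>x\<in>S. \<Sum>y\<in>S. ?g x * ?g y * of_bool (real x \<le> Y \<and> real y \<le> Y))"
        by (intro sum.cong refl) (simp add: of_bool_conj)
      also have "\<dots> = (\<Sum>m\<in>S. \<Sum>a\<in>S. \<Sum>b\<in>S. W m a b * of_bool (real (m * a) \<le> Y \<and> real (m * b) \<le> Y))"
        unfolding S_def W_def by (rule gcd_split_sum) (use fP pr in auto)
      finally have GY2: "GY\<^sup>2 = (\<Sum>m\<in>S. \<Sum>a\<in>S. \<Sum>b\<in>S. W m a b * of_bool (real (m * a) \<le> Y \<and> real (m * b) \<le> Y))" .
      \<comment> \<open>The cutoffs disagree only if \<open>max a b \<le> Y < m * max a b\<close>.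
        There the square root of \<open>m * max a b / Y\<close> is at least 1 and serves as a
        majorant; bounding the root of the maximum by a sum of roots separates the
        variables.\<close>
      have pt: "\<bar>of_bool (real (max a b * max a b) \<le> R \<and> real (m * max a b) \<le> R) - of_bool (real (m * a) \<le> Y \<and> real (m * b) \<le> Y)\<bar>
          \<le> of_bool (real a \<le> Y) * of_bool (real b \<le> Y) * (sqrt (real m) * (sqrt (real a) + sqrt (real b)) / sqrt Y)"
        if mab: "m \<ge> 1" "a \<ge> 1" "b \<ge> 1" for m a b :: nat
      proof -
        define B where "B = max a b"
        have B1: "B \<ge> 1" using mab by (simp add: B_def)
        have "real (B * B) \<le> R \<longleftrightarrow> (real B)\<^sup>2 \<le> Y\<^sup>2" using Y(3) by (simp add: power2_eq_square)
        also have "\<dots> \<longleftrightarrow> real B \<le> Y" using Y(1) by (intro power_mono_iff) auto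
        finally have BB: "real (B * B) \<le> R \<longleftrightarrow> real B \<le> Y" .
        have BY: "real B \<le> Y \<longleftrightarrow> real a \<le> Y \<and> real b \<le> Y" by (auto simp: B_def max_def)
        have mB: "real (m * a) \<le> Y \<and> real (m * b) \<le> Y \<longleftrightarrow> real (m * B) \<le> Y"
        proof -
          have "m * a \<le> m * B" "m * b \<le> m * B" "m * B = m * a \<or> m * B = m * b" by (auto simp: B_def max_def)
          then show ?thesis by (metis of_nat_mono order_trans)
        qed
        have "B \<le> m * B" using mab by simp
        then have "real B \<le> real (m * B)" by (rule of_nat_mono)
        then have imp: "real (m * B) \<le> Y \<Longrightarrow> real B \<le> Y \<and> real (m * B) \<le> R" using Y(2) by linarith
        show ?thesis
        proof (cases "real B \<le> Y \<and> \<not> real (m * B) \<le> Y")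
          case True
          have "1 \<le> sqrt (real (m * B) / Y)" using True Y(1) by simp
          also have "\<dots> = sqrt (real m) * sqrt (real B) / sqrt Y" by (simp add: real_sqrt_mult real_sqrt_divide)
          also have "\<dots> \<le> sqrt (real m) * (sqrt (real a) + sqrt (real b)) / sqrt Y"
            using Y(1) by (intro divide_right_mono mult_left_mono) (auto simp: B_def max_def)
          finally have "1 \<le> sqrt (real m) * (sqrt (real a) + sqrt (real b)) / sqrt Y" .
          then show ?thesis using True BY unfolding mB B_def[symmetric] by auto
        next
          case False
          then have "(real (B * B) \<le> R \<and> real (m * B) \<le> R) = (real (m * B) \<le> Y)" using imp BB by blast
          then show ?thesis unfolding mB B_def[symmetric] using Y(1) by simp
        qed
      qed
      have "\<bar>Q T1 - GY\<^sup>2\<bar> \<le> (\<Sum>m\<in>S. \<Sum>a\<in>S. \<Sum>b\<in>S. ((?g m)\<^sup>2 * (?g a * ?g b)) *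
          (of_bool (real a \<le> Y) * of_bool (real b \<le> Y) * (sqrt (real m) * (sqrt (real a) + sqrt (real b)) / sqrt Y)))"
        unfolding QT1 GY2 sum_subtractf[symmetric]
      proof (intro order_trans[OF sum_abs] sum_mono)
        fix m a b assume "m \<in> S" "a \<in> S" "b \<in> S"
        then have mab: "m \<ge> 1" "a \<ge> 1" "b \<ge> 1" using Spos by auto
        have "W m a b \<le> (?g m)\<^sup>2 * (?g a * ?g b)" unfolding W_def using g0 by (simp add: mult_left_le_one_le)
        then have "\<bar>W m a b\<bar> * \<bar>of_bool (real (max a b * max a b) \<le> R \<and> real (m * max a b) \<le> R) - of_bool (real (m * a) \<le> Y \<and> real (m * b) \<le> Y)\<bar>
          \<le> ((?g m)\<^sup>2 * (?g a * ?g b)) * (of_bool (real a \<le> Y) * of_bool (real b \<le> Y) * (sqrt (real m) * (sqrt (real a) + sqrt (real b)) / sqrt Y))"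
          using W0[of m a b] g0 by (intro mult_mono pt mab) auto
        then show "\<bar>W m a b * of_bool (real (max a b * max a b) \<le> R \<and> real (m * max a b) \<le> R) - W m a b * of_bool (real (m * a) \<le> Y \<and> real (m * b) \<le> Y)\<bar>
          \<le> ((?g m)\<^sup>2 * (?g a * ?g b)) * (of_bool (real a \<le> Y) * of_bool (real b \<le> Y) * (sqrt (real m) * (sqrt (real a) + sqrt (real b)) / sqrt Y))"
          unfolding right_diff_distrib[symmetric] abs_mult .
      qed
      also have "\<dots> = (\<Sum>m\<in>S. (?g m)\<^sup>2 * sqrt (real m)) * (2 * (\<Sum>a\<in>S. of_bool (real a \<le> Y) * (?g a * sqrt (real a))) * GY / sqrt Y)"
      proof -
        define A where "A = (\<Sum>a\<in>S. of_bool (real a \<le> Y) * (?g a * sqrt (real a)))"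
        define x y where "x a = of_bool (real a \<le> Y) * (?g a * sqrt (real a))" and "y a = of_bool (real a \<le> Y) * ?g a" for a
        have GYy: "GY = (\<Sum>a\<in>S. y a)" by (simp add: GY_def sqf_sum_def S_def y_def)
        have "(\<Sum>m\<in>S. \<Sum>a\<in>S. \<Sum>b\<in>S. ((?g m)\<^sup>2 * (?g a * ?g b)) *
          (of_bool (real a \<le> Y) * of_bool (real b \<le> Y) * (sqrt (real m) * (sqrt (real a) + sqrt (real b)) / sqrt Y)))
          = (\<Sum>m\<in>S. \<Sum>a\<in>S. \<Sum>b\<in>S. ((?g m)\<^sup>2 * sqrt (real m)) * ((x a * y b + y a * x b) / sqrt Y))"
          by (intro sum.cong refl) (simp add: x_def y_def field_simps)
        also have "\<dots> = (\<Sum>m\<in>S. (?g m)\<^sup>2 * sqrt (real m)) * ((\<Sum>a\<in>S. \<Sum>b\<in>S. x a * y b + y a * x b) / sqrt Y)"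
          by (simp only: sum_distrib_left[symmetric] sum_distrib_right[symmetric] sum_divide_distrib[symmetric])
        also have "(\<Sum>a\<in>S. \<Sum>b\<in>S. x a * y b + y a * x b) = 2 * A * GY"
        proof -
          have "(\<Sum>a\<in>S. \<Sum>b\<in>S. x a * y b + y a * x b) = (\<Sum>a\<in>S. x a) * (\<Sum>b\<in>S. y b) + (\<Sum>a\<in>S. y a) * (\<Sum>b\<in>S. x b)"
            by (simp only: sum.distrib sum_product)
          then show ?thesis unfolding GYy A_def x_def[symmetric] by (simp add: mult.commute)
        qed
        finally show ?thesis by (simp add: A_def)
      qed
      also have "\<dots> \<le> K2 * (2 * (K2 * sqrt Y) * GY / sqrt Y)"
      proof (rule mult_mono)
        show "(\<Sum>m\<in>S. (?g m)\<^sup>2 * sqrt (real m)) \<le> K2" unfolding S_def P_def by (rule K2)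
        have "(\<Sum>a\<in>S. of_bool (real a \<le> Y) * (?g a * sqrt (real a))) \<le> K2 * sqrt Y" unfolding S_def P_def using Y(1) by (rule K2)
        then show "2 * (\<Sum>a\<in>S. of_bool (real a \<le> Y) * (?g a * sqrt (real a))) * GY / sqrt Y \<le> 2 * (K2 * sqrt Y) * GY / sqrt Y"
          using GY(2) Y(1) by (intro divide_right_mono mult_right_mono mult_left_mono) auto
        show "0 \<le> 2 * (\<Sum>a\<in>S. of_bool (real a \<le> Y) * (?g a * sqrt (real a))) * GY / sqrt Y"
          using GY(2) Y(1) g0 by (intro divide_nonneg_nonneg mult_nonneg_nonneg sum_nonneg) auto
      qed (use K2 in auto)
      also have "\<dots> = 2 * K2 * K2 * GY" using Y(1) by simp
      also have "\<dots> \<le> 2 * K2 * K2 * ((1 + K3) * (1 + L))" using GYle K2(1) by (intro mult_left_mono) auto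
      finally show ?thesis .
    qed

    have GYsq: "\<bar>GY\<^sup>2 - L\<^sup>2 / 4\<bar> \<le> (K3\<^sup>2 + K3) * (1 + L)"
    proof -
      define e where "e = GY - L / 2"
      have e: "\<bar>e\<bar> \<le> K3" using GY by (simp add: e_def)
      have "GY\<^sup>2 - L\<^sup>2 / 4 = e * e + e * L" unfolding e_def by (simp add: power2_eq_square algebra_simps)
      also have "\<bar>\<dots>\<bar> \<le> \<bar>e * e\<bar> + \<bar>e * L\<bar>" by (rule abs_triangle_ineq)
      also have "\<dots> \<le> K3 * K3 + K3 * L" unfolding abs_mult using e L0 K3(1) by (intro add_mono mult_mono) auto
      also have "\<dots> \<le> (K3\<^sup>2 + K3) * (1 + L)" using L0 K3(1) by (simp add: power2_eq_square algebra_simps)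
      finally show ?thesis .
    qed
    have "corr_mean 1 1 1 h h h P R - 3 / 4 * L\<^sup>2 = 3 * (Q T1 - GY\<^sup>2) - 3 * Q G - 2 * Q U + 3 * (GY\<^sup>2 - L\<^sup>2 / 4)"
      unfolding split by simp
    also have "\<bar>\<dots>\<bar> \<le> 3 * (2 * K2 * K2 * ((1 + K3) * (1 + L))) + 3 * (2 * C * K1 * ((1 + K3) * (1 + L)))
        + 2 * ((1 + K3) * (1 + L)) + 3 * ((K3\<^sup>2 + K3) * (1 + L))"
    proof -
      have "\<bar>3 * a - 3 * b - 2 * c + 3 * d\<bar> \<le> 3 * a' + 3 * b' + 2 * c' + 3 * d'"
        if "\<bar>a\<bar> \<le> a'" "\<bar>b\<bar> \<le> b'" "\<bar>c\<bar> \<le> c'" "\<bar>d\<bar> \<le> d'" for a b c d a' b' c' d' :: real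
        using that by linarith
      from this[OF QT QG QU GYsq] show ?thesis .
    qed
    also have "\<dots> = K * (1 + L)" by (simp add: K_def algebra_simps)
    finally show ?thesis by (simp add: P_def L_def)
  qed
  ultimately show ?thesis using that by blast
qed

section \<open>Uniform asymptotics\<close>

text \<open>Pads a product of fewer than three weights with 1, in accordance with
  \<open>lam 0\<close>.\<close>

definition lambda_opt :: "real \<Rightarrow> real \<Rightarrow> int \<Rightarrow> real" where
  "lambda_opt u R m = (if u = 0 then 1 else lambda_R R m)"

text \<open>Fixing one set of primes makes the mean a function of the shifts and \<open>R\<close>;
  \<open>level_mean_eq\<close> moves to any larger range of primes.\<close>

definition level_mean :: "real \<Rightarrow> real \<Rightarrow> real \<Rightarrow> int \<Rightarrow> int \<Rightarrow> int \<Rightarrow> real \<Rightarrow> real" where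
  "level_mean u1 u2 u3 h1 h2 h3 R = corr_mean u1 u2 u3 h1 h2 h3 (primes_upto (nat \<lceil>R\<rceil>)) R"

lemma mem_primes_upto: "prime p \<Longrightarrow> real p \<le> R \<Longrightarrow> R \<le> real M \<Longrightarrow> p \<in> primes_upto M"
  by (simp add: primes_upto_def)

lemma level_mean_eq:
  assumes "R \<le> real M" "0 \<le> u1" "0 \<le> u2" "0 \<le> u3"
  shows "level_mean u1 u2 u3 h1 h2 h3 R = corr_mean u1 u2 u3 h1 h2 h3 (primes_upto M) R"
  unfolding level_mean_def
  by (rule corr_mean_indep)
    (use assms in \<open>auto intro: prime_primes_upto mem_primes_upto[OF _ _ real_nat_ceiling_ge] mem_primes_upto[OF _ _ assms(1)]\<close>)

text \<open>\<open>lambda_R\<close> vanishes at nonpositive arguments and its periodic continuation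
  need not. For \<open>n \<le> n0\<close> some argument is nonpositive and the product is 0; beyond
  \<open>n0\<close> the two agree, so the mean applies to an interval of length
  \<open>N - n0\<close>. A slot of weight 0 repeats the first shift and so adds no sign condition of
  its own.\<close>

lemma tuple_sum_approx:
  obtains B where "B \<ge> 0" "\<And>k u2 u3 h1 h2 h3 R X N. R \<ge> 1 \<Longrightarrow> (u2 = 0 \<and> h2 = h1) \<or> u2 = 1 \<Longrightarrow> (u3 = 0 \<and> h3 = h1) \<or> u3 = 1 \<Longrightarrow>
    real k = 1 + u2 + u3 \<Longrightarrow> real_of_int \<bar>h1\<bar> \<le> X \<Longrightarrow> real_of_int \<bar>h2\<bar> \<le> X \<Longrightarrow> real_of_int \<bar>h3\<bar> \<le> X \<Longrightarrow> X \<le> real N \<Longrightarrow>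
    \<exists>n0::nat. real n0 \<le> X \<and> \<bar>(\<Sum>n = 1..N. lambda_R R (int n + h1) * lambda_opt u2 R (int n + h2) * lambda_opt u3 R (int n + h3))
      - (real N - real n0) * level_mean 1 u2 u3 h1 h2 h3 R\<bar> \<le> B * R ^ k"
proof -
  obtain B where B: "B \<ge> 1" "\<And>P R. finite P \<Longrightarrow> (\<And>p. p \<in> P \<Longrightarrow> prime p) \<Longrightarrow> R \<ge> 1 \<Longrightarrow> lam_err 1 P R \<le> B * R"
    using lam_err_one_bound by blast
  show ?thesis
  proof (rule that[of "B ^ 3"])
    fix k :: nat and u2 u3 R X :: real and h1 h2 h3 :: int and N :: nat
    assume R: "R \<ge> 1" and u2: "(u2 = 0 \<and> h2 = h1) \<or> u2 = 1" and u3: "(u3 = 0 \<and> h3 = h1) \<or> u3 = 1"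
      and k: "real k = 1 + u2 + u3" and h: "real_of_int \<bar>h1\<bar> \<le> X" "real_of_int \<bar>h2\<bar> \<le> X" "real_of_int \<bar>h3\<bar> \<le> X" and X: "X \<le> real N"
    define P where "P = primes_upto (nat \<lceil>R\<rceil>)"
    have P: "finite P" "\<And>p. p \<in> P \<Longrightarrow> prime p" "\<And>p. prime p \<Longrightarrow> real p \<le> R \<Longrightarrow> p \<in> P"
      using prime_primes_upto by (auto simp: P_def intro: mem_primes_upto[OF _ _ real_nat_ceiling_ge])
    define n0 where "n0 = max (nat (- h1)) (max (nat (- h2)) (nat (- h3)))"
    have nX: "real (nat (- g)) \<le> X" if "real_of_int \<bar>g\<bar> \<le> X" for g :: int
      using that by linarith
    have n0X: "real n0 \<le> X" unfolding n0_def of_nat_max by (intro max.boundedI nX h)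
    then have n0N: "n0 \<le> N" using X by linarith
    let ?S = "\<lambda>n. lambda_R R (int n + h1) * lambda_opt u2 R (int n + h2) * lambda_opt u3 R (int n + h3)"
    let ?T = "\<lambda>n. lam 1 P R (int n + h1) * lam u2 P R (int n + h2) * lam u3 P R (int n + h3)"
    have lam_nonpos: "lambda_R R m = 0" if "m \<le> 0" for m using that by (simp add: lambda_R_def)
    have "(\<Sum>n = 1..N. ?S n) = (\<Sum>n\<in>{n0<..N}. ?S n)"
    proof (rule sum.mono_neutral_right)
      show "\<forall>n\<in>{1..N} - {n0<..N}. ?S n = 0"
      proof
        fix n assume "n \<in> {1..N} - {n0<..N}"
        then have "n \<le> n0" by auto
        then consider "int n + h1 \<le> 0" | "int n + h2 \<le> 0" | "int n + h3 \<le> 0" | "n = 0" unfolding n0_def by linarith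
        then show "?S n = 0"
        proof cases
          case 2
          then show ?thesis using u2 by (auto simp: lambda_opt_def lam_nonpos)
        next
          case 3
          then show ?thesis using u3 by (auto simp: lambda_opt_def lam_nonpos)
        qed (use \<open>n \<in> {1..N} - {n0<..N}\<close> lam_nonpos in auto)
      qed
    qed auto
    also have "\<dots> = (\<Sum>n\<in>{n0<..N}. ?T n)"
    proof (rule sum.cong[OF refl])
      fix n assume "n \<in> {n0<..N}"
      then have "nat (- h1) < n" "nat (- h2) < n" "nat (- h3) < n" by (auto simp: n0_def)
      then have pos: "int n + h1 > 0" "int n + h2 > 0" "int n + h3 > 0" by linarith+
      have opt: "lambda_opt u R m = lam u P R m" if "u = 0 \<or> u = 1" "m > 0" for u m
        using that(1)
      proof
        assume "u = 0"
        moreover have "lam 0 P R m = 1" by (rule lam_zero[OF R P(1,2)])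
        ultimately show ?thesis by (simp add: lambda_opt_def)
      next
        assume "u = 1"
        moreover have "lambda_R R m = lam 1 P R m" by (rule lambda_R_eq_lam[OF that(2) P])
        ultimately show ?thesis by (simp add: lambda_opt_def)
      qed
      have "lambda_R R (int n + h1) = lam 1 P R (int n + h1)"
        using opt[of 1 "int n + h1"] pos by (simp add: lambda_opt_def)
      then show "?S n = ?T n" using opt[of u2 "int n + h2"] opt[of u3 "int n + h3"] u2 u3 pos by auto
    qed
    finally have S: "(\<Sum>n = 1..N. ?S n) = (\<Sum>n\<in>{n0<..N}. ?T n)" .
    have err: "lam_err u P R \<le> B * (if u = 0 then 1 else R)" "0 \<le> lam_err u P R" if "u = 0 \<or> u = 1" for u
    proof -
      show "lam_err u P R \<le> B * (if u = 0 then 1 else R)"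
        using that lam_err_zero[OF R P(1,2)] B(2)[OF P(1,2) R] B(1) by auto
      have "0 \<le> u * (real p + 1) / (real p - 1)" if "prime p" for p
        using \<open>u = 0 \<or> u = 1\<close> prime_gt_1_nat[OF that] by auto
      then show "0 \<le> lam_err u P R" unfolding lam_err_def by (intro sum_nonneg mult_nonneg_nonneg wprod_nonneg) auto
    qed
    have uu: "u2 = 0 \<or> u2 = 1" "u3 = 0 \<or> u3 = 1" using u2 u3 by auto
    let ?r = "\<lambda>u::real. if u = 0 then 1 else R"
    have "\<bar>(\<Sum>n\<in>{n0<..N}. ?T n) - (real N - real n0) * corr_mean 1 u2 u3 h1 h2 h3 P R\<bar> \<le> lam_err 1 P R * lam_err u2 P R * lam_err u3 P R"
      by (rule corr_mean_interval) (use P uu n0N in auto)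
    also have "\<dots> \<le> (B * ?r 1) * (B * ?r u2) * (B * ?r u3)"
      using err[of 1] err[OF uu(1)] err[OF uu(2)] R B(1) by (intro mult_mono) auto
    also have "\<dots> = B ^ 3 * (?r 1 * ?r u2 * ?r u3)" by (simp add: power3_eq_cube)
    also have "?r 1 * ?r u2 * ?r u3 = R ^ k"
    proof -
      have "k = 1 \<and> u2 = 0 \<and> u3 = 0 \<or> k = 2 \<and> u2 = 1 \<and> u3 = 0 \<or> k = 2 \<and> u2 = 0 \<and> u3 = 1 \<or> k = 3 \<and> u2 = 1 \<and> u3 = 1"
        using k uu by auto
      then show ?thesis by (auto simp: power2_eq_square power3_eq_cube)
    qed
    finally show "\<exists>n0::nat. real n0 \<le> X \<and> \<bar>(\<Sum>n = 1..N. ?S n) - (real N - real n0) * level_mean 1 u2 u3 h1 h2 h3 R\<bar> \<le> B ^ 3 * R ^ k"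
      unfolding S level_mean_def P_def[symmetric] using n0X by blast
  qed (use B in auto)
qed

text \<open>A prime exceeding all differences is good, so its factor is
  \<open>1 + O(1 / p\<^sup>2)\<close>.\<close>

lemma local_sum_LIMSEQ:
  assumes u: "u1 = 0 \<or> u1 = 1" "u2 = 0 \<or> u2 = 1" "u3 = 0 \<or> u3 = 1"
    and h: "u1 * u2 \<noteq> 0 \<Longrightarrow> h1 \<noteq> h2" "u1 * u3 \<noteq> 0 \<Longrightarrow> h1 \<noteq> h3" "u2 * u3 \<noteq> 0 \<Longrightarrow> h2 \<noteq> h3"
  shows "(\<lambda>M. \<Prod>p\<in>primes_upto M. local_sum u1 u2 u3 h1 h2 h3 p) \<longlonglongrightarrow> (\<Prod>p. if prime p then local_sum u1 u2 u3 h1 h2 h3 p else 1)"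
proof (rule prodinf_primes_LIMSEQ)
  fix p :: nat
  assume p: "prime p" and big: "p > nat (\<bar>h1 - h2\<bar> + \<bar>h1 - h3\<bar> + \<bar>h2 - h3\<bar>)"
  have nd: "\<not> int p dvd g" if "g \<noteq> 0" "\<bar>g\<bar> \<le> \<bar>h1 - h2\<bar> + \<bar>h1 - h3\<bar> + \<bar>h2 - h3\<bar>" for g
  proof
    assume "int p dvd g"
    then have "\<bar>int p\<bar> \<le> \<bar>g\<bar>" using that(1) by (rule dvd_imp_le_int[rotated])
    then show False using that(2) big by linarith
  qed
  have "\<not> int p dvd h1 - h2" if "u1 * u2 \<noteq> 0" by (rule nd) (use h(1)[OF that] in simp, arith)
  moreover have "\<not> int p dvd h1 - h3" if "u1 * u3 \<noteq> 0" by (rule nd) (use h(2)[OF that] in simp, arith)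
  moreover have "\<not> int p dvd h2 - h3" if "u2 * u3 \<noteq> 0" by (rule nd) (use h(3)[OF that] in simp, arith)
  ultimately have "\<not> bad_prime u1 u2 u3 h1 h2 h3 p" unfolding bad_prime_def by blast
  then have "local_abs u1 u2 u3 h1 h2 h3 p \<le> 20 / (real p)\<^sup>2"
    using local_abs_bound[OF prime_ge_2_nat[OF p] u, of h1 h2 h3] by simp
  then show "\<bar>local_sum u1 u2 u3 h1 h2 h3 p - 1\<bar> \<le> 20 / (real p)\<^sup>2"
    unfolding local_sum_def local_abs_def by linarith
qed

text \<open>With \<open>R\<close> fixed, enlarging the set of primes leaves the mean unchanged while
  the truncated Euler product tends to the infinite one. The bound of
  \<open>corr_mean_complete\<close> is uniform in \<open>M\<close> and passes to the limit.\<close>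

lemma distinct_mean:
  assumes \<zeta>: "\<zeta> > 0"
  obtains K where "K \<ge> 1" "\<And>u1 u2 u3 h1 h2 h3 R X. u1 = 0 \<or> u1 = 1 \<Longrightarrow> u2 = 0 \<or> u2 = 1 \<Longrightarrow> u3 = 0 \<or> u3 = 1 \<Longrightarrow>
     (u1 * u2 \<noteq> 0 \<Longrightarrow> h1 \<noteq> h2 \<and> real_of_int \<bar>h1 - h2\<bar> \<le> X) \<Longrightarrow> (u1 * u3 \<noteq> 0 \<Longrightarrow> h1 \<noteq> h3 \<and> real_of_int \<bar>h1 - h3\<bar> \<le> X) \<Longrightarrow>
     (u2 * u3 \<noteq> 0 \<Longrightarrow> h2 \<noteq> h3 \<and> real_of_int \<bar>h2 - h3\<bar> \<le> X) \<Longrightarrow> X \<ge> 1 \<Longrightarrow> R \<ge> 1 \<Longrightarrow>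
     \<bar>level_mean u1 u2 u3 h1 h2 h3 R - (\<Prod>p. if prime p then local_sum u1 u2 u3 h1 h2 h3 p else 1)\<bar> \<le> K * X powr \<zeta> * R powr (- 1 / 6) \<and>
     \<bar>\<Prod>p. if prime p then local_sum u1 u2 u3 h1 h2 h3 p else 1\<bar> \<le> K * X powr \<zeta>"
proof -
  obtain K where K: "K \<ge> 1" "\<And>u1 u2 u3 h1 h2 h3 M X. u1 = 0 \<or> u1 = 1 \<Longrightarrow> u2 = 0 \<or> u2 = 1 \<Longrightarrow> u3 = 0 \<or> u3 = 1 \<Longrightarrow>
     (u1 * u2 \<noteq> 0 \<Longrightarrow> h1 \<noteq> h2 \<and> real_of_int \<bar>h1 - h2\<bar> \<le> X) \<Longrightarrow> (u1 * u3 \<noteq> 0 \<Longrightarrow> h1 \<noteq> h3 \<and> real_of_int \<bar>h1 - h3\<bar> \<le> X) \<Longrightarrow>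
     (u2 * u3 \<noteq> 0 \<Longrightarrow> h2 \<noteq> h3 \<and> real_of_int \<bar>h2 - h3\<bar> \<le> X) \<Longrightarrow> X \<ge> 1 \<Longrightarrow>
     (\<Prod>p\<in>primes_upto M. 1 + sqrt (real p) * local_abs u1 u2 u3 h1 h2 h3 p) \<le> K * X powr \<zeta>"
    by (fact distinct_error_bound[OF \<zeta>])
  show ?thesis
  proof (rule that[OF K(1)])
    fix u1 u2 u3 R X :: real and h1 h2 h3 :: int
    assume u: "u1 = 0 \<or> u1 = 1" "u2 = 0 \<or> u2 = 1" "u3 = 0 \<or> u3 = 1"
      and h: "u1 * u2 \<noteq> 0 \<Longrightarrow> h1 \<noteq> h2 \<and> real_of_int \<bar>h1 - h2\<bar> \<le> X" "u1 * u3 \<noteq> 0 \<Longrightarrow> h1 \<noteq> h3 \<and> real_of_int \<bar>h1 - h3\<bar> \<le> X"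
        "u2 * u3 \<noteq> 0 \<Longrightarrow> h2 \<noteq> h3 \<and> real_of_int \<bar>h2 - h3\<bar> \<le> X" and X: "X \<ge> 1" and R: "R \<ge> 1"
    let ?S = "\<Prod>p. if prime p then local_sum u1 u2 u3 h1 h2 h3 p else 1"
    let ?p = "\<lambda>M. \<Prod>p\<in>primes_upto M. local_sum u1 u2 u3 h1 h2 h3 p"
    have lim: "?p \<longlonglongrightarrow> ?S" by (rule local_sum_LIMSEQ) (use u h in auto)
    have Kb: "(\<Prod>p\<in>primes_upto M. 1 + sqrt (real p) * local_abs u1 u2 u3 h1 h2 h3 p) \<le> K * X powr \<zeta>" for M
      using K(2)[OF u h X] .
    have "\<bar>?p M\<bar> \<le> K * X powr \<zeta>" for M
    proof -
      have "\<bar>?p M\<bar> = (\<Prod>p\<in>primes_upto M. \<bar>local_sum u1 u2 u3 h1 h2 h3 p\<bar>)" by (rule abs_prod)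
      also have "\<dots> \<le> (\<Prod>p\<in>primes_upto M. 1 + sqrt (real p) * local_abs u1 u2 u3 h1 h2 h3 p)"
      proof (intro prod_mono conjI)
        fix p assume "p \<in> primes_upto M"
        then have "p \<ge> 1" by (intro prime_ge_1_nat prime_primes_upto)
        then have "sqrt (real p) \<ge> 1" by simp
        moreover have la: "local_abs u1 u2 u3 h1 h2 h3 p \<ge> 0" by (simp add: local_abs_def)
        ultimately have "1 * local_abs u1 u2 u3 h1 h2 h3 p \<le> sqrt (real p) * local_abs u1 u2 u3 h1 h2 h3 p" by (rule mult_right_mono)
        moreover have "\<bar>local_sum u1 u2 u3 h1 h2 h3 p\<bar> \<le> 1 + local_abs u1 u2 u3 h1 h2 h3 p"
          unfolding local_sum_def local_abs_def by linarith
        ultimately show "\<bar>local_sum u1 u2 u3 h1 h2 h3 p\<bar> \<le> 1 + sqrt (real p) * local_abs u1 u2 u3 h1 h2 h3 p" by linarith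
      qed simp
      finally show ?thesis using Kb[of M] by linarith
    qed
    then have S: "\<bar>?S\<bar> \<le> K * X powr \<zeta>" by (intro LIMSEQ_le_const2[OF tendsto_rabs[OF lim]]) auto
    have "\<bar>level_mean u1 u2 u3 h1 h2 h3 R - ?S\<bar> \<le> K * X powr \<zeta> * R powr (- 1 / 6)"
    proof (rule LIMSEQ_le_const2)
      show "(\<lambda>M. \<bar>level_mean u1 u2 u3 h1 h2 h3 R - ?p M\<bar>) \<longlonglongrightarrow> \<bar>level_mean u1 u2 u3 h1 h2 h3 R - ?S\<bar>"
        by (intro tendsto_intros lim)
      show "\<exists>n. \<forall>M\<ge>n. \<bar>level_mean u1 u2 u3 h1 h2 h3 R - ?p M\<bar> \<le> K * X powr \<zeta> * R powr (- 1 / 6)"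
      proof (intro exI allI impI)
        fix M :: nat assume "M \<ge> nat \<lceil>R\<rceil>"
        then have M: "R \<le> real M" by linarith
        have "\<bar>level_mean u1 u2 u3 h1 h2 h3 R - ?p M\<bar>
          \<le> R powr (- 1 / 6) * (\<Prod>p\<in>primes_upto M. 1 + sqrt (real p) * local_abs u1 u2 u3 h1 h2 h3 p)"
        proof -
          have "0 \<le> u1" "0 \<le> u2" "0 \<le> u3" using u by auto
          then show ?thesis unfolding level_mean_eq[OF M \<open>0 \<le> u1\<close> \<open>0 \<le> u2\<close> \<open>0 \<le> u3\<close>]
            by (intro corr_mean_complete finite_primes_upto R prime_primes_upto)
        qed
        also have "\<dots> \<le> R powr (- 1 / 6) * (K * X powr \<zeta>)" by (intro mult_left_mono Kb) auto
        finally show "\<bar>level_mean u1 u2 u3 h1 h2 h3 R - ?p M\<bar> \<le> K * X powr \<zeta> * R powr (- 1 / 6)" by (simp add: mult_ac)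
      qed
    qed
    with S show "\<bar>level_mean u1 u2 u3 h1 h2 h3 R - ?S\<bar> \<le> K * X powr \<zeta> * R powr (- 1 / 6) \<and> \<bar>?S\<bar> \<le> K * X powr \<zeta>" by blast
  qed
qed

text \<open>The product over primes is the singular series of the two distinct shifts: with weight 0
  in the third slot \<open>local_sum\<close> is a factor for two shifts.\<close>

lemma pair_mean:
  obtains K where "K \<ge> 1" "\<And>h R. R \<ge> 1 \<Longrightarrow> \<bar>level_mean 1 1 0 h h h R - ln R\<bar> \<le> K"
    "\<And>h h3 R k. R \<ge> 1 \<Longrightarrow> h \<noteq> h3 \<Longrightarrow> k \<ge> 1 \<Longrightarrow> (log 2 (real_of_int \<bar>h - h3\<bar>))\<^sup>2 \<le> 2 ^ k \<Longrightarrow>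
       \<bar>level_mean 1 1 1 h h h3 R - ln R * (\<Prod>p. if prime p then local_sum 1 1 0 h h3 h p else 1)\<bar> \<le> K * real k ^ 46"
proof -
  obtain K where K: "K \<ge> 1"
    "\<And>u3 h h3 M. u3 = 0 \<Longrightarrow> (\<Prod>p\<in>primes_upto M. 1 + pair_bad u3 h h3 p) * (1 + (\<Sum>p\<in>primes_upto M. 5 * ln (real p) * pair_bad u3 h h3 p)) \<le> K"
    "\<And>u3 h h3 M k. h \<noteq> h3 \<Longrightarrow> k \<ge> 1 \<Longrightarrow> (log 2 (real_of_int \<bar>h - h3\<bar>))\<^sup>2 \<le> 2 ^ k \<Longrightarrow>
       (\<Prod>p\<in>primes_upto M. 1 + pair_bad u3 h h3 p) * (1 + (\<Sum>p\<in>primes_upto M. 5 * ln (real p) * pair_bad u3 h h3 p)) \<le> K * real k ^ 46"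
    by (fact pair_error_bound)
  have p2: "p \<ge> 2" if "p \<in> primes_upto M" for p M using that prime_primes_upto prime_ge_2_nat by blast
  show ?thesis
  proof (rule that[OF K(1)])
    fix h :: int and R :: real
    assume R: "R \<ge> 1"
    define M where "M = nat \<lceil>R\<rceil>"
    have M: "R \<le> real M" by (simp add: M_def real_nat_ceiling_ge)
    have "(\<Prod>p\<in>primes_upto M. (1 - 1 / real p) * local_sum 1 1 0 h h h p) = 1"
      by (intro prod.neutral ballI local_sum_values(4) p2)
    then show "\<bar>level_mean 1 1 0 h h h R - ln R\<bar> \<le> K"
      using pair_mean_asymp[OF M R, of 0 h h] K(2)[where ?u3.0 = 0 and M = M and h = h and ?h3.0 = h] unfolding level_mean_def M_def[symmetric] by simp
  next
    fix h h3 :: int and R :: real and k :: nat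
    assume R: "R \<ge> 1" and h: "h \<noteq> h3" and k: "k \<ge> 1" "(log 2 (real_of_int \<bar>h - h3\<bar>))\<^sup>2 \<le> 2 ^ k"
    let ?S = "\<Prod>p. if prime p then local_sum 1 1 0 h h3 h p else 1"
    let ?p = "\<lambda>M. \<Prod>p\<in>primes_upto M. local_sum 1 1 0 h h3 h p"
    have lim: "?p \<longlonglongrightarrow> ?S" by (rule local_sum_LIMSEQ) (use h in auto)
    show "\<bar>level_mean 1 1 1 h h h3 R - ln R * ?S\<bar> \<le> K * real k ^ 46"
    proof (rule LIMSEQ_le_const2)
      show "(\<lambda>M. \<bar>level_mean 1 1 1 h h h3 R - ln R * ?p M\<bar>) \<longlonglongrightarrow> \<bar>level_mean 1 1 1 h h h3 R - ln R * ?S\<bar>"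
        by (intro tendsto_intros lim)
      show "\<exists>n. \<forall>M\<ge>n. \<bar>level_mean 1 1 1 h h h3 R - ln R * ?p M\<bar> \<le> K * real k ^ 46"
      proof (intro exI allI impI)
        fix M :: nat assume "M \<ge> nat \<lceil>R\<rceil>"
        then have M: "R \<le> real M" by linarith
        have "(\<Prod>p\<in>primes_upto M. (1 - 1 / real p) * local_sum 1 1 1 h h h3 p) = ?p M"
          by (intro prod.cong refl) (simp only: local_sum_values(2,5)[OF p2])
        then show "\<bar>level_mean 1 1 1 h h h3 R - ln R * ?p M\<bar> \<le> K * real k ^ 46"
          using pair_mean_asymp[OF M R, of 1 h h3] K(3)[OF h k, where M = M and ?u3.0 = 1] level_mean_eq[OF M, of 1 1 1 h h h3] by simp
      qed
    qed
  qed
qed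

text \<open>\<open>c\<close> is the implied constant in the lower bound for \<open>R\<close>. It is
  fixed in advance, whereas \<open>R\<close> and \<open>js\<close> may vary with
  \<open>N\<close>.\<close>

definition admissible :: "real \<Rightarrow> real \<Rightarrow> nat \<Rightarrow> nat \<Rightarrow> real \<Rightarrow> int list \<Rightarrow> bool" where
  "admissible \<epsilon> c l N R js \<longleftrightarrow> R \<ge> 1 \<and> R \<ge> c * real N powr \<epsilon> \<and> length js = l \<and> distinct js \<and>
     (\<forall>j\<in>set js. \<bar>real_of_int j\<bar> \<le> real N powr (1 - \<epsilon>))"

text \<open>The bound for the singular series is carried along because the effective interval may be
  short of \<open>N powr (1 - \<epsilon>)\<close> integers; a series of size
  \<open>N powr (\<epsilon> / 2)\<close> keeps their contribution negligible.\<close>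

definition mean_asymp :: "real \<Rightarrow> real \<Rightarrow> nat \<Rightarrow> nat \<Rightarrow> real \<Rightarrow> (real \<Rightarrow> int list \<Rightarrow> real) \<Rightarrow> bool" where
  "mean_asymp \<epsilon> c l e C A \<longleftrightarrow> (\<exists>\<delta> K. \<delta> \<longlonglongrightarrow> 0 \<and> (\<forall>\<^sub>F N in sequentially. \<forall>R js. admissible \<epsilon> c l N R js \<longrightarrow>
     \<bar>A R js - C * singular_series js * ln R ^ e\<bar> \<le> \<delta> N * ln R ^ e \<and> \<bar>singular_series js\<bar> \<le> K * real N powr (\<epsilon> / 2)))"

lemma log_level:
  fixes \<epsilon> c :: real
  assumes "\<epsilon> > 0" "c > 0"
  shows "(\<lambda>N. 1 / (ln c + \<epsilon> * ln (real N))) \<longlonglongrightarrow> 0"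
    and "\<forall>\<^sub>F N in sequentially. ln c + \<epsilon> * ln (real N) \<ge> 1"
proof -
  have lim: "filterlim (\<lambda>N. ln c + \<epsilon> * ln (real N)) at_top sequentially"
    by (intro filterlim_tendsto_add_at_top[OF tendsto_const] filterlim_tendsto_pos_mult_at_top[OF tendsto_const assms(1)]
        filterlim_compose[OF ln_at_top filterlim_real_sequentially])
  then show "(\<lambda>N. 1 / (ln c + \<epsilon> * ln (real N))) \<longlonglongrightarrow> 0"
    using tendsto_inverse_0_at_top[OF lim] by (simp add: divide_inverse)
  show "\<forall>\<^sub>F N in sequentially. ln c + \<epsilon> * ln (real N) \<ge> 1"
    using lim by (simp add: filterlim_at_top)
qed

lemma admissible_ln:
  assumes "admissible \<epsilon> c l N R js" "c > 0" "N \<ge> 1"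
  shows "ln R \<ge> ln c + \<epsilon> * ln (real N)"
proof -
  have "ln c + \<epsilon> * ln (real N) = ln (c * real N powr \<epsilon>)" using assms by (simp add: ln_mult ln_powr)
  also have "\<dots> \<le> ln R" using assms by (intro ln_mono) (auto simp: admissible_def)
  finally show ?thesis .
qed

lemma admissible_bound:
  assumes "admissible \<epsilon> c l N R js" "\<epsilon> > 0" "N \<ge> 1"
  shows "real N powr (1 - \<epsilon>) \<le> real N"
    and "\<And>i. i < l \<Longrightarrow> real_of_int \<bar>js ! i\<bar> \<le> real N powr (1 - \<epsilon>)"
    and "\<And>i j. i < l \<Longrightarrow> j < l \<Longrightarrow> real_of_int \<bar>js ! i - js ! j\<bar> \<le> 2 * real N"
proof -
  have "real N powr (1 - \<epsilon>) \<le> real N powr 1" using assms by (intro powr_mono) auto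
  then show N: "real N powr (1 - \<epsilon>) \<le> real N" using assms by simp
  show i: "real_of_int \<bar>js ! i\<bar> \<le> real N powr (1 - \<epsilon>)" if "i < l" for i
    using assms(1) that by (auto simp: admissible_def)
  show "real_of_int \<bar>js ! i - js ! j\<bar> \<le> 2 * real N" if "i < l" "j < l" for i j
    using i[OF that(1)] i[OF that(2)] N by linarith
qed

lemma tuple_asymp:
  fixes \<epsilon> c u2 u3 :: real and k l i1 i2 i3 :: nat
  assumes \<epsilon>: "\<epsilon> > 0" and c: "c > 0" and l: "l \<le> k"
    and i: "i1 < l" "i2 < l" "i3 < l"
    and u: "(u2 = 0 \<and> i2 = i1) \<or> u2 = 1" "(u3 = 0 \<and> i3 = i1) \<or> u3 = 1" "real k = 1 + u2 + u3"
    and C: "\<bar>C\<bar> \<le> 1"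
    and mean: "mean_asymp \<epsilon> c l (k - l) C (\<lambda>R js. level_mean 1 u2 u3 (js ! i1) (js ! i2) (js ! i3) R)"
    and S: "\<And>N R js. length js = l \<Longrightarrow> S N R js = (\<Sum>n = 1..N. lambda_R R (int n + js ! i1) * lambda_opt u2 R (int n + js ! i2) * lambda_opt u3 R (int n + js ! i3))"
  shows "\<exists>(\<delta> :: nat \<Rightarrow> real) B. \<delta> \<longlonglongrightarrow> 0 \<and> (\<forall>\<^sub>F N in sequentially. \<forall>R js. admissible \<epsilon> c l N R js \<longrightarrow>
    (\<exists>u v. \<bar>u\<bar> \<le> \<delta> N \<and> \<bar>v\<bar> \<le> B * R ^ k \<and> S N R js = (C * singular_series js + u) * real N * ln R ^ (k - l) + v))"
proof -
  obtain B where B: "B \<ge> 0" "\<And>k u2 u3 h1 h2 h3 R X N. R \<ge> 1 \<Longrightarrow> (u2 = 0 \<and> h2 = h1) \<or> u2 = 1 \<Longrightarrow> (u3 = 0 \<and> h3 = h1) \<or> u3 = 1 \<Longrightarrow>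
    real k = 1 + u2 + u3 \<Longrightarrow> real_of_int \<bar>h1\<bar> \<le> X \<Longrightarrow> real_of_int \<bar>h2\<bar> \<le> X \<Longrightarrow> real_of_int \<bar>h3\<bar> \<le> X \<Longrightarrow> X \<le> real N \<Longrightarrow>
    \<exists>n0::nat. real n0 \<le> X \<and> \<bar>(\<Sum>n = 1..N. lambda_R R (int n + h1) * lambda_opt u2 R (int n + h2) * lambda_opt u3 R (int n + h3))
      - (real N - real n0) * level_mean 1 u2 u3 h1 h2 h3 R\<bar> \<le> B * R ^ k"
    by (fact tuple_sum_approx)
  define e where "e = k - l"
  obtain \<delta> K where \<delta>: "\<delta> \<longlonglongrightarrow> 0" and ev: "\<forall>\<^sub>F N in sequentially. \<forall>R js. admissible \<epsilon> c l N R js \<longrightarrow>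
     \<bar>level_mean 1 u2 u3 (js ! i1) (js ! i2) (js ! i3) R - C * singular_series js * ln R ^ e\<bar> \<le> \<delta> N * ln R ^ e
     \<and> \<bar>singular_series js\<bar> \<le> K * real N powr (\<epsilon> / 2)"
    using mean unfolding mean_asymp_def e_def[symmetric] by auto
  \<comment> \<open>The second term is the number of missing integers times the bound for the
    singular series, relative to \<open>N\<close>.\<close>
  define \<delta>' where "\<delta>' N = \<delta> N + K * real N powr (- (\<epsilon> / 2))" for N
  have "(\<lambda>N. real N powr (- (\<epsilon> / 2))) \<longlonglongrightarrow> 0" using \<epsilon> by (intro tendsto_neg_powr filterlim_real_sequentially) auto
  then have "(\<lambda>N. \<delta> N + K * real N powr (- (\<epsilon> / 2))) \<longlonglongrightarrow> 0 + K * 0" by (intro tendsto_intros \<delta>)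
  then have \<delta>': "\<delta>' \<longlonglongrightarrow> 0" by (simp add: \<delta>'_def[abs_def])
  show ?thesis
  proof (intro exI[of _ \<delta>'] exI[of _ B] conjI \<delta>')
    show "\<forall>\<^sub>F N in sequentially. \<forall>R js. admissible \<epsilon> c l N R js \<longrightarrow>
      (\<exists>u v. \<bar>u\<bar> \<le> \<delta>' N \<and> \<bar>v\<bar> \<le> B * R ^ k \<and> S N R js = (C * singular_series js + u) * real N * ln R ^ (k - l) + v)"
      using ev log_level(2)[OF \<epsilon> c] eventually_ge_at_top[of 1]
    proof eventually_elim
      case (elim N)
      show ?case
      proof (intro allI impI)
        fix R js assume ad: "admissible \<epsilon> c l N R js"
        define X where "X = real N powr (1 - \<epsilon>)"
        define m where "m = level_mean 1 u2 u3 (js ! i1) (js ! i2) (js ! i3) R"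
        define SS where "SS = C * singular_series js"
        define L where "L = ln R ^ e"
        have R: "R \<ge> 1" and len: "length js = l" using ad by (auto simp: admissible_def)
        have N: "real N > 0" "N \<ge> 1" using elim by auto
        have "ln R \<ge> 1" using admissible_ln[OF ad c N(2)] elim(2) by linarith
        then have L: "L > 0" by (simp add: L_def)
        note bnd = admissible_bound[OF ad \<epsilon> N(2), folded X_def]
        have "\<exists>n0::nat. real n0 \<le> X \<and> \<bar>S N R js - (real N - real n0) * m\<bar> \<le> B * R ^ k"
          unfolding S[OF len] m_def by (rule B(2)) (use R u bnd i in auto)
        then obtain n0 :: nat where n0: "real n0 \<le> X" "\<bar>S N R js - (real N - real n0) * m\<bar> \<le> B * R ^ k" by blast
        have m: "\<bar>m - SS * L\<bar> \<le> \<delta> N * L" and SS: "\<bar>singular_series js\<bar> \<le> K * real N powr (\<epsilon> / 2)"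
          using elim(1)[rule_format, OF ad] by (simp_all add: m_def SS_def L_def)
        have "\<bar>SS\<bar> \<le> 1 * \<bar>singular_series js\<bar>" unfolding SS_def abs_mult using C by (intro mult_right_mono) auto
        then have SS: "\<bar>SS\<bar> \<le> K * real N powr (\<epsilon> / 2)" using SS by linarith
        \<comment> \<open>\<open>u\<close> is the exact relative defect of the main term and
          \<open>v\<close> the exact error of the interval mean, so the identity holds by
          construction and only their sizes are at stake.\<close>
        define u where "u = (real N - real n0) * m / (real N * L) - SS"
        define v where "v = S N R js - (real N - real n0) * m"
        have eq: "S N R js = (SS + u) * real N * L + v" using N L by (simp add: u_def v_def)
        have "u * (real N * L) = (real N - real n0) * (m - SS * L) - real n0 * (SS * L)"
          using N L by (simp add: u_def field_simps)
        also have "\<bar>\<dots>\<bar> \<le> \<bar>(real N - real n0) * (m - SS * L)\<bar> + \<bar>real n0 * (SS * L)\<bar>" by (rule abs_triangle_ineq4)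
        also have "\<dots> \<le> real N * (\<delta> N * L) + X * (K * real N powr (\<epsilon> / 2) * L)"
        proof (rule add_mono)
          have "\<bar>real N - real n0\<bar> \<le> real N" using n0(1) bnd(1) by simp
          then show "\<bar>(real N - real n0) * (m - SS * L)\<bar> \<le> real N * (\<delta> N * L)"
            unfolding abs_mult by (intro mult_mono m) auto
          have "\<bar>real n0\<bar> * (\<bar>SS\<bar> * \<bar>L\<bar>) \<le> X * (K * real N powr (\<epsilon> / 2) * L)"
            using n0(1) SS L by (intro mult_mono) (auto intro: order_trans[of 0 "\<bar>SS\<bar>"])
          then show "\<bar>real n0 * (SS * L)\<bar> \<le> X * (K * real N powr (\<epsilon> / 2) * L)" unfolding abs_mult .
        qed
        also have "\<dots> = \<delta>' N * (real N * L)"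
        proof -
          have "X * real N powr (\<epsilon> / 2) = real N powr (1 - \<epsilon> + \<epsilon> / 2)" unfolding X_def by (rule powr_add[symmetric])
          also have "\<dots> = real N powr (1 + - (\<epsilon> / 2))" by (simp add: field_simps)
          also have "\<dots> = real N * real N powr (- (\<epsilon> / 2))" unfolding powr_add using N by simp
          finally have "X * real N powr (\<epsilon> / 2) * (K * L) = real N * real N powr (- (\<epsilon> / 2)) * (K * L)" by simp
          then show ?thesis by (simp add: \<delta>'_def algebra_simps)
        qed
        finally have "\<bar>u\<bar> * (real N * L) \<le> \<delta>' N * (real N * L)" using N L by (simp add: abs_mult)
        then have "\<bar>u\<bar> \<le> \<delta>' N" using N L by (simp add: mult_le_cancel_right)
        moreover have "\<bar>v\<bar> \<le> B * R ^ k" unfolding v_def by (rule n0(2))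
        ultimately show "\<exists>u v. \<bar>u\<bar> \<le> \<delta>' N \<and> \<bar>v\<bar> \<le> B * R ^ k \<and> S N R js = (C * singular_series js + u) * real N * ln R ^ (k - l) + v"
          using eq unfolding SS_def L_def e_def by blast
      qed
    qed
  qed
qed

lemma singular_series_local_sum:
  "singular_series [a] = (\<Prod>p. if prime p then local_sum 1 0 0 a h h' p else 1)"
  "singular_series [a, b] = (\<Prod>p. if prime p then local_sum 1 1 0 a b h p else 1)"
  "singular_series [a, b, d] = (\<Prod>p. if prime p then local_sum 1 1 1 a b d p else 1)"
proof -
  have "(if prime p then series_factor [a] p else 1) = (if prime p then local_sum 1 0 0 a h h' p else 1)" for p
    by (auto simp: local_sum_values(1)[OF prime_ge_2_nat] series_factor_one[OF prime_ge_2_nat])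
  then show "singular_series [a] = (\<Prod>p. if prime p then local_sum 1 0 0 a h h' p else 1)" unfolding singular_series_alt by presburger
  have "(if prime p then series_factor [a, b] p else 1) = (if prime p then local_sum 1 1 0 a b h p else 1)" for p
    by (auto simp: local_sum_values(2)[OF prime_ge_2_nat])
  then show "singular_series [a, b] = (\<Prod>p. if prime p then local_sum 1 1 0 a b h p else 1)" unfolding singular_series_alt by presburger
  have "(if prime p then series_factor [a, b, d] p else 1) = (if prime p then local_sum 1 1 1 a b d p else 1)" for p
    by (auto simp: local_sum_values(3)[OF prime_ge_2_nat])
  then show "singular_series [a, b, d] = (\<Prod>p. if prime p then local_sum 1 1 1 a b d p else 1)" unfolding singular_series_alt by presburger
qed

lemma singular_series_one: "singular_series [a] = 1"
proof -
  have "(if prime p then series_factor [a] p else 1) = 1" for p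
    by (auto simp: series_factor_one[OF prime_ge_2_nat])
  then show ?thesis unfolding singular_series_alt by simp
qed

lemma singular_series_swap: "singular_series [a, b] = singular_series [b, a]"
proof -
  have "nu_p p [a, b] = nu_p p [b, a]" for p by (simp add: nu_p_def insert_commute)
  then show ?thesis by (simp add: singular_series_def cong: if_cong)
qed

lemma length_cases:
  "length js = 1 \<Longrightarrow> js = [js ! 0]" "length js = 2 \<Longrightarrow> js = [js ! 0, js ! 1]" "length js = 3 \<Longrightarrow> js = [js ! 0, js ! 1, js ! 2]"
  by (auto intro!: nth_equalityI simp: less_Suc_eq numeral_eq_Suc)

lemma mean_asymp_distinct:
  fixes \<epsilon> c u2 u3 :: real and l i1 i2 i3 :: nat
  assumes \<epsilon>: "\<epsilon> > 0" and c: "c > 0" and i: "i1 < l" "i2 < l" "i3 < l"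
    and u: "u2 = 0 \<or> u2 = 1 \<and> i1 \<noteq> i2" "u3 = 0 \<or> u3 = 1 \<and> i1 \<noteq> i3" "u2 = 0 \<or> u3 = 0 \<or> i2 \<noteq> i3"
    and S: "\<And>js. length js = l \<Longrightarrow> singular_series js = (\<Prod>p. if prime p then local_sum 1 u2 u3 (js ! i1) (js ! i2) (js ! i3) p else 1)"
  shows "mean_asymp \<epsilon> c l 0 1 (\<lambda>R js. level_mean 1 u2 u3 (js ! i1) (js ! i2) (js ! i3) R)"
    and "\<exists>K. \<forall>N R js. N \<ge> 1 \<longrightarrow> admissible \<epsilon> c l N R js \<longrightarrow> \<bar>singular_series js\<bar> \<le> K * real N powr (\<epsilon> / 2)"
proof -
  \<comment> \<open>Rankin's saving \<open>R powr (- 1 / 6)\<close> is at most a constant times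
    \<open>N powr (- \<epsilon> / 6)\<close>, that is \<open>N powr (- 2 * \<zeta>)\<close>; half of
    the exponent pays for the loss \<open>N powr \<zeta>\<close> at bad primes.\<close>
  define \<zeta> where "\<zeta> = \<epsilon> / 12"
  have \<zeta>: "\<zeta> > 0" using \<epsilon> by (simp add: \<zeta>_def)
  obtain K where K: "K \<ge> 1" "\<And>u1 u2 u3 h1 h2 h3 R X. u1 = 0 \<or> u1 = 1 \<Longrightarrow> u2 = 0 \<or> u2 = 1 \<Longrightarrow> u3 = 0 \<or> u3 = 1 \<Longrightarrow>
     (u1 * u2 \<noteq> 0 \<Longrightarrow> h1 \<noteq> h2 \<and> real_of_int \<bar>h1 - h2\<bar> \<le> X) \<Longrightarrow> (u1 * u3 \<noteq> 0 \<Longrightarrow> h1 \<noteq> h3 \<and> real_of_int \<bar>h1 - h3\<bar> \<le> X) \<Longrightarrow>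
     (u2 * u3 \<noteq> 0 \<Longrightarrow> h2 \<noteq> h3 \<and> real_of_int \<bar>h2 - h3\<bar> \<le> X) \<Longrightarrow> X \<ge> 1 \<Longrightarrow> R \<ge> 1 \<Longrightarrow>
     \<bar>level_mean u1 u2 u3 h1 h2 h3 R - (\<Prod>p. if prime p then local_sum u1 u2 u3 h1 h2 h3 p else 1)\<bar> \<le> K * X powr \<zeta> * R powr (- 1 / 6) \<and>
     \<bar>\<Prod>p. if prime p then local_sum u1 u2 u3 h1 h2 h3 p else 1\<bar> \<le> K * X powr \<zeta>"
    by (fact distinct_mean[OF \<zeta>])
  define A where "A = K * 2 powr \<zeta>"
  define D where "D = A * c powr (- 1 / 6)"
  have A: "A > 0" using K by (simp add: A_def)
  have main: "\<bar>level_mean 1 u2 u3 (js ! i1) (js ! i2) (js ! i3) R - singular_series js\<bar> \<le> D * real N powr (- \<zeta>) \<and> \<bar>singular_series js\<bar> \<le> A * real N powr (\<epsilon> / 2)"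
    if ad: "admissible \<epsilon> c l N R js" and N: "N \<ge> 1" for N R js
  proof -
    have R: "R \<ge> 1" "R \<ge> c * real N powr \<epsilon>" and len: "length js = l" and dist: "distinct js" using ad by (auto simp: admissible_def)
    have neq: "js ! a \<noteq> js ! b" if "a < l" "b < l" "a \<noteq> b" for a b using that dist len by (simp add: nth_eq_iff_index_eq)
    note bnd = admissible_bound(3)[OF ad \<epsilon> N]
    have X: "2 * real N \<ge> 1" using N by simp
    have uu: "u2 = 0 \<or> u2 = 1" "u3 = 0 \<or> u3 = 1" using u by auto
    have h: "1 * u2 \<noteq> 0 \<Longrightarrow> js ! i1 \<noteq> js ! i2 \<and> real_of_int \<bar>js ! i1 - js ! i2\<bar> \<le> 2 * real N"
      "1 * u3 \<noteq> 0 \<Longrightarrow> js ! i1 \<noteq> js ! i3 \<and> real_of_int \<bar>js ! i1 - js ! i3\<bar> \<le> 2 * real N"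
      "u2 * u3 \<noteq> 0 \<Longrightarrow> js ! i2 \<noteq> js ! i3 \<and> real_of_int \<bar>js ! i2 - js ! i3\<bar> \<le> 2 * real N"
      using u neq[OF i(1,2)] neq[OF i(1,3)] neq[OF i(2,3)] bnd[OF i(1,2)] bnd[OF i(1,3)] bnd[OF i(2,3)] by simp_all
    have 1: "\<bar>level_mean 1 u2 u3 (js ! i1) (js ! i2) (js ! i3) R - singular_series js\<bar> \<le> K * (2 * real N) powr \<zeta> * R powr (- 1 / 6)"
      "\<bar>singular_series js\<bar> \<le> K * (2 * real N) powr \<zeta>"
      using K(2)[OF _ uu h X R(1)] unfolding S[OF len] by simp_all
    have XA: "K * (2 * real N) powr \<zeta> = A * real N powr \<zeta>" by (simp add: A_def powr_mult)
    have cN: "c * real N powr \<epsilon> > 0" using c N by simp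
    have "R powr (- 1 / 6) \<le> (c * real N powr \<epsilon>) powr (- 1 / 6)"
      using R cN by (intro powr_mono2') auto
    also have "\<dots> = c powr (- 1 / 6) * real N powr (- 2 * \<zeta>)" using c by (simp add: powr_mult powr_powr \<zeta>_def)
    finally have "A * real N powr \<zeta> * R powr (- 1 / 6) \<le> A * real N powr \<zeta> * (c powr (- 1 / 6) * real N powr (- 2 * \<zeta>))"
      using A by (intro mult_left_mono) auto
    also have "\<dots> = D * (real N powr \<zeta> * real N powr (- 2 * \<zeta>))" by (simp add: D_def)
    also have "real N powr \<zeta> * real N powr (- 2 * \<zeta>) = real N powr (- \<zeta>)" unfolding powr_add[symmetric] by simp
    finally have "\<bar>level_mean 1 u2 u3 (js ! i1) (js ! i2) (js ! i3) R - singular_series js\<bar> \<le> D * real N powr (- \<zeta>)" using 1(1) XA by simp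
    moreover have "real N powr \<zeta> \<le> real N powr (\<epsilon> / 2)" using N \<epsilon> by (intro powr_mono) (auto simp: \<zeta>_def)
    then have "A * real N powr \<zeta> \<le> A * real N powr (\<epsilon> / 2)" using A by simp
    ultimately show ?thesis using 1(2) XA by simp
  qed
  show "mean_asymp \<epsilon> c l 0 1 (\<lambda>R js. level_mean 1 u2 u3 (js ! i1) (js ! i2) (js ! i3) R)"
    unfolding mean_asymp_def
  proof (intro exI conjI)
    have "(\<lambda>N. real N powr (- \<zeta>)) \<longlonglongrightarrow> 0" using \<zeta> by (intro tendsto_neg_powr filterlim_real_sequentially) auto
    then show "(\<lambda>N. D * real N powr (- \<zeta>)) \<longlonglongrightarrow> 0" by (rule tendsto_mult_right_zero)
    show "\<forall>\<^sub>F N in sequentially. \<forall>R js. admissible \<epsilon> c l N R js \<longrightarrow>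
      \<bar>level_mean 1 u2 u3 (js ! i1) (js ! i2) (js ! i3) R - 1 * singular_series js * ln R ^ 0\<bar> \<le> D * real N powr (- \<zeta>) * ln R ^ 0
      \<and> \<bar>singular_series js\<bar> \<le> A * real N powr (\<epsilon> / 2)"
      using eventually_ge_at_top[of 1] by eventually_elim (use main in simp)
  qed
  show "\<exists>K. \<forall>N R js. N \<ge> 1 \<longrightarrow> admissible \<epsilon> c l N R js \<longrightarrow> \<bar>singular_series js\<bar> \<le> K * real N powr (\<epsilon> / 2)"
    using main by blast
qed

lemma singular_series_length_one: "length js = 1 \<Longrightarrow> singular_series js = 1"
  using length_cases(1)[of js] singular_series_one by metis

text \<open>For a single shift the singular series is 1. An error one power of \<open>ln R\<close>
  below the main term tends to 0 relative to it, uniformly in \<open>R\<close>, because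
  \<open>ln R\<close> is at least \<open>ln c + \<epsilon> * ln N\<close>.\<close>

lemma mean_asymp_diag:
  fixes \<epsilon> c :: real
  assumes \<epsilon>: "\<epsilon> > 0" and c: "c > 0"
    and bound: "\<And>R h. R \<ge> 1 \<Longrightarrow> ln R \<ge> 1 \<Longrightarrow> \<bar>A R h - C * ln R ^ Suc e\<bar> \<le> K * ln R ^ e"
  shows "mean_asymp \<epsilon> c 1 (Suc e) C (\<lambda>R js. A R (js ! 0))"
  unfolding mean_asymp_def
proof (intro exI conjI)
  define \<delta> where "\<delta> = (\<lambda>N. \<bar>K\<bar> * (1 / (ln c + \<epsilon> * ln (real N))))"
  show "\<delta> \<longlonglongrightarrow> 0" unfolding \<delta>_def by (intro tendsto_mult_right_zero log_level \<epsilon> c)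
  show "\<forall>\<^sub>F N in sequentially. \<forall>R js. admissible \<epsilon> c 1 N R js \<longrightarrow>
     \<bar>A R (js ! 0) - C * singular_series js * ln R ^ Suc e\<bar> \<le> \<delta> N * ln R ^ Suc e \<and> \<bar>singular_series js\<bar> \<le> 1 * real N powr (\<epsilon> / 2)"
    using log_level(2)[OF \<epsilon> c] eventually_ge_at_top[of 1]
  proof eventually_elim
    case (elim N)
    show ?case
    proof (intro allI impI)
      fix R js assume ad: "admissible \<epsilon> c 1 N R js"
      then have R: "R \<ge> 1" and S: "singular_series js = 1" by (auto simp: admissible_def singular_series_length_one)
      define t where "t = ln c + \<epsilon> * ln (real N)"
      have t: "t \<ge> 1" "ln R \<ge> t" using elim admissible_ln[OF ad c] by (auto simp: t_def)
      have "\<bar>A R (js ! 0) - C * ln R ^ Suc e\<bar> \<le> K * ln R ^ e" using R t by (intro bound) auto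
      also have "\<dots> \<le> \<bar>K\<bar> * ln R ^ e" using t by (intro mult_right_mono) auto
      also have "\<dots> = \<bar>K\<bar> * ln R ^ e * 1" by simp
      also have "\<dots> \<le> \<bar>K\<bar> * ln R ^ e * (ln R / t)" using t by (intro mult_left_mono) auto
      also have "\<dots> = \<delta> N * ln R ^ Suc e" by (simp add: \<delta>_def t_def)
      finally have "\<bar>A R (js ! 0) - C * singular_series js * ln R ^ Suc e\<bar> \<le> \<delta> N * ln R ^ Suc e" unfolding S by simp
      moreover have "1 \<le> real N powr (\<epsilon> / 2)" using elim \<epsilon> by (intro ge_one_powr_ge_zero) auto
      ultimately show "\<bar>A R (js ! 0) - C * singular_series js * ln R ^ Suc e\<bar> \<le> \<delta> N * ln R ^ Suc e \<and> \<bar>singular_series js\<bar> \<le> 1 * real N powr (\<epsilon> / 2)"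
        unfolding S by simp
    qed
  qed
qed

lemma mean_asymp_square:
  assumes "\<epsilon> > 0" "c > 0"
  shows "mean_asymp \<epsilon> c 1 1 1 (\<lambda>R js. level_mean 1 1 0 (js ! 0) (js ! 0) (js ! 0) R)"
proof -
  obtain K where K: "K \<ge> 1" "\<And>h R. R \<ge> 1 \<Longrightarrow> \<bar>level_mean 1 1 0 h h h R - ln R\<bar> \<le> K"
    "\<And>h h3 R k. R \<ge> 1 \<Longrightarrow> h \<noteq> h3 \<Longrightarrow> k \<ge> 1 \<Longrightarrow> (log 2 (real_of_int \<bar>h - h3\<bar>))\<^sup>2 \<le> 2 ^ k \<Longrightarrow>
       \<bar>level_mean 1 1 1 h h h3 R - ln R * (\<Prod>p. if prime p then local_sum 1 1 0 h h3 h p else 1)\<bar> \<le> K * real k ^ 46"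
    by (fact pair_mean)
  show ?thesis
    using mean_asymp_diag[OF assms, of "\<lambda>R h. level_mean 1 1 0 h h h R" 1 0 K] K(2) by simp
qed

lemma mean_asymp_cube:
  assumes "\<epsilon> > 0" "c > 0"
  shows "mean_asymp \<epsilon> c 1 2 (3 / 4) (\<lambda>R js. level_mean 1 1 1 (js ! 0) (js ! 0) (js ! 0) R)"
proof -
  obtain K where K: "K \<ge> 0" "\<And>M R h. R \<ge> 1 \<Longrightarrow> R \<le> real M \<Longrightarrow>
    \<bar>corr_mean 1 1 1 h h h (primes_upto M) R - 3 / 4 * (ln R)\<^sup>2\<bar> \<le> K * (1 + ln R)"
    by (fact diag_mean_asymp)
  have "\<bar>level_mean 1 1 1 h h h R - 3 / 4 * ln R ^ Suc 1\<bar> \<le> 2 * K * ln R ^ 1" if "R \<ge> 1" "ln R \<ge> 1" for R h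
  proof -
    have "\<bar>level_mean 1 1 1 h h h R - 3 / 4 * (ln R)\<^sup>2\<bar> \<le> K * (1 + ln R)"
      unfolding level_mean_def using that by (intro K real_nat_ceiling_ge)
    also have "\<dots> \<le> K * (2 * ln R)" using that K(1) by (intro mult_left_mono) auto
    finally show ?thesis by (simp add: power2_eq_square)
  qed
  then show ?thesis
    using mean_asymp_diag[OF assms, of "\<lambda>R h. level_mean 1 1 1 h h h R" "3 / 4" 1 "2 * K"] by (simp add: numeral_2_eq_2)
qed

text \<open>A fixed power of a double logarithm is negligible against \<open>ln N\<close>; 46 is the
  exponent from \<open>pair_error_bound\<close>.\<close>

lemma iterated_log_limit:
  fixes \<epsilon> c :: real
  assumes "\<epsilon> > 0"
  shows "(\<lambda>N. (2 * log 2 (log 2 (2 * real N)) + 2) ^ 46 / (ln c + \<epsilon> * ln (real N))) \<longlonglongrightarrow> 0"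
  using assms by real_asymp

lemma mean_asymp_pair:
  fixes \<epsilon> c :: real
  assumes \<epsilon>: "\<epsilon> > 0" and c: "c > 0" and i: "(i1 = 0 \<and> i2 = 1) \<or> (i1 = 1 \<and> i2 = 0)"
  shows "mean_asymp \<epsilon> c 2 1 1 (\<lambda>R js. level_mean 1 1 1 (js ! i1) (js ! i1) (js ! i2) R)"
proof -
  have ss: "singular_series js = (\<Prod>p. if prime p then local_sum 1 1 0 (js ! i1) (js ! i2) (js ! i1) p else 1)" if "length js = 2" for js
  proof -
    have "singular_series js = singular_series [js ! 0, js ! 1]" using length_cases(2)[OF that] by simp
    also have "\<dots> = singular_series [js ! i1, js ! i2]" using i singular_series_swap by auto
    also have "\<dots> = (\<Prod>p. if prime p then local_sum 1 1 0 (js ! i1) (js ! i2) (js ! i1) p else 1)" by (rule singular_series_local_sum)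
    finally show ?thesis .
  qed
  \<comment> \<open>The bound for the series of the two distinct shifts is borrowed from the
    distinct case with weights 1, 1, 0.\<close>
  have "\<exists>K. \<forall>N R js. N \<ge> 1 \<longrightarrow> admissible \<epsilon> c 2 N R js \<longrightarrow> \<bar>singular_series js\<bar> \<le> K * real N powr (\<epsilon> / 2)"
    by (rule mean_asymp_distinct(2)[OF \<epsilon> c, of i1 2 i2 i1 1 0]) (use i ss in auto)
  then obtain K' where K': "\<And>N R js. N \<ge> 1 \<Longrightarrow> admissible \<epsilon> c 2 N R js \<Longrightarrow> \<bar>singular_series js\<bar> \<le> K' * real N powr (\<epsilon> / 2)" by blast
  obtain K where K: "K \<ge> 1" "\<And>h R. R \<ge> 1 \<Longrightarrow> \<bar>level_mean 1 1 0 h h h R - ln R\<bar> \<le> K"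
    "\<And>h h3 R k. R \<ge> 1 \<Longrightarrow> h \<noteq> h3 \<Longrightarrow> k \<ge> 1 \<Longrightarrow> (log 2 (real_of_int \<bar>h - h3\<bar>))\<^sup>2 \<le> 2 ^ k \<Longrightarrow>
       \<bar>level_mean 1 1 1 h h h3 R - ln R * (\<Prod>p. if prime p then local_sum 1 1 0 h h3 h p else 1)\<bar> \<le> K * real k ^ 46"
    by (fact pair_mean)
  define w where "w N = 2 * log 2 (log 2 (2 * real N)) + 2" for N
  define \<delta> where "\<delta> = (\<lambda>N. K * (w N ^ 46 / (ln c + \<epsilon> * ln (real N))))"
  show ?thesis unfolding mean_asymp_def
  proof (intro exI conjI)
    show "\<delta> \<longlonglongrightarrow> 0" unfolding \<delta>_def w_def by (intro tendsto_mult_right_zero iterated_log_limit \<epsilon>)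
    show "\<forall>\<^sub>F N in sequentially. \<forall>R js. admissible \<epsilon> c 2 N R js \<longrightarrow>
     \<bar>level_mean 1 1 1 (js ! i1) (js ! i1) (js ! i2) R - 1 * singular_series js * ln R ^ 1\<bar> \<le> \<delta> N * ln R ^ 1 \<and> \<bar>singular_series js\<bar> \<le> K' * real N powr (\<epsilon> / 2)"
      using log_level(2)[OF \<epsilon> c] eventually_ge_at_top[of 1]
    proof eventually_elim
      case (elim N)
      show ?case
      proof (intro allI impI conjI)
        fix R js assume ad: "admissible \<epsilon> c 2 N R js"
        show "\<bar>singular_series js\<bar> \<le> K' * real N powr (\<epsilon> / 2)" using K' elim(2) ad by blast
        have R: "R \<ge> 1" and len: "length js = 2" and dist: "distinct js" using ad by (auto simp: admissible_def)
        define t where "t = ln c + \<epsilon> * ln (real N)"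
        have t: "t \<ge> 1" "ln R \<ge> t" using elim admissible_ln[OF ad c] by (auto simp: t_def)
        have i2: "i1 < 2" "i2 < 2" "i1 \<noteq> i2" using i by auto
        then have neq: "js ! i1 \<noteq> js ! i2" using dist len by (simp add: nth_eq_iff_index_eq)
        define g where "g = real_of_int \<bar>js ! i1 - js ! i2\<bar>"
        have "\<bar>js ! i1 - js ! i2\<bar> \<ge> 1" using neq by linarith
        then have g: "g \<ge> 1" "g \<le> 2 * real N" using admissible_bound(3)[OF ad \<epsilon> elim(2) i2(1,2)] by (simp_all add: g_def)
        define y where "y = log 2 (2 * real N)"
        have "log 2 2 \<le> y" unfolding y_def using elim(2) by (subst log_le_cancel_iff) auto
        then have y: "y \<ge> 1" by simp
        \<comment> \<open>\<open>y\<close> bounds \<open>log 2\<close> of every difference of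
          shifts, so \<open>2 ^ k \<ge> y\<^sup>2\<close> is what \<open>pair_mean\<close> asks for;
          the added 1 guarantees \<open>k \<ge> 1\<close>.\<close>
        define k where "k = nat \<lceil>2 * log 2 y\<rceil> + 1"
        have ly: "log 2 y \<ge> 0" using y by simp
        have k: "real k \<ge> 2 * log 2 y" "real k \<le> w N" "k \<ge> 1"
          using ly by (auto simp: k_def w_def y_def[symmetric]) linarith+
        have "(log 2 g)\<^sup>2 \<le> y\<^sup>2" unfolding y_def using g elim(2) by (intro power_mono) auto
        also have "\<dots> = (2 powr (log 2 y))\<^sup>2" using y by simp
        also have "\<dots> = 2 powr (2 * log 2 y)" by (simp add: power2_eq_square powr_add[symmetric])
        also have "\<dots> \<le> 2 powr (real k)" using k(1) by (intro powr_mono) auto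
        also have "\<dots> = 2 ^ k" by (simp add: powr_realpow)
        finally have "(log 2 g)\<^sup>2 \<le> 2 ^ k" .
        then have "\<bar>level_mean 1 1 1 (js ! i1) (js ! i1) (js ! i2) R - ln R * singular_series js\<bar> \<le> K * real k ^ 46"
          unfolding ss[OF len] g_def by (rule K(3)[OF R neq k(3)])
        also have "\<dots> \<le> K * w N ^ 46" using k K(1) by (intro mult_left_mono power_mono) auto
        also have "\<dots> = \<delta> N * t" using t by (simp add: \<delta>_def t_def)
        also have "\<dots> \<le> \<delta> N * ln R"
        proof (rule mult_left_mono[OF t(2)])
          show "\<delta> N \<ge> 0" unfolding \<delta>_def t_def[symmetric] using t K(1) by (intro mult_nonneg_nonneg divide_nonneg_nonneg) auto
        qed
        finally show "\<bar>level_mean 1 1 1 (js ! i1) (js ! i1) (js ! i2) R - 1 * singular_series js * ln R ^ 1\<bar> \<le> \<delta> N * ln R ^ 1"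
          by (simp add: mult_ac)
      qed
    qed
  qed
qed

lemma corr_sum_asymp:
  fixes \<epsilon> c u2 u3 :: real and k i1 i2 i3 :: nat and as :: "nat list"
  assumes \<epsilon>: "\<epsilon> > 0" and c: "c > 0" and l: "length as \<le> k"
    and i: "i1 < length as" "i2 < length as" "i3 < length as"
    and u: "(u2 = 0 \<and> i2 = i1) \<or> u2 = 1" "(u3 = 0 \<and> i3 = i1) \<or> u3 = 1" "real k = 1 + u2 + u3"
    and C: "\<bar>corr_const k as\<bar> \<le> 1"
    and mean: "mean_asymp \<epsilon> c (length as) (k - length as) (corr_const k as) (\<lambda>R js. level_mean 1 u2 u3 (js ! i1) (js ! i2) (js ! i3) R)"
    and S: "\<And>N R js. corr_sum N R js as = (\<Sum>n = 1..N. lambda_R R (int n + js ! i1) * lambda_opt u2 R (int n + js ! i2) * lambda_opt u3 R (int n + js ! i3))"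
  shows "\<exists>(\<delta> :: nat \<Rightarrow> real) (B :: real). \<delta> \<longlonglongrightarrow> 0 \<and>
    (\<forall>\<^sub>F N in sequentially. \<forall>(R :: real) (js :: int list).
       R \<ge> 1 \<longrightarrow> R \<ge> c * real N powr \<epsilon> \<longrightarrow>
       length js = length as \<longrightarrow> distinct js \<longrightarrow>
       (\<forall>j\<in>set js. \<bar>real_of_int j\<bar> \<le> real N powr (1 - \<epsilon>)) \<longrightarrow>
       (\<exists>u v. \<bar>u\<bar> \<le> \<delta> N \<and> \<bar>v\<bar> \<le> B * R ^ k \<and>
          corr_sum N R js as =
            (corr_const k as * singular_series js + u) * real N * ln R ^ (k - length as) + v))"
proof -
  from tuple_asymp[OF \<epsilon> c l i u C mean, of "\<lambda>N R js. corr_sum N R js as"] S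
  obtain \<delta> :: "nat \<Rightarrow> real" and B where \<delta>: "\<delta> \<longlonglongrightarrow> 0"
    and ev: "\<forall>\<^sub>F N in sequentially. \<forall>R js. admissible \<epsilon> c (length as) N R js \<longrightarrow>
    (\<exists>u v. \<bar>u\<bar> \<le> \<delta> N \<and> \<bar>v\<bar> \<le> B * R ^ k \<and> corr_sum N R js as = (corr_const k as * singular_series js + u) * real N * ln R ^ (k - length as) + v)"
    by meson
  have "\<forall>\<^sub>F N in sequentially. \<forall>(R :: real) (js :: int list).
       R \<ge> 1 \<longrightarrow> R \<ge> c * real N powr \<epsilon> \<longrightarrow> length js = length as \<longrightarrow> distinct js \<longrightarrow>
       (\<forall>j\<in>set js. \<bar>real_of_int j\<bar> \<le> real N powr (1 - \<epsilon>)) \<longrightarrow>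
       (\<exists>u v. \<bar>u\<bar> \<le> \<delta> N \<and> \<bar>v\<bar> \<le> B * R ^ k \<and> corr_sum N R js as = (corr_const k as * singular_series js + u) * real N * ln R ^ (k - length as) + v)"
    using ev by eventually_elim (simp add: admissible_def)
  with \<delta> show ?thesis by blast
qed

theorem theorem1:
  fixes k :: nat and as :: "nat list" and \<epsilon> c :: real
  assumes "1 \<le> k" and "k \<le> 3"
    and "\<forall>a\<in>set as. 1 \<le> a" and "sum_list as = k"
    and "\<epsilon> > 0" and "c > 0"
  shows "\<exists>(\<delta> :: nat \<Rightarrow> real) (B :: real). \<delta> \<longlonglongrightarrow> 0 \<and>
    (\<forall>\<^sub>F N in sequentially. \<forall>(R :: real) (js :: int list).
       R \<ge> 1 \<longrightarrow> R \<ge> c * real N powr \<epsilon> \<longrightarrow>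
       length js = length as \<longrightarrow> distinct js \<longrightarrow>
       (\<forall>j\<in>set js. \<bar>real_of_int j\<bar> \<le> real N powr (1 - \<epsilon>)) \<longrightarrow>
       (\<exists>u v. \<bar>u\<bar> \<le> \<delta> N \<and> \<bar>v\<bar> \<le> B * R ^ k \<and>
          corr_sum N R js as =
            (corr_const k as * singular_series js + u) * real N * ln R ^ (k - length as) + v))"
proof -
  note \<epsilon> = assms(5) and c = assms(6)
  note sum_simps = corr_sum_def lambda_opt_def numeral_eq_Suc lessThan_Suc mult_ac
  consider "k = 1" "as = [1]" | "k = 2" "as = [2]" | "k = 2" "as = [1, 1]" | "k = 3" "as = [3]"
    | "k = 3" "as = [2, 1]" | "k = 3" "as = [1, 2]" | "k = 3" "as = [1, 1, 1]"
  proof -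
    have len: "length xs \<le> sum_list xs" if "\<forall>a\<in>set xs. 1 \<le> a" for xs :: "nat list"
      using that by (induction xs) auto
    show thesis
    proof (cases as)
      case Nil
      then show thesis using assms(1,4) by simp
    next
      case a: (Cons a as1)
      show thesis
      proof (cases as1)
        case Nil
        then have "k = a" using a assms(4) by simp
        then show thesis using that(1,2,4) a Nil assms(1,2) by (cases "a = 1"; cases "a = 2") auto
      next
        case b: (Cons b as2)
        show thesis
        proof (cases as2)
          case Nil
          then have k: "k = a + b" "a \<ge> 1" "b \<ge> 1" using a b assms(3,4) by auto
          then have "a = 1 \<and> b = 1 \<or> a = 2 \<and> b = 1 \<or> a = 1 \<and> b = 2" using assms(2) by linarith
          then show thesis using that(3,5,6) a b Nil k(1) by auto
        next
          case d: (Cons d as3)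
          have k: "k = a + (b + (d + sum_list as3))" "a \<ge> 1" "b \<ge> 1" "d \<ge> 1" "length as3 \<le> sum_list as3"
            using a b d assms(3,4) len[of as3] by auto
          then have "a = 1" "b = 1" "d = 1" "length as3 = 0" "k = 3" using assms(2) by linarith+
          then show thesis using that(7) a b d by simp
        qed
      qed
    qed
  qed
  then show ?thesis
  proof cases
    case 1
    have "mean_asymp \<epsilon> c 1 0 1 (\<lambda>R js. level_mean 1 0 0 (js ! 0) (js ! 0) (js ! 0) R)"
      by (rule mean_asymp_distinct(1)[OF \<epsilon> c]) (simp_all, metis length_cases(1) One_nat_def singular_series_local_sum(1))
    \<comment> \<open>Empty slots get weight 0 and repeat the first index, as
      \<open>tuple_sum_approx\<close> requires.\<close>
    then show ?thesis unfolding 1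
      by (intro corr_sum_asymp[OF \<epsilon> c, of _ _ 0 0 0 0 0]) (simp_all add: corr_const_def sum_simps)
  next
    case 2
    show ?thesis unfolding 2 using mean_asymp_square[OF \<epsilon> c]
      by (intro corr_sum_asymp[OF \<epsilon> c, of _ _ 0 0 0 1 0]) (simp_all add: corr_const_def sum_simps)
  next
    case 3
    have "mean_asymp \<epsilon> c 2 0 1 (\<lambda>R js. level_mean 1 1 0 (js ! 0) (js ! 1) (js ! 0) R)"
      by (rule mean_asymp_distinct(1)[OF \<epsilon> c]) (simp_all, metis length_cases(2) One_nat_def singular_series_local_sum(2))
    then show ?thesis unfolding 3
      by (intro corr_sum_asymp[OF \<epsilon> c, of _ _ 0 1 0 1 0]) (simp_all add: corr_const_def sum_simps)
  next
    case 4
    show ?thesis unfolding 4 using mean_asymp_cube[OF \<epsilon> c]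
      by (intro corr_sum_asymp[OF \<epsilon> c, of _ _ 0 0 0 1 1]) (simp_all add: corr_const_def sum_simps)
  next
    case 5
    show ?thesis unfolding 5 using mean_asymp_pair[OF \<epsilon> c, of 0 1]
      by (intro corr_sum_asymp[OF \<epsilon> c, of _ _ 0 0 1 1 1]) (simp_all add: corr_const_def sum_simps)
  next
    case 6
    \<comment> \<open>The repeated shift has to occupy the first two slots, hence the exchanged
      indices.\<close>
    show ?thesis unfolding 6 using mean_asymp_pair[OF \<epsilon> c, of 1 0]
      by (intro corr_sum_asymp[OF \<epsilon> c, of _ _ 1 1 0 1 1]) (simp_all add: corr_const_def sum_simps)
  next
    case 7
    have "mean_asymp \<epsilon> c 3 0 1 (\<lambda>R js. level_mean 1 1 1 (js ! 0) (js ! 1) (js ! 2) R)"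
      by (rule mean_asymp_distinct(1)[OF \<epsilon> c]) (simp_all, metis length_cases(3) One_nat_def singular_series_local_sum(3))
    then show ?thesis unfolding 7
      by (intro corr_sum_asymp[OF \<epsilon> c, of _ _ 0 1 2 1 1]) (simp_all add: corr_const_def sum_simps)
  qed
qed

end
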